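(* Let $N\ge2$ be an integer. Define $I_1=[\frac{N+2}{3N},\infty)$ and, for $2\le n\le N$, \[I_n=\Big[\frac{N+2}{N+2Nn+n-n^2},\ \frac{N+2}{N+2(n-1)N+(n-1)-(n-1)^2}\Big).\] Then $I_1,\dots,I_N$ form a partition of $[\frac1N,\infty)$, and for each $1\le n\le N$, \[h_N^\lambda\ge\frac{(1+n)(1+\lambda-n\lambda)}{(1+\lambda)(N+1-n)}\qquad\text{for }\lambda\in I_n.\] This lower bound equals $\frac{2}{(1+\lambda)N}$ for $\lambda\in I_1$ and is strictly larger than $\frac{2}{(1+\lambda)N}$ for $\lambda\in[\frac1N,\frac13+\frac{2}{3N})$. Conversely, for a positive integer $n$ with $N/n\in(2,3)$, \[g_N^\lambda\le\frac{n+1}{N-n+1}\qquad\text{whenever }\lambda\ge\frac{1}{(1-\gamma)N+(2\gamma-1)n},\quad\text{where }\gamma=\frac{N^2+2n^2-3Nn+2N-4n}{(n+1)(N-2n)}.\]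
   Context: $\lambda_N(\zeta)$ is the supremum of $\lambda$ such that $1\le|x|\le X$, $\max_{1\le i\le N}|\zeta^ix-y_i|\le X^{-\lambda}$ has a solution $(x,y_1,\dots,y_N)\in\mathbb{Z}^{N+1}$ for arbitrarily large $X$. $h_N^\lambda=\dim\{\zeta\in\mathbb{R}:\lambda_N(\zeta)\ge\lambda\}$ and $g_N^\lambda=\dim\{\zeta\in\mathbb{R}:\lambda_N(\zeta)>\lambda\}$, with $\dim$ the Hausdorff dimension. *)

theory Defs
  imports "HOL-Analysis.Analysis" "HOL-Library.Disjoint_Sets"
begin

text \<open>
  The simultaneous approximation exponent takes values in the extended reals, since it is infinite
  for rational and for Liouville numbers. Only the values of \<open>y\<close> on \<open>{1..N}\<close> matter.
\<close>

definition approx_exponents :: "nat \<Rightarrow> real \<Rightarrow> real set" where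
  "approx_exponents N \<zeta> =
     {l. \<forall>X\<^sub>0::real. \<exists>X>X\<^sub>0. \<exists>(x::int) (y::nat \<Rightarrow> int).
           1 \<le> \<bar>x\<bar> \<and> real_of_int \<bar>x\<bar> \<le> X \<and>
           (MAX i\<in>{1..N}. \<bar>\<zeta> ^ i * real_of_int x - real_of_int (y i)\<bar>) \<le> X powr (- l)}"

definition lambda_exp :: "nat \<Rightarrow> real \<Rightarrow> ereal" where
  "lambda_exp N \<zeta> = (SUP l\<in>approx_exponents N \<zeta>. ereal l)"

text \<open>
  For \<open>s = 0\<close> every nonempty set has weight 1, so that the 0-dimensional Hausdorff measure is the
  counting measure (note that \<open>0 powr 0 = 0\<close>).
\<close>

definition hausdorff_weight :: "real \<Rightarrow> 'a::metric_space set \<Rightarrow> ennreal" where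
  "hausdorff_weight s U =
     (if U = {} then 0 else if s = 0 then 1 else ennreal (diameter U powr s))"

text \<open>
  Boundedness of the covering sets has to be required explicitly, because \<open>diameter\<close> is
  unspecified on unbounded sets.
\<close>

definition hausdorff_premeasure :: "real \<Rightarrow> real \<Rightarrow> 'a::metric_space set \<Rightarrow> ennreal" where
  "hausdorff_premeasure \<delta> s A =
     (INF U\<in>{U :: nat \<Rightarrow> 'a set. A \<subseteq> (\<Union>i. U i) \<and> (\<forall>i. bounded (U i) \<and> diameter (U i) \<le> \<delta>)}.
        (\<Sum>i. hausdorff_weight s (U i)))"

definition hausdorff_measure :: "real \<Rightarrow> 'a::metric_space set \<Rightarrow> ennreal" where
  "hausdorff_measure s A = (SUP \<delta>\<in>{0<..}. hausdorff_premeasure \<delta> s A)"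

definition hausdorff_dim :: "'a::metric_space set \<Rightarrow> ereal" where
  "hausdorff_dim A = (INF s\<in>{s. 0 \<le> s \<and> hausdorff_measure s A = 0}. ereal s)"

definition h_dim :: "nat \<Rightarrow> real \<Rightarrow> ereal" where
  "h_dim N l = hausdorff_dim {\<zeta>::real. lambda_exp N \<zeta> \<ge> ereal l}"

definition g_dim :: "nat \<Rightarrow> real \<Rightarrow> ereal" where
  "g_dim N l = hausdorff_dim {\<zeta>::real. lambda_exp N \<zeta> > ereal l}"

definition I_int :: "nat \<Rightarrow> nat \<Rightarrow> real set" where
  "I_int N n =
     (if n = 1 then {(real N + 2) / (3 * real N)..}
      else {(real N + 2) / (real N + 2 * real N * real n + real n - (real n)\<^sup>2) ..<
            (real N + 2) / (real N + 2 * (real n - 1) * real N + (real n - 1) - (real n - 1)\<^sup>2)})"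

definition lower_bd :: "nat \<Rightarrow> nat \<Rightarrow> real \<Rightarrow> real" where
  "lower_bd N n l =
     (1 + real n) * (1 + l - real n * l) / ((1 + l) * (real N + 1 - real n))"

end

theory Submission
  imports Defs "Subresultants.Subresultant_Gcd" "Berlekamp_Zassenhaus.Factor_Bound"
begin

hide_const (open) module.smult up_ring.coeff up_ring.monom Order.top

text \<open>
  Lower bound: near almost every point there is an integer polynomial of degree at most \<open>n\<close>
  that is small there and has a derivative of the largest possible size. This follows from
  quantitative nondivergence of the lattice of integer polynomials. Each such polynomial has a
  zero nearby, around which it stays small on an interval; a Cantor-type construction with
  these intervals bounds the Hausdorff dimension from below, and transference turns a small
  polynomial of degree \<open>n\<close> into a simultaneous approximation to \<open>\<zeta>, \<dots>, \<zeta>^N\<close>.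

  Upper bound: if \<open>x\<close> is the denominator of an approximation of quality \<open>\<lambda> > 1 / n\<close>, then
  \<open>(x, y\<^sub>1, \<dots>, y\<^sub>N)\<close> is annihilated by all shifts of one polynomial of degree at most \<open>n\<close>, of
  height about \<open>x^(1 / N)\<close> and of very small value at \<open>\<zeta>\<close>. By multiplicativity of the Mahler
  measure some irreducible factor is small as well, with \<open>|P(\<zeta>)| \<le> H(P)^(- N - 1)\<close>. The
  discriminant of \<open>P\<close> forces \<open>|P'(\<zeta>)| \<ge> H(P)^(1 - n)\<close>, and counting the resulting short
  intervals yields the bound. The threshold for \<open>\<lambda>\<close> in the statement exceeds \<open>1 / n\<close>.
\<close>

text \<open>Both dimensions balance a count against a length. From below, an interval carries about
  \<open>Q^(n+1)\<close> zeros of polynomials of height \<open>Q\<close>, and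
  \<open>|P| \<le> Q^(-w)\<close> persists up to distance about \<open>Q^(-w-1)\<close> from such a
  zero; this gives \<open>(n+1)/(w+1)\<close>. The exponent \<open>w\<close> is the one that
  transference turns into \<open>l\<close>, namely \<open>(w+n-N) / ((n-1)w+N) = l\<close>, and then
  the quotient is \<open>lower_bd N n l\<close>. The obstacle is uniformity: the Cantor construction
  restarts in ever shorter intervals, so the share of good points and all constants must be the same
  in each of them, and only the threshold for \<open>Q\<close> may depend on the interval. From
  above, about \<open>H^(n+1)\<close> polynomials of height \<open>H\<close> each contribute a
  bounded number of sets of length about \<open>H^(-N-1) / H^(1-n)\<close>. The power
  \<open>N+1\<close> survives factorisation because \<open>h \<le> C Q^(1/N)\<close> and
  \<open>|P(\<zeta>)| \<le> C h Q^(-1-l)\<close> for the annihilator: \<open>h^(N+2)\<close> is at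
  most of order \<open>Q^(1+2/N)\<close>, and \<open>2/N < 1/n < l\<close> leaves a power of
  \<open>Q\<close> that absorbs all constants.\<close>

section \<open>Lower bounds for the Hausdorff dimension from nested intervals\<close>

lemma separated_set_card:
  fixes T :: "real set"
  assumes fin: "finite T" and g: "g > 0"
    and sep: "\<And>x y. x \<in> T \<Longrightarrow> y \<in> T \<Longrightarrow> x \<noteq> y \<Longrightarrow> \<bar>x - y\<bar> \<ge> g"
    and diam: "\<And>x y. x \<in> T \<Longrightarrow> y \<in> T \<Longrightarrow> \<bar>x - y\<bar> \<le> d" and d: "d \<ge> 0"
  shows "real (card T) \<le> 1 + d / g"
proof (cases "T = {}")
  case False
  define x0 where "x0 = Min T"
  have x0: "x0 \<in> T" "\<And>x. x \<in> T \<Longrightarrow> x0 \<le> x"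
    using fin False by (auto simp: x0_def)
  define q where "q x = \<lfloor>(x - x0) / g\<rfloor>" for x
  have "inj_on q T"
  proof (rule inj_onI, rule ccontr)
    fix x y assume xy: "x \<in> T" "y \<in> T" "q x = q y" "x \<noteq> y"
    have "\<bar>(x - x0) / g - (y - x0) / g\<bar> < 1"
      using xy(3) unfolding q_def by linarith
    also have "(x - x0) / g - (y - x0) / g = (x - y) / g"
      by (simp add: diff_divide_distrib)
    finally show False using sep[OF xy(1,2,4)] g by (simp add: abs_divide)
  qed
  moreover have "q ` T \<subseteq> {0..\<lfloor>d / g\<rfloor>}"
  proof safe
    fix x assume x: "x \<in> T"
    have "(x - x0) / g \<ge> 0" using x0(2)[OF x] g by simp
    moreover have "(x - x0) / g \<le> d / g"
      using diam[OF x x0(1)] g by (intro divide_right_mono) auto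
    ultimately show "q x \<in> {0..\<lfloor>d / g\<rfloor>}" by (auto simp: q_def floor_mono)
  qed
  ultimately have "card T \<le> card {0..\<lfloor>d / g\<rfloor>}" by (meson card_inj_on_le finite_atLeastAtMost_int)
  also have "\<dots> = nat (\<lfloor>d / g\<rfloor> + 1)" by simp
  finally have "real (card T) \<le> real (nat (\<lfloor>d / g\<rfloor> + 1))" by (rule of_nat_mono)
  also have "\<dots> \<le> 1 + d / g"
    using d g by (simp add: of_nat_nat)
  finally show ?thesis .
qed (use d g in auto)

lemma card_separated_intervals_meeting:
  fixes Z U :: "real set"
  assumes fin: "finite Z" and g: "g > 0" and r: "r > 0"
    and sep: "\<And>z z'. z \<in> Z \<Longrightarrow> z' \<in> Z \<Longrightarrow> z \<noteq> z' \<Longrightarrow> \<bar>z - z'\<bar> \<ge> g + r"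
    and diam: "\<And>x y. x \<in> U \<Longrightarrow> y \<in> U \<Longrightarrow> \<bar>x - y\<bar> \<le> d" and d: "d \<ge> 0"
  shows "real (card {z\<in>Z. U \<inter> {z..z+r} \<noteq> {}}) \<le> 1 + d / g"
proof -
  define Y where "Y = {z\<in>Z. U \<inter> {z..z+r} \<noteq> {}}"
  have "\<forall>z\<in>Y. \<exists>x. x \<in> U \<inter> {z..z+r}" by (auto simp: Y_def)
  then obtain x where x: "\<And>z. z \<in> Y \<Longrightarrow> x z \<in> U \<and> z \<le> x z \<and> x z \<le> z + r"
    by (metis Int_iff atLeastAtMost_iff)
  have far: "\<bar>x z - x z'\<bar> \<ge> g" if "z \<in> Y" "z' \<in> Y" "z \<noteq> z'" for z z'
    using x[OF that(1)] x[OF that(2)] sep[of z z'] that by (auto simp: Y_def)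
  have "inj_on x Y"
  proof (rule inj_onI, rule ccontr)
    fix z z' assume "z \<in> Y" "z' \<in> Y" "x z = x z'" "z \<noteq> z'"
    then show False using far[of z z'] g by simp
  qed
  then have "card Y = card (x ` Y)" by (simp add: card_image)
  moreover have "real (card (x ` Y)) \<le> 1 + d / g"
  proof (rule separated_set_card)
    show "finite (x ` Y)" using fin by (simp add: Y_def)
    fix u v assume "u \<in> x ` Y" "v \<in> x ` Y"
    then show "u \<noteq> v \<Longrightarrow> g \<le> \<bar>u - v\<bar>" "\<bar>u - v\<bar> \<le> d" using far x diam by auto
  qed (use g d in auto)
  ultimately show ?thesis by (simp add: Y_def)
qed

text \<open>Children of \<open>{a..b}\<close> that meet a covering set of diameter at least \<open>r\<close> are discarded; this
  removes at most half of them, and among the others one carries at most the average weight.\<close>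

lemma light_child_interval:
  fixes v :: "nat \<Rightarrow> real" and U :: "nat \<Rightarrow> real set"
  defines "W \<equiv> \<lambda>a b. \<Sum>i. if U i \<inter> {a..b} \<noteq> {} then v i else 0"
  assumes s: "0 < s" "s \<le> 1" and kap: "0 < \<kappa>" "\<kappa> \<le> 1" "\<kappa> \<le> c / 4" and c: "c > 0"
    and v: "\<And>i. v i > 0" "summable v"
    and diam: "\<And>i x y. x \<in> U i \<Longrightarrow> y \<in> U i \<Longrightarrow> \<bar>x - y\<bar> \<le> v i powr (1 / s)"
    and ab: "a < b" "W a b \<le> \<kappa> * (b - a) powr s"
    and Z: "finite Z" and g: "g > 0" and r: "r > 0" "r \<le> g"
    and sep: "\<And>z z'. z \<in> Z \<Longrightarrow> z' \<in> Z \<Longrightarrow> z \<noteq> z' \<Longrightarrow> \<bar>z - z'\<bar> \<ge> g + r"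
    and card1: "real (card Z) \<ge> c * (b - a) / g"
    and card2: "real (card Z) * r powr s \<ge> 8 * (b - a) powr s"
    and sub: "\<And>z. z \<in> Z \<Longrightarrow> {z..z+r} \<subseteq> {a..b}"
  shows "\<exists>z\<in>Z. W z (z + r) \<le> \<kappa> * r powr s"
proof -
  define d where "d i = v i powr (1 / s)" for i
  define S where "S = {i. U i \<inter> {a..b} \<noteq> {}}"
  define m where "m = real (card Z)"
  have rs: "r powr s > 0" using r by simp
  have "c * (b - a) / g > 0" using c ab g by simp
  then have m: "m > 0" using card1 by (simp add: m_def)
  have d0: "d i > 0" for i using v(1)[of i] by (simp add: d_def)
  have dv: "d i powr s = v i" for i using v(1)[of i] s by (simp add: d_def powr_powr)
  have summ: "summable (\<lambda>i. if P i then v i else 0)" for P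
    by (rule summable_comparison_test'[OF v(2), of 0]) (use v(1) in \<open>auto simp: less_imp_le\<close>)
  have sumS: "(\<Sum>i\<in>I. v i) \<le> \<kappa> * (b - a) powr s" if "finite I" "I \<subseteq> S" for I
  proof -
    have "(\<Sum>i\<in>I. v i) = (\<Sum>i\<in>I. if U i \<inter> {a..b} \<noteq> {} then v i else 0)"
      using that by (intro sum.cong) (auto simp: S_def)
    also have "\<dots> \<le> W a b" unfolding W_def
      by (rule sum_le_suminf[OF summ that(1)]) (use v(1) in \<open>auto simp: less_imp_le\<close>)
    finally show ?thesis using ab by simp
  qed
  \<comment> \<open>A set meeting \<open>{a..b}\<close> has weight at most
    \<open>\<kappa> * (b - a) powr s\<close>, and \<open>\<kappa> \<le> 1\<close> turns this into a
    bound for its diameter.\<close>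
  have dS: "d i \<le> b - a" if "i \<in> S" for i
  proof -
    have "d i powr s \<le> \<kappa> * (b - a) powr s" using sumS[of "{i}"] that by (simp add: dv)
    also have "\<dots> \<le> (b - a) powr s" using kap by (simp add: mult_left_le_one_le)
    finally show ?thesis using s ab powr_less_mono2[of s "b - a" "d i"] by linarith
  qed
  define R where "R = {i\<in>S. r \<le> d i}"
  have "v \<longlonglongrightarrow> 0" using v(2) by (rule summable_LIMSEQ_zero)
  then have "\<forall>\<^sub>F i in sequentially. v i < r powr s" using rs by (rule order_tendstoD)
  then obtain M where M: "\<And>i. i \<ge> M \<Longrightarrow> v i < r powr s" by (auto simp: eventually_sequentially)
  have Rv: "r powr s \<le> v i" if "i \<in> R" for i
    using that s r by (subst dv[symmetric]) (auto simp: R_def intro!: powr_mono2)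
  have "R \<subseteq> {..<M}"
    using M Rv by (meson lessThan_iff not_le subsetI)
  then have finR: "finite R" using finite_subset by blast
  define Z1 where "Z1 = (\<Union>i\<in>R. {z\<in>Z. U i \<inter> {z..z+r} \<noteq> {}})"
  have "real (card Z1) \<le> (\<Sum>i\<in>R. real (card {z\<in>Z. U i \<inter> {z..z+r} \<noteq> {}}))"
    unfolding Z1_def of_nat_sum[symmetric] of_nat_le_iff by (rule card_UN_le[OF finR])
  also have "\<dots> \<le> (\<Sum>i\<in>R. 1 + d i / g)"
    using diam d0 by (intro sum_mono card_separated_intervals_meeting Z g r sep) (auto simp: d_def less_imp_le)
  \<comment> \<open>Writing \<open>d = d^s * d^(1-s)\<close> converts the number of gaps spanned by
    a set into a multiple of its weight, so that the number of discarded children is controlled by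
    the total weight alone.\<close>
  also have "\<dots> \<le> (\<Sum>i\<in>R. v i * (1 / r powr s + (b - a) powr (1 - s) / g))"
  proof (rule sum_mono)
    fix i assume i: "i \<in> R"
    have "1 \<le> v i / r powr s" using Rv[OF i] rs by simp
    moreover have "d i = d i powr s * d i powr (1 - s)" using d0[of i] by (simp add: powr_add[symmetric])
    moreover have "d i powr (1 - s) \<le> (b - a) powr (1 - s)"
      using dS[of i] i d0[of i] s by (intro powr_mono2) (auto simp: R_def)
    ultimately have "d i \<le> v i * (b - a) powr (1 - s)" using v(1)[of i]
      by (metis dv less_imp_le mult_left_mono)
    then have "d i / g \<le> v i * (b - a) powr (1 - s) / g" using g by (simp add: divide_right_mono)
    then show "1 + d i / g \<le> v i * (1 / r powr s + (b - a) powr (1 - s) / g)"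
      using \<open>1 \<le> v i / r powr s\<close> by (simp add: ring_distribs)
  qed
  also have "\<dots> = (\<Sum>i\<in>R. v i) * (1 / r powr s + (b - a) powr (1 - s) / g)"
    by (simp add: sum_distrib_right)
  also have "\<dots> \<le> (\<kappa> * (b - a) powr s) * (1 / r powr s + (b - a) powr (1 - s) / g)"
    using finR g by (intro mult_right_mono sumS) (auto simp: R_def)
  also have "\<dots> = \<kappa> * ((b - a) powr s / r powr s + (b - a) / g)"
    using ab by (simp add: algebra_simps powr_add[symmetric])
  also have "\<dots> \<le> \<kappa> * (m / 8 + m / c)"
  proof -
    have "(b - a) powr s / r powr s \<le> m / 8" using card2 rs by (simp add: m_def field_simps)
    moreover have "(b - a) / g \<le> m / c" using card1 c g by (simp add: m_def field_simps)
    ultimately show ?thesis using kap by (intro mult_left_mono add_mono) auto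
  qed
  also have "\<dots> \<le> m / 8 + m / 4"
  proof -
    have "\<kappa> * (m / 8) \<le> 1 * (m / 8)" using kap m by (intro mult_right_mono) auto
    moreover have "\<kappa> * (m / c) \<le> (c / 4) * (m / c)" using kap m c by (intro mult_right_mono) auto
    moreover have "(c / 4) * (m / c) = m / 4" using c by simp
    ultimately show ?thesis unfolding distrib_left by linarith
  qed
  finally have Z1: "real (card Z1) \<le> m / 2" using m by linarith
  define Z2 where "Z2 = Z - Z1"
  have "Z1 \<subseteq> Z" by (auto simp: Z1_def)
  then have Z2: "real (card Z2) \<ge> m / 2"
    using Z Z1 by (simp add: Z2_def card_Diff_subset finite_subset m_def card_mono of_nat_diff)
  have finZ2: "finite Z2" using Z by (simp add: Z2_def)
  show ?thesis
  proof (rule ccontr)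
    assume "\<not> ?thesis"
    then have big: "W z (z + r) > \<kappa> * r powr s" if "z \<in> Z" for z using that by force
    have "4 * (\<kappa> * (b - a) powr s) = \<kappa> / 2 * (8 * (b - a) powr s)" by simp
    also have "\<dots> \<le> \<kappa> / 2 * (m * r powr s)" using card2 kap by (intro mult_left_mono) (auto simp: m_def)
    also have "\<dots> = m / 2 * (\<kappa> * r powr s)" by simp
    also have "\<dots> \<le> real (card Z2) * (\<kappa> * r powr s)" using Z2 kap by (intro mult_right_mono) auto
    also have "\<dots> = (\<Sum>z\<in>Z2. \<kappa> * r powr s)" by simp
    also have "\<dots> \<le> (\<Sum>z\<in>Z2. W z (z + r))" using big by (intro sum_mono) (auto simp: Z2_def less_imp_le)
    also have "\<dots> = (\<Sum>i. \<Sum>z\<in>Z2. if U i \<inter> {z..z+r} \<noteq> {} then v i else 0)"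
      unfolding W_def by (rule suminf_sum[symmetric]) (rule summ)
    \<comment> \<open>A set that meets a surviving child has diameter below \<open>r \<le> g\<close>
      and therefore meets only one of them. No weight is counted twice, and the children together
      carry at most the weight of the parent.\<close>
    also have "\<dots> \<le> W a b" unfolding W_def
    proof (rule suminf_le)
      fix i
      define Y where "Y = {z\<in>Z2. U i \<inter> {z..z+r} \<noteq> {}}"
      have "(\<Sum>z\<in>Z2. if U i \<inter> {z..z+r} \<noteq> {} then v i else 0) = real (card Y) * v i"
        unfolding Y_def by (subst sum.inter_filter[symmetric]) (use finZ2 in auto)
      also have "\<dots> \<le> (if U i \<inter> {a..b} \<noteq> {} then v i else 0)"
      proof (cases "Y = {}")
        case False
        then obtain z where z: "z \<in> Z2" "U i \<inter> {z..z+r} \<noteq> {}" by (auto simp: Y_def)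
        then have iS: "i \<in> S" using sub[of z] by (auto simp: S_def Z2_def)
        then have "d i < r" using z unfolding Z2_def Z1_def R_def by (fastforce simp: not_less)
        have "real (card Y) \<le> 1 + d i / g" unfolding Y_def
          using diam d0 sep Z by (intro card_separated_intervals_meeting g r) (auto simp: d_def less_imp_le Z2_def)
        also have "\<dots> < 2" using \<open>d i < r\<close> r g by simp
        finally have "card Y \<le> 1" by linarith
        then show ?thesis using iS v(1)[of i] by (auto simp: S_def mult_left_le_one_le)
      qed (use v(1)[of i] in auto)
      finally show "(\<Sum>z\<in>Z2. if U i \<inter> {z..z+r} \<noteq> {} then v i else 0)
        \<le> (if U i \<inter> {a..b} \<noteq> {} then v i else 0)" .
    qed (intro summable_sum summ)+
    also have "\<dots> \<le> \<kappa> * (b - a) powr s" by (rule ab)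
    finally show False using kap ab by simp
  qed
qed

text \<open>The mass distribution principle without a measure. A cover of small weight is fixed
  first, and among the children one is always chosen that carries at most its share,
  \<open>W a b \<le> \<kappa> * (b - a) powr s\<close>. The limit point lies in some set of the
  cover, whose weight is positive, yet this weight is bounded by shares that tend to 0.\<close>

lemma hausdorff_measure_nonzero_nested:
  fixes A :: "real set" and E :: "nat \<Rightarrow> real set"
  assumes s: "0 < s" "s \<le> 1" and c: "c > 0" and ab0: "a0 < b0"
    and step: "\<And>a b k. a0 \<le> a \<Longrightarrow> a < b \<Longrightarrow> b \<le> b0 \<Longrightarrow>
      \<exists>Z g r. finite Z \<and> g > 0 \<and> r > 0 \<and> r \<le> g \<and> r \<le> (b - a) / 2 \<and>
        (\<forall>z\<in>Z. \<forall>z'\<in>Z. z \<noteq> z' \<longrightarrow> \<bar>z - z'\<bar> \<ge> g + r) \<and>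
        real (card Z) \<ge> c * (b - a) / g \<and> real (card Z) * r powr s \<ge> 8 * (b - a) powr s \<and>
        (\<forall>z\<in>Z. {z..z+r} \<subseteq> {a..b} \<inter> E k)"
    and A: "{a0..b0} \<inter> (\<Inter>k. E k) \<subseteq> A"
  shows "hausdorff_measure s A \<noteq> 0"
proof
  assume null: "hausdorff_measure s A = 0"
  define \<kappa> where "\<kappa> = min 1 (c / 4)"
  have kap: "0 < \<kappa>" "\<kappa> \<le> 1" "\<kappa> \<le> c / 4" using c by (auto simp: \<kappa>_def)
  define e where "e = \<kappa> * (b0 - a0) powr s / 2"
  have e: "e > 0" using kap ab0 by (simp add: e_def)
  have "hausdorff_premeasure 1 s A \<le> hausdorff_measure s A"
    unfolding hausdorff_measure_def by (rule SUP_upper) simp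
  then have "hausdorff_premeasure 1 s A < ennreal e" using null e by simp
  then obtain U :: "nat \<Rightarrow> real set" where U: "A \<subseteq> (\<Union>i. U i)" "\<And>i. bounded (U i)"
    "(\<Sum>i. hausdorff_weight s (U i)) < ennreal e"
    unfolding hausdorff_premeasure_def INF_less_iff by auto
  define w where "w i = diameter (U i) powr s" for i
  have w: "hausdorff_weight s (U i) = ennreal (w i)" for i
    using s by (auto simp: hausdorff_weight_def w_def)
  have w0: "w i \<ge> 0" for i by (simp add: w_def)
  have "(\<Sum>i. ennreal (w i)) \<noteq> top" using U(3) by (auto simp: w)
  then have sw: "summable w" by (rule summable_suminf_not_top[OF w0])
  have "ennreal (\<Sum>i. w i) < ennreal e" using U(3) by (simp add: w suminf_ennreal2[OF w0 sw])
  then have swe: "(\<Sum>i. w i) < e" using suminf_nonneg[OF sw w0] by (simp add: ennreal_less_iff)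
  \<comment> \<open>One-point sets have weight 0, so every weight is enlarged by a term of a
    geometric series. The enlargement costs \<open>e\<close> in total, as much as the cover itself;
    hence the halving in \<open>e\<close>.\<close>
  define v where "v i = w i + e * (1 / 2) ^ Suc i" for i
  have v0: "v i > 0" for i using w0[of i] e by (simp add: v_def add_nonneg_pos)
  have geo: "(\<lambda>i. e * (1 / 2) ^ Suc i) sums e"
    using sums_mult[OF power_half_series, of e] by simp
  have sv: "summable v" unfolding v_def using sw geo by (intro summable_add) (auto simp: sums_iff)
  have "(\<Sum>i. v i) = (\<Sum>i. w i) + e" unfolding v_def
    using suminf_add[OF sw sums_summable[OF geo]] geo by (simp add: sums_iff)
  then have tot: "(\<Sum>i. v i) \<le> \<kappa> * (b0 - a0) powr s" using swe by (simp add: e_def)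
  have diam: "\<bar>x - y\<bar> \<le> v i powr (1 / s)" if "x \<in> U i" "y \<in> U i" for i x y
  proof -
    have "\<bar>x - y\<bar> \<le> diameter (U i)" using diameter_bounded_bound[OF U(2) that] by (simp add: dist_real_def)
    also have "\<dots> = w i powr (1 / s)" using s diameter_ge_0[OF U(2)[of i]] by (simp add: w_def powr_powr)
    also have "\<dots> \<le> v i powr (1 / s)" using w0[of i] e s by (intro powr_mono2) (auto simp: v_def)
    finally show ?thesis .
  qed
  define W where "W a b = (\<Sum>i. if U i \<inter> {a..b} \<noteq> {} then v i else 0)" for a b
  have summ: "summable (\<lambda>i. if P i then v i else 0)" for P
    by (rule summable_comparison_test'[OF sv, of 0]) (use v0 in \<open>auto simp: less_imp_le\<close>)
  define stage_ok where "stage_ok k p \<longleftrightarrow> a0 \<le> fst p \<and> fst p < snd p \<and> snd p \<le> b0 \<and>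
    snd p - fst p \<le> (b0 - a0) / 2 ^ k \<and> W (fst p) (snd p) \<le> \<kappa> * (snd p - fst p) powr s"
    for k :: nat and p :: "real \<times> real"
  have "\<exists>p. \<forall>k. stage_ok k (p k) \<and> {fst (p (Suc k))..snd (p (Suc k))} \<subseteq> {fst (p k)..snd (p k)} \<inter> E k"
  proof (rule dependent_nat_choice)
    have "W a0 b0 \<le> (\<Sum>i. v i)" unfolding W_def
      by (rule suminf_le[OF _ summ sv]) (use v0 in \<open>auto simp: less_imp_le\<close>)
    then show "\<exists>p. stage_ok 0 p" using tot ab0 by (intro exI[of _ "(a0, b0)"]) (auto simp: stage_ok_def)
  next
    fix p k assume "stage_ok k p"
    then obtain a b where p: "p = (a, b)" "a0 \<le> a" "a < b" "b \<le> b0" "b - a \<le> (b0 - a0) / 2 ^ k"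
      "W a b \<le> \<kappa> * (b - a) powr s" by (cases p) (auto simp: stage_ok_def)
    from step[OF p(2-4), of k] obtain Z g r where Z: "finite Z" "g > 0" "r > 0" "r \<le> g" "r \<le> (b - a) / 2"
      "\<And>z z'. z \<in> Z \<Longrightarrow> z' \<in> Z \<Longrightarrow> z \<noteq> z' \<Longrightarrow> \<bar>z - z'\<bar> \<ge> g + r"
      "real (card Z) \<ge> c * (b - a) / g" "real (card Z) * r powr s \<ge> 8 * (b - a) powr s"
      "\<And>z. z \<in> Z \<Longrightarrow> {z..z+r} \<subseteq> {a..b} \<inter> E k" by metis
    have "\<exists>z\<in>Z. W z (z + r) \<le> \<kappa> * r powr s" unfolding W_def
      by (rule light_child_interval[OF s kap c v0 sv diam p(3) p(6)[unfolded W_def] Z(1-4) Z(6) Z(7,8)])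
        (use Z(9) in auto)
    then obtain z where z: "z \<in> Z" "W z (z + r) \<le> \<kappa> * r powr s" by blast
    have "z \<in> {z..z+r}" "z + r \<in> {z..z+r}" using Z(3) by auto
    then have "z \<in> {a..b}" "z + r \<in> {a..b}" using Z(9)[OF z(1)] by blast+
    then have "stage_ok (Suc k) (z, z + r)" using z(2) Z(3,5) p by (auto simp: stage_ok_def)
    then show "\<exists>q. stage_ok (Suc k) q \<and> {fst q..snd q} \<subseteq> {fst p..snd p} \<inter> E k"
      using Z(9)[OF z(1)] p(1) by (intro exI[of _ "(z, z + r)"]) auto
  qed
  then obtain p where p: "\<And>k. stage_ok k (p k)"
    "\<And>k. {fst (p (Suc k))..snd (p (Suc k))} \<subseteq> {fst (p k)..snd (p k)} \<inter> E k" by blast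
  define I where "I k = {fst (p k)..snd (p k)}" for k
  have "\<Inter>(range I) \<noteq> {}"
  proof (rule compact_nest)
    show "compact (I n)" "I n \<noteq> {}" for n using p(1)[of n] by (auto simp: I_def stage_ok_def)
    show "I n \<subseteq> I m" if "m \<le> n" for m n
      using that
    proof (induction rule: dec_induct)
      case (step k)
      then show ?case using p(2)[of k] unfolding I_def by blast
    qed simp
  qed
  then obtain x where x: "\<And>k. x \<in> I k" by blast
  have "x \<in> E k" for k using x[of "Suc k"] p(2)[of k] by (auto simp: I_def)
  moreover have "x \<in> {a0..b0}" using x[of 0] p(1)[of 0] by (auto simp: I_def stage_ok_def)
  ultimately obtain i where i: "x \<in> U i" using A U(1) by blast
  have le: "v i \<le> \<kappa> * ((b0 - a0) / 2 ^ k) powr s" for k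
  proof -
    have "v i = (\<Sum>j\<in>{i}. if U j \<inter> I k \<noteq> {} then v j else 0)" using i x[of k] by auto
    also have "\<dots> \<le> W (fst (p k)) (snd (p k))" unfolding W_def I_def
      by (rule sum_le_suminf[OF summ]) (use v0 in \<open>auto simp: less_imp_le\<close>)
    also have "\<dots> \<le> \<kappa> * (snd (p k) - fst (p k)) powr s" using p(1)[of k] by (simp add: stage_ok_def)
    also have "\<dots> \<le> \<kappa> * ((b0 - a0) / 2 ^ k) powr s"
      using p(1)[of k] kap s by (intro mult_left_mono powr_mono2) (auto simp: stage_ok_def)
    finally show ?thesis .
  qed
  have "(\<lambda>k. \<kappa> * ((b0 - a0) / 2 ^ k) powr s) \<longlonglongrightarrow> \<kappa> * 0"
  proof (intro tendsto_mult_left)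
    have "(\<lambda>k. (b0 - a0) / 2 ^ k) \<longlonglongrightarrow> 0" 
      by (rule LIMSEQ_divide_realpow_zero) simp
    then show "(\<lambda>k. ((b0 - a0) / 2 ^ k) powr s) \<longlonglongrightarrow> 0"
      by (rule tendsto_zero_powrI[OF _ tendsto_const]) (use s ab0 in auto)
  qed
  then have "v i \<le> \<kappa> * 0" by (rule LIMSEQ_le_const) (use le in auto)
  then show False using v0[of i] by simp
qed

lemma hausdorff_dim_ge_nested:
  fixes A :: "real set" and E :: "real \<Rightarrow> nat \<Rightarrow> real set"
  assumes \<sigma>: "0 < \<sigma>" "\<sigma> \<le> 1" and c: "c > 0" and ab0: "a0 < b0"
    and step: "\<And>s a b k. 0 < s \<Longrightarrow> s < \<sigma> \<Longrightarrow> a0 \<le> a \<Longrightarrow> a < b \<Longrightarrow> b \<le> b0 \<Longrightarrow>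
      \<exists>Z g r. finite Z \<and> g > 0 \<and> r > 0 \<and> r \<le> g \<and> r \<le> (b - a) / 2 \<and>
        (\<forall>z\<in>Z. \<forall>z'\<in>Z. z \<noteq> z' \<longrightarrow> \<bar>z - z'\<bar> \<ge> g + r) \<and>
        real (card Z) \<ge> c * (b - a) / g \<and> real (card Z) * r powr s \<ge> 8 * (b - a) powr s \<and>
        (\<forall>z\<in>Z. {z..z+r} \<subseteq> {a..b} \<inter> E s k)"
    and A: "\<And>s. {a0..b0} \<inter> (\<Inter>k. E s k) \<subseteq> A"
  shows "hausdorff_dim A \<ge> ereal \<sigma>"
  unfolding hausdorff_dim_def
proof (rule INF_greatest, clarify)
  fix s assume s: "0 \<le> s" "hausdorff_measure s A = 0"
  have pos: "hausdorff_measure s A \<noteq> 0" if "0 < s" "s < \<sigma>" for s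
    by (rule hausdorff_measure_nonzero_nested[OF that(1) _ c ab0 step[OF that] A]) (use that \<sigma> in auto)
  show "ereal \<sigma> \<le> ereal s"
  proof (rule ccontr)
    assume "\<not> ?thesis"
    then have "s < \<sigma>" by simp
    show False
    proof (cases "s = 0")
      case False
      then show False using pos s \<open>s < \<sigma>\<close> by simp
    next
      case True
      \<comment> \<open>The exponent 0 competes in the infimum as well. There the measure counts
        points, so it suffices that \<open>A\<close> is nonempty, and this follows from the positive
        measure at \<open>\<sigma> / 2\<close>.\<close>
      have "A \<noteq> {}"
      proof
        assume "A = {}"
        then have "hausdorff_measure (\<sigma> / 2) A = 0" unfolding hausdorff_measure_def
        proof (intro antisym SUP_least)
          fix \<delta> :: real assume "\<delta> \<in> {0<..}"
          then show "hausdorff_premeasure \<delta> (\<sigma> / 2) A \<le> 0" unfolding hausdorff_premeasure_def \<open>A = {}\<close>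
            by (intro INF_lower2[of "\<lambda>_. {}"]) (auto simp: hausdorff_weight_def)
        qed simp
        then show False using pos[of "\<sigma> / 2"] \<sigma> by simp
      qed
      have "hausdorff_premeasure 1 0 A \<le> hausdorff_measure 0 A"
        unfolding hausdorff_measure_def by (rule SUP_upper) simp
      then have "hausdorff_premeasure 1 0 A < 1" using s(2) True by simp
      then obtain U :: "nat \<Rightarrow> real set" where U: "A \<subseteq> (\<Union>i. U i)"
        "(\<Sum>i. hausdorff_weight 0 (U i)) < 1"
        unfolding hausdorff_premeasure_def INF_less_iff by auto
      then obtain i where "U i \<noteq> {}" using \<open>A \<noteq> {}\<close> by blast
      then have "1 = (\<Sum>i\<in>{i}. hausdorff_weight 0 (U i))" by (simp add: hausdorff_weight_def)
      also have "\<dots> \<le> (\<Sum>i. hausdorff_weight 0 (U i))" by (rule sum_le_suminf) auto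
      finally show False using U(2) by simp
    qed
  qed
qed

section \<open>Sets of Hausdorff measure zero\<close>

lemma hausdorff_dim_nonneg: "hausdorff_dim A \<ge> 0"
  unfolding hausdorff_dim_def by (rule INF_greatest) (auto simp: zero_ereal_def)

lemma hausdorff_measure_zeroI:
  assumes "\<And>\<delta> e. \<delta> > 0 \<Longrightarrow> e > 0 \<Longrightarrow> \<exists>U::nat \<Rightarrow> 'a::metric_space set. A \<subseteq> (\<Union>i. U i) \<and>
    (\<forall>i. bounded (U i) \<and> diameter (U i) \<le> \<delta>) \<and> (\<Sum>i. hausdorff_weight s (U i)) \<le> ennreal e"
  shows "hausdorff_measure s A = 0"
proof -
  have "hausdorff_premeasure \<delta> s A \<le> 0" if "\<delta> > 0" for \<delta>
  proof (rule ennreal_le_epsilon)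
    fix e :: real assume "e > 0"
    from assms[OF that this] obtain U :: "nat \<Rightarrow> 'a set" where U: "A \<subseteq> (\<Union>i. U i)"
      "\<forall>i. bounded (U i) \<and> diameter (U i) \<le> \<delta>" "(\<Sum>i. hausdorff_weight s (U i)) \<le> ennreal e" by blast
    then have "hausdorff_premeasure \<delta> s A \<le> (\<Sum>i. hausdorff_weight s (U i))"
      unfolding hausdorff_premeasure_def by (intro INF_lower) auto
    then show "hausdorff_premeasure \<delta> s A \<le> 0 + ennreal e" using U by (simp add: order_trans)
  qed
  then show ?thesis unfolding hausdorff_measure_def
    by (intro antisym SUP_least) auto
qed

lemma hausdorff_measure_zeroD:
  assumes "hausdorff_measure s A = 0" "\<delta> > 0" "e > 0"
  shows "\<exists>U::nat \<Rightarrow> 'a::metric_space set. A \<subseteq> (\<Union>i. U i) \<and>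
    (\<forall>i. bounded (U i) \<and> diameter (U i) \<le> \<delta>) \<and> (\<Sum>i. hausdorff_weight s (U i)) \<le> ennreal e"
proof -
  have "hausdorff_premeasure \<delta> s A \<le> hausdorff_measure s A"
    unfolding hausdorff_measure_def using assms by (intro SUP_upper) auto
  then have "hausdorff_premeasure \<delta> s A < ennreal e" using assms by simp
  then show ?thesis unfolding hausdorff_premeasure_def INF_less_iff by (force simp: less_imp_le)
qed

lemma hausdorff_measure_zero_mono:
  fixes A B :: "'a::metric_space set"
  assumes "hausdorff_measure s B = 0" "A \<subseteq> B"
  shows "hausdorff_measure s A = 0"
proof (rule hausdorff_measure_zeroI)
  fix \<delta> e :: real assume "\<delta> > 0" "e > 0"
  from hausdorff_measure_zeroD[OF assms(1) this]
  show "\<exists>U::nat \<Rightarrow> 'a set. A \<subseteq> (\<Union>i. U i) \<and>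
    (\<forall>i. bounded (U i) \<and> diameter (U i) \<le> \<delta>) \<and> (\<Sum>i. hausdorff_weight s (U i)) \<le> ennreal e"
    using assms(2) by (elim exE conjE) (rule exI, intro conjI, erule (1) subset_trans, assumption+)
qed

lemma hausdorff_measure_zero_UN:
  fixes A :: "nat \<Rightarrow> 'a::metric_space set"
  assumes "\<And>k. hausdorff_measure s (A k) = 0"
  shows "hausdorff_measure s (\<Union>k. A k) = 0"
proof (rule hausdorff_measure_zeroI)
  fix \<delta> e :: real assume de: "\<delta> > 0" "e > 0"
  have "\<exists>U::nat \<Rightarrow> 'a set. A k \<subseteq> (\<Union>i. U i) \<and> (\<forall>i. bounded (U i) \<and> diameter (U i) \<le> \<delta>) \<and>
    (\<Sum>i. hausdorff_weight s (U i)) \<le> ennreal (e * (1 / 2) ^ Suc k)" for k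
    using de by (intro hausdorff_measure_zeroD assms) auto
  then obtain U :: "nat \<Rightarrow> nat \<Rightarrow> 'a set" where U: "\<And>k. A k \<subseteq> (\<Union>i. U k i)"
    "\<And>k i. bounded (U k i) \<and> diameter (U k i) \<le> \<delta>"
    "\<And>k. (\<Sum>i. hausdorff_weight s (U k i)) \<le> ennreal (e * (1 / 2) ^ Suc k)" by metis
  define V where "V j = case_prod U (prod_decode j)" for j
  have "(\<Sum>j. hausdorff_weight s (V j)) = (\<Sum>j. (\<lambda>(k, i). hausdorff_weight s (U k i)) (prod_decode j))"
    by (simp add: V_def case_prod_beta)
  also have "\<dots> = (\<Sum>k. \<Sum>i. hausdorff_weight s (U k i))"
    by (rule suminf_ennreal_2dimen) auto
  also have "\<dots> \<le> (\<Sum>k. ennreal (e * (1 / 2) ^ Suc k))" by (intro suminf_le U) auto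
  also have "\<dots> = ennreal e"
    using de sums_mult[OF power_half_series, of e]
    by (subst suminf_ennreal2) (auto simp: sums_iff)
  finally have "(\<Sum>j. hausdorff_weight s (V j)) \<le> ennreal e" .
  moreover have "(\<Union>k. A k) \<subseteq> (\<Union>j. V j)"
  proof
    fix x assume "x \<in> (\<Union>k. A k)"
    then obtain k i where "x \<in> U k i" using U(1) by blast
    then have "x \<in> V (prod_encode (k, i))" by (simp add: V_def)
    then show "x \<in> (\<Union>j. V j)" by blast
  qed
  moreover have "bounded (V j) \<and> diameter (V j) \<le> \<delta>" for j using U(2) by (simp add: V_def split: prod.split)
  ultimately show "\<exists>U::nat \<Rightarrow> 'a set. (\<Union>k. A k) \<subseteq> (\<Union>i. U i) \<and>
    (\<forall>i. bounded (U i) \<and> diameter (U i) \<le> \<delta>) \<and> (\<Sum>i. hausdorff_weight s (U i)) \<le> ennreal e" by blast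
qed

lemma hausdorff_measure_countable:
  fixes A :: "'a::metric_space set"
  assumes "countable A" "s > 0"
  shows "hausdorff_measure s A = 0"
proof (rule hausdorff_measure_zeroI)
  fix \<delta> e :: real assume de: "\<delta> > 0" "e > 0"
  define U where "U i = {from_nat_into A i}" for i
  have "A \<subseteq> (\<Union>i. U i)"
  proof
    fix x assume "x \<in> A"
    then have "x \<in> U (to_nat_on A x)" using assms by (simp add: U_def)
    then show "x \<in> (\<Union>i. U i)" by blast
  qed
  moreover have "hausdorff_weight s (U i) = 0" for i using assms by (simp add: hausdorff_weight_def U_def)
  ultimately show "\<exists>U::nat \<Rightarrow> 'a set. A \<subseteq> (\<Union>i. U i) \<and>
    (\<forall>i. bounded (U i) \<and> diameter (U i) \<le> \<delta>) \<and> (\<Sum>i. hausdorff_weight s (U i)) \<le> ennreal e"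
    using de by (intro exI[of _ U]) (auto simp: U_def)
qed

text \<open>The Hausdorff-Cantelli lemma: the families from any index on still cover
  \<open>A\<close>, and their weight is at most a tail of a convergent series.\<close>

lemma hausdorff_measure_limsup:
  fixes A :: "'a::metric_space set" and \<C> :: "nat \<Rightarrow> 'a set set"
  assumes s: "s > 0" and fin: "\<And>j. finite (\<C> j)"
    and diam: "\<And>j S. S \<in> \<C> j \<Longrightarrow> bounded S \<and> diameter S \<le> \<rho> j"
    and lim: "\<rho> \<longlonglongrightarrow> 0" and summ: "summable (\<lambda>j. real (card (\<C> j)) * \<rho> j powr s)"
    and cover: "\<And>x k. x \<in> A \<Longrightarrow> \<exists>j\<ge>k. \<exists>S\<in>\<C> j. x \<in> S"
  shows "hausdorff_measure s A = 0"
proof (rule hausdorff_measure_zeroI)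
  fix \<delta> e :: real assume de: "\<delta> > 0" "e > 0"
  define f where "f j = real (card (\<C> j)) * \<rho> j powr s" for j
  have sf: "summable f" using summ unfolding f_def .
  have f0: "f j \<ge> 0" for j by (simp add: f_def)
  from suminf_exist_split[OF de(2) sf] obtain k1 where k1: "\<And>k. k \<ge> k1 \<Longrightarrow> norm (\<Sum>j. f (j + k)) < e" by blast
  from order_tendstoD(2)[OF lim de(1)] obtain k2 where k2: "\<And>k. k \<ge> k2 \<Longrightarrow> \<rho> k < \<delta>"
    by (auto simp: eventually_sequentially)
  define k where "k = max k1 k2"
  have "\<exists>xs. set xs = \<C> j \<and> distinct xs" for j using finite_distinct_list[OF fin] .
  then obtain xs where xs: "\<And>j. set (xs j) = \<C> j" "\<And>j. distinct (xs j)" by metis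
  have len: "length (xs j) = card (\<C> j)" for j using xs distinct_card by metis
  \<comment> \<open>A cover is a sequence of sets, so each finite family is padded with empty sets,
    which have weight 0 by definition.\<close>
  define U where "U j i = (if i < length (xs (j + k)) then xs (j + k) ! i else {})" for j i
  have inC: "U j i \<in> \<C> (j + k)" if "i < length (xs (j + k))" for j i
    using nth_mem[OF that] that unfolding U_def xs(1) by simp
  have w: "hausdorff_weight s (U j i) \<le> ennreal (\<rho> (j + k) powr s)" for j i
  proof (cases "i < length (xs (j + k))")
    case True
    from diam[OF inC[OF this]] have "diameter (U j i) powr s \<le> \<rho> (j + k) powr s"
      using s by (intro powr_mono2) (auto simp: diameter_ge_0)
    then show ?thesis using s by (auto simp: hausdorff_weight_def)
  qed (auto simp: U_def hausdorff_weight_def)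
  define V where "V l = case_prod U (prod_decode l)" for l
  have "(\<Sum>l. hausdorff_weight s (V l)) = (\<Sum>l. (\<lambda>(j, i). hausdorff_weight s (U j i)) (prod_decode l))"
    by (simp add: V_def case_prod_beta)
  also have "\<dots> = (\<Sum>j. \<Sum>i. hausdorff_weight s (U j i))"
    by (rule suminf_ennreal_2dimen) auto
  also have "\<dots> \<le> (\<Sum>j. ennreal (f (j + k)))"
  proof (rule suminf_le)
    fix j
    have "(\<Sum>i. hausdorff_weight s (U j i)) = (\<Sum>i<length (xs (j + k)). hausdorff_weight s (U j i))"
      by (rule suminf_finite) (auto simp: U_def hausdorff_weight_def)
    also have "\<dots> \<le> (\<Sum>i<length (xs (j + k)). ennreal (\<rho> (j + k) powr s))" by (intro sum_mono w)
    also have "\<dots> = ennreal (f (j + k))" by (simp add: f_def len ennreal_mult ennreal_of_nat_eq_real_of_nat)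
    finally show "(\<Sum>i. hausdorff_weight s (U j i)) \<le> ennreal (f (j + k))" .
  qed auto
  also have "\<dots> = ennreal (\<Sum>j. f (j + k))"
    using f0 sf by (intro suminf_ennreal2) (auto simp: summable_iff_shift)
  also have "\<dots> \<le> ennreal e" using k1[of k] by (intro ennreal_leI) (auto simp: k_def)
  finally have "(\<Sum>l. hausdorff_weight s (V l)) \<le> ennreal e" .
  moreover have "A \<subseteq> (\<Union>l. V l)"
  proof
    fix x assume "x \<in> A"
    then obtain j S where j: "j \<ge> k" "S \<in> \<C> j" "x \<in> S" using cover by blast
    then obtain i where i: "i < length (xs j)" "xs j ! i = S" using xs(1)[of j] by (metis in_set_conv_nth)
    then have "x \<in> V (prod_encode (j - k, i))" using j by (simp add: V_def U_def)
    then show "x \<in> (\<Union>l. V l)" by blast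
  qed
  moreover have "bounded (V l) \<and> diameter (V l) \<le> \<delta>" for l
  proof -
    obtain j i where l: "prod_decode l = (j, i)" by force
    show ?thesis
    proof (cases "i < length (xs (j + k))")
      case True
      have "k2 \<le> j + k" by (simp add: k_def)
      then show ?thesis using diam[OF inC[OF True]] k2[of "j + k"] by (simp add: V_def l)
    qed (use de in \<open>auto simp: V_def l U_def\<close>)
  qed
  ultimately show "\<exists>U::nat \<Rightarrow> 'a set. A \<subseteq> (\<Union>i. U i) \<and>
    (\<forall>i. bounded (U i) \<and> diameter (U i) \<le> \<delta>) \<and> (\<Sum>i. hausdorff_weight s (U i)) \<le> ennreal e" by blast
qed

lemma hausdorff_dim_leI:
  assumes "0 \<le> \<sigma>" "\<And>s. s > \<sigma> \<Longrightarrow> hausdorff_measure s A = 0"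
  shows "hausdorff_dim A \<le> ereal \<sigma>"
proof (rule ereal_le_epsilon2)
  fix e :: real assume "e > 0"
  then show "hausdorff_dim A \<le> ereal \<sigma> + ereal e" unfolding hausdorff_dim_def
    using assms by (intro INF_lower2[of "\<sigma> + e"]) auto
qed

section \<open>Lagrange interpolation and small values of polynomials\<close>

definition lagrange_basis :: "real set \<Rightarrow> real \<Rightarrow> real poly" where
  "lagrange_basis T y = (\<Prod>z\<in>T - {y}. smult (inverse (y - z)) [:- z, 1:])"

lemma poly_lagrange_basis: "poly (lagrange_basis T y) x = (\<Prod>z\<in>T - {y}. (x - z) / (y - z))"
  unfolding lagrange_basis_def poly_prod by (intro prod.cong) (auto simp: divide_inverse algebra_simps)

lemma lagrange_interpolation:
  assumes T: "finite T" and p: "degree p < card T"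
  shows "p = (\<Sum>y\<in>T. smult (poly p y) (lagrange_basis T y))"
proof -
  define q where "q = p - (\<Sum>y\<in>T. smult (poly p y) (lagrange_basis T y))"
  have dl: "degree (lagrange_basis T y) \<le> card T - 1" if "y \<in> T" for y
  proof -
    have "degree (lagrange_basis T y) \<le> (\<Sum>z\<in>T - {y}. degree (smult (inverse (y - z)) [:- z, 1:]))"
      unfolding lagrange_basis_def by (rule degree_prod_sum_le[unfolded o_def]) (use T in auto)
    also have "\<dots> \<le> (\<Sum>z\<in>T - {y}. 1)" by (intro sum_mono) auto
    finally show ?thesis using that T by simp
  qed
  have "degree q \<le> card T - 1" unfolding q_def
    using p dl by (intro degree_diff_le degree_sum_le T order_trans[OF degree_smult_le]) auto
  then have dq: "degree q < card T" using p by linarith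
  have "poly q x = 0" if "x \<in> T" for x
  proof -
    have "poly (lagrange_basis T y) x = (if y = x then 1 else 0)" if "y \<in> T" for y
      unfolding poly_lagrange_basis using T that \<open>x \<in> T\<close> by (auto intro!: prod.neutral)
    then have "(\<Sum>y\<in>T. poly p y * poly (lagrange_basis T y) x) = (\<Sum>y\<in>T. if y = x then poly p y else 0)"
      by (intro sum.cong) auto
    then show ?thesis using T that by (simp add: q_def poly_sum)
  qed
  then have sub: "T \<subseteq> {x. poly q x = 0}" by auto
  have "q = 0"
  proof (rule ccontr)
    assume "q \<noteq> 0"
    then have "card T \<le> degree q"
      using card_mono[OF poly_roots_finite sub] card_poly_roots_bound[of q] by linarith
    then show False using dq by simp
  qed
  then show ?thesis by (simp add: q_def)
qed

text \<open>Used twice with fixed nodes: a covolume polynomial with an integer coefficient cannot be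
  small at all nodes in an interval, and an integer polynomial of large height is large at one of
  \<open>0, \<dots>, n\<close>.\<close>

lemma coeff_bound_from_values:
  assumes T: "finite T"
  shows "\<exists>C>0. \<forall>(p::real poly) B. degree p < card T \<longrightarrow> (\<forall>y\<in>T. \<bar>poly p y\<bar> \<le> B) \<longrightarrow> (\<forall>j. \<bar>coeff p j\<bar> \<le> C * B)"
proof -
  define C where "C = 1 + (\<Sum>y\<in>T. \<Sum>j\<le>card T. \<bar>coeff (lagrange_basis T y) j\<bar>)"
  have C: "C > 0" unfolding C_def by (intro add_pos_nonneg sum_nonneg) auto
  have "\<bar>coeff p j\<bar> \<le> C * B" if p: "degree p < card T" and B: "\<forall>y\<in>T. \<bar>poly p y\<bar> \<le> B" for p :: "real poly" and B j
  proof -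
    obtain y where "y \<in> T" using p by fastforce
    then have B0: "B \<ge> 0" using B by force
    show ?thesis
    proof (cases "j \<le> card T")
      case False
      then have "coeff p j = 0" using p by (intro coeff_eq_0) auto
      then show ?thesis using C B0 by simp
    next
      case True
      have "coeff p j = (\<Sum>y\<in>T. poly p y * coeff (lagrange_basis T y) j)"
        by (subst lagrange_interpolation[OF T p]) (simp add: coeff_sum)
      then have "\<bar>coeff p j\<bar> \<le> (\<Sum>y\<in>T. \<bar>poly p y\<bar> * \<bar>coeff (lagrange_basis T y) j\<bar>)"
        using sum_abs[of "\<lambda>y. poly p y * coeff (lagrange_basis T y) j" T] by (simp add: abs_mult)
      also have "\<dots> \<le> (\<Sum>y\<in>T. B * (\<Sum>j\<le>card T. \<bar>coeff (lagrange_basis T y) j\<bar>))"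
        using True B B0 by (intro sum_mono mult_mono member_le_sum) auto
      also have "\<dots> \<le> C * B" using B0 by (simp add: C_def sum_distrib_left[symmetric] algebra_simps)
      finally show ?thesis .
    qed
  qed
  then show ?thesis using C by blast
qed

text \<open>Greedy choice: the intervals of length \<open>2 * t\<close> around the points chosen so
  far are too short in total to cover \<open>S\<close>.\<close>

lemma separated_points_of_measure:
  fixes S :: "real set"
  assumes S: "S \<in> sets lborel" and t: "t > 0" and big: "emeasure lborel S > ennreal (2 * t * real k)"
  shows "\<exists>T\<subseteq>S. finite T \<and> card T = Suc k \<and> (\<forall>x\<in>T. \<forall>y\<in>T. x \<noteq> y \<longrightarrow> \<bar>x - y\<bar> \<ge> t)"
  using big
proof (induction k)
  case 0
  then have "S \<noteq> {}" by auto
  then obtain x where "x \<in> S" by blast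
  then show ?case by (intro exI[of _ "{x}"]) auto
next
  case (Suc k)
  have "ennreal (2 * t * real k) \<le> ennreal (2 * t * real (Suc k))" using t by (intro ennreal_leI) auto
  then have "ennreal (2 * t * real k) < emeasure lborel S" using Suc.prems by (rule le_less_trans)
  then obtain T where T: "T \<subseteq> S" "finite T" "card T = Suc k" "\<forall>x\<in>T. \<forall>y\<in>T. x \<noteq> y \<longrightarrow> \<bar>x - y\<bar> \<ge> t"
    using Suc.IH by blast
  have "\<exists>x\<in>S. x \<notin> (\<Union>y\<in>T. {y - t<..<y + t})"
  proof (rule ccontr)
    assume "\<not> ?thesis"
    then have "S \<subseteq> (\<Union>y\<in>T. {y - t<..<y + t})" by blast
    then have "emeasure lborel S \<le> emeasure lborel (\<Union>y\<in>T. {y - t<..<y + t})"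
      using T by (intro emeasure_mono) auto
    also have "\<dots> \<le> (\<Sum>y\<in>T. emeasure lborel {y - t<..<y + t})"
      using T by (intro emeasure_subadditive_finite) auto
    also have "\<dots> = (\<Sum>y\<in>T. ennreal (2 * t))" using t by (intro sum.cong) auto
    also have "\<dots> = ennreal (real (Suc k) * (2 * t))"
      using t T by (simp add: ennreal_mult ennreal_of_nat_eq_real_of_nat)
    finally show False using Suc.prems by (simp add: mult.commute)
  qed
  then obtain x where x: "x \<in> S" "\<And>y. y \<in> T \<Longrightarrow> \<bar>x - y\<bar> \<ge> t" by force
  have "x \<notin> T" using x(2)[of x] t by auto
  moreover have "\<bar>y - x\<bar> \<ge> t" if "y \<in> T" for y using x(2)[OF that] by (simp add: abs_minus_commute)
  ultimately show ?case using T x by (intro exI[of _ "insert x T"]) auto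
qed

lemma poly_sublevel_measurable: "{x\<in>{u..v}. \<bar>poly p x\<bar> < (c::real)} \<in> sets lborel"
proof -
  have "{x\<in>{u..v}. \<bar>poly p x\<bar> < c} = {u..v} \<inter> {x. \<bar>poly p x\<bar> < c}" by auto
  moreover have "open {x. \<bar>poly p x\<bar> < c}" by (intro open_Collect_less continuous_intros)
  ultimately show ?thesis by (simp add: borel_open)
qed

text \<open>A large sublevel set contains \<open>m + 1\<close> well-spaced points, and interpolation
  through them would keep the polynomial below 1 on the whole interval. The constant depends only on
  the degree and on \<open>\<eta>\<close>, neither on the interval nor on the size of the
  coefficients; this is the property of being "good" in the sense of Kleinbock and Margulis.\<close>

lemma poly_sublevel_measure:
  fixes \<eta> :: real
  assumes \<eta>: "\<eta> > 0"
  shows "\<exists>c>0. \<forall>(p::real poly) u v. degree p \<le> m \<longrightarrow> u < v \<longrightarrow> (\<exists>x\<in>{u..v}. \<bar>poly p x\<bar> \<ge> 1) \<longrightarrow>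
    emeasure lborel {x\<in>{u..v}. \<bar>poly p x\<bar> < c} \<le> ennreal (\<eta> * (v - u))"
proof -
  \<comment> \<open>The ratio of the interval length to the spacing of the nodes. Each of the
    \<open>m\<close> factors of a Lagrange basis polynomial is at most \<open>q\<close>, and there
    are \<open>m + 1\<close> basis polynomials; this fixes \<open>c\<close>.\<close>
  define q where "q = 2 * real (m + 1) / \<eta>"
  have q: "q > 0" using \<eta> by (simp add: q_def)
  define c where "c = 1 / (real (m + 1) * q ^ m)"
  have c: "c > 0" using q by (simp add: c_def)
  have "emeasure lborel {x\<in>{u..v}. \<bar>poly p x\<bar> < c} \<le> ennreal (\<eta> * (v - u))"
    if p: "degree p \<le> m" and uv: "u < v" and x0: "x0 \<in> {u..v}" "\<bar>poly p x0\<bar> \<ge> 1" for p :: "real poly" and u v x0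
  proof (rule ccontr)
    assume neg: "\<not> ?thesis"
    define t where "t = (v - u) / q"
    have t: "t > 0" using uv q by (simp add: t_def)
    have "2 * t * real m \<le> 2 * t * real (m + 1)" using t by (intro mult_left_mono) auto
    also have "\<dots> = \<eta> * (v - u)" using \<eta> by (simp add: t_def q_def field_simps)
    finally have "ennreal (2 * t * real m) \<le> ennreal (\<eta> * (v - u))" by (rule ennreal_leI)
    then have "emeasure lborel {x\<in>{u..v}. \<bar>poly p x\<bar> < c} > ennreal (2 * t * real m)"
      using neg by (simp add: not_le)
    from separated_points_of_measure[OF poly_sublevel_measurable t this]
    obtain T where T: "T \<subseteq> {x\<in>{u..v}. \<bar>poly p x\<bar> < c}" "finite T" "card T = Suc m"
      "\<And>x y. x \<in> T \<Longrightarrow> y \<in> T \<Longrightarrow> x \<noteq> y \<Longrightarrow> \<bar>x - y\<bar> \<ge> t" by blast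
    have "poly p x0 = (\<Sum>y\<in>T. poly p y * poly (lagrange_basis T y) x0)"
      by (subst lagrange_interpolation[of T p]) (use p T in \<open>auto simp: poly_sum\<close>)
    then have "\<bar>poly p x0\<bar> \<le> (\<Sum>y\<in>T. \<bar>poly p y * poly (lagrange_basis T y) x0\<bar>)" by simp
    also have "\<dots> < (\<Sum>y\<in>T. c * q ^ m)"
    proof (rule sum_strict_mono)
      show "finite T" "T \<noteq> {}" using T by auto
      fix y assume y: "y \<in> T"
      have "\<bar>poly (lagrange_basis T y) x0\<bar> = (\<Prod>z\<in>T - {y}. \<bar>x0 - z\<bar> / \<bar>y - z\<bar>)"
        by (simp add: poly_lagrange_basis abs_prod)
      also have "\<dots> \<le> (\<Prod>z\<in>T - {y}. q)"
      proof (rule prod_mono)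
        fix z assume z: "z \<in> T - {y}"
        have "\<bar>x0 - z\<bar> \<le> v - u" using x0 z T(1) by auto
        also have "\<dots> = q * t" using q by (simp add: t_def)
        also have "\<dots> \<le> q * \<bar>y - z\<bar>" using T(4)[of y z] y z q by (intro mult_left_mono) auto
        finally show "0 \<le> \<bar>x0 - z\<bar> / \<bar>y - z\<bar> \<and> \<bar>x0 - z\<bar> / \<bar>y - z\<bar> \<le> q"
          using z by (auto simp: divide_le_eq)
      qed
      also have "\<dots> = q ^ m" using T y by simp
      finally have "\<bar>poly (lagrange_basis T y) x0\<bar> \<le> q ^ m" .
      moreover have "\<bar>poly p y\<bar> < c" using T y by auto
      ultimately show "\<bar>poly p y * poly (lagrange_basis T y) x0\<bar> < c * q ^ m"
        using q unfolding abs_mult by (smt (verit) mult_less_le_imp_less mult_nonneg_nonneg zero_less_power mult_le_less_imp_less mult_strict_right_mono mult_left_mono)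
    qed
    also have "\<dots> = 1" using T q by (simp add: c_def)
    finally show False using x0 by simp
  qed
  then show ?thesis using c by blast
qed

section \<open>Pigeonhole and growth estimates\<close>

lemma card_le_fibres:
  assumes "finite A" "\<And>y. y \<in> f ` A \<Longrightarrow> real (card {x\<in>A. f x = y}) \<le> c" "finite B" "f ` A \<subseteq> B" "c \<ge> 0"
  shows "real (card A) \<le> real (card B) * c"
proof -
  have "real (card A) = (\<Sum>x\<in>A. 1)" by simp
  also have "\<dots> = (\<Sum>y\<in>f ` A. \<Sum>x\<in>{x\<in>A. f x = y}. 1)" by (rule sum.image_gen[OF assms(1)])
  also have "\<dots> \<le> (\<Sum>y\<in>f ` A. c)" using assms(2) by (intro sum_mono) simp
  also have "\<dots> \<le> real (card B) * c" using assms(3-5) by (simp add: card_mono mult_right_mono)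
  finally show ?thesis .
qed

lemma same_cell_diff:
  fixes x y d :: real
  assumes "\<lfloor>x / d\<rfloor> = \<lfloor>y / d\<rfloor>" "d > 0"
  shows "\<bar>x - y\<bar> < d"
proof -
  have "\<bar>x / d - y / d\<bar> < 1" using assms(1) by linarith
  then have "\<bar>(x - y) / d\<bar> < 1" by (simp add: diff_divide_distrib)
  then show ?thesis using assms(2) by (simp add: abs_divide)
qed

lemma card_cells:
  fixes B d :: real
  assumes "d > 0" "B \<ge> 0"
  shows "real (card {\<lfloor>- B / d\<rfloor>..\<lfloor>B / d\<rfloor>}) \<le> 2 * B / d + 2"
proof -
  have "- B / d \<le> B / d" using assms by (intro divide_right_mono) auto
  then have "\<lfloor>- B / d\<rfloor> \<le> \<lfloor>B / d\<rfloor>" by (rule floor_mono)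
  then have "real (card {\<lfloor>- B / d\<rfloor>..\<lfloor>B / d\<rfloor>}) = of_int (\<lfloor>B / d\<rfloor> - \<lfloor>- B / d\<rfloor> + 1)" by simp
  also have "\<dots> \<le> B / d - (- B / d - 1) + 1" by linarith
  finally show ?thesis by simp
qed

lemma poly_abs_bound:
  fixes p :: "real poly"
  assumes "degree p \<le> n" "\<And>i. i \<le> n \<Longrightarrow> \<bar>coeff p i\<bar> \<le> B" "\<bar>x\<bar> \<le> R" "R \<ge> 1"
  shows "\<bar>poly p x\<bar> \<le> real (n + 1) * B * R ^ n"
proof -
  have B: "B \<ge> 0" using assms(2)[of 0] by linarith
  have "poly p x = (\<Sum>i\<le>n. coeff p i * x ^ i)"
    using assms(1) by (subst poly_altdef, intro sum.mono_neutral_left) (auto simp: coeff_eq_0)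
  then have "\<bar>poly p x\<bar> \<le> (\<Sum>i\<le>n. \<bar>coeff p i * x ^ i\<bar>)" by simp
  also have "\<dots> \<le> (\<Sum>i\<le>n. B * R ^ n)"
  proof (rule sum_mono)
    fix i assume "i \<in> {..n}"
    have "\<bar>x\<bar> ^ i \<le> R ^ i" using assms by (intro power_mono) auto
    also have "\<dots> \<le> R ^ n" using assms \<open>i \<in> {..n}\<close> by (intro power_increasing) auto
    finally show "\<bar>coeff p i * x ^ i\<bar> \<le> B * R ^ n"
      unfolding abs_mult power_abs using assms(2)[of i] \<open>i \<in> {..n}\<close> B by (intro mult_mono) auto
  qed
  finally show ?thesis by (simp add: mult.assoc)
qed

lemma powr_eventually_ge:
  fixes t :: real
  assumes "t > 0"
  shows "\<forall>\<^sub>F Q in at_top. C \<le> Q powr t"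
  using eventually_ge_at_top[of "max 1 C powr (1 / t)"]
proof eventually_elim
  case (elim Q)
  have "C \<le> (max 1 C powr (1 / t)) powr t" using assms by (simp add: powr_powr)
  also have "\<dots> \<le> Q powr t" using elim assms by (intro powr_mono2) auto
  finally show ?case .
qed

section \<open>Rational subspaces, their integer bases and flags\<close>

interpretation qpoly: vector_space "Polynomial.smult :: rat \<Rightarrow> rat poly \<Rightarrow> rat poly"
  by unfold_locales (auto simp: smult_add_right smult_add_left)

abbreviation rat_poly :: "int poly \<Rightarrow> rat poly" where "rat_poly \<equiv> of_int_poly"

text \<open>The Plucker coordinates of the span of \<open>\<tau>\<close>, with columns selected by
  \<open>g\<close>.\<close>

definition int_minor :: "int poly list \<Rightarrow> (nat \<Rightarrow> nat) \<Rightarrow> int" where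
  "int_minor \<tau> g = det (mat (length \<tau>) (length \<tau>) (\<lambda>(i, j). coeff (\<tau> ! i) (g j)))"

text \<open>Induction on the list. If every choice of the last column gave a vanishing minor,
  expansion along that column would express the new polynomial through the old ones: the cofactors
  do not depend on the choice, and the one belonging to the new polynomial is the nonzero minor of
  the shorter list.\<close>

lemma int_minor_nonzero_of_independent:
  assumes "distinct \<tau>" "qpoly.independent (rat_poly ` set \<tau>)" "\<forall>P\<in>set \<tau>. degree P \<le> n"
  shows "\<exists>g\<in>{..<length \<tau>} \<rightarrow>\<^sub>E {..n}. int_minor \<tau> g \<noteq> 0"
  using assms
proof (induction \<tau> rule: rev_induct)
  case Nil
  then show ?case by (auto simp: int_minor_def)
next
  case (snoc v \<tau>)
  define k where "k = length \<tau>"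
  have "qpoly.independent (rat_poly ` set \<tau>)"
    using snoc.prems(2) by (rule qpoly.independent_mono) auto
  then obtain g where g: "g \<in> {..<k} \<rightarrow>\<^sub>E {..n}" "int_minor \<tau> g \<noteq> 0"
    using snoc by (auto simp: k_def)
  have v: "rat_poly v \<notin> rat_poly ` set \<tau>" using snoc.prems(1) by auto
  then have vspan: "rat_poly v \<notin> qpoly.span (rat_poly ` set \<tau>)"
    using snoc.prems(2) by (simp add: qpoly.independent_insert)
  have "\<exists>m\<le>n. int_minor (\<tau> @ [v]) (g(k := m)) \<noteq> 0"
  proof (rule ccontr)
    assume "\<not> ?thesis"
    then have zero: "int_minor (\<tau> @ [v]) (g(k := m)) = 0" if "m \<le> n" for m using that by blast
    define A where "A m = mat (Suc k) (Suc k) (\<lambda>(i, j). coeff ((\<tau> @ [v]) ! i) ((g(k := m)) j))" for m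
    define c where "c i = cofactor (A 0) i k" for i
    have cof: "cofactor (A m) i k = c i" for m i
    proof -
      have "mat_delete (A m) i k = mat_delete (A 0) i k"
        by (auto simp: mat_delete_def A_def intro!: cong_mat)
      then show ?thesis by (simp add: cofactor_def c_def)
    qed
    have ck: "c k = int_minor \<tau> g"
    proof -
      have "mat_delete (A 0) k k = mat k k (\<lambda>(i, j). coeff (\<tau> ! i) (g j))"
        by (auto simp: mat_delete_def A_def nth_append k_def intro!: cong_mat)
      then show ?thesis by (simp add: c_def cofactor_def int_minor_def k_def)
    qed
    have rel: "(\<Sum>i<k. c i * coeff (\<tau> ! i) m) + c k * coeff v m = 0" for m
    proof (cases "m \<le> n")
      case True
      have "det (A m) = (\<Sum>i<Suc k. A m $$ (i, k) * cofactor (A m) i k)"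
        by (rule laplace_expansion_column) (auto simp: A_def)
      also have "\<dots> = (\<Sum>i<k. c i * coeff (\<tau> ! i) m) + c k * coeff v m"
        by (simp add: cof) (simp add: A_def nth_append k_def mult.commute)
      finally show ?thesis using zero[OF True] by (simp add: int_minor_def A_def k_def)
    next
      case False
      have "coeff P m = 0" if "P \<in> set (\<tau> @ [v])" for P
        using that snoc.prems(3) False by (intro coeff_eq_0) (meson le_less_trans not_le)
      then show ?thesis by (simp add: k_def)
    qed
    define q where "q = (\<Sum>i<k. Polynomial.smult (- of_int (c i) / of_int (c k)) (rat_poly (\<tau> ! i)))"
    have "rat_poly v = q"
    proof (rule poly_eqI)
      fix m
      have "(of_int ((\<Sum>i<k. c i * coeff (\<tau> ! i) m) + c k * coeff v m) :: rat) = 0" by (simp only: rel of_int_0)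
      then have "of_int (c k) * of_int (coeff v m) = - (\<Sum>i<k. of_int (c i) * (of_int (coeff (\<tau> ! i) m) :: rat))"
        by (simp add: eq_neg_iff_add_eq_0 add.commute)
      then have "of_int (coeff v m) = - (\<Sum>i<k. of_int (c i) * (of_int (coeff (\<tau> ! i) m) :: rat)) / of_int (c k)"
        using g(2) by (simp add: ck field_simps)
      also have "\<dots> = coeff q m"
        by (simp add: q_def coeff_sum sum_negf sum_divide_distrib)
      finally show "coeff (rat_poly v) m = coeff q m" by simp
    qed
    moreover have "q \<in> qpoly.span (rat_poly ` set \<tau>)" unfolding q_def
      by (intro qpoly.span_sum qpoly.span_scale qpoly.span_base) (auto simp: k_def)
    ultimately show False using vspan by simp
  qed
  then obtain m where m: "m \<le> n" "int_minor (\<tau> @ [v]) (g(k := m)) \<noteq> 0" by blast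
  have "g(k := m) \<in> {..<length (\<tau> @ [v])} \<rightarrow>\<^sub>E {..n}"
    using g(1) m(1) by (auto simp: k_def PiE_iff extensional_def less_Suc_eq)
  then show ?case using m(2) by blast
qed

lemma int_minor_nonzero_inj:
  assumes "int_minor \<tau> g \<noteq> 0"
  shows "inj_on g {..<length \<tau>}"
proof (rule inj_onI, rule ccontr)
  fix i j assume ij: "i \<in> {..<length \<tau>}" "j \<in> {..<length \<tau>}" "g i = g j" "i \<noteq> j"
  have "int_minor \<tau> g = 0" unfolding int_minor_def
    by (rule det_identical_columns[of _ "length \<tau>" i j]) (use ij in \<open>auto simp: col_def\<close>)
  then show False using assms by simp
qed

text \<open>A basis over the rationals that consists of integer polynomials. It need not generate
  the lattice of all integer polynomials in \<open>V\<close>; the minimisation in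
  \<open>red_basis\<close> takes the place of primitivity.\<close>

definition is_int_basis :: "int poly list \<Rightarrow> rat poly set \<Rightarrow> bool" where
  "is_int_basis \<tau> V \<longleftrightarrow> distinct \<tau> \<and> qpoly.independent (rat_poly ` set \<tau>) \<and> qpoly.span (rat_poly ` set \<tau>) = V"

lemma rat_poly_inj: "inj rat_poly" by (rule of_int_poly_hom.inj_f)

lemma is_int_basis_card: "is_int_basis \<tau> V \<Longrightarrow> card (rat_poly ` set \<tau>) = length \<tau>"
  unfolding is_int_basis_def by (simp add: card_image inj_on_subset[OF rat_poly_inj] distinct_card)

lemma rat_poly_common_denominator: "\<exists>c q. c \<noteq> 0 \<and> rat_poly q = Polynomial.smult (of_int c) p"
proof -
  obtain c q where cq: "rat_to_int_poly p = (c, q)" by force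
  from rat_to_int_poly[OF this] have "p = Polynomial.smult (inverse (of_int c)) (rat_poly q)" "c > 0" by auto
  then show ?thesis by (intro exI[of _ c] exI[of _ q]) auto
qed

lemma int_basis_exists:
  assumes V: "qpoly.subspace V" and deg: "V \<subseteq> {p. degree p \<le> n}"
  shows "\<exists>\<tau>. is_int_basis \<tau> V \<and> length \<tau> \<le> Suc n"
proof -
  obtain B where B: "B \<subseteq> V \<inter> range rat_poly" "qpoly.independent B" "V \<inter> range rat_poly \<subseteq> qpoly.span B"
    using qpoly.maximal_independent_subset[of "V \<inter> range rat_poly"] by blast
  have spanB: "qpoly.span B = V"
  proof
    show "qpoly.span B \<subseteq> V" using B(1) V by (simp add: qpoly.span_minimal)
    show "V \<subseteq> qpoly.span B"
    proof
      fix p assume p: "p \<in> V"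
      obtain c q where cq: "c \<noteq> 0" "rat_poly q = Polynomial.smult (of_int c) p"
        using rat_poly_common_denominator by blast
      have "rat_poly q \<in> V" unfolding cq(2) using V p by (rule qpoly.subspace_scale)
      then have "rat_poly q \<in> qpoly.span B" using B(3) by blast
      then have "Polynomial.smult (inverse (of_int c)) (rat_poly q) \<in> qpoly.span B" by (rule qpoly.span_scale)
      moreover have "Polynomial.smult (inverse (of_int c)) (rat_poly q) = p"
        unfolding cq(2) using cq(1) by simp
      ultimately show "p \<in> qpoly.span B" by simp
    qed
  qed
  define M where "M = (\<lambda>i. Polynomial.monom (1::rat) i) ` {..n}"
  have "B \<subseteq> qpoly.span M"
  proof
    fix p assume "p \<in> B"
    then have "degree p \<le> n" using B(1) deg by blast
    then have "p = (\<Sum>i\<le>n. Polynomial.monom (coeff p i) i)" by (simp add: poly_as_sum_of_monoms')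
    also have "\<dots> = (\<Sum>i\<le>n. Polynomial.smult (coeff p i) (Polynomial.monom 1 i))" by (simp add: smult_monom)
    also have "\<dots> \<in> qpoly.span M" by (intro qpoly.span_sum qpoly.span_scale qpoly.span_base) (auto simp: M_def)
    finally show "p \<in> qpoly.span M" .
  qed
  then have fin: "finite B" "card B \<le> card M"
    using qpoly.independent_span_bound[OF _ B(2), of M] by (auto simp: M_def)
  have "card M \<le> Suc n" unfolding M_def using card_image_le[of "{..n}"] by (simp add: le_trans)
  obtain bs where bs: "set bs = B" "distinct bs" using finite_distinct_list[OF fin(1)] by blast
  define \<tau> where "\<tau> = map (inv_into UNIV rat_poly) bs"
  have inv: "rat_poly (inv_into UNIV rat_poly b) = b" if "b \<in> B" for b using that B(1) by (meson Int_iff f_inv_into_f subset_eq)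
  have "rat_poly ` set \<tau> = B" unfolding \<tau>_def using inv bs(1) by (force simp: image_image)
  moreover have "distinct \<tau>" unfolding \<tau>_def distinct_map using bs inv by (metis inj_onI)
  moreover have "length \<tau> \<le> Suc n" using bs fin(2) \<open>card M \<le> Suc n\<close> by (simp add: \<tau>_def distinct_card[symmetric])
  ultimately show ?thesis using B(2) spanB unfolding is_int_basis_def by blast
qed

lemma is_int_basis_length_eq:
  assumes "is_int_basis \<tau> V" "is_int_basis \<sigma> V"
  shows "length \<tau> = length \<sigma>"
proof -
  have "card (rat_poly ` set \<tau>) \<le> card (rat_poly ` set \<sigma>)" "card (rat_poly ` set \<sigma>) \<le> card (rat_poly ` set \<tau>)"
    using qpoly.independent_span_bound[of "rat_poly ` set \<sigma>" "rat_poly ` set \<tau>"]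
      qpoly.independent_span_bound[of "rat_poly ` set \<tau>" "rat_poly ` set \<sigma>"] assms
      qpoly.span_superset[of "rat_poly ` set \<tau>"] qpoly.span_superset[of "rat_poly ` set \<sigma>"]
    by (auto simp: is_int_basis_def)
  then show ?thesis using is_int_basis_card assms by (metis antisym)
qed

lemma is_int_basis_snoc:
  assumes "is_int_basis \<tau> V" "rat_poly v \<notin> V"
  shows "is_int_basis (\<tau> @ [v]) (qpoly.span (insert (rat_poly v) V))"
proof -
  let ?B = "rat_poly ` set \<tau>"
  have V: "qpoly.span ?B = V" using assms(1) by (simp add: is_int_basis_def)
  have "qpoly.span (insert (rat_poly v) V) = qpoly.span (insert (rat_poly v) ?B)"
  proof (rule antisym)
    show "qpoly.span (insert (rat_poly v) V) \<subseteq> qpoly.span (insert (rat_poly v) ?B)"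
      using qpoly.span_mono[of ?B "insert (rat_poly v) ?B"]
      by (intro qpoly.span_minimal qpoly.subspace_span) (auto simp: V[symmetric] intro: qpoly.span_base)
    show "qpoly.span (insert (rat_poly v) ?B) \<subseteq> qpoly.span (insert (rat_poly v) V)"
      using qpoly.span_superset[of ?B] by (intro qpoly.span_mono) (auto simp: V[symmetric])
  qed
  moreover have "v \<notin> set \<tau>" using assms(2) V qpoly.span_base by blast
  moreover have "qpoly.independent (insert (rat_poly v) ?B)"
    using assms V by (intro qpoly.independent_insertI) (auto simp: is_int_basis_def)
  ultimately show ?thesis using assms(1) by (auto simp: is_int_basis_def)
qed

lemma is_int_basis_change:
  assumes \<tau>: "is_int_basis \<tau> V" and \<sigma>: "is_int_basis \<sigma> V"
  shows "\<exists>a. \<forall>i<length \<sigma>. \<forall>m. rat_of_int (coeff (\<sigma> ! i) m) = (\<Sum>j<length \<tau>. a i j * rat_of_int (coeff (\<tau> ! j) m))"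
proof -
  have "\<forall>i. \<exists>a. i < length \<sigma> \<longrightarrow> (\<forall>m. rat_of_int (coeff (\<sigma> ! i) m) = (\<Sum>j<length \<tau>. a j * rat_of_int (coeff (\<tau> ! j) m)))"
  proof (intro allI)
    fix i
    show "\<exists>a. i < length \<sigma> \<longrightarrow> (\<forall>m. rat_of_int (coeff (\<sigma> ! i) m) = (\<Sum>j<length \<tau>. a j * rat_of_int (coeff (\<tau> ! j) m)))"
    proof (cases "i < length \<sigma>")
      case True
      have "rat_poly (\<sigma> ! i) \<in> qpoly.span (rat_poly ` set \<sigma>)" using True by (intro qpoly.span_base) auto
      then have "rat_poly (\<sigma> ! i) \<in> qpoly.span (rat_poly ` set \<tau>)" using assms by (simp add: is_int_basis_def)
      then obtain u where u: "rat_poly (\<sigma> ! i) = (\<Sum>w\<in>rat_poly ` set \<tau>. Polynomial.smult (u w) w)"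
        using qpoly.span_finite[of "rat_poly ` set \<tau>"] by auto
      have "(\<Sum>w\<in>rat_poly ` set \<tau>. Polynomial.smult (u w) w)
        = (\<Sum>P\<in>set \<tau>. Polynomial.smult (u (rat_poly P)) (rat_poly P))"
        by (rule sum.reindex_cong[OF inj_on_subset[OF rat_poly_inj]]) auto
      also have "\<dots> = (\<Sum>j<length \<tau>. Polynomial.smult (u (rat_poly (\<tau> ! j))) (rat_poly (\<tau> ! j)))"
        using \<tau> by (intro sum.reindex_bij_betw[symmetric] bij_betw_nth) (auto simp: is_int_basis_def)
      finally have eq: "rat_poly (\<sigma> ! i) = (\<Sum>j<length \<tau>. Polynomial.smult (u (rat_poly (\<tau> ! j))) (rat_poly (\<tau> ! j)))"
        using u by simp
      have "rat_of_int (coeff (\<sigma> ! i) m) = (\<Sum>j<length \<tau>. u (rat_poly (\<tau> ! j)) * rat_of_int (coeff (\<tau> ! j) m))" for m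
        using arg_cong[OF eq, of "\<lambda>p. coeff p m"] by (simp add: coeff_sum)
      then show ?thesis by (intro exI[of _ "\<lambda>j. u (rat_poly (\<tau> ! j))"]) auto
    qed auto
  qed
  then obtain a where "\<forall>i. i < length \<sigma> \<longrightarrow> (\<forall>m. rat_of_int (coeff (\<sigma> ! i) m) = (\<Sum>j<length \<tau>. a i j * rat_of_int (coeff (\<tau> ! j) m)))"
    by metis
  then show ?thesis by blast
qed

definition proper_spaces :: "nat \<Rightarrow> rat poly set set" where
  "proper_spaces n = {V. qpoly.subspace V \<and> V \<noteq> {0} \<and> V \<subseteq> {p. degree p \<le> n}}"

text \<open>The minors of any two integer bases of \<open>V\<close> are proportional, so a basis of
  least total minor has the least covolume in every coordinate. The quantity minimised involves
  neither \<open>\<zeta>\<close> nor \<open>Q\<close>; one basis therefore serves all points, and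
  its covolumes are polynomials in \<open>\<zeta>\<close>.\<close>

definition red_basis :: "nat \<Rightarrow> rat poly set \<Rightarrow> int poly list" where
  "red_basis n V = (ARG_MIN (\<lambda>\<tau>. nat (\<Sum>g\<in>{..<length \<tau>} \<rightarrow>\<^sub>E {..n}. \<bar>int_minor \<tau> g\<bar>)) \<tau>. is_int_basis \<tau> V)"

lemma red_basis:
  assumes "V \<in> proper_spaces n"
  shows "is_int_basis (red_basis n V) V" "length (red_basis n V) \<le> Suc n" "length (red_basis n V) > 0"
    "\<And>P. P \<in> set (red_basis n V) \<Longrightarrow> degree P \<le> n"
proof -
  from assms obtain \<tau> where \<tau>: "is_int_basis \<tau> V" "length \<tau> \<le> Suc n"
    using int_basis_exists unfolding proper_spaces_def by blast
  then show b: "is_int_basis (red_basis n V) V" unfolding red_basis_def by (rule_tac arg_min_natI)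
  then show "length (red_basis n V) \<le> Suc n" using is_int_basis_length_eq[OF \<tau>(1) b] \<tau>(2) by simp
  have "set (red_basis n V) \<noteq> {}" using b assms by (auto simp: is_int_basis_def proper_spaces_def)
  then show "length (red_basis n V) > 0" by auto
  fix P assume "P \<in> set (red_basis n V)"
  then have "rat_poly P \<in> V" using b qpoly.span_base[of "rat_poly P" "rat_poly ` set (red_basis n V)"]
    unfolding is_int_basis_def by simp
  then have "degree (rat_poly P) \<le> n" using assms by (auto simp: proper_spaces_def)
  then show "degree P \<le> n" by simp
qed

lemma red_basis_minimal:
  assumes "is_int_basis \<sigma> V"
  shows "nat (\<Sum>g\<in>{..<length (red_basis n V)} \<rightarrow>\<^sub>E {..n}. \<bar>int_minor (red_basis n V) g\<bar>)
    \<le> nat (\<Sum>g\<in>{..<length \<sigma>} \<rightarrow>\<^sub>E {..n}. \<bar>int_minor \<sigma> g\<bar>)"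
  unfolding red_basis_def using assms by (intro arg_min_nat_le)

lemma length_red_basis_mono:
  assumes "V \<in> proper_spaces n" "W \<in> proper_spaces n" "V \<subset> W"
  shows "length (red_basis n V) < length (red_basis n W)"
proof -
  obtain w where w: "w \<in> W" "w \<notin> V" using assms(3) by blast
  note V = red_basis(1)[OF assms(1)] and W = red_basis(1)[OF assms(2)]
  let ?B = "rat_poly ` set (red_basis n V)"
  have ind: "qpoly.independent (insert w ?B)"
    using V w by (intro qpoly.independent_insertI) (auto simp: is_int_basis_def)
  have "?B \<subseteq> V" using V qpoly.span_superset[of ?B] unfolding is_int_basis_def by simp
  then have "w \<notin> ?B" using w by blast
  have "insert w ?B \<subseteq> qpoly.span (rat_poly ` set (red_basis n W))"
    using W w \<open>?B \<subseteq> V\<close> assms(3) by (auto simp: is_int_basis_def)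
  from qpoly.independent_span_bound[OF _ ind this] have "card (insert w ?B) \<le> length (red_basis n W)"
    using is_int_basis_card[OF W] by simp
  then show ?thesis using is_int_basis_card[OF V] \<open>w \<notin> ?B\<close> by simp
qed

definition is_flag :: "nat \<Rightarrow> rat poly set set \<Rightarrow> bool" where
  "is_flag n F \<longleftrightarrow> F \<subseteq> proper_spaces n \<and> finite F \<and> (\<forall>V\<in>F. \<forall>W\<in>F. V \<subseteq> W \<or> W \<subseteq> V)"

lemma is_flag_card:
  assumes "is_flag n F"
  shows "card F \<le> Suc n"
proof -
  have "inj_on (\<lambda>V. length (red_basis n V)) F"
  proof (rule inj_onI, rule ccontr)
    fix V W assume VW: "V \<in> F" "W \<in> F" "length (red_basis n V) = length (red_basis n W)" "V \<noteq> W"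
    then have "V \<subset> W \<or> W \<subset> V" using assms by (auto simp: is_flag_def)
    then show False using length_red_basis_mono[of V n W] length_red_basis_mono[of W n V] VW assms
      by (auto simp: is_flag_def)
  qed
  moreover have "(\<lambda>V. length (red_basis n V)) ` F \<subseteq> {1..Suc n}"
  proof safe
    fix V assume "V \<in> F"
    then have "V \<in> proper_spaces n" using assms by (auto simp: is_flag_def)
    from red_basis(2,3)[OF this] show "length (red_basis n V) \<in> {1..Suc n}"
      unfolding atLeastAtMost_iff by linarith
  qed
  ultimately have "card F \<le> card {1..Suc n}" by (meson card_inj_on_le finite_atLeastAtMost)
  then show ?thesis by simp
qed

definition flag_ext :: "nat \<Rightarrow> rat poly set set \<Rightarrow> rat poly set set" where
  "flag_ext n F = {V \<in> proper_spaces n. V \<notin> F \<and> (\<forall>W\<in>F. V \<subseteq> W \<or> W \<subseteq> V)}"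

lemma is_flag_insert: "is_flag n F \<Longrightarrow> V \<in> flag_ext n F \<Longrightarrow> is_flag n (insert V F)"
  by (auto simp: is_flag_def flag_ext_def)

lemma flag_ext_insert: "flag_ext n (insert V F) \<subseteq> flag_ext n F"
  by (auto simp: flag_ext_def)

section \<open>Covolumes of rational subspaces in the stretched lattice\<close>

text \<open>The lattice of integer polynomials of degree at most \<open>n\<close> is observed in the coordinates
  \<open>(Q\<^sup>n P(\<zeta>), a\<^sub>1 / Q, \<dots>, a\<^sub>n / Q)\<close>.\<close>

locale veronese =
  fixes n :: nat and Q :: real
  assumes n: "n \<ge> 1" and Q: "Q \<ge> 1"
begin

definition vbase :: "real \<Rightarrow> nat \<Rightarrow> nat \<Rightarrow> real" where
  "vbase \<zeta> m j = (if j = 0 then Q ^ n * \<zeta> ^ m else if m = j then 1 / Q else 0)"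

definition vcoord :: "real \<Rightarrow> int poly \<Rightarrow> nat \<Rightarrow> real" where
  "vcoord \<zeta> P j = (\<Sum>m\<le>n. of_int (coeff P m) * vbase \<zeta> m j)"

definition wedge :: "int poly list \<Rightarrow> (nat \<Rightarrow> nat) \<Rightarrow> real \<Rightarrow> real" where
  "wedge \<tau> f \<zeta> = det (mat (length \<tau>) (length \<tau>) (\<lambda>(i, j). vcoord \<zeta> (\<tau> ! i) (f j)))"

text \<open>A bound on the covolume in the maximum norm of the exterior power. An index function
  with a repetition contributes the value 0; for the empty list the only coordinate is 1.\<close>

definition wedge_lt :: "int poly list \<Rightarrow> real \<Rightarrow> real \<Rightarrow> bool" where
  "wedge_lt \<tau> \<zeta> t \<longleftrightarrow> (\<forall>f\<in>{..<length \<tau>} \<rightarrow>\<^sub>E {..n}. \<bar>wedge \<tau> f \<zeta>\<bar> < t)"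

lemma vcoord_0: "degree P \<le> n \<Longrightarrow> vcoord \<zeta> P 0 = Q ^ n * poly (of_int_poly P) \<zeta>"
proof -
  assume "degree P \<le> n"
  then have "poly (of_int_poly P) \<zeta> = (\<Sum>m\<le>n. coeff (of_int_poly P :: real poly) m * \<zeta> ^ m)"
    by (subst poly_altdef, intro sum.mono_neutral_left) (auto simp: coeff_eq_0)
  then show ?thesis by (simp add: vcoord_def vbase_def sum_distrib_left algebra_simps)
qed

lemma vcoord_pos: "0 < j \<Longrightarrow> j \<le> n \<Longrightarrow> vcoord \<zeta> P j = of_int (coeff P j) / Q"
proof -
  assume j: "0 < j" "j \<le> n"
  then have "vcoord \<zeta> P j = (\<Sum>m\<le>n. if m = j then of_int (coeff P m) / Q else 0)"
    unfolding vcoord_def vbase_def by (intro sum.cong) auto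
  then show ?thesis using j by simp
qed

lemma wedge_cong: "(\<And>j. j < length \<tau> \<Longrightarrow> f j = g j) \<Longrightarrow> wedge \<tau> f \<zeta> = wedge \<tau> g \<zeta>"
  unfolding wedge_def by (intro arg_cong[where f = det] cong_mat) auto

lemma wedge_bound:
  assumes "wedge_lt \<tau> \<zeta> t" "\<And>j. j < length \<tau> \<Longrightarrow> f j \<le> n"
  shows "\<bar>wedge \<tau> f \<zeta>\<bar> < t"
proof -
  have "restrict f {..<length \<tau>} \<in> {..<length \<tau>} \<rightarrow>\<^sub>E {..n}" using assms(2) by auto
  then have "\<bar>wedge \<tau> (restrict f {..<length \<tau>}) \<zeta>\<bar> < t" using assms(1) by (simp add: wedge_lt_def)
  then show ?thesis by (subst wedge_cong[of \<tau> f "restrict f {..<length \<tau>}"]) auto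
qed

text \<open>Laplace expansion along the appended row, whose entries are below \<open>e\<close>,
  while the cofactors are up to sign coordinates of the wedge of \<open>\<tau>\<close>.\<close>

lemma wedge_snoc:
  assumes lt: "wedge_lt \<tau> \<zeta> t" and e: "\<And>j. j \<le> n \<Longrightarrow> \<bar>vcoord \<zeta> v j\<bar> < e" and te: "t > 0" "e > 0"
  shows "wedge_lt (\<tau> @ [v]) \<zeta> (real (Suc (length \<tau>)) * (e * t))"
  unfolding wedge_lt_def
proof
  define k where "k = length \<tau>"
  fix f assume f: "f \<in> {..<length (\<tau> @ [v])} \<rightarrow>\<^sub>E {..n}"
  then have fn: "f j \<le> n" if "j < Suc k" for j using that by (auto simp: k_def PiE_iff)
  define A where "A = mat (Suc k) (Suc k) (\<lambda>(i, j). vcoord \<zeta> ((\<tau> @ [v]) ! i) (f j))"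
  have det: "det A = (\<Sum>j<Suc k. A $$ (k, j) * cofactor A k j)"
    by (rule laplace_expansion_row) (auto simp: A_def)
  have "\<bar>A $$ (k, j) * cofactor A k j\<bar> < e * t" if j: "j < Suc k" for j
  proof -
    define f' where "f' i = (if i < j then f i else f (Suc i))" for i
    have "mat_delete A k j = mat k k (\<lambda>(i, j). vcoord \<zeta> (\<tau> ! i) (f' j))"
      using j by (auto simp: mat_delete_def A_def nth_append k_def f'_def intro!: cong_mat)
    then have "\<bar>cofactor A k j\<bar> = \<bar>wedge \<tau> f' \<zeta>\<bar>"
      by (simp add: cofactor_def wedge_def k_def abs_mult power_abs)
    also have "\<dots> < t" using fn by (intro wedge_bound[OF lt]) (auto simp: f'_def k_def)
    finally have "\<bar>cofactor A k j\<bar> < t" .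
    moreover have "\<bar>A $$ (k, j)\<bar> < e" using e[OF fn[OF j]] j by (simp add: A_def k_def nth_append)
    ultimately show ?thesis unfolding abs_mult using te by (intro mult_strict_mono) auto
  qed
  then have "(\<Sum>j<Suc k. \<bar>A $$ (k, j) * cofactor A k j\<bar>) < (\<Sum>j<Suc k. e * t)"
    by (intro sum_strict_mono) auto
  then have "\<bar>det A\<bar> < real (Suc k) * (e * t)" unfolding det
    using sum_abs[of "\<lambda>j. A $$ (k, j) * cofactor A k j" "{..<Suc k}"] by simp
  then show "\<bar>wedge (\<tau> @ [v]) f \<zeta>\<bar> < real (Suc (length \<tau>)) * (e * t)" by (simp add: wedge_def A_def k_def)
qed

text \<open>The degree bound is the same for all \<open>Q\<close>, all subspaces and all
  coordinates, so that a single constant from \<open>poly_sublevel_measure\<close> serves every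
  covolume.\<close>

lemma wedge_poly:
  assumes "length \<tau> \<le> Suc n"
  shows "\<exists>p. degree p \<le> n * Suc n \<and> (\<forall>\<zeta>. wedge \<tau> f \<zeta> = poly p \<zeta>)"
proof -
  define k where "k = length \<tau>"
  define b where "b m j = (if j = 0 then Polynomial.monom (Q ^ n) m else if m = j then [:1 / Q:] else 0)" for m j :: nat
  define c where "c i j = (\<Sum>m\<le>n. Polynomial.smult (of_int (coeff (\<tau> ! i) m)) (b m (f j)))" for i j
  define A where "A = mat k k (\<lambda>(i, j). c i j)"
  have b: "poly (b m j) \<zeta> = vbase \<zeta> m j" "m \<le> n \<Longrightarrow> degree (b m j) \<le> n" for m j \<zeta>
    by (auto simp: b_def vbase_def poly_monom intro: order_trans[OF degree_monom_le])
  have c: "poly (c i j) \<zeta> = vcoord \<zeta> (\<tau> ! i) (f j)" for i j \<zeta>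
    by (simp add: c_def vcoord_def poly_sum b)
  have dc: "degree (c i j) \<le> n" for i j
    unfolding c_def by (intro degree_sum_le order_trans[OF degree_smult_le] b) auto
  have "degree (det A) \<le> n * k" by (rule degree_det_le) (auto simp: A_def dc)
  also have "\<dots> \<le> n * Suc n" unfolding k_def using assms by (rule mult_le_mono2)
  finally have "degree (det A) \<le> n * Suc n" .
  moreover have "wedge \<tau> f \<zeta> = poly (det A) \<zeta>" for \<zeta>
  proof -
    have "det A = (\<Sum>p | p permutes {0..<k}. of_int (sign p) * (\<Prod>i = 0..<k. A $$ (i, p i)))"
      by (rule det_def') (simp add: A_def)
    then have "poly (det A) \<zeta> = (\<Sum>p | p permutes {0..<k}. of_int (sign p) * (\<Prod>i = 0..<k. poly (A $$ (i, p i)) \<zeta>))"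
      by (simp add: poly_sum poly_prod)
    also have "\<dots> = (\<Sum>p | p permutes {0..<k}. of_int (sign p) * (\<Prod>i = 0..<k. vcoord \<zeta> (\<tau> ! i) (f (p i))))"
    proof (intro sum.cong refl arg_cong2[where f = "(*)"] prod.cong)
      fix p i assume "p \<in> {p. p permutes {0..<k}}" "i \<in> {0..<k}"
      then have "p i < k" "i < k" using permutes_in_image[of p "{0..<k}" i] by auto
      then show "poly (A $$ (i, p i)) \<zeta> = vcoord \<zeta> (\<tau> ! i) (f (p i))" by (simp add: A_def c)
    qed
    also have "\<dots> = wedge \<tau> f \<zeta>" unfolding wedge_def
    proof (subst det_def'[of _ k], simp add: k_def, intro sum.cong refl arg_cong2[where f = "(*)"] prod.cong)
      fix p i assume "p \<in> {p. p permutes {0..<k}}" "i \<in> {0..<k}"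
      then have "p i < k" "i < k" using permutes_in_image[of p "{0..<k}" i] by auto
      then show "vcoord \<zeta> (\<tau> ! i) (f (p i)) = mat (length \<tau>) (length \<tau>) (\<lambda>(i, j). vcoord \<zeta> (\<tau> ! i) (f j)) $$ (i, p i)"
        by (simp add: k_def)
    qed
    finally show ?thesis by simp
  qed
  ultimately show ?thesis by blast
qed

text \<open>The factor is the determinant of the rational change of basis. That it is the same for
  the wedges and for the integer minors is what lets minimality of the latter control the
  former.\<close>

lemma int_basis_proportional:
  assumes \<tau>: "is_int_basis \<tau> V" and \<sigma>: "is_int_basis \<sigma> V"
  shows "\<exists>c::real. (\<forall>f \<zeta>. wedge \<sigma> f \<zeta> = c * wedge \<tau> f \<zeta>) \<and> (\<forall>g. of_int (int_minor \<sigma> g) = c * of_int (int_minor \<tau> g))"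
proof -
  have len: "length \<sigma> = length \<tau>" using is_int_basis_length_eq[OF \<sigma> \<tau>] .
  define k where "k = length \<tau>"
  obtain a where a: "\<And>i m. i < k \<Longrightarrow> rat_of_int (coeff (\<sigma> ! i) m) = (\<Sum>j<k. a i j * rat_of_int (coeff (\<tau> ! j) m))"
    using is_int_basis_change[OF \<tau> \<sigma>] len unfolding k_def by metis
  have ar: "real_of_int (coeff (\<sigma> ! i) m) = (\<Sum>j<k. real_of_rat (a i j) * real_of_int (coeff (\<tau> ! j) m))" if "i < k" for i m
  proof -
    have "real_of_int (coeff (\<sigma> ! i) m) = real_of_rat (rat_of_int (coeff (\<sigma> ! i) m))" by simp
    also have "\<dots> = (\<Sum>j<k. real_of_rat (a i j) * real_of_int (coeff (\<tau> ! j) m))"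
      unfolding a[OF that] by (simp add: of_rat_sum of_rat_mult)
    finally show ?thesis .
  qed
  define A where "A = mat k k (\<lambda>(i, j). real_of_rat (a i j))"
  have "wedge \<sigma> f \<zeta> = det A * wedge \<tau> f \<zeta>" for f \<zeta>
  proof -
    define B where "B = mat k k (\<lambda>(i, j). vcoord \<zeta> (\<tau> ! i) (f j))"
    have "vcoord \<zeta> (\<sigma> ! i) j = (\<Sum>l<k. real_of_rat (a i l) * vcoord \<zeta> (\<tau> ! l) j)" if "i < k" for i j
      unfolding vcoord_def ar[OF that] sum_distrib_left sum_distrib_right
      by (subst sum.swap) (simp add: mult.assoc)
    then have "mat k k (\<lambda>(i, j). vcoord \<zeta> (\<sigma> ! i) (f j)) = A * B"
      by (intro eq_matI) (auto simp: A_def B_def scalar_prod_def atLeast0LessThan)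
    moreover have "det (A * B) = det A * det B" by (rule det_mult[of _ k]) (auto simp: A_def B_def)
    ultimately show ?thesis by (simp add: wedge_def len k_def B_def)
  qed
  moreover have "of_int (int_minor \<sigma> g) = det A * of_int (int_minor \<tau> g)" for g
  proof -
    define B where "B = mat k k (\<lambda>(i, j). real_of_int (coeff (\<tau> ! i) (g j)))"
    have hom: "real_of_int (int_minor \<rho> g) = det (mat k k (\<lambda>(i, j). real_of_int (coeff (\<rho> ! i) (g j))))" if "length \<rho> = k" for \<rho>
    proof -
      have "real_of_int (int_minor \<rho> g) = det (map_mat of_int (mat k k (\<lambda>(i, j). coeff (\<rho> ! i) (g j))))"
        unfolding int_minor_def that by simp
      also have "map_mat real_of_int (mat k k (\<lambda>(i, j). coeff (\<rho> ! i) (g j))) = mat k k (\<lambda>(i, j). real_of_int (coeff (\<rho> ! i) (g j)))"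
        by (intro eq_matI) auto
      finally show ?thesis .
    qed
    have "mat k k (\<lambda>(i, j). real_of_int (coeff (\<sigma> ! i) (g j))) = A * B"
      by (intro eq_matI) (auto simp: A_def B_def scalar_prod_def atLeast0LessThan ar)
    moreover have "det (A * B) = det A * det B" by (rule det_mult[of _ k]) (auto simp: A_def B_def)
    ultimately show ?thesis using hom[of \<sigma>] hom[of \<tau>] by (simp add: len k_def B_def)
  qed
  ultimately show ?thesis by blast
qed

text \<open>Minimality of the total minor forces the proportionality factor to have absolute value
  at least 1.\<close>

lemma red_basis_wedge_lt:
  assumes V: "V \<in> proper_spaces n" and \<sigma>: "is_int_basis \<sigma> V" and lt: "wedge_lt \<sigma> \<zeta> t"
  shows "wedge_lt (red_basis n V) \<zeta> t"
proof -
  define \<rho> where "\<rho> = red_basis n V"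
  have \<rho>: "is_int_basis \<rho> V" unfolding \<rho>_def by (rule red_basis[OF V])
  obtain c where c: "\<And>f \<zeta>. wedge \<sigma> f \<zeta> = c * wedge \<rho> f \<zeta>" "\<And>g. real_of_int (int_minor \<sigma> g) = c * of_int (int_minor \<rho> g)"
    using int_basis_proportional[OF \<rho> \<sigma>] by blast
  have len: "length \<sigma> = length \<rho>" using is_int_basis_length_eq[OF \<sigma> \<rho>] .
  define G where "G = {..<length \<rho>} \<rightarrow>\<^sub>E {..n}"
  have finG: "finite G" unfolding G_def by (intro finite_PiE) auto
  define S where "S \<tau> = (\<Sum>g\<in>G. \<bar>int_minor \<tau> g\<bar>)" for \<tau>
  have "\<exists>g\<in>G. int_minor \<rho> g \<noteq> 0" unfolding G_def
    using \<rho> red_basis(4)[OF V] by (intro int_minor_nonzero_of_independent) (auto simp: is_int_basis_def \<rho>_def)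
  then obtain g where "g \<in> G" "int_minor \<rho> g \<noteq> 0" by blast
  then have "S \<rho> > 0" unfolding S_def using finG by (intro sum_pos2[of _ g]) auto
  have "nat (S \<rho>) \<le> nat (S \<sigma>)"
    using red_basis_minimal[OF \<sigma>, of n] by (simp add: S_def G_def len \<rho>_def[symmetric])
  then have "real_of_int (S \<rho>) \<le> real_of_int (S \<sigma>)" using \<open>S \<rho> > 0\<close> by simp
  also have "real_of_int (S \<sigma>) = (\<Sum>g\<in>G. \<bar>real_of_int (int_minor \<sigma> g)\<bar>)" by (simp add: S_def)
  also have "\<dots> = \<bar>c\<bar> * (\<Sum>g\<in>G. \<bar>real_of_int (int_minor \<rho> g)\<bar>)" by (simp add: c(2) abs_mult sum_distrib_left)
  also have "\<dots> = \<bar>c\<bar> * real_of_int (S \<rho>)" by (simp add: S_def)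
  finally have c1: "\<bar>c\<bar> \<ge> 1" using \<open>S \<rho> > 0\<close> by simp
  show ?thesis unfolding wedge_lt_def \<rho>_def[symmetric]
  proof
    fix f assume "f \<in> {..<length \<rho>} \<rightarrow>\<^sub>E {..n}"
    then have "\<bar>wedge \<sigma> f \<zeta>\<bar> < t" using lt by (simp add: wedge_lt_def len)
    moreover have "\<bar>wedge \<rho> f \<zeta>\<bar> \<le> \<bar>wedge \<sigma> f \<zeta>\<bar>"
      using c1 by (simp add: c(1) abs_mult mult_le_cancel_right1)
    ultimately show "\<bar>wedge \<rho> f \<zeta>\<bar> < t" by simp
  qed
qed

text \<open>Columns other than \<open>p\<close> lie among the coordinates \<open>a_j / Q\<close>, so
  each of them contributes one factor \<open>1 / Q\<close>, whereas column \<open>p\<close> is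
  \<open>Q^n\<close> times the evaluation at \<open>\<zeta>\<close>. Expansion along column
  \<open>p\<close> leaves a polynomial in \<open>\<zeta>\<close> whose coefficients are integer
  minors.\<close>

lemma wedge_expand_column:
  assumes p: "p < length \<tau>" and g: "\<And>j. j < length \<tau> \<Longrightarrow> j \<noteq> p \<Longrightarrow> 0 < g j \<and> g j \<le> n"
  shows "wedge \<tau> (g(p := 0)) \<zeta> * Q ^ (length \<tau> - 1) = Q ^ n * (\<Sum>m\<le>n. of_int (int_minor \<tau> (g(p := m))) * \<zeta> ^ m)"
proof -
  define k where "k = length \<tau>"
  have k: "p < k" "k > 0" using p by (auto simp: k_def)
  define A where "A = mat k k (\<lambda>(i, j). vcoord \<zeta> (\<tau> ! i) ((g(p := 0)) j))"
  define B where "B m = mat k k (\<lambda>(i, j). coeff (\<tau> ! i) ((g(p := m)) j))" for m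
  define c where "c i = cofactor (B 0) i p" for i
  have cofB: "cofactor (B m) i p = c i" for m i
  proof -
    have "mat_delete (B m) i p = mat_delete (B 0) i p"
      by (auto simp: mat_delete_def B_def intro!: cong_mat)
    then show ?thesis by (simp add: cofactor_def c_def)
  qed
  have cofA: "cofactor A i p * Q ^ (k - 1) = of_int (c i)" if "i < k" for i
  proof -
    define M where "M = map_mat real_of_int (mat_delete (B 0) i p)"
    have "mat_delete A i p = (1 / Q) \<cdot>\<^sub>m M"
    proof (intro eq_matI)
      fix i' j' assume "i' < dim_row ((1 / Q) \<cdot>\<^sub>m M)" "j' < dim_col ((1 / Q) \<cdot>\<^sub>m M)"
      then have ij: "i' < k - 1" "j' < k - 1" by (auto simp: M_def B_def mat_delete_def)
      define j where "j = (if j' < p then j' else Suc j')"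
      have j: "j < k" "j \<noteq> p" using ij k by (auto simp: j_def)
      have "vcoord \<zeta> P (g j) = of_int (coeff P (g j)) / Q" for P
        using g[of j] j by (intro vcoord_pos) (auto simp: k_def)
      then show "mat_delete A i p $$ (i', j') = ((1 / Q) \<cdot>\<^sub>m M) $$ (i', j')"
        using ij j by (auto simp: mat_delete_def A_def M_def B_def j_def[symmetric])
    qed (auto simp: mat_delete_def A_def M_def B_def)
    then have "det (mat_delete A i p) = (1 / Q) ^ (k - 1) * of_int (det (mat_delete (B 0) i p))"
      by (simp add: det_smult M_def) (simp add: mat_delete_def B_def)
    then show ?thesis using Q by (simp add: cofactor_def c_def power_divide)
  qed
  have "det A = (\<Sum>i<k. A $$ (i, p) * cofactor A i p)"
    by (rule laplace_expansion_column) (auto simp: A_def k)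
  then have "det A * Q ^ (k - 1) = (\<Sum>i<k. A $$ (i, p) * (cofactor A i p * Q ^ (k - 1)))"
    by (simp add: sum_distrib_right mult.assoc)
  also have "\<dots> = (\<Sum>i<k. vcoord \<zeta> (\<tau> ! i) 0 * of_int (c i))"
  proof (intro sum.cong refl)
    fix i assume "i \<in> {..<k}"
    then show "A $$ (i, p) * (cofactor A i p * Q ^ (k - 1)) = vcoord \<zeta> (\<tau> ! i) 0 * of_int (c i)"
      using cofA[of i] k by (simp add: A_def)
  qed
  also have "\<dots> = (\<Sum>i<k. \<Sum>m\<le>n. Q ^ n * \<zeta> ^ m * of_int (coeff (\<tau> ! i) m * c i))"
    by (simp add: vcoord_def vbase_def sum_distrib_right sum_distrib_left algebra_simps)
  also have "\<dots> = (\<Sum>m\<le>n. Q ^ n * \<zeta> ^ m * of_int (\<Sum>i<k. coeff (\<tau> ! i) m * c i))"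
    by (subst sum.swap) (simp add: sum_distrib_left)
  also have "\<dots> = (\<Sum>m\<le>n. Q ^ n * \<zeta> ^ m * of_int (int_minor \<tau> (g(p := m))))"
  proof (intro sum.cong refl)
    fix m
    have "det (B m) = (\<Sum>i<k. B m $$ (i, p) * cofactor (B m) i p)"
      by (rule laplace_expansion_column) (auto simp: B_def k)
    also have "\<dots> = (\<Sum>i<k. coeff (\<tau> ! i) m * c i)" unfolding cofB
      using k by (intro sum.cong) (auto simp: B_def)
    finally show "Q ^ n * \<zeta> ^ m * of_int (\<Sum>i<k. coeff (\<tau> ! i) m * c i) = Q ^ n * \<zeta> ^ m * real_of_int (int_minor \<tau> (g(p := m)))"
      by (simp add: int_minor_def B_def k_def)
  qed
  finally show ?thesis by (simp add: wedge_def A_def k_def sum_distrib_left algebra_simps)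
qed

text \<open>This starts the nondivergence argument: on the whole interval no subspace has covolume
  below 1 throughout. A suitable coordinate is a power of \<open>Q\<close> times a polynomial with a
  nonzero integer coefficient, and such a polynomial cannot be small at all of \<open>n + 1\<close>
  fixed points.\<close>

lemma wedge_not_small:
  assumes V: "V \<in> proper_spaces n"
    and T: "finite T" "T \<subseteq> {u..v}" "card T = Suc n"
    and C: "C > 0" "\<And>(p::real poly) B. degree p < card T \<Longrightarrow> (\<forall>y\<in>T. \<bar>poly p y\<bar> \<le> B) \<Longrightarrow> (\<forall>j. \<bar>coeff p j\<bar> \<le> C * B)"
    and QC: "Q \<ge> 2 * C"
  shows "\<exists>x\<in>{u..v}. \<not> wedge_lt (red_basis n V) x 1"
proof -
  define \<tau> where "\<tau> = red_basis n V"
  define k where "k = length \<tau>"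
  have k: "k > 0" "k \<le> Suc n" using red_basis[OF V] by (auto simp: k_def \<tau>_def)
  have "\<exists>g\<in>{..<length \<tau>} \<rightarrow>\<^sub>E {..n}. int_minor \<tau> g \<noteq> 0"
    using red_basis[OF V] by (intro int_minor_nonzero_of_independent) (auto simp: is_int_basis_def \<tau>_def)
  then obtain g where g: "g \<in> {..<k} \<rightarrow>\<^sub>E {..n}" "int_minor \<tau> g \<noteq> 0" by (auto simp: k_def)
  have inj: "inj_on g {..<k}" using int_minor_nonzero_inj[OF g(2)] by (simp add: k_def)
  have gn: "g j \<le> n" if "j < k" for j using g(1) that by (auto simp: PiE_iff)
  \<comment> \<open>At most one column of \<open>g\<close> is 0, since \<open>g\<close> is
    injective. If there is one, it is chosen as \<open>p\<close>; otherwise any position will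
    do.\<close>
  obtain p where p: "p < k" "\<And>j. j < k \<Longrightarrow> j \<noteq> p \<Longrightarrow> 0 < g j"
  proof (cases "\<exists>p<k. g p = 0")
    case True
    then obtain p where "p < k" "g p = 0" by blast
    then show ?thesis using that[of p] inj by (metis inj_onD lessThan_iff neq0_conv)
  next
    case False
    then show ?thesis using that[of 0] k by auto
  qed
  define c where "c m = real_of_int (int_minor \<tau> (g(p := m)))" for m
  define q where "q = (\<Sum>m\<le>n. Polynomial.monom (c m) m)"
  have cq: "coeff q m = (if m \<le> n then c m else 0)" for m
    unfolding q_def by (simp add: coeff_sum coeff_monom)
  have dq: "degree q \<le> n" unfolding q_def by (intro degree_sum_le order_trans[OF degree_monom_le]) auto
  have polyq: "poly q \<zeta> = (\<Sum>m\<le>n. c m * \<zeta> ^ m)" for \<zeta> by (simp add: q_def poly_sum poly_monom)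
  have wq: "wedge \<tau> (g(p := 0)) \<zeta> * Q ^ (k - 1) = Q ^ n * poly q \<zeta>" for \<zeta>
    unfolding polyq c_def k_def using p gn by (intro wedge_expand_column) (auto simp: k_def)
  have cp: "\<bar>c (g p)\<bar> \<ge> 1"
  proof -
    have "\<bar>int_minor \<tau> g\<bar> \<ge> 1" using g(2) by linarith
    then show ?thesis by (simp add: c_def)
  qed
  \<comment> \<open>For \<open>k = Suc n\<close> no power of \<open>Q\<close> is left over, but then
    every coefficient of \<open>q\<close> except the constant one is a minor with a repeated column,
    and the wedge is a nonzero integer. For smaller \<open>k\<close> at least one factor
    \<open>Q\<close> remains and beats the lower bound \<open>1 / (2 * C)\<close> for
    \<open>q\<close> at some point of \<open>T\<close>.\<close>
  obtain x where x: "x \<in> {u..v}" "\<bar>wedge \<tau> (g(p := 0)) x\<bar> \<ge> 1"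
  proof (cases "k = Suc n")
    case True
    have bij: "g ` {..<k} = {..n}"
      using gn inj True by (intro card_subset_eq) (auto simp: card_image)
    then have "0 \<in> g ` {..<k}" by simp
    then obtain j0 where "j0 < k" "g j0 = 0" by auto
    then have "g p = 0" using p(2)[of j0] by (cases "j0 = p") auto
    have "c m = 0" if "m \<le> n" "m \<noteq> 0" for m
    proof -
      have "m \<in> g ` {..<k}" using bij that by simp
      then obtain j where j: "j < k" "g j = m" by auto
      have "j \<noteq> p" using j that \<open>g p = 0\<close> by auto
      then have "\<not> inj_on (g(p := m)) {..<k}" using j p(1) by (auto simp: inj_on_def)
      then have "int_minor \<tau> (g(p := m)) = 0" using int_minor_nonzero_inj[of \<tau> "g(p := m)"] by (auto simp: k_def)
      then show ?thesis by (simp add: c_def)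
    qed
    then have "poly q x = c 0" for x
      unfolding polyq by (subst sum.remove[of _ 0]) (auto intro!: sum.neutral)
    then have "wedge \<tau> (g(p := 0)) x = c 0" for x using wq[of x] True Q by simp
    moreover obtain x where "x \<in> T" using T by fastforce
    ultimately show ?thesis using that[of x] cp \<open>g p = 0\<close> T by auto
  next
    case False
    then have kn: "k \<le> n" using k by simp
    have "\<exists>y\<in>T. \<bar>poly q y\<bar> > 1 / (2 * C)"
    proof (rule ccontr)
      assume "\<not> ?thesis"
      then have small: "\<forall>y\<in>T. \<bar>poly q y\<bar> \<le> 1 / (2 * C)" by (auto simp: not_less)
      have "degree q < card T" using dq T(3) by simp
      from C(2)[OF this small] have "\<bar>coeff q (g p)\<bar> \<le> C * (1 / (2 * C))" by blast
      then show False using cp gn[OF p(1)] C(1) by (simp add: cq)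
    qed
    then obtain y where y: "y \<in> T" "\<bar>poly q y\<bar> > 1 / (2 * C)" by blast
    have Qpos: "Q > 0" using Q by simp
    have eq: "wedge \<tau> (g(p := 0)) y = Q ^ (n - (k - 1)) * poly q y"
    proof -
      have "Q ^ n = Q ^ (n - (k - 1)) * Q ^ (k - 1)" using kn by (simp add: power_add[symmetric])
      then show ?thesis using wq[of y] Qpos by simp
    qed
    have "1 \<le> Q * (1 / (2 * C))" using QC C(1) by (simp add: field_simps)
    also have "\<dots> \<le> Q ^ (n - (k - 1)) * \<bar>poly q y\<bar>"
    proof (rule mult_mono)
      show "Q \<le> Q ^ (n - (k - 1))" using kn k Q by (intro self_le_power) auto
    qed (use y C Qpos in auto)
    also have "\<dots> = \<bar>wedge \<tau> (g(p := 0)) y\<bar>" using Qpos by (simp add: eq abs_mult)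
    finally show ?thesis using that[of y] y T by auto
  qed
  have "\<not> wedge_lt \<tau> x 1"
  proof
    assume "wedge_lt \<tau> x 1"
    from wedge_bound[OF this, of "g(p := 0)"] gn have "\<bar>wedge \<tau> (g(p := 0)) x\<bar> < 1" by (auto simp: k_def)
    then show False using x(2) by simp
  qed
  then show ?thesis using x(1) by (auto simp: \<tau>_def)
qed

end

section \<open>Stopping intervals and quantitative nondivergence\<close>

text \<open>\<open>E\<close> is decomposed into the stopped dyadic intervals of least level around
  its points. These are disjoint and their parents are not stopped, so \<open>step\<close> applies
  to each of them and the bounds add up to \<open>\<beta> * (b - a)\<close>.\<close>

lemma dyadic_stopping:
  fixes stop :: "real \<Rightarrow> real \<Rightarrow> bool" and X E :: "real set" and \<beta> :: real
  assumes ab: "a < b" and \<beta>: "\<beta> \<ge> 0" and top: "\<not> stop a b"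
    and E: "\<And>x. x \<in> E \<Longrightarrow> a \<le> x \<and> x < b \<and> (\<exists>d>0. \<forall>u v. u \<le> x \<longrightarrow> x \<le> v \<longrightarrow> v - u < d \<longrightarrow> stop u v)"
    and step: "\<And>u v u' v'. u < v \<Longrightarrow> stop u v \<Longrightarrow> \<not> stop u' v' \<Longrightarrow> u' \<le> u \<Longrightarrow> v \<le> v' \<Longrightarrow> v' - u' = 2 * (v - u) \<Longrightarrow>
      \<exists>U\<in>sets lborel. X \<inter> {u..<v} \<subseteq> U \<and> emeasure lborel U \<le> ennreal (\<beta> * (v - u))"
  shows "\<exists>U\<in>sets lborel. X \<inter> E \<subseteq> U \<and> emeasure lborel U \<le> ennreal (\<beta> * (b - a))"
proof -
  define t where "t x = (x - a) / (b - a)" for x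
  define ix where "ix k x = \<lfloor>t x * 2 ^ k\<rfloor>" for k :: nat and x
  define L where "L k i = a + (b - a) * (of_int i / 2 ^ k)" for k :: nat and i :: int
  have mem: "x \<in> {L k i..<L k (i + 1)} \<longleftrightarrow> ix k x = i" for k i x
  proof -
    have "L k i \<le> x \<longleftrightarrow> of_int i / 2 ^ k \<le> t x" "x < L k j \<longleftrightarrow> t x < of_int j / 2 ^ k" for i j
      using ab by (simp_all add: L_def t_def field_simps)
    then show ?thesis unfolding ix_def by (simp add: floor_eq_iff field_simps)
  qed
  have len: "L k (i + 1) - L k i = (b - a) / 2 ^ k" for k i
    by (simp add: L_def field_simps)
  have ix_div: "ix k x = ix (Suc k) x div 2" for k x
  proof -
    have "t x * 2 ^ k = (t x * 2 ^ Suc k) / of_int 2" by simp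
    then show ?thesis unfolding ix_def by (metis floor_divide_real_eq_div zero_le_numeral)
  qed
  have ix_le: "ix k' x = ix k' y" if "ix k x = ix k y" "k' \<le> k" for k k' x y
    using that(2,1)
  proof (induction k rule: dec_induct)
    case (step k)
    then show ?case using ix_div[of k x] ix_div[of k y] by simp
  qed simp
  define st where "st k i = stop (L k i) (L k (i + 1))" for k i
  have ex: "\<exists>k. st k (ix k x)" if x: "x \<in> E" for x
  proof -
    obtain d where d: "d > 0" "\<And>u v. u \<le> x \<Longrightarrow> x \<le> v \<Longrightarrow> v - u < d \<Longrightarrow> stop u v" using E[OF x] by blast
    have "(\<lambda>k. (b - a) / 2 ^ k) \<longlonglongrightarrow> 0" by (rule LIMSEQ_divide_realpow_zero) simp
    from order_tendstoD(2)[OF this d(1)] obtain k where k: "(b - a) / 2 ^ k < d"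
      by (auto simp: eventually_sequentially)
    have "x \<in> {L k (ix k x)..<L k (ix k x + 1)}" using mem by blast
    then have "st k (ix k x)" unfolding st_def using k len[of k "ix k x"] by (intro d(2)) auto
    then show ?thesis by blast
  qed
  define lev where "lev x = (LEAST k. st k (ix k x))" for x
  have lev: "st (lev x) (ix (lev x) x)" "k < lev x \<Longrightarrow> \<not> st k (ix k x)" if "x \<in> E" for x k
    using ex[OF that] unfolding lev_def by (auto intro: LeastI_ex dest: not_less_Least)
  define M where "M = {(k, i). \<exists>x\<in>E. k = lev x \<and> i = ix k x}"
  define I where "I = (\<lambda>(k::nat, i). {L k i..<L k (i + 1)})"
  have IU: "\<exists>U\<in>sets lborel. X \<inter> I ki \<subseteq> U \<and> emeasure lborel U \<le> ennreal \<beta> * emeasure lborel (I ki)" if ki: "ki \<in> M" for ki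
  proof -
    obtain x where x: "x \<in> E" "ki = (lev x, ix (lev x) x)" using ki by (auto simp: M_def)
    have "\<not> st 0 (ix 0 x)"
    proof -
      have "0 \<le> t x" "t x < 1" using E[OF x(1)] ab by (auto simp: t_def)
      then have "ix 0 x = 0" by (simp add: ix_def floor_eq_iff)
      then show ?thesis using top by (simp add: st_def L_def)
    qed
    then have "lev x \<noteq> 0" using lev(1)[OF x(1)] by metis
    then obtain k where k: "lev x = Suc k" using not0_implies_Suc by blast
    define j where "j = ix k x"
    define i where "i = ix (Suc k) x"
    have j: "j = i div 2" unfolding i_def j_def by (rule ix_div)
    have "L k j \<le> L (Suc k) i" "L (Suc k) (i + 1) \<le> L k (j + 1)"
    proof -
      have "2 * j \<le> i" "i + 1 \<le> 2 * (j + 1)" unfolding j by auto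
      then have le: "of_int (2 * j) \<le> (of_int i :: real)" "(of_int (i + 1) :: real) \<le> of_int (2 * (j + 1))"
        by (simp_all only: of_int_le_iff)
      have half: "of_int l / 2 ^ k = (of_int (2 * l) / 2 ^ Suc k :: real)" for l by simp
      show "L k j \<le> L (Suc k) i" "L (Suc k) (i + 1) \<le> L k (j + 1)"
        unfolding L_def half using ab le by (auto intro!: add_left_mono mult_left_mono divide_right_mono simp del: of_int_mult of_int_add)
    qed
    moreover have "L k (j + 1) - L k j = 2 * (L (Suc k) (i + 1) - L (Suc k) i)" unfolding len power_Suc by (simp add: field_simps)
    moreover have "L (Suc k) i < L (Suc k) (i + 1)" 
    proof -
      have "L (Suc k) (i + 1) - L (Suc k) i > 0" unfolding len using ab by simp
      then show ?thesis by simp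
    qed
    moreover have "stop (L (Suc k) i) (L (Suc k) (i + 1))" using lev(1)[OF x(1)] by (simp add: k st_def i_def)
    moreover have "\<not> stop (L k j) (L k (j + 1))" using lev(2)[OF x(1), of k] by (simp add: k st_def j_def)
    ultimately obtain U where U: "U \<in> sets lborel" "X \<inter> {L (Suc k) i..<L (Suc k) (i + 1)} \<subseteq> U"
      "emeasure lborel U \<le> ennreal (\<beta> * (L (Suc k) (i + 1) - L (Suc k) i))" using step by meson
    moreover have "I ki = {L (Suc k) i..<L (Suc k) (i + 1)}" by (simp add: I_def x(2) k i_def)
    ultimately show ?thesis using \<beta> \<open>L (Suc k) i < L (Suc k) (i + 1)\<close>
      by (intro bexI[of _ U]) (auto simp: ennreal_mult)
  qed
  then obtain U where U: "\<And>ki. ki \<in> M \<Longrightarrow> U ki \<in> sets lborel" "\<And>ki. ki \<in> M \<Longrightarrow> X \<inter> I ki \<subseteq> U ki"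
    "\<And>ki. ki \<in> M \<Longrightarrow> emeasure lborel (U ki) \<le> ennreal \<beta> * emeasure lborel (I ki)" by metis
  have disj: "disjoint_family_on I M"
    unfolding disjoint_family_on_def
  proof (intro ballI impI, rule ccontr)
    fix p q assume pq: "p \<in> M" "q \<in> M" "p \<noteq> q" "I p \<inter> I q \<noteq> {}"
    obtain x y where xy: "x \<in> E" "y \<in> E" "p = (lev x, ix (lev x) x)" "q = (lev y, ix (lev y) y)"
      using pq by (auto simp: M_def)
    obtain z where z: "z \<in> I p" "z \<in> I q" using pq(4) by blast
    have zx: "ix (lev x) z = ix (lev x) x" and zy: "ix (lev y) z = ix (lev y) y"
      using z mem by (simp_all add: I_def xy(3,4) del: atLeastLessThan_iff)
    show False
    proof (cases "lev x" "lev y" rule: linorder_cases)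
      case less
      have "ix (lev x) y = ix (lev x) x" using ix_le[OF zy, of "lev x"] zx less by simp
      then show False using lev(1)[OF xy(1)] lev(2)[OF xy(2) less] by simp
    next
      case equal
      then show False using zx zy xy pq by simp
    next
      case greater
      have "ix (lev y) x = ix (lev y) y" using ix_le[OF zx, of "lev y"] zy greater by simp
      then show False using lev(1)[OF xy(2)] lev(2)[OF xy(1) greater] by simp
    qed
  qed
  have Isub: "I ki \<subseteq> {a..<b}" if kiM: "ki \<in> M" for ki
  proof
    fix z assume z: "z \<in> I ki"
    obtain x where x: "x \<in> E" "ki = (lev x, ix (lev x) x)" using kiM by (auto simp: M_def)
    have "ix (lev x) z = ix (lev x) x" using z mem by (simp add: I_def x(2) del: atLeastLessThan_iff)
    then have "ix 0 z = ix 0 x" by (rule ix_le) simp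
    moreover have "0 \<le> t x" "t x < 1" using E[OF x(1)] ab by (auto simp: t_def)
    then have "ix 0 x = 0" by (simp add: ix_def floor_eq_iff)
    ultimately have "ix 0 z = 0" by simp
    then have "0 \<le> t z" "t z < 1" by (auto simp: ix_def floor_eq_iff)
    then show "z \<in> {a..<b}" using ab by (auto simp: t_def zero_le_divide_iff divide_less_eq)
  qed
  have Im: "I ki \<in> sets lborel" for ki by (auto simp: I_def split: prod.split)
  \<comment> \<open>The countably many intervals are enumerated by \<open>from_nat\<close>. The
    second conjunct admits one index per interval, without which a repetition could destroy
    disjointness.\<close>
  define ok where "ok l \<longleftrightarrow> (from_nat l :: nat \<times> int) \<in> M \<and> to_nat (from_nat l :: nat \<times> int) = l" for l
  define J where "J l = (if ok l then I (from_nat l) else {})" for l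
  define UU where "UU l = (if ok l then U (from_nat l) else {})" for l
  have UU: "(\<Union>ki\<in>M. U ki) = (\<Union>l. UU l)"
  proof
    show "(\<Union>ki\<in>M. U ki) \<subseteq> (\<Union>l. UU l)"
    proof
      fix x assume "x \<in> (\<Union>ki\<in>M. U ki)"
      then obtain ki where "ki \<in> M" "x \<in> U ki" by blast
      then have "x \<in> UU (to_nat ki)" by (simp add: UU_def ok_def)
      then show "x \<in> (\<Union>l. UU l)" by blast
    qed
  qed (auto simp: UU_def ok_def)
  have UUm: "UU l \<in> sets lborel" for l using U(1) by (simp add: UU_def ok_def)
  have Jm: "J l \<in> sets lborel" for l using Im by (simp add: J_def)
  have dJ: "disjoint_family J" unfolding disjoint_family_on_def
  proof (intro ballI impI)
    fix l l' :: nat assume "l \<noteq> l'"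
    then have "(from_nat l :: nat \<times> int) \<noteq> from_nat l'" if "ok l" "ok l'" using that by (metis ok_def)
    then show "J l \<inter> J l' = {}" using disj by (auto simp: J_def ok_def disjoint_family_on_def)
  qed
  have "J l \<subseteq> {a..<b}" for l using Isub[of "from_nat l"] by (simp add: J_def ok_def)
  then have Jsub: "(\<Union>l. J l) \<subseteq> {a..<b}" by blast
  have "emeasure lborel (\<Union>l. UU l) \<le> (\<Sum>l. emeasure lborel (UU l))"
    using UUm by (intro emeasure_subadditive_countably) auto
  also have "\<dots> \<le> (\<Sum>l. ennreal \<beta> * emeasure lborel (J l))"
    using U(3) by (intro suminf_le) (auto simp: UU_def J_def ok_def)
  also have "\<dots> = ennreal \<beta> * (\<Sum>l. emeasure lborel (J l))" by (rule ennreal_suminf_cmult)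
  also have "(\<Sum>l. emeasure lborel (J l)) = emeasure lborel (\<Union>l. J l)"
    using Jm dJ by (intro suminf_emeasure) auto
  also have "ennreal \<beta> * \<dots> \<le> ennreal \<beta> * emeasure lborel {a..<b}"
    using Jsub by (intro mult_left_mono emeasure_mono) auto
  also have "\<dots> = ennreal (\<beta> * (b - a))" using ab \<beta> by (simp add: ennreal_mult)
  finally have "emeasure lborel (\<Union>ki\<in>M. U ki) \<le> ennreal (\<beta> * (b - a))" unfolding UU .
  moreover have "(\<Union>ki\<in>M. U ki) \<in> sets lborel" unfolding UU using UUm by blast
  moreover have "X \<inter> E \<subseteq> (\<Union>ki\<in>M. U ki)"
  proof
    fix x assume x: "x \<in> X \<inter> E"
    define ki where "ki = (lev x, ix (lev x) x)"
    have "ki \<in> M" using x by (auto simp: M_def ki_def)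
    moreover have "x \<in> I ki" using mem by (simp add: I_def ki_def del: atLeastLessThan_iff)
    ultimately show "x \<in> (\<Union>ki\<in>M. U ki)" using U(2) x by blast
  qed
  ultimately show ?thesis by blast
qed

context veronese
begin

text \<open>A point is marked relative to \<open>F\<close> if \<open>F\<close> extends to a flag whose new members have
  covolume between \<open>\<epsilon>\<close> and \<open>1\<close> there, while all spaces compatible with that flag have covolume at least \<open>1\<close>.\<close>

definition marked :: "real \<Rightarrow> rat poly set set \<Rightarrow> real \<Rightarrow> bool" where
  "marked \<epsilon> F x \<longleftrightarrow> (\<exists>F'. F \<subseteq> F' \<and> is_flag n F' \<and>
     (\<forall>V\<in>F' - F. wedge_lt (red_basis n V) x 1 \<and> \<not> wedge_lt (red_basis n V) x \<epsilon>) \<and>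
     (\<forall>V\<in>flag_ext n F'. \<not> wedge_lt (red_basis n V) x 1))"

lemma wedge_lt_open:
  assumes "length \<tau> \<le> Suc n" "wedge_lt \<tau> x t"
  shows "\<exists>d>0. \<forall>y. \<bar>y - x\<bar> < d \<longrightarrow> wedge_lt \<tau> y t"
proof -
  let ?G = "{..<length \<tau>} \<rightarrow>\<^sub>E {..n}"
  have finG: "finite ?G" by (intro finite_PiE) auto
  have "\<forall>\<^sub>F y in nhds x. \<forall>f\<in>?G. \<bar>wedge \<tau> f y\<bar> < t"
  proof (rule eventually_ball_finite[OF finG], rule ballI)
    fix f assume f: "f \<in> ?G"
    obtain p where p: "\<And>\<zeta>. wedge \<tau> f \<zeta> = poly p \<zeta>" using wedge_poly[OF assms(1)] by metis
    have "open {y. \<bar>poly p y\<bar> < t}" by (intro open_Collect_less continuous_intros)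
    moreover have "x \<in> {y. \<bar>poly p y\<bar> < t}" using assms(2) f by (simp add: wedge_lt_def p[symmetric])
    ultimately show "\<forall>\<^sub>F y in nhds x. \<bar>wedge \<tau> f y\<bar> < t"
      unfolding eventually_nhds p by blast
  qed
  then show ?thesis unfolding eventually_nhds_metric wedge_lt_def by (simp add: dist_real_def)
qed

text \<open>Induction on the number \<open>j\<close> of members that the flag still lacks. Points
  where every extension has covolume at least 1 are marked by \<open>F\<close> itself. The others
  lie in a stopped interval, on which one extension \<open>V\<close> stays below 1; there an
  unmarked point is unmarked relative to \<open>insert V F\<close> or has covolume of
  \<open>V\<close> below \<open>\<epsilon>\<close>. Both sets are estimated on the parent, twice as
  long, and \<open>2 * (4 ^ j + 1) \<le> 4 ^ Suc j\<close>.\<close>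

lemma unmarked_measure:
  assumes \<eta>: "\<eta> \<ge> 0" and \<epsilon>: "\<And>(p::real poly) u v. degree p \<le> n * Suc n \<Longrightarrow> u < v \<Longrightarrow> (\<exists>x\<in>{u..v}. \<bar>poly p x\<bar> \<ge> 1) \<Longrightarrow>
    emeasure lborel {x\<in>{u..v}. \<bar>poly p x\<bar> < \<epsilon>} \<le> ennreal (\<eta> * (v - u))"
  assumes "is_flag n F" "card F + j = Suc n" "a < b"
    and "\<And>V. V \<in> flag_ext n F \<Longrightarrow> \<exists>x\<in>{a..b}. \<not> wedge_lt (red_basis n V) x 1"
  shows "\<exists>U\<in>sets lborel. {x\<in>{a..<b}. \<not> marked \<epsilon> F x} \<subseteq> U \<and> emeasure lborel U \<le> ennreal (4 ^ j * \<eta> * (b - a))"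
  using assms(3-)
proof (induction j arbitrary: F a b)
  case 0
  have "flag_ext n F = {}"
  proof (rule ccontr)
    assume "flag_ext n F \<noteq> {}"
    then obtain V where V: "V \<in> flag_ext n F" by blast
    from is_flag_card[OF is_flag_insert[OF 0(1) V]] have "card (insert V F) \<le> Suc n" .
    then show False using V 0(1,2) by (auto simp: flag_ext_def is_flag_def)
  qed
  then have "marked \<epsilon> F x" for x unfolding marked_def using 0(1) by (intro exI[of _ F]) auto
  then show ?case by (intro bexI[of _ "{}"]) auto
next
  case (Suc j)
  define stop where "stop u v \<longleftrightarrow> (\<exists>V\<in>flag_ext n F. \<forall>x\<in>{u..v}. wedge_lt (red_basis n V) x 1)" for u v :: real
  define E where "E = {x\<in>{a..<b}. \<exists>V\<in>flag_ext n F. wedge_lt (red_basis n V) x 1}"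
  define X where "X = {x. \<not> marked \<epsilon> F x}"
  define \<beta> where "\<beta> = 2 * (4 ^ j * \<eta> + \<eta>)"
  have \<beta>: "\<beta> \<ge> 0" using \<eta> by (simp add: \<beta>_def)
  have "\<exists>U\<in>sets lborel. X \<inter> E \<subseteq> U \<and> emeasure lborel U \<le> ennreal (\<beta> * (b - a))"
  proof (rule dyadic_stopping[OF Suc.prems(3) \<beta>, of stop])
    show "\<not> stop a b" using Suc.prems(4) by (auto simp: stop_def)
  next
    fix x assume "x \<in> E"
    then obtain V where V: "a \<le> x" "x < b" "V \<in> flag_ext n F" "wedge_lt (red_basis n V) x 1" by (auto simp: E_def)
    then have "V \<in> proper_spaces n" by (simp add: flag_ext_def)
    from wedge_lt_open[OF red_basis(2)[OF this] V(4)] obtain d where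
      d: "d > 0" "\<And>y. \<bar>y - x\<bar> < d \<Longrightarrow> wedge_lt (red_basis n V) y 1" by blast
    have "stop u v" if "u \<le> x" "x \<le> v" "v - u < d" for u v
      unfolding stop_def using V(3) d(2) that by (intro bexI[of _ V]) auto
    then show "a \<le> x \<and> x < b \<and> (\<exists>d>0. \<forall>u v. u \<le> x \<longrightarrow> x \<le> v \<longrightarrow> v - u < d \<longrightarrow> stop u v)"
      using V d(1) by blast
  next
    fix u v u' v' assume uv: "u < v" "stop u v" "\<not> stop u' v'" "u' \<le> u" "v \<le> v'" "v' - u' = 2 * (v - u)"
    obtain V where V: "V \<in> flag_ext n F" "\<And>x. x \<in> {u..v} \<Longrightarrow> wedge_lt (red_basis n V) x 1" using uv(2) by (auto simp: stop_def)
    have big: "\<exists>x\<in>{u'..v'}. \<not> wedge_lt (red_basis n W) x 1" if "W \<in> flag_ext n F" for W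
      using uv(3) that by (auto simp: stop_def)
    have VF: "V \<notin> F" "V \<in> proper_spaces n" using V(1) by (auto simp: flag_ext_def)
    have u'v': "u' < v'" using uv by linarith
    \<comment> \<open>The induction hypothesis is applied on the parent, because only there does
      every extension, including \<open>V\<close>, reach covolume 1 at some point.\<close>
    have "\<exists>U\<in>sets lborel. {x\<in>{u'..<v'}. \<not> marked \<epsilon> (insert V F) x} \<subseteq> U \<and> emeasure lborel U \<le> ennreal (4 ^ j * \<eta> * (v' - u'))"
    proof (rule Suc.IH[OF is_flag_insert[OF Suc.prems(1) V(1)] _ u'v'])
      show "card (insert V F) + j = Suc n" using Suc.prems(1,2) VF by (simp add: is_flag_def)
      show "\<exists>x\<in>{u'..v'}. \<not> wedge_lt (red_basis n W) x 1" if "W \<in> flag_ext n (insert V F)" for W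
        using big flag_ext_insert that by blast
    qed
    then obtain U1 where U1: "U1 \<in> sets lborel" "{x\<in>{u'..<v'}. \<not> marked \<epsilon> (insert V F) x} \<subseteq> U1"
      "emeasure lborel U1 \<le> ennreal (4 ^ j * \<eta> * (v' - u'))" by blast
    obtain x0 f where x0: "x0 \<in> {u'..v'}" "f \<in> {..<length (red_basis n V)} \<rightarrow>\<^sub>E {..n}"
      "\<bar>wedge (red_basis n V) f x0\<bar> \<ge> 1"
      using big[OF V(1)] by (auto simp: wedge_lt_def not_less)
    obtain p where p: "degree p \<le> n * Suc n" "\<And>\<zeta>. wedge (red_basis n V) f \<zeta> = poly p \<zeta>"
      using wedge_poly[OF red_basis(2)[OF VF(2)]] by metis
    define U2 where "U2 = {x\<in>{u'..v'}. \<bar>poly p x\<bar> < \<epsilon>}"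
    have U2: "U2 \<in> sets lborel" "emeasure lborel U2 \<le> ennreal (\<eta> * (v' - u'))"
    proof -
      have "\<exists>x\<in>{u'..v'}. \<bar>poly p x\<bar> \<ge> 1" using x0(1,3) unfolding p(2) by blast
      then show "emeasure lborel U2 \<le> ennreal (\<eta> * (v' - u'))" unfolding U2_def by (rule \<epsilon>[OF p(1) u'v'])
    qed (simp only: U2_def poly_sublevel_measurable)
    have "emeasure lborel (U1 \<union> U2) \<le> emeasure lborel U1 + emeasure lborel U2"
      using U1 U2 by (intro emeasure_subadditive) auto
    also have "\<dots> \<le> ennreal (4 ^ j * \<eta> * (v' - u')) + ennreal (\<eta> * (v' - u'))" using U1 U2 by (intro add_mono)
    also have "\<dots> = ennreal (4 ^ j * \<eta> * (v' - u') + \<eta> * (v' - u'))" using \<eta> u'v' by (simp add: ennreal_plus)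
    also have "\<dots> = ennreal (\<beta> * (v - u))" unfolding uv(6) \<beta>_def by (simp add: algebra_simps)
    finally have "emeasure lborel (U1 \<union> U2) \<le> ennreal (\<beta> * (v - u))" .
    moreover have "X \<inter> {u..<v} \<subseteq> U1 \<union> U2"
    proof (rule subsetI, rule ccontr)
      fix x assume x: "x \<in> X \<inter> {u..<v}" "x \<notin> U1 \<union> U2"
      have xin: "x \<in> {u'..<v'}" "x \<in> {u'..v'}" "x \<in> {u..v}" using x uv by auto
      then have "marked \<epsilon> (insert V F) x" using x U1(2) by blast
      then obtain F' where F': "insert V F \<subseteq> F'" "is_flag n F'"
        "\<forall>W\<in>F' - insert V F. wedge_lt (red_basis n W) x 1 \<and> \<not> wedge_lt (red_basis n W) x \<epsilon>"
        "\<forall>W\<in>flag_ext n F'. \<not> wedge_lt (red_basis n W) x 1"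
        unfolding marked_def by (elim exE conjE) (rule that)
      have "\<not> \<bar>poly p x\<bar> < \<epsilon>" using x xin by (auto simp: U2_def)
      then have "\<not> wedge_lt (red_basis n V) x \<epsilon>" using x0(2) p(2)[of x] unfolding wedge_lt_def by metis
      then have "wedge_lt (red_basis n W) x 1 \<and> \<not> wedge_lt (red_basis n W) x \<epsilon>" if "W \<in> F' - F" for W
        using V(2)[OF xin(3)] F'(3) that by (cases "W = V") auto
      then have "marked \<epsilon> F x" unfolding marked_def using F'(1,2,4)
        by (intro exI[of _ F'] conjI) auto
      then show False using x by (simp add: X_def)
    qed
    ultimately show "\<exists>U\<in>sets lborel. X \<inter> {u..<v} \<subseteq> U \<and> emeasure lborel U \<le> ennreal (\<beta> * (v - u))"
      using U1 U2 by (intro bexI[of _ "U1 \<union> U2"]) auto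
  qed
  then obtain U where U: "U \<in> sets lborel" "X \<inter> E \<subseteq> U" "emeasure lborel U \<le> ennreal (\<beta> * (b - a))" by blast
  have "{x\<in>{a..<b}. \<not> marked \<epsilon> F x} \<subseteq> U"
  proof
    fix x assume x: "x \<in> {x\<in>{a..<b}. \<not> marked \<epsilon> F x}"
    have "x \<in> E"
    proof (rule ccontr)
      assume "x \<notin> E"
      then have "marked \<epsilon> F x" unfolding marked_def using x Suc.prems(1) by (intro exI[of _ F]) (auto simp: E_def)
      then show False using x by simp
    qed
    then show "x \<in> U" using x U(2) by (auto simp: X_def)
  qed
  moreover have "ennreal (\<beta> * (b - a)) \<le> ennreal (4 ^ Suc j * \<eta> * (b - a))"
  proof (intro ennreal_leI mult_right_mono)
    have "1 * \<eta> \<le> 4 ^ j * \<eta>" using \<eta> by (intro mult_right_mono) auto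
    then show "\<beta> \<le> 4 ^ Suc j * \<eta>" by (simp add: \<beta>_def mult.commute)
  qed (use Suc.prems(3) in simp)
  ultimately show ?case using U by (intro bexI[of _ U]) (auto intro: order_trans)
qed

lemma wedge_lt_mono: "wedge_lt \<tau> x t \<Longrightarrow> t \<le> t' \<Longrightarrow> wedge_lt \<tau> x t'"
  by (force simp: wedge_lt_def)

text \<open>Let \<open>V0\<close> be the largest member of the flag that does not contain
  \<open>v\<close>, or the zero space. Adding a short \<open>v\<close> to it gives a space
  comparable with the whole flag and of covolume below \<open>\<epsilon>\<close>. It can neither
  belong to the flag, whose members have covolume at least \<open>\<epsilon>\<close>, nor extend it,
  since extensions have covolume at least 1.\<close>

lemma marked_no_short_vector:
  assumes mk: "marked \<epsilon> {} x" and \<epsilon>: "0 < \<epsilon>" "\<epsilon> \<le> 1" and e: "e > 0" "real (n + 2) * (e * 2) \<le> \<epsilon>"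
    and v: "degree v \<le> n" "v \<noteq> 0" and short: "\<And>j. j \<le> n \<Longrightarrow> \<bar>vcoord x v j\<bar> < e"
  shows False
proof -
  obtain F where F: "is_flag n F"
    "\<And>V. V \<in> F \<Longrightarrow> wedge_lt (red_basis n V) x 1 \<and> \<not> wedge_lt (red_basis n V) x \<epsilon>"
    "\<And>V. V \<in> flag_ext n F \<Longrightarrow> \<not> wedge_lt (red_basis n V) x 1"
    using mk unfolding marked_def by auto
  define w where "w = rat_poly v"
  have w0: "w \<noteq> 0" using v(2) by (simp add: w_def)
  define F0 where "F0 = {V\<in>F. w \<notin> V}"
  have finF0: "finite F0" using F(1) by (simp add: F0_def is_flag_def)
  have Fsub: "qpoly.subspace V" if "V \<in> F" for V using F(1) that by (auto simp: is_flag_def proper_spaces_def)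
  have Fdeg: "V \<subseteq> {p. degree p \<le> n}" if "V \<in> F" for V using F(1) that by (auto simp: is_flag_def proper_spaces_def)
  \<comment> \<open>The bound 2 rather than 1 covers the zero space: its covolume is exactly 1,
    while \<open>wedge_lt\<close> is strict.\<close>
  obtain V0 \<tau> where V0: "V0 \<subseteq> {p. degree p \<le> n}" "w \<notin> V0" "\<And>W. W \<in> F0 \<Longrightarrow> W \<subseteq> V0"
    "\<And>W. W \<in> F - F0 \<Longrightarrow> V0 \<subseteq> W" "is_int_basis \<tau> V0" "wedge_lt \<tau> x 2" "length \<tau> \<le> Suc n"
  proof (cases "F0 = {}")
    case True
    have "is_int_basis [] {0}" by (simp add: is_int_basis_def qpoly.independent_empty)
    moreover have "wedge_lt [] x 2" by (simp add: wedge_lt_def wedge_def)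
    ultimately show ?thesis using True w0 Fsub by (intro that[of "{0}" "[]"]) (auto simp: qpoly.subspace_0)
  next
    case False
    obtain V0 where V0: "V0 \<in> F0" "\<And>W. W \<in> F0 \<Longrightarrow> V0 \<subseteq> W \<Longrightarrow> V0 = W"
      using finite_has_maximal[OF finF0 False] by blast
    have "V0 \<in> F" using V0 by (simp add: F0_def)
    have cmp: "V0 \<subseteq> W \<or> W \<subseteq> V0" if "W \<in> F" for W using F(1) that \<open>V0 \<in> F\<close> by (auto simp: is_flag_def)
    have ps: "V0 \<in> proper_spaces n" using F(1) \<open>V0 \<in> F\<close> by (auto simp: is_flag_def)
    show ?thesis
    proof (rule that[of V0 "red_basis n V0"])
      show "V0 \<subseteq> {p. degree p \<le> n}" using Fdeg \<open>V0 \<in> F\<close> by auto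
      show "w \<notin> V0" using V0 by (simp add: F0_def)
      show "W \<subseteq> V0" if "W \<in> F0" for W using cmp[of W] V0(2)[OF that] that by (auto simp: F0_def)
      show "V0 \<subseteq> W" if "W \<in> F - F0" for W using cmp[of W] V0(1) that by (auto simp: F0_def)
      show "is_int_basis (red_basis n V0) V0" "length (red_basis n V0) \<le> Suc n" using red_basis[OF ps] by auto
      show "wedge_lt (red_basis n V0) x 2" using F(2)[OF \<open>V0 \<in> F\<close>] by (auto intro: wedge_lt_mono)
    qed
  qed
  define V' where "V' = qpoly.span (insert w V0)"
  have wV': "w \<in> V'" "V0 \<subseteq> V'" using qpoly.span_superset[of "insert w V0"] by (auto simp: V'_def)
  have "qpoly.subspace {p :: rat poly. degree p \<le> n}"
    by (auto simp: qpoly.subspace_def degree_add_le intro: order_trans[OF degree_smult_le])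
  then have "V' \<subseteq> {p. degree p \<le> n}" unfolding V'_def using V0(1) v(1) by (intro qpoly.span_minimal) (auto simp: w_def)
  then have ps: "V' \<in> proper_spaces n" using wV' w0 by (auto simp: proper_spaces_def V'_def)
  have "V' \<subseteq> W \<or> W \<subseteq> V'" if W: "W \<in> F" for W
  proof (cases "W \<in> F0")
    case True
    then show ?thesis using V0(3) wV' by blast
  next
    case False
    then have "insert w V0 \<subseteq> W" using V0(4)[of W] W by (auto simp: F0_def)
    then show ?thesis unfolding V'_def using Fsub[OF W] by (simp add: qpoly.span_minimal)
  qed
  then have cases: "V' \<in> F \<or> V' \<in> flag_ext n F" using ps by (auto simp: flag_ext_def)
  have "wedge_lt (\<tau> @ [v]) x (real (Suc (length \<tau>)) * (e * 2))"
    using V0(6) short e(1) by (intro wedge_snoc) auto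
  then have "wedge_lt (\<tau> @ [v]) x \<epsilon>"
  proof (rule wedge_lt_mono)
    have "real (Suc (length \<tau>)) * (e * 2) \<le> real (n + 2) * (e * 2)"
      using V0(7) e(1) by (intro mult_right_mono) auto
    then show "real (Suc (length \<tau>)) * (e * 2) \<le> \<epsilon>" using e(2) by linarith
  qed
  moreover have "is_int_basis (\<tau> @ [v]) V'" unfolding V'_def w_def
    by (rule is_int_basis_snoc[OF V0(5)]) (use V0(2) in \<open>simp add: w_def\<close>)
  ultimately have "wedge_lt (red_basis n V') x \<epsilon>" by (intro red_basis_wedge_lt[OF ps])
  then show False using cases F(2,3)[of V'] wedge_lt_mono[OF _ \<epsilon>(2)] by blast
qed

end

text \<open>Quantitative nondivergence in the sense of Kleinbock and Margulis, for the curve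
  \<open>(\<zeta>, \<dots>, \<zeta>\<^sup>n)\<close>; the constant \<open>\<delta>\<close> does not depend on the interval.\<close>

theorem nondivergence:
  fixes n :: nat
  assumes n: "n \<ge> 1"
  shows "\<exists>\<delta>>0. \<forall>a b. a < b \<longrightarrow> (\<exists>Q0. \<forall>Q\<ge>Q0. \<exists>U\<in>sets lborel. emeasure lborel U \<le> ennreal ((b - a) / 4) \<and>
    (\<forall>x\<in>{a..<b} - U. \<forall>R::int poly. R \<noteq> 0 \<longrightarrow> degree R \<le> n \<longrightarrow> \<bar>poly (of_int_poly R) x\<bar> < \<delta> / Q ^ n \<longrightarrow>
       (\<exists>j\<in>{1..n}. of_int \<bar>coeff R j\<bar> \<ge> \<delta> * Q)))"
proof -
  \<comment> \<open>The induction over flags of length up to \<open>n + 1\<close> costs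
    \<open>4 ^ Suc n\<close>; this value leaves an exceptional set of a quarter of the
    interval.\<close>
  define \<eta> :: real where "\<eta> = 1 / 4 ^ (n + 2)"
  have \<eta>: "\<eta> > 0" by (simp add: \<eta>_def)
  obtain \<epsilon>0 where \<epsilon>0: "\<epsilon>0 > 0" "\<And>(p::real poly) u v. degree p \<le> n * Suc n \<Longrightarrow> u < v \<Longrightarrow> (\<exists>x\<in>{u..v}. \<bar>poly p x\<bar> \<ge> 1) \<Longrightarrow>
    emeasure lborel {x\<in>{u..v}. \<bar>poly p x\<bar> < \<epsilon>0} \<le> ennreal (\<eta> * (v - u))"
    using poly_sublevel_measure[OF \<eta>, of "n * Suc n"] by blast
  define \<epsilon> where "\<epsilon> = min \<epsilon>0 1"
  have \<epsilon>: "0 < \<epsilon>" "\<epsilon> \<le> 1" using \<epsilon>0 by (auto simp: \<epsilon>_def)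
  have sub: "emeasure lborel {x\<in>{u..v}. \<bar>poly p x\<bar> < \<epsilon>} \<le> ennreal (\<eta> * (v - u))"
    if "degree p \<le> n * Suc n" "u < v" "\<exists>x\<in>{u..v}. \<bar>poly p x\<bar> \<ge> 1" for p :: "real poly" and u v
  proof -
    have "emeasure lborel {x\<in>{u..v}. \<bar>poly p x\<bar> < \<epsilon>} \<le> emeasure lborel {x\<in>{u..v}. \<bar>poly p x\<bar> < \<epsilon>0}"
      by (intro emeasure_mono poly_sublevel_measurable) (auto simp: \<epsilon>_def)
    then show ?thesis using \<epsilon>0(2)[OF that] by (rule order_trans)
  qed
  define \<delta> where "\<delta> = \<epsilon> / (2 * real (n + 2))"
  have \<delta>: "\<delta> > 0" "real (n + 2) * (\<delta> * 2) \<le> \<epsilon>" using \<epsilon> by (auto simp: \<delta>_def field_simps)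
  have "\<exists>Q0. \<forall>Q\<ge>Q0. \<exists>U\<in>sets lborel. emeasure lborel U \<le> ennreal ((b - a) / 4) \<and>
    (\<forall>x\<in>{a..<b} - U. \<forall>R::int poly. R \<noteq> 0 \<longrightarrow> degree R \<le> n \<longrightarrow> \<bar>poly (of_int_poly R) x\<bar> < \<delta> / Q ^ n \<longrightarrow>
       (\<exists>j\<in>{1..n}. of_int \<bar>coeff R j\<bar> \<ge> \<delta> * Q))" if ab: "a < b" for a b
  proof -
    \<comment> \<open>The interval enters only through the constant \<open>C\<close> for these
      nodes, hence only through the threshold for \<open>Q\<close>.\<close>
    have "infinite {a..b}" using ab by (simp add: infinite_Icc)
    then obtain T where T: "T \<subseteq> {a..b}" "finite T" "card T = Suc n"
      using infinite_arbitrarily_large by blast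
    obtain C where C: "C > 0" "\<And>(p::real poly) B. degree p < card T \<Longrightarrow> (\<forall>y\<in>T. \<bar>poly p y\<bar> \<le> B) \<Longrightarrow> (\<forall>j. \<bar>coeff p j\<bar> \<le> C * B)"
      using coeff_bound_from_values[OF T(2)] by blast
    show ?thesis
    proof (intro exI[of _ "max 1 (2 * C)"] allI impI)
      fix Q :: real assume "max 1 (2 * C) \<le> Q"
      then have QC: "Q \<ge> 1" "Q \<ge> 2 * C" by auto
      interpret veronese n Q by unfold_locales (use n QC in auto)
      have fl: "is_flag n {}" by (simp add: is_flag_def)
      have "\<exists>U\<in>sets lborel. {x\<in>{a..<b}. \<not> marked \<epsilon> {} x} \<subseteq> U \<and> emeasure lborel U \<le> ennreal (4 ^ Suc n * \<eta> * (b - a))"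
        by (rule unmarked_measure[OF _ sub fl _ ab])
          (use \<eta> wedge_not_small[OF _ T(2,1,3) C QC(2)] in \<open>auto simp: flag_ext_def\<close>)
      then obtain U where U: "U \<in> sets lborel" "{x\<in>{a..<b}. \<not> marked \<epsilon> {} x} \<subseteq> U"
        "emeasure lborel U \<le> ennreal (4 ^ Suc n * \<eta> * (b - a))" by blast
      have "4 ^ Suc n * \<eta> * (b - a) = (b - a) / 4" by (simp add: \<eta>_def)
      then have "emeasure lborel U \<le> ennreal ((b - a) / 4)" using U(3) by (simp only:)
      moreover have "\<exists>j\<in>{1..n}. of_int \<bar>coeff R j\<bar> \<ge> \<delta> * Q" if x: "x \<in> {a..<b} - U"
        and R: "R \<noteq> 0" "degree R \<le> n" "\<bar>poly (of_int_poly R) x\<bar> < \<delta> / Q ^ n" for x R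
      proof (rule ccontr)
        assume neg: "\<not> ?thesis"
        have "marked \<epsilon> {} x" using x U(2) by blast
        moreover have "\<bar>vcoord x R j\<bar> < \<delta>" if j: "j \<le> n" for j
        proof (cases "j = 0")
          case True
          then show ?thesis using R(3) Q by (simp add: vcoord_0[OF R(2)] abs_mult field_simps)
        next
          case False
          then have "of_int \<bar>coeff R j\<bar> < \<delta> * Q" using neg j by (auto simp: not_le Suc_le_eq)
          then show ?thesis using False j Q by (simp add: vcoord_pos field_simps)
        qed
        ultimately show False using marked_no_short_vector[OF _ \<epsilon> \<delta> R(2,1)] by blast
      qed
      ultimately show "\<exists>U\<in>sets lborel. emeasure lborel U \<le> ennreal ((b - a) / 4) \<and>
        (\<forall>x\<in>{a..<b} - U. \<forall>R::int poly. R \<noteq> 0 \<longrightarrow> degree R \<le> n \<longrightarrow> \<bar>poly (of_int_poly R) x\<bar> < \<delta> / Q ^ n \<longrightarrow>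
         (\<exists>j\<in>{1..n}. of_int \<bar>coeff R j\<bar> \<ge> \<delta> * Q))"
        using U(1) by (intro bexI[of _ U]) auto
    qed
  qed
  then show ?thesis using \<delta>(1) by blast
qed

section \<open>Polynomials with large derivative\<close>

text \<open>The coordinate of the coefficient of \<open>X\<close> is replaced by that of the
  derivative at \<open>\<zeta>\<close>. The change is triangular with bounded entries, so the
  lattice keeps its shape while a small derivative becomes visible as a thin side of a box.\<close>

definition flat_coord :: "real \<Rightarrow> real \<Rightarrow> nat \<Rightarrow> int poly \<Rightarrow> nat \<Rightarrow> real" where
  "flat_coord Q \<zeta> n P i = (if i = 0 then poly (of_int_poly P) \<zeta> * Q ^ n
     else if i = 1 then poly (pderiv (of_int_poly P)) \<zeta> / Q else of_int (coeff P i) / Q)"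

lemma poly_pderiv_expand:
  assumes "degree P \<le> n" "n \<ge> 1"
  shows "poly (pderiv (of_int_poly P)) (\<zeta>::real) = of_int (coeff P 1) + (\<Sum>i\<in>{2..n}. real i * of_int (coeff P i) * \<zeta> ^ (i - 1))"
proof -
  let ?p = "of_int_poly P :: real poly"
  have "poly (pderiv ?p) \<zeta> = (\<Sum>i\<le>n - 1. coeff (pderiv ?p) i * \<zeta> ^ i)"
    using assms by (subst poly_altdef, intro sum.mono_neutral_left) (auto simp: coeff_eq_0 degree_pderiv)
  also have "\<dots> = (\<Sum>i\<in>{0..n - 1}. real (Suc i) * of_int (coeff P (Suc i)) * \<zeta> ^ i)"
    by (simp add: coeff_pderiv atLeast0AtMost)
  also have "\<dots> = (\<Sum>i\<in>{1..n}. real i * of_int (coeff P i) * \<zeta> ^ (i - 1))"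
    using assms(2) sum.shift_bounds_cl_Suc_ivl[of "\<lambda>i. real i * of_int (coeff P i) * \<zeta> ^ (i - 1)" 0 "n - 1"] by simp
  also have "\<dots> = of_int (coeff P 1) + (\<Sum>i\<in>{2..n}. real i * of_int (coeff P i) * \<zeta> ^ (i - 1))"
    using assms(2) by (subst sum.atLeast_Suc_atMost) (auto simp: numeral_2_eq_2)
  finally show ?thesis .
qed

text \<open>Polynomials with small coordinates are packed: if no nonzero polynomial is very short,
  a box with one side of length comparable to \<open>\<delta>\<close> contains few of them.\<close>

lemma flat_packing:
  fixes \<zeta> Q \<delta> K :: real
  assumes n: "n \<ge> 1" and z: "\<zeta> \<in> {1..2}" and Q: "Q \<ge> 1" and \<delta>: "0 < \<delta>" "\<delta> \<le> 1" and K: "K \<ge> 1"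
    and good: "\<And>R::int poly. R \<noteq> 0 \<Longrightarrow> degree R \<le> n \<Longrightarrow> \<bar>poly (of_int_poly R) \<zeta>\<bar> < \<delta> / Q ^ n \<Longrightarrow>
       \<exists>j\<in>{1..n}. of_int \<bar>coeff R j\<bar> \<ge> \<delta> * Q"
    and d': "d' = \<delta> / (1 + real n * (real n * 2 ^ n))"
    and i0: "1 \<le> i0" "i0 \<le> n"
    and T: "\<And>P. P \<in> T \<Longrightarrow> degree P \<le> n \<and> \<bar>flat_coord Q \<zeta> n P 0\<bar> \<le> 1 \<and> \<bar>flat_coord Q \<zeta> n P i0\<bar> \<le> d' \<and>
       (\<forall>i\<in>{1..n}. \<bar>flat_coord Q \<zeta> n P i\<bar> \<le> K)"
  shows "finite T \<and> real (card T) \<le> 4 * (4 / d') ^ n * K ^ (n - 1)"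
proof -
  have dd: "1 + real n * (real n * 2 ^ n) \<ge> 1" by simp
  have d'0: "0 < d'" unfolding d' by (intro divide_pos_pos \<delta>(1) add_pos_nonneg) auto
  have "\<delta> / (1 + real n * (real n * 2 ^ n)) \<le> \<delta> / 1" using \<delta>(1) by (intro divide_left_mono dd mult_pos_pos add_pos_nonneg) auto
  then have "d' \<le> \<delta>" unfolding d' by simp
  note d'0 = d'0 this order_trans[OF this \<delta>(2)]
  \<comment> \<open>The thin side at \<open>i0\<close> is as long as one cell. It costs a constant
    number of cells instead of a multiple of \<open>K\<close>, which is how one factor
    \<open>K\<close> is saved.\<close>
  define B where "B i = (if i = 0 then 1 else if i = i0 then d' else K)" for i
  have B0: "B i \<ge> 0" for i using d'0 K by (auto simp: B_def)
  define f where "f P = (\<lambda>i\<in>{..n}. \<lfloor>flat_coord Q \<zeta> n P i / d'\<rfloor>)" for P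
  define S where "S = (\<Pi>\<^sub>E i\<in>{..n}. {\<lfloor>- B i / d'\<rfloor>..\<lfloor>B i / d'\<rfloor>})"
  have finS: "finite S" unfolding S_def by (intro finite_PiE) auto
  have fS: "f ` T \<subseteq> S"
  proof
    fix y assume "y \<in> f ` T"
    then obtain P where P: "P \<in> T" "y = f P" by blast
    have "\<bar>flat_coord Q \<zeta> n P i\<bar> \<le> B i" if "i \<le> n" for i
      using T[OF P(1)] that by (auto simp: B_def)
    then have "- B i / d' \<le> flat_coord Q \<zeta> n P i / d' \<and> flat_coord Q \<zeta> n P i / d' \<le> B i / d'" if "i \<le> n" for i
    proof -
      have "- B i \<le> flat_coord Q \<zeta> n P i" "flat_coord Q \<zeta> n P i \<le> B i"
        using \<open>\<And>i. i \<le> n \<Longrightarrow> \<bar>flat_coord Q \<zeta> n P i\<bar> \<le> B i\<close>[OF that] by (auto simp: abs_le_iff)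
      then show ?thesis using d'0(1) by (intro conjI divide_right_mono) auto
    qed
    then show "y \<in> S" unfolding S_def P(2) f_def by (auto intro!: floor_mono)
  qed
  \<comment> \<open>Two polynomials in one cell differ by a polynomial with all flat coordinates
    below \<open>d'\<close>. Recovering the coefficient of \<open>X\<close> from the derivative
    costs the factor by which \<open>\<delta>\<close> was divided, so the difference would
    contradict \<open>good\<close>.\<close>
  have inj: "inj_on f T"
  proof (rule inj_onI, rule ccontr)
    fix P1 P2 assume P: "P1 \<in> T" "P2 \<in> T" "f P1 = f P2" "P1 \<noteq> P2"
    define R where "R = P1 - P2"
    have dR: "degree R \<le> n" unfolding R_def using T P by (intro degree_diff_le) auto
    have lin: "flat_coord Q \<zeta> n R i = flat_coord Q \<zeta> n P1 i - flat_coord Q \<zeta> n P2 i" for i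
      by (simp add: flat_coord_def R_def of_int_poly_hom.hom_minus pderiv_diff algebra_simps diff_divide_distrib)
    have small: "\<bar>flat_coord Q \<zeta> n R i\<bar> < d'" if "i \<le> n" for i
      unfolding lin using fun_cong[OF P(3), of i] that d'0 by (intro same_cell_diff) (auto simp: f_def)
    have "\<bar>poly (of_int_poly R) \<zeta>\<bar> * Q ^ n < d'" using small[of 0] Q by (simp add: flat_coord_def abs_mult)
    then have "\<bar>poly (of_int_poly R) \<zeta>\<bar> < \<delta> / Q ^ n" using d'0 Q by (simp add: field_simps)
    then obtain j where j: "j \<in> {1..n}" "of_int \<bar>coeff R j\<bar> \<ge> \<delta> * Q"
      using good[of R] P(4) dR by (auto simp: R_def)
    have c: "\<bar>real_of_int (coeff R i)\<bar> \<le> d' * Q" if "2 \<le> i" "i \<le> n" for i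
      using small[OF that(2)] that Q by (simp add: flat_coord_def field_simps)
    have "\<bar>real_of_int (coeff R j)\<bar> < \<delta> * Q"
    proof (cases "j = 1")
      case False
      then have "\<bar>flat_coord Q \<zeta> n R j\<bar> < \<delta>" using small[of j] j d'0 by simp
      then show ?thesis using False j Q by (simp add: flat_coord_def field_simps)
    next
      case True
      have "\<bar>\<Sum>i\<in>{2..n}. real i * of_int (coeff R i) * \<zeta> ^ (i - 1)\<bar> \<le> (\<Sum>i\<in>{2..n}. real n * (d' * Q) * 2 ^ n)"
      proof (rule order_trans[OF sum_abs], rule sum_mono)
        fix i assume i: "i \<in> {2..n}"
        have "\<zeta> ^ (i - 1) \<le> 2 ^ (i - 1)" using z by (intro power_mono) auto
        also have "\<dots> \<le> (2::real) ^ n" using i by (intro power_increasing) auto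
        finally show "\<bar>real i * of_int (coeff R i) * \<zeta> ^ (i - 1)\<bar> \<le> real n * (d' * Q) * 2 ^ n"
          unfolding abs_mult using z i c[of i] d'0 Q by (intro mult_mono) auto
      qed
      also have "\<dots> \<le> real n * (real n * (d' * Q) * 2 ^ n)"
        using d'0 Q by (simp add: mult_right_mono)
      finally have "\<bar>real_of_int (coeff R 1)\<bar> \<le> \<bar>poly (pderiv (of_int_poly R)) \<zeta>\<bar> + real n * (real n * (d' * Q) * 2 ^ n)"
        using poly_pderiv_expand[OF dR n, of \<zeta>] by linarith
      also have "\<bar>poly (pderiv (of_int_poly R)) \<zeta>\<bar> < d' * Q"
        using small[of 1] n Q by (simp add: flat_coord_def field_simps)
      also have "d' * Q + real n * (real n * (d' * Q) * 2 ^ n) = (1 + real n * (real n * 2 ^ n)) * d' * Q"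
        by (simp add: algebra_simps)
      also have "\<dots> = \<delta> * Q"
      proof -
        have "1 + real n * (real n * 2 ^ n) \<noteq> 0" using dd by linarith
        then show ?thesis by (simp add: d')
      qed
      finally show ?thesis using True by simp
    qed
    then show False using j by simp
  qed
  have cardT: "card T \<le> card S" using inj fS finS by (rule card_inj_on_le)
  have finT: "finite T" using inj fS finS by (rule inj_on_finite)
  have "real (card S) = (\<Prod>i\<le>n. real (card {\<lfloor>- B i / d'\<rfloor>..\<lfloor>B i / d'\<rfloor>}))"
    unfolding S_def by (simp add: card_PiE)
  also have "\<dots> \<le> (\<Prod>i\<le>n. if i = 0 then 4 / d' else if i = i0 then 4 else 4 / d' * K)"
  proof (rule prod_mono, intro conjI)
    fix i assume "i \<in> {..n}"
    have "real (card {\<lfloor>- B i / d'\<rfloor>..\<lfloor>B i / d'\<rfloor>}) \<le> 2 * B i / d' + 2" by (rule card_cells[OF d'0(1) B0])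
    also have "\<dots> \<le> (if i = 0 then 4 / d' else if i = i0 then 4 else 4 / d' * K)"
    proof -
      have "2 * K / d' + 2 \<le> 2 * K / d' + 2 * K / d'"
      proof -
        have "d' \<le> K" using d'0 K by linarith
        then have "1 \<le> K / d'" using d'0 by simp
        then show ?thesis by simp
      qed
      then have K': "2 * K / d' + 2 \<le> 4 / d' * K" by simp
      have "1 \<le> 1 / d'" using d'0(1,3) by simp
      then have one: "2 * 1 / d' + 2 \<le> 4 / d'" by simp
      have "2 * d' / d' + 2 = (4::real)" using d'0(1) by simp
      then show ?thesis unfolding B_def using K' one by (simp split: if_split)
    qed
    finally show "real (card {\<lfloor>- B i / d'\<rfloor>..\<lfloor>B i / d'\<rfloor>}) \<le> (if i = 0 then 4 / d' else if i = i0 then 4 else 4 / d' * K)" .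
  qed simp
  also have "\<dots> = 4 / d' * (4 * (4 / d' * K) ^ (n - 1))"
  proof -
    define F where "F i = (if i = 0 then 4 / d' else if i = i0 then 4 else 4 / d' * K)" for i
    have "prod F {..n} = F 0 * prod F ({..n} - {0})" by (rule prod.remove) auto
    also have "prod F ({..n} - {0}) = F i0 * prod F ({..n} - {0} - {i0})" by (rule prod.remove) (use i0 in auto)
    also have "prod F ({..n} - {0} - {i0}) = (\<Prod>i\<in>{..n} - {0} - {i0}. 4 / d' * K)"
      by (rule prod.cong) (auto simp: F_def)
    also have "\<dots> = (4 / d' * K) ^ (n - 1)" using i0 by simp
    finally show ?thesis using i0 by (simp add: F_def)
  qed
  also have "4 / d' * (4 * (4 / d' * K) ^ (n - 1)) = 4 * (4 / d') ^ n * K ^ (n - 1)"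
  proof -
    obtain k where "n = Suc k" using n by (cases n) auto
    then show ?thesis by (simp add: power_mult_distrib power_divide)
  qed
  finally show ?thesis using cardT finT by linarith
qed

text \<open>Dirichlet's pigeonhole argument produces a multiple of \<open>K^n\<close> polynomials
  with the required value and height, whereas by packing only \<open>O(K^(n-1))\<close> of them can
  have a small derivative or a small leading coefficient; a large \<open>K\<close> leaves one with
  neither defect. The derivative is needed to find a zero, the leading coefficient to run a
  recurrence in the transference.\<close>

lemma polynomial_with_large_derivative:
  fixes n :: nat and \<delta> :: real
  assumes n: "n \<ge> 1" and \<delta>: "0 < \<delta>" "\<delta> \<le> 1"
  shows "\<exists>K\<ge>1. \<exists>\<eta>>0. \<forall>\<zeta>\<in>{1..2}. \<forall>Q\<ge>1.
    (\<forall>R::int poly. R \<noteq> 0 \<longrightarrow> degree R \<le> n \<longrightarrow> \<bar>poly (of_int_poly R) \<zeta>\<bar> < \<delta> / Q ^ n \<longrightarrow>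
       (\<exists>j\<in>{1..n}. of_int \<bar>coeff R j\<bar> \<ge> \<delta> * Q)) \<longrightarrow>
    (\<exists>P::int poly. degree P \<le> n \<and> \<bar>poly (of_int_poly P) \<zeta>\<bar> \<le> 1 / Q ^ n \<and>
       (\<forall>i\<in>{1..n}. of_int \<bar>coeff P i\<bar> \<le> K * Q) \<and> poly (pderiv (of_int_poly P)) \<zeta> \<ge> \<eta> * Q \<and>
       of_int \<bar>coeff P n\<bar> \<ge> \<eta> * Q)"
proof -
  define d' where "d' = \<delta> / (1 + real n * (real n * 2 ^ n))"
  define C1 :: real where "C1 = 1 + real n * (real n * 2 ^ n)"
  have C1: "C1 \<ge> 1" by (simp add: C1_def)
  have d'0: "d' > 0" unfolding d'_def C1_def[symmetric] using \<delta> C1 by simp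
  define C2 where "C2 = 4 * (4 / d') ^ n * C1 ^ (n - 1)"
  have C2: "C2 > 0" using d'0 C1 by (simp add: C2_def)
  define K where "K = 4 * C2 + 1"
  have K: "K \<ge> 1" using C2 by (simp add: K_def)
  have main: "\<exists>P::int poly. degree P \<le> n \<and> \<bar>poly (of_int_poly P) \<zeta>\<bar> \<le> 1 / Q ^ n \<and>
       (\<forall>i\<in>{1..n}. of_int \<bar>coeff P i\<bar> \<le> K * Q) \<and> poly (pderiv (of_int_poly P)) \<zeta> \<ge> d' * Q \<and>
       of_int \<bar>coeff P n\<bar> \<ge> d' * Q"
    if z: "\<zeta> \<in> {1..2}" and Q: "Q \<ge> 1" and good: "\<And>R::int poly. R \<noteq> 0 \<Longrightarrow> degree R \<le> n \<Longrightarrow> \<bar>poly (of_int_poly R) \<zeta>\<bar> < \<delta> / Q ^ n \<Longrightarrow>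
       \<exists>j\<in>{1..n}. of_int \<bar>coeff R j\<bar> \<ge> \<delta> * Q" for \<zeta> Q
  proof (rule ccontr)
    assume none: "\<not> ?thesis"
    define S where "S = {P::int poly. degree P \<le> n \<and> \<bar>poly (of_int_poly P) \<zeta>\<bar> \<le> 1 / Q ^ n \<and>
       (\<forall>i\<in>{1..n}. of_int \<bar>coeff P i\<bar> \<le> K * Q)}"
    define T where "T i0 = {P\<in>S. \<bar>flat_coord Q \<zeta> n P i0\<bar> \<le> d'}" for i0
    have "\<bar>flat_coord Q \<zeta> n P 0\<bar> \<le> 1 \<and> (\<forall>i\<in>{1..n}. \<bar>flat_coord Q \<zeta> n P i\<bar> \<le> C1 * K)" if P: "P \<in> S" for P
    proof (intro conjI ballI)
      show "\<bar>flat_coord Q \<zeta> n P 0\<bar> \<le> 1" using P Q by (simp add: S_def flat_coord_def abs_mult field_simps)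
      fix i assume i: "i \<in> {1..n}"
      have dP: "degree P \<le> n" and c: "\<And>i. 1 \<le> i \<Longrightarrow> i \<le> n \<Longrightarrow> \<bar>real_of_int (coeff P i)\<bar> \<le> K * Q"
        using P by (auto simp: S_def)
      show "\<bar>flat_coord Q \<zeta> n P i\<bar> \<le> C1 * K"
      proof (cases "i = 1")
        case False
        have "\<bar>flat_coord Q \<zeta> n P i\<bar> \<le> 1 * K" using c[of i] i Q False by (simp add: flat_coord_def field_simps)
        also have "\<dots> \<le> C1 * K" using C1 K by (intro mult_right_mono) auto
        finally show ?thesis .
      next
        case True
        have "\<bar>\<Sum>i\<in>{2..n}. real i * of_int (coeff P i) * \<zeta> ^ (i - 1)\<bar> \<le> (\<Sum>i\<in>{2..n}. real n * (K * Q) * 2 ^ n)"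
        proof (rule order_trans[OF sum_abs], rule sum_mono)
          fix i assume i: "i \<in> {2..n}"
          have "\<zeta> ^ (i - 1) \<le> 2 ^ (i - 1)" using z by (intro power_mono) auto
          also have "\<dots> \<le> (2::real) ^ n" using i by (intro power_increasing) auto
          finally show "\<bar>real i * of_int (coeff P i) * \<zeta> ^ (i - 1)\<bar> \<le> real n * (K * Q) * 2 ^ n"
            unfolding abs_mult using z i c[of i] K Q by (intro mult_mono) auto
        qed
        also have "\<dots> \<le> real n * (real n * (K * Q) * 2 ^ n)" using K Q by (simp add: mult_right_mono)
        finally have "\<bar>poly (pderiv (of_int_poly P)) \<zeta>\<bar> \<le> K * Q + real n * (real n * (K * Q) * 2 ^ n)"
          using poly_pderiv_expand[OF dP n, of \<zeta>] c[of 1] n by linarith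
        also have "\<dots> = C1 * K * Q" by (simp add: C1_def algebra_simps)
        finally show ?thesis using True Q by (simp add: flat_coord_def field_simps)
      qed
    qed
    then have TP: "degree P \<le> n \<and> \<bar>flat_coord Q \<zeta> n P 0\<bar> \<le> 1 \<and> \<bar>flat_coord Q \<zeta> n P i0\<bar> \<le> d' \<and>
       (\<forall>i\<in>{1..n}. \<bar>flat_coord Q \<zeta> n P i\<bar> \<le> C1 * K)" if "P \<in> T i0" for P i0
      using that by (auto simp: T_def S_def)
    have C1K: "C1 * K \<ge> 1" using C1 K mult_mono[of 1 C1 1 K] by simp
    have cT: "finite (T i0) \<and> real (card (T i0)) \<le> C2 * K ^ (n - 1)" if "1 \<le> i0" "i0 \<le> n" for i0
    proof -
      have "finite (T i0) \<and> real (card (T i0)) \<le> 4 * (4 / d') ^ n * (C1 * K) ^ (n - 1)"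
        by (rule flat_packing[OF n z Q \<delta> C1K good d'_def that TP])
      then show ?thesis by (simp add: C2_def power_mult_distrib)
    qed
    have ST: "S \<subseteq> T 1 \<union> T n"
    proof
      fix P assume P: "P \<in> S"
      show "P \<in> T 1 \<union> T n"
      proof (rule ccontr)
        assume "P \<notin> T 1 \<union> T n"
        then have "\<bar>poly (pderiv (of_int_poly P)) \<zeta>\<bar> > d' * Q" "\<bar>flat_coord Q \<zeta> n P n\<bar> > d'"
          using P Q by (auto simp: T_def flat_coord_def field_simps)
        moreover have "of_int \<bar>coeff P n\<bar> \<ge> d' * Q"
        proof (cases "n = 1")
          case True
          have "poly (pderiv (of_int_poly P)) \<zeta> = real_of_int (coeff P 1)"
            using poly_pderiv_expand[of P n \<zeta>] P True by (simp add: S_def)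
          then show ?thesis using calculation True by simp
        next
          case False
          then show ?thesis using calculation n Q by (simp add: flat_coord_def field_simps)
        qed
        ultimately have "P \<in> S \<and> \<bar>poly (pderiv (of_int_poly P)) \<zeta>\<bar> \<ge> d' * Q \<and> of_int \<bar>coeff P n\<bar> \<ge> d' * Q" using P by simp
        \<comment> \<open>Passing to \<open>- P\<close> if necessary makes the derivative positive,
          as the claim requires.\<close>
        moreover have "- P \<in> S \<and> of_int \<bar>coeff (- P) n\<bar> \<ge> d' * Q \<and> poly (pderiv (of_int_poly (- P))) \<zeta> = - poly (pderiv (of_int_poly P)) \<zeta>"
          using calculation by (simp add: S_def of_int_poly_hom.hom_uminus pderiv_minus)
        ultimately show False using none unfolding S_def
          by (cases "poly (pderiv (of_int_poly P)) \<zeta> \<ge> 0") (smt (verit) mem_Collect_eq)+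
      qed
    qed
    have finS: "finite S" using ST cT n by (meson finite_UnI finite_subset le_refl)
    have cS: "real (card S) \<le> 2 * C2 * K ^ (n - 1)"
    proof -
      have "card S \<le> card (T 1 \<union> T n)" using ST cT n by (intro card_mono) auto
      also have "\<dots> \<le> card (T 1) + card (T n)" by (rule card_Un_le)
      finally show ?thesis using cT[of 1] cT[of n] n by linarith
    qed
    define M where "M = \<lfloor>K * Q\<rfloor>"
    have KQ: "K * Q \<ge> 1" using K Q mult_mono[of 1 K 1 Q] by simp
    have M: "M \<ge> 1" using KQ by (simp add: M_def)
    define A where "A = {1..n} \<rightarrow>\<^sub>E {0..M}"
    have finA: "finite A" unfolding A_def by (intro finite_PiE) auto
    have cA: "real (card A) \<ge> (K * Q) ^ n"
    proof -
      have "real (card A) = of_int (M + 1) ^ n" using M by (simp add: A_def card_PiE)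
      also have "of_int (M + 1) ^ n \<ge> (K * Q) ^ n" 
      proof (intro power_mono)
        show "K * Q \<le> of_int (M + 1)" unfolding M_def by linarith
      qed (use KQ in simp)
      finally show ?thesis .
    qed
    define s where "s a = (\<Sum>i\<in>{1..n}. of_int (a i) * \<zeta> ^ i)" for a :: "nat \<Rightarrow> int"
    \<comment> \<open>The constant term reduces the value at \<open>\<zeta>\<close> to its
      fractional part, so all values fall into the unit interval.\<close>
    define Pa where "Pa a = [:- \<lfloor>s a\<rfloor>:] + (\<Sum>i\<in>{1..n}. Polynomial.monom (a i) i)" for a
    have cPa: "coeff (Pa a) i = (if i = 0 then - \<lfloor>s a\<rfloor> else if i \<le> n then a i else 0)" for a i
      by (auto simp: Pa_def coeff_sum coeff_monom coeff_pCons split: nat.split)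
    have dPa: "degree (Pa a) \<le> n" for a by (intro degree_le) (auto simp: cPa)
    have vPa: "poly (of_int_poly (Pa a)) \<zeta> = s a - of_int \<lfloor>s a\<rfloor>" for a
    proof -
      have "poly (of_int_poly (Pa a)) \<zeta> = (\<Sum>i\<le>n. of_int (coeff (Pa a) i) * \<zeta> ^ i)"
        using dPa[of a] by (subst poly_altdef, simp, intro sum.mono_neutral_left) (auto simp: coeff_eq_0)
      also have "\<dots> = of_int (coeff (Pa a) 0) + (\<Sum>i\<in>{1..n}. of_int (coeff (Pa a) i) * \<zeta> ^ i)"
        by (simp add: atMost_atLeast0 sum.atLeast_Suc_atMost)
      also have "\<dots> = s a - of_int \<lfloor>s a\<rfloor>" unfolding s_def by (simp add: cPa s_def)
      finally show ?thesis .
    qed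
    define cell where "cell a = \<lfloor>poly (of_int_poly (Pa a)) \<zeta> * Q ^ n\<rfloor>" for a
    have "real (card A) \<le> real (card {0..\<lfloor>Q ^ n\<rfloor>}) * (2 * C2 * K ^ (n - 1))"
    proof (rule card_le_fibres[OF finA, of cell])
      show "cell ` A \<subseteq> {0..\<lfloor>Q ^ n\<rfloor>}"
      proof
        fix y assume "y \<in> cell ` A"
        then obtain a where "y = cell a" by blast
        moreover have "0 \<le> poly (of_int_poly (Pa a)) \<zeta>" "poly (of_int_poly (Pa a)) \<zeta> \<le> 1" unfolding vPa by linarith+
        then have "0 \<le> poly (of_int_poly (Pa a)) \<zeta> * Q ^ n" "poly (of_int_poly (Pa a)) \<zeta> * Q ^ n \<le> 1 * Q ^ n"
          using Q by (auto intro: mult_right_mono)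
        ultimately show "y \<in> {0..\<lfloor>Q ^ n\<rfloor>}" by (simp add: cell_def floor_mono)
      qed
      fix y assume "y \<in> cell ` A"
      then obtain a0 where a0: "a0 \<in> A" "y = cell a0" by blast
      define h where "h a = Pa a - Pa a0" for a
      have "inj_on h {a\<in>A. cell a = y}"
      proof (rule inj_onI)
        fix a b assume ab: "a \<in> {a\<in>A. cell a = y}" "b \<in> {a\<in>A. cell a = y}" "h a = h b"
        then have "Pa a = Pa b" by (simp add: h_def)
        then have "coeff (Pa a) i = coeff (Pa b) i" for i by simp
        then have "a i = b i" if "i \<in> {1..n}" for i using that cPa[of _ i] by (metis atLeastAtMost_iff not_one_le_zero)
        then show "a = b" using ab by (intro PiE_ext[of a "{1..n}" _ b]) (auto simp: A_def)
      qed
      moreover have "h ` {a\<in>A. cell a = y} \<subseteq> S"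
      proof safe
        fix a assume a: "a \<in> A" "y = cell a"
        have "\<bar>poly (of_int_poly (Pa a)) \<zeta> * Q ^ n - poly (of_int_poly (Pa a0)) \<zeta> * Q ^ n\<bar> < 1"
          using a a0 unfolding cell_def by linarith
        then have "\<bar>poly (of_int_poly (h a)) \<zeta>\<bar> * Q ^ n < 1"
          using Q by (simp add: h_def of_int_poly_hom.hom_minus left_diff_distrib[symmetric] abs_mult)
        then have "\<bar>poly (of_int_poly (h a)) \<zeta>\<bar> \<le> 1 / Q ^ n" using Q by (simp add: field_simps)
        moreover have "of_int \<bar>coeff (h a) i\<bar> \<le> K * Q" if i: "i \<in> {1..n}" for i
        proof -
          have "0 \<le> a i" "a i \<le> M" "0 \<le> a0 i" "a0 i \<le> M" using a a0 i by (auto simp: A_def PiE_iff)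
          moreover have "coeff (h a) i = a i - a0 i" using i by (simp add: h_def cPa)
          ultimately have "\<bar>coeff (h a) i\<bar> \<le> M" by linarith
          then have "real_of_int \<bar>coeff (h a) i\<bar> \<le> of_int M" by (rule of_int_le_iff[THEN iffD2])
          then show ?thesis unfolding M_def by linarith
        qed
        moreover have "degree (h a) \<le> n" unfolding h_def by (intro degree_diff_le dPa)
        ultimately show "h a \<in> S" by (simp add: S_def)
      qed
      ultimately have "card {a\<in>A. cell a = y} \<le> card S" using finS by (rule card_inj_on_le)
      then show "real (card {a\<in>A. cell a = y}) \<le> 2 * C2 * K ^ (n - 1)" using cS by linarith
    qed (use C2 K in auto)
    also have "\<dots> \<le> (2 * Q ^ n) * (2 * C2 * K ^ (n - 1))"
    proof (rule mult_right_mono)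
      have "Q ^ n \<ge> 1" using Q by simp
      then have "\<lfloor>Q ^ n\<rfloor> \<ge> 0" by simp
      then have "real (card {0..\<lfloor>Q ^ n\<rfloor>}) = of_int \<lfloor>Q ^ n\<rfloor> + 1" by simp
      then show "real (card {0..\<lfloor>Q ^ n\<rfloor>}) \<le> 2 * Q ^ n" using \<open>Q ^ n \<ge> 1\<close> by linarith
    qed (use C2 K in auto)
    finally have "(K * Q) ^ n \<le> 4 * C2 * K ^ (n - 1) * Q ^ n" using cA by (simp add: ac_simps)
    also have "\<dots> < K * K ^ (n - 1) * Q ^ n" using K Q by (intro mult_strict_right_mono) (auto simp: K_def)
    also have "\<dots> = (K * Q) ^ n" using n by (cases n) (auto simp: power_mult_distrib)
    finally show False by simp
  qed
  show ?thesis
  proof (rule exI[of _ K], rule conjI[OF K], rule exI[of _ d'], rule conjI[OF d'0], intro ballI allI impI)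
    fix \<zeta> Q :: real assume "\<zeta> \<in> {1..2}" "1 \<le> Q" and good: "\<forall>R::int poly. R \<noteq> 0 \<longrightarrow> degree R \<le> n \<longrightarrow>
       \<bar>poly (of_int_poly R) \<zeta>\<bar> < \<delta> / Q ^ n \<longrightarrow> (\<exists>j\<in>{1..n}. of_int \<bar>coeff R j\<bar> \<ge> \<delta> * Q)"
    then show "\<exists>P::int poly. degree P \<le> n \<and> \<bar>poly (of_int_poly P) \<zeta>\<bar> \<le> 1 / Q ^ n \<and>
       (\<forall>i\<in>{1..n}. of_int \<bar>coeff P i\<bar> \<le> K * Q) \<and> poly (pderiv (of_int_poly P)) \<zeta> \<ge> d' * Q \<and>
       of_int \<bar>coeff P n\<bar> \<ge> d' * Q" by (intro main) (use good in simp_all)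
  qed
qed

section \<open>Zeros near good points and the dimension of the limsup set\<close>

lemma poly_diff_bound:
  fixes p :: "real poly"
  assumes "\<And>y. \<bar>y - a\<bar> \<le> r \<Longrightarrow> \<bar>poly (pderiv p) y\<bar> \<le> B" "\<bar>x - a\<bar> \<le> r"
  shows "\<bar>poly p x - poly p a\<bar> \<le> B * \<bar>x - a\<bar>"
proof -
  have "norm (poly p x - poly p a) \<le> B * norm (x - a)"
  proof (rule field_differentiable_bound[of "cball a r" "poly p" "poly (pderiv p)"])
    show "(poly p has_real_derivative poly (pderiv p) y) (at y within cball a r)" for y
      by (rule has_field_derivative_at_within[OF poly_DERIV])
  qed (use assms in \<open>auto simp: dist_real_def abs_minus_commute\<close>)
  then show ?thesis by simp
qed

text \<open>Within \<open>\<rho>\<close> of \<open>\<zeta>\<close> the derivative stays above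
  \<open>\<eta> * Q / 2\<close>, because the second derivative is \<open>O(Q)\<close> and
  \<open>\<rho>\<close> is small. As \<open>\<eta> * Q / 2 * \<rho> = 1 / Q ^ n\<close>, the
  polynomial changes sign within this distance. \<open>D * Q\<close> bounds the first and second
  derivatives for \<open>|x| \<le> 3\<close>.\<close>

lemma root_near_point:
  fixes P :: "int poly" and \<zeta> Q K \<eta> :: real
  assumes n: "n \<ge> 1" and dP: "degree P \<le> n" and z: "\<zeta> \<in> {1..2}" and Q: "Q \<ge> 1" and K: "K \<ge> 1" and \<eta>: "\<eta> > 0"
    and val: "\<bar>poly (of_int_poly P) \<zeta>\<bar> \<le> 1 / Q ^ n" and c: "\<And>i. i \<in> {1..n} \<Longrightarrow> of_int \<bar>coeff P i\<bar> \<le> K * Q"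
    and der: "poly (pderiv (of_int_poly P)) \<zeta> \<ge> \<eta> * Q"
    and D: "D = real (n + 1) * (real n ^ 2 * K) * 3 ^ n"
    and \<rho>: "\<rho> = 2 / (\<eta> * Q ^ (n + 1))" "\<rho> \<le> 1 / 2" "D * \<rho> \<le> \<eta> / 2"
  shows "\<exists>\<alpha>. \<bar>\<alpha> - \<zeta>\<bar> \<le> \<rho> \<and> (\<forall>x. \<bar>x - \<alpha>\<bar> \<le> 1 / 2 \<longrightarrow> \<bar>poly (of_int_poly P) x\<bar> \<le> D * Q * \<bar>x - \<alpha>\<bar>)"
proof -
  define p where "p = (of_int_poly P :: real poly)"
  have dp: "degree p \<le> n" using dP by (simp add: p_def)
  have KQ: "K * Q \<ge> 0" using K Q by simp
  have \<rho>0: "\<rho> > 0" using \<eta> Q by (simp add: \<rho>)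
  have cp: "\<bar>coeff (pderiv p) i\<bar> \<le> real n * K * Q" for i
  proof (cases "Suc i \<le> n")
    case True
    then show ?thesis using mult_mono[of "real (Suc i)" "real n" "of_int \<bar>coeff P (Suc i)\<bar>" "K * Q"] c[of "Suc i"] KQ
      by (simp add: coeff_pderiv p_def abs_mult mult.assoc)
  next
    case False
    then have "coeff p (Suc i) = 0" using dp by (intro coeff_eq_0) simp
    then show ?thesis using K Q by (simp add: coeff_pderiv)
  qed
  have cpp: "\<bar>coeff (pderiv (pderiv p)) i\<bar> \<le> real n ^ 2 * K * Q" for i
  proof (cases "Suc i \<le> n")
    case True
    have "\<bar>coeff (pderiv (pderiv p)) i\<bar> = real (Suc i) * \<bar>coeff (pderiv p) (Suc i)\<bar>"
      by (subst coeff_pderiv) (simp add: abs_mult)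
    also have "\<dots> \<le> real n * (real n * K * Q)" using True cp[of "Suc i"] by (intro mult_mono) auto
    finally show ?thesis by (simp add: power2_eq_square mult.assoc)
  next
    case False
    then have "coeff p (Suc (Suc i)) = 0" using dp by (intro coeff_eq_0) simp
    then show ?thesis using K Q by (simp add: coeff_pderiv)
  qed
  have d2: "\<bar>poly (pderiv (pderiv p)) x\<bar> \<le> D * Q" if "\<bar>x\<bar> \<le> 3" for x
    using poly_abs_bound[of "pderiv (pderiv p)" n "real n ^ 2 * K * Q" x 3] cpp that dp
    by (simp add: D degree_pderiv algebra_simps)
  have d1: "\<bar>poly (pderiv p) x\<bar> \<le> D * Q" if "\<bar>x\<bar> \<le> 3" for x
  proof -
    have "real n * K * Q \<le> real n ^ 2 * K * Q"
      using n K Q by (intro mult_right_mono) (auto simp: power2_eq_square)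
    then have "\<bar>coeff (pderiv p) i\<bar> \<le> real n ^ 2 * K * Q" for i using cp[of i] by linarith
    then show ?thesis using poly_abs_bound[of "pderiv p" n "real n ^ 2 * K * Q" x 3] that dp
      by (simp add: D degree_pderiv algebra_simps)
  qed
  have slope: "poly (pderiv p) x \<ge> \<eta> * Q / 2" if x: "\<bar>x - \<zeta>\<bar> \<le> \<rho>" for x
  proof -
    have "\<bar>poly (pderiv p) x - poly (pderiv p) \<zeta>\<bar> \<le> D * Q * \<bar>x - \<zeta>\<bar>"
    proof (rule poly_diff_bound[OF _ x])
      fix y assume "\<bar>y - \<zeta>\<bar> \<le> \<rho>"
      then show "\<bar>poly (pderiv (pderiv p)) y\<bar> \<le> D * Q" using z \<rho>(2) by (intro d2) (auto simp: abs_le_iff)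
    qed
    also have "\<dots> \<le> D * Q * \<rho>" using x D Q K by (intro mult_left_mono) auto
    also have "\<dots> \<le> \<eta> / 2 * Q" using mult_right_mono[OF \<rho>(3), of Q] Q by (simp add: ac_simps)
    finally have "\<bar>poly (pderiv p) x - poly (pderiv p) \<zeta>\<bar> \<le> \<eta> / 2 * Q" .
    then show ?thesis using der unfolding p_def[symmetric] abs_le_iff by argo
  qed
  have incr: "poly p y - poly p x \<ge> \<eta> * Q / 2 * (y - x)" if "x \<le> y" "\<bar>x - \<zeta>\<bar> \<le> \<rho>" "\<bar>y - \<zeta>\<bar> \<le> \<rho>" for x y
  proof (cases "x = y")
    case False
    then have "x < y" using that by simp
    from MVT2[OF this, of "poly p" "poly (pderiv p)"] obtain t where
      t: "x < t" "t < y" "poly p y - poly p x = (y - x) * poly (pderiv p) t" by (auto intro: poly_DERIV)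
    have "\<bar>t - \<zeta>\<bar> \<le> \<rho>" using t that by auto
    then show ?thesis using slope[of t] t \<open>x < y\<close> by (simp add: mult.commute mult_left_mono)
  qed simp
  have eq: "\<eta> * Q / 2 * \<rho> = 1 / Q ^ n" using \<eta> Q by (simp add: \<rho>(1))
  have "poly p (\<zeta> + \<rho>) \<ge> 0" "poly p (\<zeta> - \<rho>) \<le> 0"
    using incr[of \<zeta> "\<zeta> + \<rho>"] incr[of "\<zeta> - \<rho>" \<zeta>] eq val \<rho>0 by (auto simp: p_def)
  then have "\<exists>\<alpha>\<ge>\<zeta> - \<rho>. \<alpha> \<le> \<zeta> + \<rho> \<and> poly p \<alpha> = 0"
    using \<rho>0 by (intro IVT') (auto intro: continuous_intros)
  then obtain \<alpha> where "\<zeta> - \<rho> \<le> \<alpha>" "\<alpha> \<le> \<zeta> + \<rho>" "poly p \<alpha> = 0" by blast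
  then have \<alpha>: "\<bar>\<alpha> - \<zeta>\<bar> \<le> \<rho>" "poly p \<alpha> = 0" by (auto simp: abs_le_iff)
  have "\<bar>poly p x\<bar> \<le> D * Q * \<bar>x - \<alpha>\<bar>" if x: "\<bar>x - \<alpha>\<bar> \<le> 1 / 2" for x
  proof -
    have "\<bar>poly p x - poly p \<alpha>\<bar> \<le> D * Q * \<bar>x - \<alpha>\<bar>"
    proof (rule poly_diff_bound[OF _ x])
      fix y assume "\<bar>y - \<alpha>\<bar> \<le> 1 / 2"
      then have "\<bar>y\<bar> \<le> 3" using z[unfolded atLeastAtMost_iff] \<rho>(2) \<alpha>(1) by linarith
      then show "\<bar>poly (pderiv p) y\<bar> \<le> D * Q" by (rule d1)
    qed
    then show ?thesis by (simp add: \<alpha>(2))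
  qed
  then show ?thesis using \<alpha>(1) by (auto simp: p_def)
qed

text \<open>The parameter \<open>k\<close> forces \<open>Q\<close> to infinity when the intersection
  over all \<open>k\<close> is taken. The constant coefficient is left free, since it is determined
  by the others up to the value at \<open>\<zeta>\<close>.\<close>

definition poly_approx :: "nat \<Rightarrow> real \<Rightarrow> real \<Rightarrow> real \<Rightarrow> nat \<Rightarrow> real set" where
  "poly_approx n w K \<eta> k = {\<zeta>. \<exists>Q\<ge>real k. Q \<ge> 1 \<and> (\<exists>P::int poly. degree P \<le> n \<and>
     (\<forall>i\<in>{1..n}. of_int \<bar>coeff P i\<bar> \<le> K * Q) \<and> of_int \<bar>coeff P n\<bar> \<ge> \<eta> * Q \<and>
     \<bar>poly (of_int_poly P) \<zeta>\<bar> \<le> Q powr (- w))}"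

text \<open>Three quarters of the interval remain outside \<open>U\<close>, and each chosen point
  blocks a length \<open>2 * g0\<close>; hence the factor \<open>3 / 8\<close>.\<close>

lemma separated_intervals_of_measure:
  fixes a b g0 :: real
  assumes ab: "a < b" and U: "U \<in> sets lborel" "emeasure lborel U \<le> ennreal ((b - a) / 4)" and g0: "g0 > 0"
  shows "\<exists>T\<subseteq>{a..<b} - U. finite T \<and> real (card T) \<ge> 3 / 8 * (b - a) / g0 \<and> (\<forall>x\<in>T. \<forall>y\<in>T. x \<noteq> y \<longrightarrow> \<bar>x - y\<bar> \<ge> g0)"
proof -
  define m where "m = nat (\<lceil>3 / 8 * (b - a) / g0\<rceil> - 1)"
  have pos: "3 / 8 * (b - a) / g0 > 0" using ab g0 by simp
  then have ce: "\<lceil>3 / 8 * (b - a) / g0\<rceil> \<ge> 1" by simp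
  then have m: "real m = of_int \<lceil>3 / 8 * (b - a) / g0\<rceil> - 1" by (simp add: m_def of_nat_nat)
  then have m1: "real m < 3 / 8 * (b - a) / g0" "real (Suc m) \<ge> 3 / 8 * (b - a) / g0" by linarith+
  have "real m * g0 < 3 / 8 * (b - a)" using m1(1) unfolding pos_less_divide_eq[OF g0] .
  then have "2 * g0 * real m < 3 / 4 * (b - a)" by (simp add: mult.commute)
  then have "ennreal (2 * g0 * real m) < ennreal (3 / 4 * (b - a))" using ab by (intro ennreal_lessI) auto
  also have "\<dots> = ennreal (b - a) - ennreal ((b - a) / 4)" using ab by (subst ennreal_minus) auto
  also have "\<dots> \<le> ennreal (b - a) - emeasure lborel U" using U(2) by (rule ennreal_minus_mono[OF order_refl])
  also have "\<dots> \<le> emeasure lborel ({a..<b} - U)"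
  proof -
    have "emeasure lborel {a..<b} \<le> emeasure lborel (({a..<b} - U) \<union> U)" using U by (intro emeasure_mono) auto
    also have "\<dots> \<le> emeasure lborel ({a..<b} - U) + emeasure lborel U" using U by (intro emeasure_subadditive) auto
    finally have le: "ennreal (b - a) \<le> emeasure lborel ({a..<b} - U) + emeasure lborel U" using ab by simp
    have "emeasure lborel U < \<infinity>" using U(2) by (simp add: le_less_trans)
    then show ?thesis using le by (simp add: ennreal_minus_le_iff add.commute)
  qed
  finally have "\<exists>T\<subseteq>{a..<b} - U. finite T \<and> card T = Suc m \<and> (\<forall>x\<in>T. \<forall>y\<in>T. x \<noteq> y \<longrightarrow> \<bar>x - y\<bar> \<ge> g0)"
    using U g0 by (intro separated_points_of_measure) auto
  then show ?thesis using m1(2) by metis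
qed

text \<open>The zeros form a regular system in the sense of Baker and Schmidt: every interval
  contains, for large \<open>Q\<close>, at least a fixed multiple of
  \<open>(b - a) * Q^(n+1)\<close> of them, spaced by about \<open>Q^(-n-1)\<close>. The children
  are the intervals of length about \<open>Q^(-w-1)\<close> around these zeros.\<close>

lemma hausdorff_dim_poly_approx:
  fixes n :: nat
  assumes n: "n \<ge> 1"
  shows "\<exists>K\<ge>1. \<exists>\<eta>>0. \<forall>w A. w \<ge> real n \<longrightarrow> {1..2} \<inter> (\<Inter>k. poly_approx n w K \<eta> k) \<subseteq> A \<longrightarrow>
    hausdorff_dim A \<ge> ereal ((real n + 1) / (w + 1))"
proof -
  obtain \<delta>0 where \<delta>0: "\<delta>0 > 0" "\<And>a b::real. a < b \<Longrightarrow> (\<exists>Q0. \<forall>Q\<ge>Q0. \<exists>U\<in>sets lborel. emeasure lborel U \<le> ennreal ((b - a) / 4) \<and>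
    (\<forall>x\<in>{a..<b} - U. \<forall>R::int poly. R \<noteq> 0 \<longrightarrow> degree R \<le> n \<longrightarrow> \<bar>poly (of_int_poly R) x\<bar> < \<delta>0 / Q ^ n \<longrightarrow>
       (\<exists>j\<in>{1..n}. of_int \<bar>coeff R j\<bar> \<ge> \<delta>0 * Q)))" using nondivergence[OF n] by metis
  define \<delta> where "\<delta> = min \<delta>0 1"
  have \<delta>: "0 < \<delta>" "\<delta> \<le> 1" "\<delta> \<le> \<delta>0" using \<delta>0(1) by (auto simp: \<delta>_def)
  from polynomial_with_large_derivative[OF n \<delta>(1,2)]
  obtain K \<eta> where K: "K \<ge> 1" and \<eta>: "\<eta> > 0" and good: "\<forall>\<zeta>\<in>{1..2}. \<forall>Q\<ge>1.
    (\<forall>R::int poly. R \<noteq> 0 \<longrightarrow> degree R \<le> n \<longrightarrow> \<bar>poly (of_int_poly R) \<zeta>\<bar> < \<delta> / Q ^ n \<longrightarrow>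
       (\<exists>j\<in>{1..n}. of_int \<bar>coeff R j\<bar> \<ge> \<delta> * Q)) \<longrightarrow>
    (\<exists>P::int poly. degree P \<le> n \<and> \<bar>poly (of_int_poly P) \<zeta>\<bar> \<le> 1 / Q ^ n \<and>
       (\<forall>i\<in>{1..n}. of_int \<bar>coeff P i\<bar> \<le> K * Q) \<and> poly (pderiv (of_int_poly P)) \<zeta> \<ge> \<eta> * Q \<and>
       of_int \<bar>coeff P n\<bar> \<ge> \<eta> * Q)"
    by (elim exE conjE) (rule that)
  define D where "D = real (n + 1) * (real n ^ 2 * K) * 3 ^ n"
  have D: "D \<ge> 1"
  proof -
    have "real (n + 1) \<ge> 1" "real n ^ 2 * K \<ge> 1" "(3::real) ^ n \<ge> 1"
      using n K mult_mono[of 1 "real n ^ 2" 1 K] by auto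
    then show ?thesis unfolding D_def
      using mult_mono[of 1 "real (n + 1)" 1 "real n ^ 2 * K"] mult_mono[of 1 "real (n + 1) * (real n ^ 2 * K)" 1 "3 ^ n"] by auto
  qed
  have "hausdorff_dim A \<ge> ereal ((real n + 1) / (w + 1))"
    if w: "w \<ge> real n" and A: "{1..2} \<inter> (\<Inter>k. poly_approx n w K \<eta> k) \<subseteq> A" for w A
  proof (rule hausdorff_dim_ge_nested[where E = "\<lambda>s. poly_approx n w K \<eta>" and c = "3 / 32" and ?a0.0 = 1 and ?b0.0 = 2])
    show "0 < (real n + 1) / (w + 1)" "(real n + 1) / (w + 1) \<le> 1" using w by (auto simp: field_simps)
    fix s a b k assume s: "0 < s" "s < (real n + 1) / (w + 1)" and ab: "(1::real) \<le> a" "a < b" "b \<le> 2"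
    \<comment> \<open>Good points are taken from the middle half, so that the nearby zeros and their
      intervals remain inside \<open>{a..b}\<close>.\<close>
    define a' where "a' = a + (b - a) / 4"
    define b' where "b' = b - (b - a) / 4"
    have ab': "a' < b'" "b' - a' = (b - a) / 2" "a' - a = (b - a) / 4" "b - b' = (b - a) / 4"
      using ab by (auto simp: a'_def b'_def field_simps)
    obtain Q0 where Q0: "\<forall>Q\<ge>Q0. \<exists>U\<in>sets lborel. emeasure lborel U \<le> ennreal ((b' - a') / 4) \<and>
      (\<forall>x\<in>{a'..<b'} - U. \<forall>R::int poly. R \<noteq> 0 \<longrightarrow> degree R \<le> n \<longrightarrow> \<bar>poly (of_int_poly R) x\<bar> < \<delta>0 / Q ^ n \<longrightarrow>
       (\<exists>j\<in>{1..n}. of_int \<bar>coeff R j\<bar> \<ge> \<delta>0 * Q))" using \<delta>0(2)[OF ab'(1)] by (elim exE) (rule that)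
    define K2 where "K2 = 2 / \<eta>"
    have K2: "K2 > 0" using \<eta> by (simp add: K2_def)
    \<comment> \<open>The surplus exponent: the number of children times \<open>r powr s\<close>
      grows like \<open>Q powr tt\<close>, and \<open>s < (n + 1) / (w + 1)\<close> makes it
      positive.\<close>
    define tt where "tt = real n + 1 - (w + 1) * s"
    have tt: "tt > 0" using s w by (simp add: tt_def field_simps)
    have ev0: "\<forall>\<^sub>F Q in at_top. C / Q ^ (n + 1) < e" if "e > 0" for C e :: real
    proof -
      have "((\<lambda>Q::real. C / Q ^ (n + 1)) \<longlongrightarrow> 0) at_top"
        by (intro tendsto_divide_0[OF tendsto_const] filterlim_at_top_imp_at_infinity filterlim_pow_at_top filterlim_ident) auto
      then show ?thesis using that by (rule order_tendstoD)
    qed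
    have ev1: "\<forall>\<^sub>F Q in at_top. C \<le> Q powr tt" for C :: real by (rule powr_eventually_ge[OF tt])
    define C0 where "C0 = 8 * (b - a) powr s * (16 / 3 * (4 * K2 + 4) * D powr s / (b - a))"
    have "\<forall>\<^sub>F Q in at_top. Q \<ge> Q0 \<and> Q \<ge> 1 \<and> Q \<ge> real k \<and> K2 / Q ^ (n + 1) < 1 / 2 \<and> (D * K2) / Q ^ (n + 1) < \<eta> / 2 \<and>
      (K2 + 1) / Q ^ (n + 1) < (b - a) / 4 \<and> C0 \<le> Q powr tt"
      using ab \<eta> by (intro eventually_conj ev0 ev1 eventually_ge_at_top) auto
    from this[unfolded eventually_at_top_linorder] obtain Q where Q: "Q \<ge> Q0" "Q \<ge> 1" "Q \<ge> real k"
      "K2 / Q ^ (n + 1) < 1 / 2" "(D * K2) / Q ^ (n + 1) < \<eta> / 2"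
      "(K2 + 1) / Q ^ (n + 1) < (b - a) / 4" "C0 \<le> Q powr tt" by (meson order_refl)
    define q where "q = 1 / Q ^ (n + 1)"
    have q: "q > 0" "q \<le> 1" using Q(2) one_le_power[OF Q(2), of "n + 1"] unfolding q_def by (auto simp: divide_le_eq)
    \<comment> \<open>At distance at most \<open>r / 2\<close> from a zero the linear bound
      \<open>D * Q * \<bar>x - \<alpha>\<bar>\<close> stays below
      \<open>Q powr (- w)\<close>.\<close>
    define r where "r = Q powr (- (w + 1)) / D"
    have r0: "r > 0" using Q(2) D by (simp add: r_def)
    have rq: "r \<le> q"
    proof -
      have "r \<le> Q powr (- (w + 1)) / 1" unfolding r_def using D by (intro divide_left_mono) auto
      also have "\<dots> \<le> Q powr (- real (n + 1))" using Q(2) w by (simp add: powr_mono)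
      also have "Q powr (- real (n + 1)) = inverse (Q powr real (n + 1))" by (rule powr_minus)
      also have "Q powr real (n + 1) = Q ^ (n + 1)" using Q(2) by (intro powr_realpow) simp
      finally show ?thesis by (simp only: q_def inverse_eq_divide)
    qed
    \<comment> \<open>The spacing of the good points exceeds the wanted gap \<open>g\<close> by
      twice the distance \<open>K2 * q\<close> to a zero and by the length \<open>r \<le> q\<close>
      of a child. Moreover \<open>g0 \<le> 2 * g\<close>, which together with \<open>3 / 8\<close>
      of the middle half gives the constant \<open>3 / 32\<close>.\<close>
    define g0 where "g0 = (4 * K2 + 4) * q"
    define g where "g = (2 * K2 + 3) * q"
    have g0: "g0 > 0" and g: "g > 0" using K2 q by (auto simp: g0_def g_def)
    from Q0[rule_format, OF Q(1)]
    obtain U where U: "U \<in> sets lborel" "emeasure lborel U \<le> ennreal ((b' - a') / 4)"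
      and UR: "\<forall>x\<in>{a'..<b'} - U. \<forall>R::int poly. R \<noteq> 0 \<longrightarrow> degree R \<le> n \<longrightarrow> \<bar>poly (of_int_poly R) x\<bar> < \<delta>0 / Q ^ n \<longrightarrow>
       (\<exists>j\<in>{1..n}. of_int \<bar>coeff R j\<bar> \<ge> \<delta>0 * Q)" by (elim bexE conjE) (rule that)
    obtain T where T: "T \<subseteq> {a'..<b'} - U" "finite T" "real (card T) \<ge> 3 / 8 * (b' - a') / g0"
      "\<And>x y. x \<in> T \<Longrightarrow> y \<in> T \<Longrightarrow> x \<noteq> y \<Longrightarrow> \<bar>x - y\<bar> \<ge> g0"
      using separated_intervals_of_measure[OF ab'(1) U(1,2) g0] by blast
    have "\<exists>\<alpha>. \<bar>\<alpha> - \<zeta>\<bar> \<le> K2 * q \<and> {\<alpha> - r / 2..\<alpha> - r / 2 + r} \<subseteq> poly_approx n w K \<eta> k" if \<zeta>: "\<zeta> \<in> T" for \<zeta>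
    proof -
      have zT: "\<zeta> \<in> {a'..<b'} - U" using T(1) \<zeta> by blast
      then have z12: "\<zeta> \<in> {1..2}" using ab ab' by auto
      have "\<exists>P::int poly. degree P \<le> n \<and> \<bar>poly (of_int_poly P) \<zeta>\<bar> \<le> 1 / Q ^ n \<and>
       (\<forall>i\<in>{1..n}. of_int \<bar>coeff P i\<bar> \<le> K * Q) \<and> poly (pderiv (of_int_poly P)) \<zeta> \<ge> \<eta> * Q \<and>
       of_int \<bar>coeff P n\<bar> \<ge> \<eta> * Q"
      proof (rule good[rule_format, OF z12 Q(2)])
        fix R :: "int poly" assume R: "R \<noteq> 0" "degree R \<le> n" "\<bar>poly (of_int_poly R) \<zeta>\<bar> < \<delta> / Q ^ n"
        have "\<delta> / Q ^ n \<le> \<delta>0 / Q ^ n" using \<delta>(3) Q(2) by (intro divide_right_mono) auto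
        then obtain j where j: "j \<in> {1..n}" "of_int \<bar>coeff R j\<bar> \<ge> \<delta>0 * Q" using UR[rule_format, OF zT R(1,2) order_less_le_trans[OF R(3)]] by blast
        have "\<delta> * Q \<le> \<delta>0 * Q" using \<delta>(3) Q(2) by (intro mult_right_mono) auto
        then show "\<exists>j\<in>{1..n}. of_int \<bar>coeff R j\<bar> \<ge> \<delta> * Q" using j by (intro bexI[of _ j]) auto
      qed
      then obtain P :: "int poly" where P: "degree P \<le> n" "\<bar>poly (of_int_poly P) \<zeta>\<bar> \<le> 1 / Q ^ n"
       "\<And>i. i \<in> {1..n} \<Longrightarrow> of_int \<bar>coeff P i\<bar> \<le> K * Q" "poly (pderiv (of_int_poly P)) \<zeta> \<ge> \<eta> * Q"
       "of_int \<bar>coeff P n\<bar> \<ge> \<eta> * Q" by blast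
      have rho: "2 / (\<eta> * Q ^ (n + 1)) = K2 * q" by (simp add: K2_def q_def)
      have "\<exists>\<alpha>. \<bar>\<alpha> - \<zeta>\<bar> \<le> K2 * q \<and> (\<forall>x. \<bar>x - \<alpha>\<bar> \<le> 1 / 2 \<longrightarrow> \<bar>poly (of_int_poly P) x\<bar> \<le> D * Q * \<bar>x - \<alpha>\<bar>)"
        by (rule root_near_point[OF n P(1) z12 Q(2) K \<eta> P(2,3,4) D_def rho[symmetric]])
          (use Q(4,5) in \<open>auto simp: q_def\<close>)
      then obtain \<alpha> where \<alpha>: "\<bar>\<alpha> - \<zeta>\<bar> \<le> K2 * q" "\<And>x. \<bar>x - \<alpha>\<bar> \<le> 1 / 2 \<Longrightarrow> \<bar>poly (of_int_poly P) x\<bar> \<le> D * Q * \<bar>x - \<alpha>\<bar>" by blast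
      have "x \<in> poly_approx n w K \<eta> k" if x: "x \<in> {\<alpha> - r / 2..\<alpha> - r / 2 + r}" for x
      proof -
        have xa: "\<bar>x - \<alpha>\<bar> \<le> r / 2" using x[unfolded atLeastAtMost_iff] by linarith
        then have "\<bar>poly (of_int_poly P) x\<bar> \<le> D * Q * \<bar>x - \<alpha>\<bar>" using rq q by (intro \<alpha>(2)) linarith
        also have "\<dots> \<le> D * Q * r" using xa r0 D Q(2) by (intro mult_left_mono) auto
        also have "\<dots> = Q powr 1 * Q powr (- (w + 1))" using D Q(2) by (simp add: r_def)
        also have "\<dots> = Q powr (- w)" unfolding powr_add[symmetric] by simp
        finally show ?thesis unfolding poly_approx_def using Q(2,3) P(1,3,5) by blast
      qed
      then show ?thesis using \<alpha>(1) by blast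
    qed
    then obtain \<alpha> where \<alpha>: "\<And>\<zeta>. \<zeta> \<in> T \<Longrightarrow> \<bar>\<alpha> \<zeta> - \<zeta>\<bar> \<le> K2 * q"
      "\<And>\<zeta>. \<zeta> \<in> T \<Longrightarrow> {\<alpha> \<zeta> - r / 2..\<alpha> \<zeta> - r / 2 + r} \<subseteq> poly_approx n w K \<eta> k" by metis
    define Z where "Z = (\<lambda>\<zeta>. \<alpha> \<zeta> - r / 2) ` T"
    have sepT: "\<bar>(\<alpha> x - r / 2) - (\<alpha> y - r / 2)\<bar> \<ge> g + r" if "x \<in> T" "y \<in> T" "x \<noteq> y" for x y
    proof -
      have "g0 = g + 2 * (K2 * q) + q" by (simp add: g0_def g_def algebra_simps)
      then show ?thesis using T(4)[OF that] \<alpha>(1)[OF that(1)] \<alpha>(1)[OF that(2)] rq by linarith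
    qed
    have inj: "inj_on (\<lambda>\<zeta>. \<alpha> \<zeta> - r / 2) T"
    proof (rule inj_onI, rule ccontr)
      fix x y assume "x \<in> T" "y \<in> T" "\<alpha> x - r / 2 = \<alpha> y - r / 2" "x \<noteq> y"
      then show False using sepT[of x y] g r0 by simp
    qed
    then have cZ: "card Z = card T" by (simp add: Z_def card_image)
    have cT: "real (card T) \<ge> 3 / 16 * (b - a) / g0" using T(3) ab'(2) by simp
    show "\<exists>Z g r. finite Z \<and> g > 0 \<and> r > 0 \<and> r \<le> g \<and> r \<le> (b - a) / 2 \<and>
        (\<forall>z\<in>Z. \<forall>z'\<in>Z. z \<noteq> z' \<longrightarrow> \<bar>z - z'\<bar> \<ge> g + r) \<and>
        real (card Z) \<ge> 3 / 32 * (b - a) / g \<and> real (card Z) * r powr s \<ge> 8 * (b - a) powr s \<and>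
        (\<forall>z\<in>Z. {z..z+r} \<subseteq> {a..b} \<inter> poly_approx n w K \<eta> k)"
    proof (rule exI[of _ Z], rule exI[of _ g], rule exI[of _ r], intro conjI g r0)
      show "finite Z" using T(2) by (simp add: Z_def)
      have "q \<le> g" using q K2 by (simp add: g_def algebra_simps)
      then show "r \<le> g" using rq by linarith
      have Q6: "(K2 + 1) * q < (b - a) / 4" using Q(6) by (simp add: q_def)
      moreover have "(K2 + 1) * q = K2 * q + q" by (simp add: algebra_simps)
      moreover have "K2 * q > 0" using K2 q by simp
      ultimately have small: "K2 * q + q < (b - a) / 4" "q < (b - a) / 4" by linarith+
      have "(b - a) / 4 \<le> (b - a) / 2" using ab(2) by simp
      then show "r \<le> (b - a) / 2" by (rule order_trans[OF rq order_trans[OF less_imp_le[OF small(2)]]])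
      show "\<forall>z\<in>Z. \<forall>z'\<in>Z. z \<noteq> z' \<longrightarrow> g + r \<le> \<bar>z - z'\<bar>" unfolding Z_def using sepT by auto
      show "3 / 32 * (b - a) / g \<le> real (card Z)"
      proof -
        have "g0 \<le> 2 * g" using K2 q by (simp add: g0_def g_def)
        then have "3 / 16 * (b - a) / (2 * g) \<le> 3 / 16 * (b - a) / g0" using g0 g ab by (intro divide_left_mono) auto
        then show ?thesis using cT cZ by simp
      qed
      show "8 * (b - a) powr s \<le> real (card Z) * r powr s"
      proof -
        define X where "X = 16 / 3 * (4 * K2 + 4) * D powr s / (b - a)"
        have X: "X > 0" using K2 D ab by (simp add: X_def)
        have rs: "r powr s = Q powr (- (w + 1) * s) / D powr s"
          using Q(2) D by (simp add: r_def powr_divide powr_powr)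
        have "C0 = 8 * (b - a) powr s * X" by (simp only: C0_def X_def)
        then have "8 * (b - a) powr s = C0 / X" using X by simp
        also have "\<dots> \<le> Q powr tt / X" using Q(7) X by (intro divide_right_mono) auto
        also have "Q powr tt = Q powr (real (n + 1)) * Q powr (- (w + 1) * s)"
          unfolding powr_add[symmetric] by (simp add: tt_def algebra_simps)
        also have "Q powr (real (n + 1)) = Q ^ (n + 1)" using Q(2) by (intro powr_realpow) simp
        also have "Q ^ (n + 1) = 1 / q" by (simp add: q_def)
        also have "1 / q * Q powr (- (w + 1) * s) / X = 3 / 16 * (b - a) / g0 * r powr s"
        proof -
          have nz: "D powr s \<noteq> 0" "b - a \<noteq> 0" "4 * K2 + 4 \<noteq> 0" "q \<noteq> 0" using D ab K2 q by auto
          then show ?thesis unfolding rs X_def g0_def by (simp add: divide_simps)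
        qed
        also have "\<dots> \<le> real (card Z) * r powr s" using cT cZ by (intro mult_right_mono) auto
        finally show ?thesis .
      qed
      show "\<forall>z\<in>Z. {z..z + r} \<subseteq> {a..b} \<inter> poly_approx n w K \<eta> k"
      proof
        fix z assume "z \<in> Z"
        then obtain \<zeta> where \<zeta>: "\<zeta> \<in> T" "z = \<alpha> \<zeta> - r / 2" by (auto simp: Z_def)
        have "a' \<le> \<zeta>" "\<zeta> < b'" using T(1) \<zeta>(1) by auto
        then have "a \<le> z" "z + r \<le> b" using \<alpha>(1)[OF \<zeta>(1)] \<zeta>(2) small rq r0 ab'(3,4) by linarith+
        then have "{z..z + r} \<subseteq> {a..b}" by auto
        then show "{z..z + r} \<subseteq> {a..b} \<inter> poly_approx n w K \<eta> k" using \<alpha>(2)[OF \<zeta>(1)] \<zeta>(2) by blast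
      qed
    qed
  qed (use A in auto)
  then show ?thesis using K \<eta> by blast
qed

section \<open>Transference to simultaneous approximation\<close>

lemma lambda_exp_geI:
  assumes l: "l > 0" and "\<And>l'. 0 < l' \<Longrightarrow> l' < l \<Longrightarrow> l' \<in> approx_exponents N \<zeta>"
  shows "lambda_exp N \<zeta> \<ge> ereal l"
proof (rule ereal_le_epsilon2)
  fix e :: real assume e: "e > 0"
  define l' where "l' = max (l - e) (l / 2)"
  have "l' \<in> approx_exponents N \<zeta>" using l e by (intro assms(2)) (auto simp: l'_def)
  then have "ereal l' \<le> lambda_exp N \<zeta>" unfolding lambda_exp_def by (rule SUP_upper)
  then have "ereal l' + ereal e \<le> lambda_exp N \<zeta> + ereal e" by (rule add_right_mono)
  moreover have "l \<le> l' + e" by (auto simp: l'_def max_def)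
  then have "ereal l \<le> ereal l' + ereal e" by simp
  ultimately show "ereal l \<le> lambda_exp N \<zeta> + ereal e" by (rule order_trans[rotated])
qed

lemma approx_exponentsI:
  assumes N: "N \<ge> 1" and "\<And>X0. \<exists>X>X0. \<exists>(x::int) (y::nat \<Rightarrow> int). 1 \<le> \<bar>x\<bar> \<and> real_of_int \<bar>x\<bar> \<le> X \<and>
    (\<forall>i\<in>{1..N}. \<bar>\<zeta> ^ i * real_of_int x - real_of_int (y i)\<bar> \<le> X powr (- l))"
  shows "l \<in> approx_exponents N \<zeta>"
  unfolding approx_exponents_def
proof (intro CollectI allI)
  fix X0
  from assms(2)[of X0] obtain X and x :: int and y :: "nat \<Rightarrow> int" where X: "X > X0" "1 \<le> \<bar>x\<bar>" "real_of_int \<bar>x\<bar> \<le> X"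
    "\<And>i. i \<in> {1..N} \<Longrightarrow> \<bar>\<zeta> ^ i * real_of_int x - real_of_int (y i)\<bar> \<le> X powr (- l)" by blast
  have "(MAX i\<in>{1..N}. \<bar>\<zeta> ^ i * real_of_int x - real_of_int (y i)\<bar>) \<le> X powr (- l)"
    using N X(4) by (subst Max_le_iff) auto
  then show "\<exists>X>X0. \<exists>x y. 1 \<le> \<bar>x\<bar> \<and> real_of_int \<bar>x\<bar> \<le> X \<and>
     (MAX i\<in>{1..N}. \<bar>\<zeta> ^ i * real_of_int x - real_of_int (y i)\<bar>) \<le> X powr (- l)" using X by blast
qed

text \<open>A pigeonhole form of Khintchine's transference principle: an integer vector annihilated by
  \<open>P, X P, \<dots>, X^(N-n) P\<close> is found, whose first \<open>n - 1\<close> errors are smaller than \<open>\<mu>\<close>; the remaining errors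
  are controlled by the linear recurrence with characteristic polynomial \<open>P\<close>.\<close>

lemma transference_step:
  fixes P :: "int poly" and \<zeta> Q K \<eta> \<mu> X :: real
  assumes n: "1 \<le> n" "n \<le> N" and dP: "degree P \<le> n" and z: "\<zeta> \<in> {1..2}" and Q: "Q \<ge> 1"
    and K: "K \<ge> 1" and \<eta>: "\<eta> > 0" and \<mu>: "0 < \<mu>" "\<mu> \<le> 1" and X: "X \<ge> 1"
    and c: "\<And>i. i \<le> n \<Longrightarrow> of_int \<bar>coeff P i\<bar> \<le> K * Q" and lc: "of_int \<bar>coeff P n\<bar> \<ge> \<eta> * Q"
    and small: "\<bar>poly (of_int_poly P) \<zeta>\<bar> * X \<le> Q * \<mu>"
    and count: "X > (2 * (2 ^ N + real (n + 1) * K) * Q + 3) ^ (N - n + 1) * (1 / \<mu> + 3) ^ (n - 1)"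
  shows "\<exists>(x::int) (y::nat \<Rightarrow> int). 1 \<le> x \<and> real_of_int x \<le> X \<and>
    (\<forall>i\<in>{1..N}. \<bar>\<zeta> ^ i * real_of_int x - real_of_int (y i)\<bar> \<le> (1 + (real n * K + 2 ^ N) / \<eta>) ^ N * \<mu>)"
proof -
  define p0 where "p0 = poly (of_int_poly P) \<zeta>"
  have p0: "p0 = (\<Sum>k\<le>n. of_int (coeff P k) * \<zeta> ^ k)"
    unfolding p0_def using dP by (subst poly_altdef, simp, intro sum.mono_neutral_left) (auto simp: coeff_eq_0)
  define M where "M = \<lfloor>X\<rfloor>"
  have M: "M \<ge> 1" using X by (simp add: M_def)
  define v where "v x i = \<lfloor>\<zeta> ^ i * of_int x\<rfloor>" for x :: int and i :: nat
  define u where "u x i = of_int (v x i) - \<zeta> ^ i * of_int x" for x i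
  have u: "-1 < u x i" "u x i \<le> 0" for x i unfolding u_def v_def by linarith+
  have v0: "v x 0 = x" for x by (simp add: v_def)
  \<comment> \<open>The pairing of the shift \<open>X^j P\<close> with the vector of floors. The
    main term is bounded by \<open>small\<close>, the rounding errors by the coefficients, so only
    \<open>O(Q)\<close> integer values occur.\<close>
  define L where "L x j = (\<Sum>k\<le>n. coeff P k * v x (k + j))" for x j
  have zp: "\<zeta> ^ j \<le> 2 ^ N" if "j \<le> N" for j
  proof -
    have "\<zeta> ^ j \<le> 2 ^ j" using z by (intro power_mono) auto
    also have "\<dots> \<le> 2 ^ N" using that by (intro power_increasing) auto
    finally show ?thesis .
  qed
  have Lform: "of_int (\<Sum>k\<le>n. coeff P k * w (k + j)) = \<zeta> ^ j * p0 * of_int x + (\<Sum>k\<le>n. of_int (coeff P k) * (of_int (w (k + j)) - \<zeta> ^ (k + j) * of_int x))"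
    for w :: "nat \<Rightarrow> int" and x :: int and j
  proof -
    have "(\<Sum>k\<le>n. of_int (coeff P k) * (of_int (w (k + j)) - \<zeta> ^ (k + j) * of_int x))
      = of_int (\<Sum>k\<le>n. coeff P k * w (k + j)) - (\<Sum>k\<le>n. of_int (coeff P k) * \<zeta> ^ k) * \<zeta> ^ j * of_int x"
      by (simp add: algebra_simps sum_subtractf sum_distrib_left sum_distrib_right power_add)
    then show ?thesis unfolding p0 by (simp add: algebra_simps)
  qed
  define C where "C = (2 ^ N + real (n + 1) * K) * Q"
  have C: "C \<ge> 0" using K Q by (simp add: C_def)
  have Lb: "\<bar>of_int (L x j)\<bar> \<le> C" if x: "0 \<le> x" "x \<le> M" and j: "j \<le> N - n" for x j
  proof -
    have "\<bar>\<zeta> ^ j * p0 * of_int x\<bar> \<le> 2 ^ N * Q"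
    proof -
      have "\<bar>p0\<bar> * of_int x \<le> \<bar>p0\<bar> * X" using x by (intro mult_left_mono) (auto simp: M_def le_floor_iff)
      also have "\<dots> \<le> Q * \<mu>" using small by (simp add: p0_def)
      also have "\<dots> \<le> Q * 1" using \<mu> Q by (intro mult_left_mono) auto
      finally have "\<bar>p0\<bar> * of_int x \<le> Q" by simp
      then have "\<zeta> ^ j * (\<bar>p0\<bar> * of_int x) \<le> 2 ^ N * Q" using zp[of j] j x z by (intro mult_mono) auto
      then show ?thesis using z x by (simp add: abs_mult mult.assoc)
    qed
    moreover have "\<bar>\<Sum>k\<le>n. of_int (coeff P k) * u x (k + j)\<bar> \<le> (\<Sum>k\<le>n. K * Q)"
    proof (rule order_trans[OF sum_abs], rule sum_mono)
      fix k assume "k \<in> {..n}"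
      then have "\<bar>of_int (coeff P k)\<bar> * \<bar>u x (k + j)\<bar> \<le> (K * Q) * 1"
        using c[of k] u[of x "k + j"] K Q by (intro mult_mono) auto
      then show "\<bar>of_int (coeff P k) * u x (k + j)\<bar> \<le> K * Q" by (simp add: abs_mult)
    qed
    moreover have "of_int (L x j) = \<zeta> ^ j * p0 * of_int x + (\<Sum>k\<le>n. of_int (coeff P k) * u x (k + j))"
      unfolding L_def u_def by (rule Lform)
    moreover have "(\<Sum>k\<le>n. K * Q) = real (n + 1) * K * Q" by simp
    moreover have "C = 2 ^ N * Q + real (n + 1) * K * Q" by (simp add: C_def algebra_simps)
    ultimately show ?thesis by linarith
  qed
  \<comment> \<open>A collision of \<open>f\<close> makes the difference vector annihilated by all
    shifts and its errors of index below \<open>n\<close> at most \<open>\<mu>\<close>. Index 0 is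
    omitted, as its error vanishes. The hypothesis \<open>count\<close> says that there are more
    \<open>x\<close> than boxes.\<close>
  define f where "f x = ((\<lambda>j\<in>{..N - n}. L x j), (\<lambda>i\<in>{1..<n}. \<lfloor>u x i / \<mu>\<rfloor>))" for x
  define B where "B = ({..N - n} \<rightarrow>\<^sub>E {-\<lfloor>C\<rfloor>..\<lfloor>C\<rfloor>}) \<times> ({1..<n} \<rightarrow>\<^sub>E {\<lfloor>-1 / \<mu>\<rfloor>..0})"
  have finB: "finite B" unfolding B_def by (intro finite_cartesian_product finite_PiE) auto
  have fB: "f ` {0..M} \<subseteq> B"
  proof
    fix y assume "y \<in> f ` {0..M}"
    then obtain x where x: "0 \<le> x" "x \<le> M" "y = f x" by auto
    have "L x j \<in> {-\<lfloor>C\<rfloor>..\<lfloor>C\<rfloor>}" if "j \<le> N - n" for j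
    proof -
      have "of_int \<bar>L x j\<bar> \<le> C" using Lb[OF x(1,2) that] by simp
      then have "\<bar>L x j\<bar> \<le> \<lfloor>C\<rfloor>" by (simp add: le_floor_iff)
      then show ?thesis by auto
    qed
    moreover have "\<lfloor>u x i / \<mu>\<rfloor> \<in> {\<lfloor>-1 / \<mu>\<rfloor>..0}" for i
    proof -
      have "-1 / \<mu> \<le> u x i / \<mu>" using u[of x i] \<mu> by (intro divide_right_mono) auto
      moreover have "u x i / \<mu> \<le> 0" using u[of x i] \<mu> by (simp add: divide_le_0_iff)
      ultimately show ?thesis by (auto intro: floor_mono simp: floor_le_zero)
    qed
    ultimately show "y \<in> B" unfolding x(3) f_def B_def by auto
  qed
  have cardB: "real (card B) \<le> (2 * C + 3) ^ (N - n + 1) * (1 / \<mu> + 3) ^ (n - 1)"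
  proof -
    have "- 1 / \<mu> \<le> 0" using \<mu> by simp
    then have "\<lfloor>-1 / \<mu>\<rfloor> \<le> \<lfloor>0::real\<rfloor>" by (rule floor_mono)
    then have f0: "\<lfloor>C\<rfloor> \<ge> 0" "\<lfloor>-1 / \<mu>\<rfloor> \<le> 0" using C by auto
    have "real (card B) = real (nat (2 * \<lfloor>C\<rfloor> + 1)) ^ (N - n + 1) * real (nat (1 - \<lfloor>-1 / \<mu>\<rfloor>)) ^ (n - 1)"
      unfolding B_def by (simp add: card_cartesian_product card_PiE)
    also have "\<dots> \<le> (2 * C + 3) ^ (N - n + 1) * (1 / \<mu> + 3) ^ (n - 1)"
    proof (intro mult_mono power_mono)
      show "real (nat (2 * \<lfloor>C\<rfloor> + 1)) \<le> 2 * C + 3" using f0 by (simp add: of_nat_nat) linarith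
      show "real (nat (1 - \<lfloor>-1 / \<mu>\<rfloor>)) \<le> 1 / \<mu> + 3" using f0 by (simp add: of_nat_nat) linarith
    qed (use C \<mu> in auto)
    finally show ?thesis .
  qed
  have "\<not> inj_on f {0..M}"
  proof
    assume "inj_on f {0..M}"
    then have "card {0..M} \<le> card B" using fB finB by (rule card_inj_on_le)
    then have "real (card {0..M}) \<le> real (card B)" by (rule of_nat_mono)
    moreover have "real (card {0..M}) = of_int M + 1" using M by simp
    then have "real (card {0..M}) > X" unfolding M_def by linarith
    moreover have "X > (2 * C + 3) ^ (N - n + 1) * (1 / \<mu> + 3) ^ (n - 1)"
      using count by (simp only: C_def mult.assoc)
    ultimately show False using cardB by linarith
  qed
  then obtain x1 x2 where "x1 \<in> {0..M}" "x2 \<in> {0..M}" "f x1 = f x2" "x1 \<noteq> x2" by (auto simp: inj_on_def)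
  then obtain x1 x2 where x12: "0 \<le> x1" "x1 < x2" "x2 \<le> M" "f x1 = f x2"
    by (metis atLeastAtMost_iff linorder_neqE)
  define x where "x = x2 - x1"
  define y where "y i = v x2 i - v x1 i" for i
  define d where "d i = of_int (y i) - \<zeta> ^ i * of_int x" for i
  have du: "d i = u x2 i - u x1 i" for i by (simp add: d_def y_def x_def u_def algebra_simps)
  have d0: "d 0 = 0" by (simp add: d_def y_def x_def v0)
  have dsmall: "\<bar>d i\<bar> \<le> \<mu>" if "i < n" for i
  proof (cases "i = 0")
    case False
    have "snd (f x1) i = snd (f x2) i" using x12(4) by simp
    then have "\<lfloor>u x2 i / \<mu>\<rfloor> = \<lfloor>u x1 i / \<mu>\<rfloor>" using that False by (simp add: f_def)
    from same_cell_diff[OF this \<mu>(1)] show ?thesis by (simp add: du)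
  qed (use d0 \<mu> in simp)
  have ann: "(\<Sum>k\<le>n. coeff P k * y (k + j)) = 0" if "j \<le> N - n" for j
  proof -
    have "fst (f x1) j = fst (f x2) j" using x12(4) by simp
    then have "L x1 j = L x2 j" using that by (simp add: f_def)
    then show ?thesis by (simp add: L_def y_def algebra_simps sum_subtractf)
  qed
  have xX: "1 \<le> x" "of_int x \<le> X" using x12 by (auto simp: x_def M_def le_floor_iff)
  define D where "D = 1 + (real n * K + 2 ^ N) / \<eta>"
  have D1: "D \<ge> 1" using K \<eta> by (simp add: D_def)
  \<comment> \<open>Annihilation by a shift of \<open>P\<close> expresses the error of index
    \<open>i\<close> through the \<open>n\<close> preceding ones and \<open>P(\<zeta>) * x\<close>.
    The leading coefficient is at least \<open>\<eta> * Q\<close> in absolute value and all others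
    are at most \<open>K * Q\<close>, so dividing by it costs a factor independent of
    \<open>Q\<close>.\<close>
  have main: "\<bar>d i\<bar> \<le> D ^ i * \<mu>" if "i \<le> N" for i
    using that
  proof (induction i rule: less_induct)
    case (less i)
    show ?case
    proof (cases "i < n")
      case True
      have "1 * \<mu> \<le> D ^ i * \<mu>" using D1 \<mu> by (intro mult_right_mono) auto
      then show ?thesis using dsmall[OF True] by simp
    next
      case False
      define j where "j = i - n"
      have j: "j \<le> N - n" "n + j = i" using False less.prems by (auto simp: j_def)
      have "0 = \<zeta> ^ j * p0 * of_int x + (\<Sum>k\<le>n. of_int (coeff P k) * d (k + j))"
        using Lform[of y j x] ann[OF j(1)] unfolding d_def by simp
      also have "(\<Sum>k\<le>n. of_int (coeff P k) * d (k + j)) = (\<Sum>k<n. of_int (coeff P k) * d (k + j)) + of_int (coeff P n) * d i"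
        using j(2) by (simp add: lessThan_Suc_atMost[symmetric])
      finally have eq: "of_int (coeff P n) * d i = - (\<zeta> ^ j * p0 * of_int x) - (\<Sum>k<n. of_int (coeff P k) * d (k + j))" by simp
      have b1: "\<bar>\<zeta> ^ j * p0 * of_int x\<bar> \<le> 2 ^ N * (Q * \<mu>)"
      proof -
        have "\<bar>p0\<bar> * of_int x \<le> \<bar>p0\<bar> * X" using xX by (intro mult_left_mono) auto
        also have "\<dots> \<le> Q * \<mu>" using small by (simp add: p0_def)
        finally have px: "\<bar>p0\<bar> * of_int x \<le> Q * \<mu>" .
        have "j \<le> N" using j(1) by simp
        from mult_mono[OF zp[OF this] px] have "\<zeta> ^ j * (\<bar>p0\<bar> * of_int x) \<le> 2 ^ N * (Q * \<mu>)" using xX by simp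
        then show ?thesis using z xX by (simp add: abs_mult mult.assoc)
      qed
      have i1: "i \<ge> 1" using False n by simp
      have b2: "\<bar>\<Sum>k<n. of_int (coeff P k) * d (k + j)\<bar> \<le> (\<Sum>k<n. K * Q * (D ^ (i - 1) * \<mu>))"
      proof (rule order_trans[OF sum_abs], rule sum_mono)
        fix k assume k: "k \<in> {..<n}"
        have "\<bar>d (k + j)\<bar> \<le> D ^ (k + j) * \<mu>" using k j less.prems by (intro less.IH) auto
        also have "\<dots> \<le> D ^ (i - 1) * \<mu>" using k j D1 \<mu> by (intro mult_right_mono power_increasing) auto
        finally have "\<bar>of_int (coeff P k)\<bar> * \<bar>d (k + j)\<bar> \<le> (K * Q) * (D ^ (i - 1) * \<mu>)"
          using c[of k] k K Q by (intro mult_mono) auto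
        then show "\<bar>of_int (coeff P k) * d (k + j)\<bar> \<le> K * Q * (D ^ (i - 1) * \<mu>)" by (simp add: abs_mult)
      qed
      have D1i: "1 \<le> D ^ (i - 1)" using D1 by simp
      have "\<eta> * Q * \<bar>d i\<bar> \<le> \<bar>of_int (coeff P n)\<bar> * \<bar>d i\<bar>" using lc by (intro mult_right_mono) auto
      also have "\<dots> = \<bar>of_int (coeff P n) * d i\<bar>" by (simp add: abs_mult)
      also have "\<dots> \<le> 2 ^ N * (Q * \<mu>) + real n * (K * Q * (D ^ (i - 1) * \<mu>))" using b1 b2 unfolding eq by simp
      also have "\<dots> \<le> 2 ^ N * (Q * \<mu>) * D ^ (i - 1) + real n * (K * Q * (D ^ (i - 1) * \<mu>))"
      proof -
        have "2 ^ N * (Q * \<mu>) * 1 \<le> 2 ^ N * (Q * \<mu>) * D ^ (i - 1)" using D1i Q \<mu> by (intro mult_left_mono) auto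
        then show ?thesis by simp
      qed
      also have "\<dots> = Q * ((real n * K + 2 ^ N) * (D ^ (i - 1) * \<mu>))" by (simp add: algebra_simps)
      finally have "Q * (\<eta> * \<bar>d i\<bar>) \<le> Q * ((real n * K + 2 ^ N) * (D ^ (i - 1) * \<mu>))" by (simp add: ac_simps)
      then have "\<eta> * \<bar>d i\<bar> \<le> (real n * K + 2 ^ N) * (D ^ (i - 1) * \<mu>)" using Q by simp
      also have "\<dots> = \<eta> * ((D - 1) * (D ^ (i - 1) * \<mu>))" using \<eta> by (simp add: D_def)
      finally have "\<bar>d i\<bar> \<le> (D - 1) * (D ^ (i - 1) * \<mu>)" using \<eta> by simp
      also have "\<dots> \<le> D * (D ^ (i - 1) * \<mu>)" using D1 \<mu> by (intro mult_right_mono) auto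
      also have "\<dots> = D ^ i * \<mu>" using i1 by (cases i) auto
      finally show ?thesis .
    qed
  qed
  have "\<bar>\<zeta> ^ i * real_of_int x - real_of_int (y i)\<bar> \<le> D ^ N * \<mu>" if i: "i \<in> {1..N}" for i
  proof -
    have "\<bar>\<zeta> ^ i * real_of_int x - real_of_int (y i)\<bar> = \<bar>d i\<bar>" by (simp add: d_def abs_minus_commute)
    also have "\<dots> \<le> D ^ i * \<mu>" using i by (intro main) auto
    also have "\<dots> \<le> D ^ N * \<mu>" using D1 \<mu> i by (intro mult_right_mono power_increasing) auto
    finally show ?thesis .
  qed
  then show ?thesis using xX unfolding D_def by blast
qed

lemma lambda_exp_ge_of_poly_approx:
  assumes n: "1 \<le> n" "n \<le> N" and K: "K \<ge> 1" and \<eta>: "\<eta> > 0" and w: "w \<ge> real n" "w > real N - real n"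
    and z: "\<zeta> \<in> {1..2}" "\<And>k. \<zeta> \<in> poly_approx n w K \<eta> k"
  shows "lambda_exp N \<zeta> \<ge> ereal ((w + real n - real N) / ((real n - 1) * w + real N))"
proof (rule lambda_exp_geI)
  \<comment> \<open>With \<open>X = Q^\<theta>\<close> and \<open>\<mu> = Q^(-\<beta>)\<close> the
    two requirements of \<open>transference_step\<close> become
    \<open>\<theta> - w = 1 - \<beta>\<close> and
    \<open>\<theta> = (N - n + 1) + \<beta> (n - 1)\<close>. These values solve both equations, and
    \<open>\<beta> / \<theta>\<close> is the claimed exponent.\<close>
  define \<beta> where "\<beta> = (w + real n - real N) / real n"
  define \<theta> where "\<theta> = ((real n - 1) * w + real N) / real n"
  have n0: "real n \<ge> 1" using n by simp
  have \<beta>: "\<beta> > 0" using w n0 by (simp add: \<beta>_def)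
  have den: "(real n - 1) * w + real N > 0" using w n n0 by (intro add_nonneg_pos mult_nonneg_nonneg) auto
  have \<theta>: "\<theta> > 0" using den n0 by (simp add: \<theta>_def)
  have rel: "\<theta> - w - 1 = - \<beta>" "real (N - n + 1) + \<beta> * real (n - 1) = \<theta>"
  proof -
    have "real (N - n + 1) = real N - real n + 1" "real (n - 1) = real n - 1" using n by (auto simp: of_nat_diff)
    then show "\<theta> - w - 1 = - \<beta>" "real (N - n + 1) + \<beta> * real (n - 1) = \<theta>"
      using n0 by (auto simp: \<theta>_def \<beta>_def field_simps)
  qed
  have lb: "(w + real n - real N) / ((real n - 1) * w + real N) = \<beta> / \<theta>" using n0 by (simp add: \<beta>_def \<theta>_def)
  show "0 < (w + real n - real N) / ((real n - 1) * w + real N)" unfolding lb using \<beta> \<theta> by simp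
  fix l assume l: "0 < l" "l < (w + real n - real N) / ((real n - 1) * w + real N)"
  have l2: "l * \<theta> < \<beta>" using l(2) \<theta> unfolding lb by (simp add: field_simps)
  \<comment> \<open>The exponents are tilted to \<open>X = Q^(\<theta>+e)\<close> and
    \<open>\<mu> = Q^(-(\<beta>-e))\<close>, which keeps the first equation and wins a power of
    \<open>Q\<close> in the second, enough to absorb constants. The size of \<open>e\<close> still
    leaves a quotient above \<open>l\<close>, and \<open>e \<le> \<beta>\<close> keeps
    \<open>\<mu> \<le> 1\<close>.\<close>
  define e where "e = min \<beta> ((\<beta> - l * \<theta>) / (2 * (1 + l)))"
  have e: "e > 0" "e \<le> \<beta>" using \<beta> l2 l(1) by (auto simp: e_def)
  have tau: "\<beta> - e - l * (\<theta> + e) > 0"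
  proof -
    have "e \<le> (\<beta> - l * \<theta>) / (2 * (1 + l))" by (simp add: e_def)
    then have "e * (2 * (1 + l)) \<le> \<beta> - l * \<theta>" using l(1) by (simp add: pos_le_divide_eq)
    then have "2 * (e * (1 + l)) \<le> \<beta> - l * \<theta>" by (simp add: algebra_simps)
    moreover have "e * (1 + l) > 0" using e l by simp
    moreover have "\<beta> - e - l * (\<theta> + e) = (\<beta> - l * \<theta>) - e * (1 + l)" by (simp add: algebra_simps)
    ultimately show ?thesis by linarith
  qed
  \<comment> \<open>\<open>poly_approx\<close> leaves the constant coefficient unbounded; the small
    value at \<open>\<zeta>\<close> and the other coefficients bound it by
    \<open>K' * Q\<close>.\<close>
  define K' where "K' = 1 + real (n + 1) * K * 2 ^ n"
  have K': "K' \<ge> 1" "K \<le> K'"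
  proof -
    have "K \<le> real (n + 1) * K * 1" using K by simp
    also have "real (n + 1) * K * 1 \<le> real (n + 1) * K * 2 ^ n" using K by (intro mult_left_mono) auto
    finally show "K \<le> K'" by (simp add: K'_def)
  qed (use K in \<open>simp add: K'_def\<close>)
  define C1 where "C1 = (2 * (2 ^ N + real (n + 1) * K') + 3) ^ (N - n + 1) * 4 ^ (n - 1)"
  define C2 where "C2 = (1 + (real n * K' + 2 ^ N) / \<eta>) ^ N"
  show "l \<in> approx_exponents N \<zeta>"
  proof (rule approx_exponentsI)
    show "1 \<le> N" using n by simp
    fix X0 :: real
    have "\<forall>\<^sub>F Q in at_top. C1 + 1 \<le> Q powr e \<and> C2 \<le> Q powr (\<beta> - e - l * (\<theta> + e)) \<and> \<bar>X0\<bar> + 1 \<le> Q powr (\<theta> + e) \<and> (1::real) \<le> Q"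
      using e \<theta> tau by (intro eventually_conj powr_eventually_ge eventually_ge_at_top) auto
    then obtain Q1 where Q1: "\<And>Q. Q \<ge> Q1 \<Longrightarrow> C1 + 1 \<le> Q powr e \<and> C2 \<le> Q powr (\<beta> - e - l * (\<theta> + e)) \<and> \<bar>X0\<bar> + 1 \<le> Q powr (\<theta> + e) \<and> 1 \<le> Q"
      unfolding eventually_at_top_linorder by blast
    obtain k :: nat where k: "real k \<ge> Q1" using real_arch_simple by blast
    from z(2)[of k] obtain Q and P :: "int poly" where QP: "Q \<ge> real k" "degree P \<le> n"
      "\<And>i. i \<in> {1..n} \<Longrightarrow> of_int \<bar>coeff P i\<bar> \<le> K * Q" "of_int \<bar>coeff P n\<bar> \<ge> \<eta> * Q"
      "\<bar>poly (of_int_poly P) \<zeta>\<bar> \<le> Q powr (- w)" unfolding poly_approx_def by blast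
    have "Q \<ge> Q1" using k QP(1) by linarith
    from Q1[OF this] have Q: "C1 + 1 \<le> Q powr e" "C2 \<le> Q powr (\<beta> - e - l * (\<theta> + e))" "\<bar>X0\<bar> + 1 \<le> Q powr (\<theta> + e)" "1 \<le> Q" by auto
    define X where "X = Q powr (\<theta> + e)"
    define \<mu> where "\<mu> = Q powr (- (\<beta> - e))"
    have \<mu>: "0 < \<mu>" "\<mu> \<le> 1" using Q(4) e powr_mono[of "- (\<beta> - e)" 0 Q] by (auto simp: \<mu>_def)
    have X1: "X \<ge> 1" "X > X0" using Q(3) by (auto simp: X_def)
    have "\<exists>(x::int) (y::nat \<Rightarrow> int). 1 \<le> x \<and> real_of_int x \<le> X \<and>
      (\<forall>i\<in>{1..N}. \<bar>\<zeta> ^ i * real_of_int x - real_of_int (y i)\<bar> \<le> (1 + (real n * K' + 2 ^ N) / \<eta>) ^ N * \<mu>)"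
    proof (rule transference_step[OF n QP(2) z(1) Q(4) K'(1) \<eta> \<mu> X1(1) _ QP(4)])
      have KQ: "K * Q \<le> K' * Q" using K' Q(4) by (intro mult_right_mono) auto
      fix i assume i: "i \<le> n"
      show "of_int \<bar>coeff P i\<bar> \<le> K' * Q"
      proof (cases "i = 0")
        case False
        then show ?thesis using QP(3)[of i] i KQ by simp
      next
        case True
        have "poly (of_int_poly P) \<zeta> = (\<Sum>k\<le>n. of_int (coeff P k) * \<zeta> ^ k)"
          using QP(2) by (subst poly_altdef, simp, intro sum.mono_neutral_left) (auto simp: coeff_eq_0)
        also have "\<dots> = of_int (coeff P 0) + (\<Sum>k\<in>{1..n}. of_int (coeff P k) * \<zeta> ^ k)"
          by (simp add: atMost_atLeast0 sum.atLeast_Suc_atMost)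
        finally have "of_int (coeff P 0) = poly (of_int_poly P) \<zeta> - (\<Sum>k\<in>{1..n}. of_int (coeff P k) * \<zeta> ^ k)" by simp
        moreover have "\<bar>\<Sum>k\<in>{1..n}. of_int (coeff P k) * \<zeta> ^ k\<bar> \<le> (\<Sum>k\<in>{1..n}. K * Q * 2 ^ n)"
        proof (rule order_trans[OF sum_abs], rule sum_mono)
          fix k assume k: "k \<in> {1..n}"
          have "\<zeta> ^ k \<le> 2 ^ k" using z(1) by (intro power_mono) auto
          also have "\<dots> \<le> 2 ^ n" using k by (intro power_increasing) auto
          finally show "\<bar>of_int (coeff P k) * \<zeta> ^ k\<bar> \<le> K * Q * 2 ^ n"
            unfolding abs_mult using QP(3)[OF k] z(1) K Q(4) by (intro mult_mono) auto
        qed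
        moreover have "(\<Sum>k\<in>{1..n}. K * Q * 2 ^ n) \<le> real (n + 1) * K * 2 ^ n * Q"
          using K Q(4) by (simp add: algebra_simps)
        moreover have "Q powr (- w) \<le> 1" using Q(4) w(1) powr_mono[of "- w" 0 Q] by auto
        moreover have "K' * Q = Q + real (n + 1) * K * 2 ^ n * Q" by (simp add: K'_def algebra_simps)
        ultimately show ?thesis using QP(5) Q(4) True by simp
      qed
    next
      have "\<bar>poly (of_int_poly P) \<zeta>\<bar> * X \<le> Q powr (- w) * X" using QP(5) X1 by (intro mult_right_mono) auto
      also have "\<dots> = Q powr (- w + (\<theta> + e))" unfolding X_def powr_add ..
      also have "- w + (\<theta> + e) = 1 + - (\<beta> - e)" using rel(1) by linarith
      also have "Q powr (1 + - (\<beta> - e)) = Q powr 1 * \<mu>" unfolding \<mu>_def powr_add ..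
      also have "Q powr 1 = Q" using Q(4) by simp
      finally show "\<bar>poly (of_int_poly P) \<zeta>\<bar> * X \<le> Q * \<mu>" .
      have "1 / \<mu> = Q powr (\<beta> - e)" by (simp only: \<mu>_def powr_minus divide_inverse inverse_inverse_eq mult_1_left)
      also have "\<dots> \<le> Q powr \<beta>" using Q(4) e by (intro powr_mono) auto
      finally have "1 / \<mu> + 3 \<le> 4 * Q powr \<beta>" using powr_mono[of 0 \<beta> Q] \<beta> Q(4) by simp
      moreover have "2 * (2 ^ N + real (n + 1) * K') * Q + 3 \<le> (2 * (2 ^ N + real (n + 1) * K') + 3) * Q"
        using Q(4) by (simp add: algebra_simps)
      ultimately have "(2 * (2 ^ N + real (n + 1) * K') * Q + 3) ^ (N - n + 1) * (1 / \<mu> + 3) ^ (n - 1)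
        \<le> ((2 * (2 ^ N + real (n + 1) * K') + 3) * Q) ^ (N - n + 1) * (4 * Q powr \<beta>) ^ (n - 1)"
        using \<mu> K' Q(4) by (intro mult_mono power_mono) auto
      also have "\<dots> = C1 * (Q ^ (N - n + 1) * (Q powr \<beta>) ^ (n - 1))"
        by (simp add: C1_def power_mult_distrib mult.assoc mult.left_commute)
      also have "Q ^ (N - n + 1) = Q powr real (N - n + 1)" using Q(4) by (intro powr_realpow[symmetric]) simp
      also have "(Q powr \<beta>) ^ (n - 1) = Q powr (\<beta> * real (n - 1))"
        using Q(4) by (simp add: powr_realpow[symmetric] powr_powr)
      also have "Q powr real (N - n + 1) * Q powr (\<beta> * real (n - 1)) = Q powr \<theta>"
        unfolding powr_add[symmetric] rel(2) ..
      also have "C1 * Q powr \<theta> < Q powr e * Q powr \<theta>" using Q(1,4) by (intro mult_strict_right_mono) auto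
      also have "\<dots> = X" unfolding X_def powr_add[symmetric] by (simp add: add.commute)
      finally show "(2 * (2 ^ N + real (n + 1) * K') * Q + 3) ^ (N - n + 1) * (1 / \<mu> + 3) ^ (n - 1) < X" .
    qed
    then obtain x :: int and y :: "nat \<Rightarrow> int" where xy: "1 \<le> x" "real_of_int x \<le> X"
      "\<And>i. i \<in> {1..N} \<Longrightarrow> \<bar>\<zeta> ^ i * real_of_int x - real_of_int (y i)\<bar> \<le> C2 * \<mu>" unfolding C2_def by blast
    have "C2 * \<mu> \<le> Q powr (\<beta> - e - l * (\<theta> + e)) * \<mu>" using Q(2) \<mu> by (intro mult_right_mono) auto
    also have "\<dots> = X powr (- l)" unfolding \<mu>_def X_def powr_add[symmetric] powr_powr by (simp add: algebra_simps)
    finally have "C2 * \<mu> \<le> X powr (- l)" .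
    then have "\<forall>i\<in>{1..N}. \<bar>\<zeta> ^ i * real_of_int x - real_of_int (y i)\<bar> \<le> X powr (- l)" using xy(3) by (meson order_trans)
    then show "\<exists>X>X0. \<exists>(x::int) (y::nat \<Rightarrow> int). 1 \<le> \<bar>x\<bar> \<and> real_of_int \<bar>x\<bar> \<le> X \<and>
      (\<forall>i\<in>{1..N}. \<bar>\<zeta> ^ i * real_of_int x - real_of_int (y i)\<bar> \<le> X powr (- l))"
      using X1(2) xy(1,2) by (intro exI[of _ X] conjI exI[of _ x] exI[of _ y]) auto
  qed
qed

lemma h_dim_lower_bound:
  assumes N: "N \<ge> 2" and n: "n \<in> {1..N}" and l: "l \<ge> 1 / real N"
  shows "h_dim N l \<ge> ereal (lower_bd N n l)"
proof (cases "1 + l - real n * l > 0")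
  case False
  have "lower_bd N n l \<le> 0"
  proof -
    have "1 / real N > 0" using N by simp
    then have "l > 0" using l by linarith
    then show ?thesis unfolding lower_bd_def using False n
      by (intro divide_nonpos_pos mult_nonneg_nonpos mult_pos_pos) auto
  qed
  then have "ereal (lower_bd N n l) \<le> 0" by (simp add: zero_ereal_def)
  then show ?thesis unfolding h_dim_def using hausdorff_dim_nonneg by (rule order_trans)
next
  case True
  have N0: "real N \<ge> 2" and n0: "real n \<ge> 1" "real n \<le> real N" using N n by auto
  have "1 / real N > 0" using N by simp
  then have l0: "l > 0" using l by linarith
  \<comment> \<open>The solution of \<open>(w + n - N) / ((n - 1) w + N) = l\<close>, so that a
    value of order \<open>Q^(-w)\<close> transfers to the exponent \<open>l\<close>.\<close>
  define w where "w = (1 + l) * (real N + 1 - real n) / (1 + l - real n * l) - 1"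
  have w1: "(w + 1) * (1 + l - real n * l) = (1 + l) * (real N + 1 - real n)" using True by (simp add: w_def)
  have lN: "l * real N \<ge> 1" using l N0 by (simp add: field_simps)
  \<comment> \<open>This rests on \<open>l \<ge> 1 / N\<close>: the difference of the two sides
    increases with \<open>l\<close>, and \<open>N\<close> times its value at
    \<open>l = 1 / N\<close> is \<open>(N - n)^2 + (N - n)\<close>.\<close>
  have wn: "w \<ge> real n"
  proof -
    have "(real n + 1) * (1 + l - real n * l) \<le> (1 + l) * (real N + 1 - real n)"
    proof -
      have "(1 + l) * (real N + 1 - real n) - (real n + 1) * (1 + l - real n * l)
        = (real N - 2 * real n) + l * (real N - real n + real n ^ 2)"
        by (simp add: algebra_simps power2_eq_square)
      moreover have "real N * ((real N - 2 * real n) + l * (real N - real n + real n ^ 2)) \<ge> 0"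
      proof -
        have "real N - real n + real n ^ 2 \<ge> 0" using n0 by simp
        then have "1 * (real N - real n + real n ^ 2) \<le> (l * real N) * (real N - real n + real n ^ 2)"
          using lN by (intro mult_right_mono) auto
        moreover have "real N * (real N - 2 * real n) + (real N - real n + real n ^ 2) = (real N - real n) ^ 2 + (real N - real n)"
          by (simp add: algebra_simps power2_eq_square)
        moreover have "(real N - real n) ^ 2 + (real N - real n) \<ge> 0" using n0 by simp
        ultimately show ?thesis by (simp add: algebra_simps)
      qed
      ultimately show ?thesis using N0 by (simp add: zero_le_mult_iff)
    qed
    then have "(real n + 1) * (1 + l - real n * l) \<le> (w + 1) * (1 + l - real n * l)" using w1 by simp
    then show ?thesis using True by simp
  qed
  have expo: "(w + real n - real N) = l * ((real n - 1) * w + real N)"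
    using w1 by (simp add: algebra_simps)
  have den: "(real n - 1) * w + real N > 0" using wn n0 N0 by (intro add_nonneg_pos mult_nonneg_nonneg) auto
  have "l * ((real n - 1) * w + real N) > 0" using den l0 by simp
  then have wN: "w > real N - real n" using expo by linarith
  have ratio: "(w + real n - real N) / ((real n - 1) * w + real N) = l" using expo den by simp
  have n1: "1 \<le> n" "n \<le> N" using n by auto
  obtain K \<eta> where K: "K \<ge> 1" "\<eta> > 0" "\<And>w A. w \<ge> real n \<Longrightarrow> {1..2} \<inter> (\<Inter>k. poly_approx n w K \<eta> k) \<subseteq> A \<Longrightarrow>
    hausdorff_dim A \<ge> ereal ((real n + 1) / (w + 1))"
    using hausdorff_dim_poly_approx[OF n1(1)] by metis
  have "hausdorff_dim {\<zeta>. lambda_exp N \<zeta> \<ge> ereal l} \<ge> ereal ((real n + 1) / (w + 1))"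
  proof (rule K(3)[OF wn], rule subsetI, rule CollectI)
    fix \<zeta> assume "\<zeta> \<in> {1..2} \<inter> (\<Inter>k. poly_approx n w K \<eta> k)"
    then show "lambda_exp N \<zeta> \<ge> ereal l"
      using lambda_exp_ge_of_poly_approx[OF n1 K(1,2) wn wN, of \<zeta>] unfolding ratio by blast
  qed
  moreover have "(real n + 1) / (w + 1) = lower_bd N n l"
    using True l0 n0 by (simp add: w_def lower_bd_def add.commute)
  ultimately show ?thesis by (simp add: h_dim_def)
qed

section \<open>Annihilators of an approximation vector\<close>

lemma pigeonhole_small_value:
  fixes G :: "int poly set" and \<zeta> B w0 R :: real
  assumes fin: "finite G" and G: "\<And>f. f \<in> G \<Longrightarrow> degree f \<le> a \<and> (\<forall>i\<le>a. \<bar>real_of_int (coeff f i)\<bar> \<le> B)"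
    and z: "\<bar>\<zeta>\<bar> \<le> R" "R \<ge> 1" and w0: "w0 > 0" and B: "B \<ge> 0"
    and big: "real (card G) > 2 * (real (a + 1) * B * R ^ a) / w0 + 2"
  shows "\<exists>f\<in>G. \<exists>g\<in>G. f \<noteq> g \<and> \<bar>poly (of_int_poly (f - g)) \<zeta>\<bar> < w0"
proof -
  define V where "V = real (a + 1) * B * R ^ a"
  have V: "V \<ge> 0" using B z by (simp add: V_def)
  define q where "q f = \<lfloor>poly (of_int_poly f) \<zeta> / w0\<rfloor>" for f :: "int poly"
  have "q ` G \<subseteq> {\<lfloor>- V / w0\<rfloor>..\<lfloor>V / w0\<rfloor>}"
  proof
    fix y assume "y \<in> q ` G"
    then obtain f where f: "f \<in> G" "y = q f" by blast
    have "\<bar>poly (of_int_poly f) \<zeta>\<bar> \<le> V" unfolding V_def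
      using G[OF f(1)] z by (intro poly_abs_bound) auto
    then have "- V / w0 \<le> poly (of_int_poly f) \<zeta> / w0" "poly (of_int_poly f) \<zeta> / w0 \<le> V / w0"
      using w0 by (intro divide_right_mono; simp add: abs_le_iff)+
    then show "y \<in> {\<lfloor>- V / w0\<rfloor>..\<lfloor>V / w0\<rfloor>}" unfolding f(2) q_def by (simp add: floor_mono)
  qed
  have "\<not> inj_on q G"
  proof
    assume "inj_on q G"
    then have "card G \<le> card {\<lfloor>- V / w0\<rfloor>..\<lfloor>V / w0\<rfloor>}"
      using \<open>q ` G \<subseteq> _\<close> by (intro card_inj_on_le) auto
    then have "real (card G) \<le> real (card {\<lfloor>- V / w0\<rfloor>..\<lfloor>V / w0\<rfloor>})" by (rule of_nat_mono)
    also have "\<dots> \<le> 2 * V / w0 + 2" by (rule card_cells[OF w0 V])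
    finally show False using big by (simp add: V_def)
  qed
  then obtain f g where fg: "f \<in> G" "g \<in> G" "q f = q g" "f \<noteq> g" by (auto simp: inj_on_def)
  have "\<bar>poly (of_int_poly f) \<zeta> - poly (of_int_poly g) \<zeta>\<bar> < w0"
    using fg(3) w0 unfolding q_def by (rule same_cell_diff)
  then show ?thesis using fg by (intro bexI[of _ f] bexI[of _ g]) (auto simp: of_int_poly_hom.hom_minus)
qed

text \<open>The linear functional sending \<open>X^i\<close> to \<open>y i\<close>. Coefficients
  above index \<open>N\<close> are ignored, so it represents the polynomial faithfully only up to
  degree \<open>N\<close>.\<close>

definition seq_eval :: "nat \<Rightarrow> (nat \<Rightarrow> int) \<Rightarrow> int poly \<Rightarrow> int" where
  "seq_eval N y f = (\<Sum>i\<le>N. coeff f i * y i)"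

lemma seq_eval_add: "seq_eval N y (f + g) = seq_eval N y f + seq_eval N y g"
  by (simp add: seq_eval_def algebra_simps sum.distrib)

lemma seq_eval_smult: "seq_eval N y (Polynomial.smult c f) = c * seq_eval N y f"
  by (simp add: seq_eval_def sum_distrib_left mult.assoc)

lemma seq_eval_diff: "seq_eval N y (f - g) = seq_eval N y f - seq_eval N y g"
  by (simp add: seq_eval_def algebra_simps sum_subtractf)

lemma seq_eval_sum: "seq_eval N y (sum f A) = (\<Sum>a\<in>A. seq_eval N y (f a))"
  by (induction A rule: infinite_finite_induct) (auto simp: seq_eval_add, simp_all add: seq_eval_def)

lemma seq_eval_0 [simp]: "seq_eval N y 0 = 0" by (simp add: seq_eval_def)

text \<open>\<open>G\<close> is the characteristic polynomial of a linear recurrence satisfied by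
  the finite sequence \<open>y 0, \<dots>, y N\<close>, in other words an element of the kernel of a
  Hankel matrix.\<close>

definition annihilates :: "nat \<Rightarrow> (nat \<Rightarrow> int) \<Rightarrow> int poly \<Rightarrow> bool" where
  "annihilates N y G \<longleftrightarrow> G \<noteq> 0 \<and> degree G \<le> N \<and> (\<forall>j\<le>N - degree G. seq_eval N y (G * Polynomial.monom 1 j) = 0)"

lemma poly_times_as_sum: "(G::int poly) * f = (\<Sum>i\<le>degree f. Polynomial.smult (coeff f i) (G * Polynomial.monom 1 i))"
proof -
  have "f = (\<Sum>i\<le>degree f. Polynomial.monom (coeff f i) i)" by (simp add: poly_as_sum_of_monoms)
  also have "\<dots> = (\<Sum>i\<le>degree f. Polynomial.smult (coeff f i) (Polynomial.monom 1 i))" by (simp add: smult_monom)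
  finally show ?thesis by (metis (no_types, lifting) mult_smult_right sum.cong sum_distrib_left)
qed

lemma annihilates_mult:
  assumes G: "annihilates N y G" and f: "degree (G * f) \<le> N"
  shows "seq_eval N y (G * f) = 0"
proof (cases "f = 0")
  case False
  have G0: "G \<noteq> 0" using G by (simp add: annihilates_def)
  have "degree G + degree f \<le> N" using f G0 False by (simp add: degree_mult_eq)
  then have "seq_eval N y (G * Polynomial.monom 1 i) = 0" if "i \<le> degree f" for i
    using G that unfolding annihilates_def by simp
  then show ?thesis unfolding poly_times_as_sum[of G f] seq_eval_sum seq_eval_smult by simp
qed simp

text \<open>Modulo a minimal annihilator \<open>P\<close>, a polynomial killed against \<open>1, \<dots>, X^(m-1)\<close> is zero.\<close>

lemma minimal_annihilator_dvd:
  assumes P: "annihilates N y P" and deg: "degree P = m" "m \<ge> 1" "2 * m \<le> N + 1"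
    and min: "\<And>G. annihilates N y G \<Longrightarrow> m \<le> degree G" and prim: "content P = 1"
    and f: "degree f \<le> N - m + 1" "\<And>j. j < m \<Longrightarrow> seq_eval N y (f * Polynomial.monom 1 j) = 0"
  shows "P dvd f"
proof -
  have P0: "P \<noteq> 0" using P by (simp add: annihilates_def)
  obtain c q where cq: "c \<noteq> 0" "Polynomial.smult c f = P * q + pseudo_mod f P" using pseudo_mod(1)[OF P0, of f] by blast
  define r where "r = pseudo_mod f P"
  have r: "r = 0 \<or> degree r < m" using pseudo_mod(2)[OF P0, of f] deg by (simp add: r_def)
  have r_eq: "r = Polynomial.smult c f - P * q" using cq(2) by (simp add: r_def)
  have dr: "degree r \<le> N - m + 1" using r deg by auto
  have dPq: "degree (P * q) \<le> N - m + 1"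
  proof -
    have "P * q = Polynomial.smult c f - r" by (simp add: r_eq)
    then show ?thesis using f(1) dr by (metis degree_diff_le degree_smult_le order_trans)
  qed
  have small: "seq_eval N y (r * Polynomial.monom 1 j) = 0" if j: "j < m" for j
  proof -
    have "degree (P * q * Polynomial.monom 1 j) \<le> degree (P * q) + j"
      by (rule order_trans[OF degree_mult_le]) (simp add: degree_monom_eq)
    then have "degree (P * (q * Polynomial.monom 1 j)) \<le> N" using dPq j deg by (simp add: mult.assoc)
    then have "seq_eval N y (P * (q * Polynomial.monom 1 j)) = 0" by (rule annihilates_mult[OF P])
    then show ?thesis unfolding r_eq using f(2)[OF j]
      by (simp add: left_diff_distrib seq_eval_diff mult.assoc seq_eval_smult)
  qed
  have "r = 0"
  proof (rule ccontr)
    assume r0: "r \<noteq> 0"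
    have rm: "degree r < m" using r r0 by simp
    \<comment> \<open>From \<open>m\<close> vanishing evaluations the recurrence with characteristic
      polynomial \<open>P\<close> produces all further ones, its leading coefficient being nonzero.
      The remainder would then be an annihilator of degree below \<open>m\<close>.\<close>
    have "seq_eval N y (r * Polynomial.monom 1 j) = 0" if "j \<le> N - degree r" for j
      using that
    proof (induction j rule: less_induct)
      case (less j)
      show ?case
      proof (cases "j < m")
        case False
        then obtain k where k: "j = m + k" using le_Suc_ex by (metis not_less)
        have "degree (P * (Polynomial.monom 1 k * r)) \<le> N"
        proof -
          have "degree (P * (Polynomial.monom 1 k * r)) \<le> degree P + degree (Polynomial.monom 1 k * r)" by (rule degree_mult_le)
          also have "degree (Polynomial.monom 1 k * r) \<le> degree (Polynomial.monom (1::int) k) + degree r" by (rule degree_mult_le)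
          finally show ?thesis using less.prems deg(1) k rm by (simp add: degree_monom_eq)
        qed
        then have z: "seq_eval N y (P * (Polynomial.monom 1 k * r)) = 0" by (rule annihilates_mult[OF P])
        have "P * (Polynomial.monom 1 k * r) = (r * Polynomial.monom 1 k) * P" by (simp add: mult.commute mult.left_commute)
        also have "\<dots> = (\<Sum>i\<le>m. Polynomial.smult (coeff P i) ((r * Polynomial.monom 1 k) * Polynomial.monom 1 i))"
          unfolding deg(1)[symmetric] by (rule poly_times_as_sum)
        also have "\<dots> = (\<Sum>i\<le>m. Polynomial.smult (coeff P i) (r * Polynomial.monom 1 (i + k)))"
          by (simp add: mult.assoc mult_monom add.commute)
        finally have "(\<Sum>i\<le>m. coeff P i * seq_eval N y (r * Polynomial.monom 1 (i + k))) = 0"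
          using z by (simp add: seq_eval_sum seq_eval_smult)
        moreover have "(\<Sum>i\<le>m. coeff P i * seq_eval N y (r * Polynomial.monom 1 (i + k)))
          = (\<Sum>i<m. coeff P i * seq_eval N y (r * Polynomial.monom 1 (i + k))) + coeff P m * seq_eval N y (r * Polynomial.monom 1 j)"
          by (simp add: lessThan_Suc_atMost[symmetric] k)
        moreover have "(\<Sum>i<m. coeff P i * seq_eval N y (r * Polynomial.monom 1 (i + k))) = 0"
          using less.IH less.prems k by (intro sum.neutral) auto
        moreover have "coeff P m \<noteq> 0" using P0 deg(1) by auto
        ultimately show ?thesis by simp
      qed (use small in auto)
    qed
    then have "annihilates N y r" using r0 rm deg by (simp add: annihilates_def)
    then show False using min[of r] rm by simp
  qed
  then have eq: "Polynomial.smult c f = P * q" using r_eq by simp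
  \<comment> \<open>Pseudo-division introduced the factor \<open>c\<close>. By Gauss's lemma and
    primitivity of \<open>P\<close> it divides the quotient and can be cancelled.\<close>
  have "c dvd content (Polynomial.smult c f)" by (simp add: content_smult)
  also have "content (Polynomial.smult c f) = content q" unfolding eq by (simp add: content_mult prim)
  finally have "[:c:] dvd q" by (simp add: const_poly_dvd_iff_dvd_content)
  then obtain s where "q = [:c:] * s" by (elim dvdE)
  then have "Polynomial.smult c f = Polynomial.smult c (P * s)" using eq by simp
  then have "f = P * s" using cq(1) by (metis smult_cancel)
  then show ?thesis by simp
qed

text \<open>The evaluation is an integer. It equals \<open>y 0\<close> times the value of the
  shifted polynomial at \<open>\<zeta>\<close> minus a combination of the approximation errors; the
  first part is below \<open>1 / 2\<close> and the second at most \<open>1 / 2\<close>.\<close>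

lemma annihilates_of_small_value:
  fixes \<zeta> R Q l B :: real
  assumes z: "\<bar>\<zeta>\<bar> \<le> R" "R \<ge> 1" and Q: "Q > 0"
    and y: "real_of_int \<bar>y 0\<bar> = Q" "\<And>i. i \<le> N \<Longrightarrow> \<bar>\<zeta> ^ i * real_of_int (y 0) - real_of_int (y i)\<bar> \<le> Q powr (- l)"
    and f: "degree f + j \<le> N" "\<And>i. i \<le> N \<Longrightarrow> \<bar>real_of_int (coeff f i)\<bar> \<le> B"
      "\<bar>poly (of_int_poly f) \<zeta>\<bar> < 1 / (2 * R ^ N * Q)" and B: "real (N + 1) * B * Q powr (- l) \<le> 1 / 2"
  shows "seq_eval N y (f * Polynomial.monom 1 j) = 0"
proof -
  define h where "h = f * Polynomial.monom 1 j"
  have B0: "B \<ge> 0" using f(2)[of 0] by linarith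
  have ch: "\<bar>real_of_int (coeff h i)\<bar> \<le> B" if "i \<le> N" for i
    using f(2)[of "i - j"] B0 that by (auto simp: h_def mult.commute[of f] coeff_monom_mult)
  have dh: "degree h \<le> N"
    unfolding h_def by (rule order_trans[OF degree_mult_le]) (use f(1) in \<open>simp add: degree_monom_eq\<close>)
  have ph: "poly (of_int_poly h) \<zeta> = (\<Sum>i\<le>N. of_int (coeff h i) * \<zeta> ^ i)"
    using dh by (subst poly_altdef, simp, intro sum.mono_neutral_left) (auto simp: coeff_eq_0)
  have "real_of_int (seq_eval N y h) = of_int (y 0) * poly (of_int_poly h) \<zeta>
    - (\<Sum>i\<le>N. of_int (coeff h i) * (\<zeta> ^ i * real_of_int (y 0) - real_of_int (y i)))"
    unfolding ph seq_eval_def by (simp add: algebra_simps sum_subtractf sum_distrib_left)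
  moreover have "\<bar>\<Sum>i\<le>N. of_int (coeff h i) * (\<zeta> ^ i * real_of_int (y 0) - real_of_int (y i))\<bar> \<le> (\<Sum>i\<le>N. B * Q powr (- l))"
    by (rule order_trans[OF sum_abs], rule sum_mono, unfold abs_mult, rule mult_mono) (use ch y(2) B0 in auto)
  then have "\<bar>\<Sum>i\<le>N. of_int (coeff h i) * (\<zeta> ^ i * real_of_int (y 0) - real_of_int (y i))\<bar> \<le> 1 / 2"
    using B by (simp add: mult.assoc)
  moreover have "\<bar>of_int (y 0) * poly (of_int_poly h) \<zeta>\<bar> < 1 / 2"
  proof -
    have "poly (of_int_poly h) \<zeta> = poly (of_int_poly f) \<zeta> * \<zeta> ^ j"
      by (simp add: h_def of_int_poly_hom.hom_mult poly_monom of_int_hom.map_poly_hom_monom)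
    moreover have "\<bar>\<zeta>\<bar> ^ j \<le> R ^ N"
    proof -
      have "\<bar>\<zeta>\<bar> ^ j \<le> R ^ j" using z by (intro power_mono) auto
      also have "\<dots> \<le> R ^ N" using z f(1) by (intro power_increasing) auto
      finally show ?thesis .
    qed
    ultimately have "\<bar>of_int (y 0) * poly (of_int_poly h) \<zeta>\<bar> \<le> Q * (\<bar>poly (of_int_poly f) \<zeta>\<bar> * R ^ N)"
      using y(1) Q by (simp add: abs_mult power_abs mult_left_mono)
    also have "\<dots> < Q * (1 / (2 * R ^ N * Q) * R ^ N)"
      using Q z f(3) by (intro mult_strict_left_mono mult_strict_right_mono) auto
    also have "\<dots> = 1 / 2" using Q z by simp
    finally show ?thesis .
  qed
  ultimately have "\<bar>real_of_int (seq_eval N y h)\<bar> < 1" by linarith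
  then have "\<bar>seq_eval N y h\<bar> < 1" by linarith
  then show ?thesis by (simp add: h_def)
qed

lemma pcompose_coeff_bound: "\<exists>C\<ge>1. \<forall>c\<le>n. \<forall>(g::int poly) B. degree g \<le> N \<longrightarrow> (\<forall>j\<le>N. \<bar>real_of_int (coeff g j)\<bar> \<le> B) \<longrightarrow>
   (\<forall>i\<le>N. \<bar>real_of_int (coeff (pcompose g [:- int c, 1:]) i)\<bar> \<le> C * B)"
proof -
  define C where "C = 1 + (\<Sum>c\<le>n. \<Sum>j\<le>N. \<Sum>i\<le>N. \<bar>real_of_int (coeff ([:- int c, 1:] ^ j) i)\<bar>)"
  have "C \<ge> 1" by (simp add: C_def sum_nonneg)
  moreover have "\<bar>real_of_int (coeff (pcompose g [:- int c, 1:]) i)\<bar> \<le> C * B"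
    if c: "c \<le> n" and g: "degree g \<le> N" and B: "\<forall>j\<le>N. \<bar>real_of_int (coeff g j)\<bar> \<le> B" and i: "i \<le> N" for c i B and g :: "int poly"
  proof -
    have B0: "B \<ge> 0" using B[rule_format, of 0] by linarith
    have "pcompose g [:- int c, 1:] = (\<Sum>j\<le>degree g. Polynomial.smult (coeff g j) ([:- int c, 1:] ^ j))"
      by (simp add: pcompose_altdef poly_altdef)
    also have "\<dots> = (\<Sum>j\<le>N. Polynomial.smult (coeff g j) ([:- int c, 1:] ^ j))"
      using g by (intro sum.mono_neutral_left) (auto simp: coeff_eq_0)
    finally have "\<bar>real_of_int (coeff (pcompose g [:- int c, 1:]) i)\<bar> = \<bar>\<Sum>j\<le>N. real_of_int (coeff g j) * real_of_int (coeff ([:- int c, 1:] ^ j) i)\<bar>"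
      by (simp add: coeff_sum)
    also have "\<dots> \<le> (\<Sum>j\<le>N. B * \<bar>real_of_int (coeff ([:- int c, 1:] ^ j) i)\<bar>)"
      by (rule order_trans[OF sum_abs], rule sum_mono) (use B in \<open>simp add: abs_mult mult_right_mono\<close>)
    also have "\<dots> \<le> (\<Sum>j\<le>N. B * (\<Sum>i\<le>N. \<bar>real_of_int (coeff ([:- int c, 1:] ^ j) i)\<bar>))"
      using i B0 by (intro sum_mono mult_left_mono member_le_sum) auto
    also have "\<dots> = B * (\<Sum>j\<le>N. \<Sum>i\<le>N. \<bar>real_of_int (coeff ([:- int c, 1:] ^ j) i)\<bar>)" by (simp add: sum_distrib_left)
    also have "\<dots> \<le> B * (\<Sum>c\<le>n. \<Sum>j\<le>N. \<Sum>i\<le>N. \<bar>real_of_int (coeff ([:- int c, 1:] ^ j) i)\<bar>)"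
      using c B0 by (intro mult_left_mono member_le_sum[of c "{..n}" "\<lambda>c. \<Sum>j\<le>N. \<Sum>i\<le>N. \<bar>real_of_int (coeff ([:- int c, 1:] ^ j) i)\<bar>"]) (auto intro!: sum_nonneg)
    also have "\<dots> \<le> C * B" using B0 by (simp add: C_def algebra_simps)
    finally show ?thesis .
  qed
  ultimately show ?thesis by blast
qed

lemma pcompose_shift_cancel: "pcompose (pcompose (g::int poly) [:- c, 1:]) [:c, 1:] = g"
proof -
  have "pcompose [:- c, 1:] [:c, 1:] = [:0, 1:]" by (simp add: pcompose_pCons)
  moreover have "pcompose p [:0, 1:] = p" for p :: "int poly"
    by (induction p) (simp_all add: pcompose_pCons)
  ultimately have "pcompose g (pcompose [:- c, 1:] [:c, 1:]) = g" by (simp only:)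
  then show ?thesis unfolding pcompose_assoc .
qed

text \<open>The box of expansions around \<open>c\<close> whose lowest coefficients are reduced modulo \<open>P(c)\<close> injects
  into the residue classes modulo \<open>P\<close>; pigeonhole on it is what bounds \<open>P(c)\<close> in terms of \<open>Q\<close>.\<close>

lemma dvd_shift_box:
  fixes P g :: "int poly" and c :: int
  assumes dvd: "P dvd pcompose g [:- c, 1:]" and deg: "degree g \<le> a" "degree P = m" "m \<le> a"
    and P: "P \<noteq> 0" and small: "\<And>j. j \<le> a - m \<Longrightarrow> \<bar>coeff g j\<bar> < \<bar>poly P c\<bar>"
  shows "g = 0"
proof (rule ccontr)
  assume g0: "g \<noteq> 0"
  obtain S where S: "pcompose g [:- c, 1:] = P * S" using dvd by (elim dvdE)
  have geq: "g = pcompose P [:c, 1:] * pcompose S [:c, 1:]"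
    using pcompose_shift_cancel[of g c] unfolding S pcompose_mult by (rule sym)
  define p where "p = pcompose P [:c, 1:]"
  define s where "s = pcompose S [:c, 1:]"
  have s0: "s \<noteq> 0" and p0: "p \<noteq> 0" using g0 geq by (auto simp: p_def s_def)
  have dp: "degree p = m" by (simp add: p_def degree_pcompose deg)
  have gps: "g = p * s" unfolding p_def s_def by (rule geq)
  have "degree g = m + degree s" unfolding gps using degree_mult_eq[OF p0 s0] dp by simp
  then have ds: "degree s \<le> a - m" using deg by simp
  \<comment> \<open>At the lowest nonzero coefficient of the cofactor, the corresponding coefficient
    of \<open>g\<close> is a nonzero multiple of the constant term of the shifted \<open>P\<close>,
    which is \<open>P(c)\<close>.\<close>
  define i where "i = (LEAST i. coeff s i \<noteq> 0)"
  have ex: "\<exists>i. coeff s i \<noteq> 0" using s0 by (metis leading_coeff_0_iff)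
  have i1: "coeff s i \<noteq> 0" unfolding i_def using ex by (rule LeastI_ex)
  have i2: "coeff s k = 0" if "k < i" for k
    using not_less_Least[OF that[unfolded i_def]] by simp
  note i = i1 i2
  have "i \<le> a - m" using i(1) ds by (meson le_degree order_trans)
  have "coeff g i = (\<Sum>k\<le>i. coeff p k * coeff s (i - k))" unfolding gps by (rule coeff_mult)
  also have "\<dots> = (\<Sum>k\<in>{0}. coeff p k * coeff s (i - k))"
    using i(2) by (intro sum.mono_neutral_right) auto
  also have "\<dots> = poly P c * coeff s i"
    by (simp add: p_def poly_0_coeff_0[symmetric] poly_pcompose)
  finally have "\<bar>coeff g i\<bar> = \<bar>poly P c\<bar> * \<bar>coeff s i\<bar>" by (simp add: abs_mult)
  also have "\<dots> \<ge> \<bar>poly P c\<bar> * 1" using i(1) by (intro mult_left_mono) auto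
  finally show False using small[OF \<open>i \<le> a - m\<close>] by simp
qed

lemma card_coeff_box:
  fixes b :: "nat \<Rightarrow> int"
  assumes "\<And>j. b j \<ge> 0"
  shows "card {g::int poly. degree g \<le> a \<and> (\<forall>j\<le>a. 0 \<le> coeff g j \<and> coeff g j < b j)} = (\<Prod>j\<le>a. nat (b j))"
    and "finite {g::int poly. degree g \<le> a \<and> (\<forall>j\<le>a. 0 \<le> coeff g j \<and> coeff g j < b j)}"
proof -
  let ?G = "{g::int poly. degree g \<le> a \<and> (\<forall>j\<le>a. 0 \<le> coeff g j \<and> coeff g j < b j)}"
  let ?E = "\<Pi>\<^sub>E j\<in>{..a}. {0..<b j}"
  have bij: "bij_betw (\<lambda>g. restrict (coeff g) {..a}) ?G ?E"
  proof (rule bij_betwI[where g = "\<lambda>h. \<Sum>j\<le>a. Polynomial.monom (h j) j"])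
    show "(\<lambda>g. restrict (coeff g) {..a}) \<in> ?G \<rightarrow> ?E" by auto
    have cf: "coeff (\<Sum>j\<le>a. Polynomial.monom (h j) j) i = (if i \<le> a then h i else 0)" for h :: "nat \<Rightarrow> int" and i
      by (simp add: coeff_sum coeff_monom)
    show "(\<lambda>h. \<Sum>j\<le>a. Polynomial.monom (h j) j) \<in> ?E \<rightarrow> ?G"
      by (auto simp: cf PiE_iff intro!: degree_le)
    fix g assume "g \<in> ?G"
    then show "(\<Sum>j\<le>a. Polynomial.monom (restrict (coeff g) {..a} j) j) = g"
      by (intro poly_eqI) (auto simp: cf coeff_eq_0)
  next
    have cf: "coeff (\<Sum>j\<le>a. Polynomial.monom (h j) j) i = (if i \<le> a then h i else 0)" for h :: "nat \<Rightarrow> int" and i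
      by (simp add: coeff_sum coeff_monom)
    fix h assume "h \<in> ?E"
    then show "restrict (coeff (\<Sum>j\<le>a. Polynomial.monom (h j) j)) {..a} = h"
      by (auto simp: cf PiE_iff extensional_def)
  qed
  have finE: "finite ?E" by (intro finite_PiE) auto
  show "finite ?G" using bij finE by (simp add: bij_betw_finite)
  have "card ?G = card ?E" using bij by (rule bij_betw_same_card)
  also have "\<dots> = (\<Prod>j\<le>a. nat (b j))" by (simp add: card_PiE)
  finally show "card ?G = (\<Prod>j\<le>a. nat (b j))" .
qed

text \<open>The approximation tolerates coefficients up to a multiple of \<open>Q^l\<close>. One
  pigeonhole argument gives an annihilator of degree at most \<open>n\<close>. A second one, in a
  box around a point \<open>c\<close> where \<open>P\<close> is as large as its height, yields
  multiples of the minimal annihilator \<open>P\<close>; since the box contains no nonzero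
  difference divisible by \<open>P\<close>, it must be small, and this bounds the height by a
  multiple of \<open>Q^(1/N)\<close>. The value at \<open>\<zeta>\<close> is then small because
  \<open>P\<close> kills the vector \<open>y\<close> itself.\<close>

lemma annihilator_height:
  fixes n N :: nat and l R :: real
  assumes n: "n \<ge> 1" and N: "N \<ge> 2 * n + 1" and l: "l > 1 / real n" and R: "R \<ge> 1"
  shows "\<exists>C\<ge>1. \<exists>Q0. \<forall>\<zeta> Q. \<forall>y::nat \<Rightarrow> int. \<bar>\<zeta>\<bar> \<le> R \<longrightarrow> Q \<ge> Q0 \<longrightarrow> real_of_int \<bar>y 0\<bar> = Q \<longrightarrow>
     (\<forall>i\<le>N. \<bar>\<zeta> ^ i * real_of_int (y 0) - real_of_int (y i)\<bar> \<le> Q powr (- l)) \<longrightarrow>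
     (\<exists>P::int poly. \<exists>h. P \<noteq> 0 \<and> degree P \<le> n \<and> (\<forall>i. \<bar>real_of_int (coeff P i)\<bar> \<le> h) \<and> h \<le> C * Q powr (1 / real N) \<and>
        \<bar>poly (of_int_poly P) \<zeta>\<bar> \<le> C * h * Q powr (- 1 - l))"
proof -
  obtain Ca where Ca: "Ca \<ge> 1" and Cab: "\<And>c g B i. c \<le> n \<Longrightarrow> degree g \<le> N \<Longrightarrow> (\<forall>j\<le>N. \<bar>real_of_int (coeff g j)\<bar> \<le> B) \<Longrightarrow>
    i \<le> N \<Longrightarrow> \<bar>real_of_int (coeff (pcompose g [:- int c, 1:]) i)\<bar> \<le> Ca * B"
    using pcompose_coeff_bound[of n N] by metis
  have card_n: "card (real ` {..n}) = Suc n" by (simp add: card_image)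
  obtain Cb where Cb: "Cb > 0" and Cbb: "\<And>(p::real poly) B j. degree p < card (real ` {..n}) \<Longrightarrow> (\<forall>y\<in>real ` {..n}. \<bar>poly p y\<bar> \<le> B) \<Longrightarrow> \<bar>coeff p j\<bar> \<le> Cb * B"
    using coeff_bound_from_values[of "real ` {..n}"] by blast
  have RN: "R ^ N \<ge> 1" using R by simp
  \<comment> \<open>Chosen so that coefficients up to \<open>Ca * T\<close> with
    \<open>T \<le> c2 * Q^l\<close> cause a total error of at most \<open>1 / 4\<close>; differences
    of two such polynomials then stay within the \<open>1 / 2\<close> allowed by
    \<open>annihilates_of_small_value\<close>.\<close>
  define c2 where "c2 = 1 / (4 * real (N + 1) * Ca)"
  have c2: "c2 > 0" using Ca by (simp add: c2_def)
  define C1 where "C1 = 2 * (real (N + 1) * Ca * R ^ N) * (2 * R ^ N) + 2"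
  have C1: "C1 \<ge> 1" using Ca RN by (simp add: C1_def)
  have ln: "l * real n > 1" using l n by (simp add: field_simps)
  have "1 / real n > 0" using n by simp
  then have l0: "l > 0" using l by linarith
  have lN: "l \<ge> 2 / real N"
  proof -
    have "2 / real N \<le> 2 / (2 * real n)" using N n by (intro divide_left_mono) auto
    then show ?thesis using l by simp
  qed
  define C2 where "C2 = 1 + C1 * (2 / c2) ^ n"
  have C21: "C2 \<ge> 1" using C1 c2 by (simp add: C2_def)
  define C where "C = max (real (N + 1)) (max 1 Cb * C2)"
  have C: "C \<ge> 1" "C \<ge> real (N + 1)" "C \<ge> Cb * C2"
  proof -
    have "Cb * C2 \<le> max 1 Cb * C2" using C21 by (intro mult_right_mono) auto
    then show "C \<ge> Cb * C2" unfolding C_def by linarith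
  qed (auto simp: C_def)
  have "\<forall>\<^sub>F Q in at_top. (1::real) \<le> Q \<and> 2 / c2 \<le> Q powr l \<and> C1 * (2 / c2) ^ n + 1 \<le> Q powr (l * real n - 1)"
    using l0 ln by (intro eventually_conj powr_eventually_ge eventually_ge_at_top) auto
  then obtain Q0 where Q0: "\<And>Q. Q \<ge> Q0 \<Longrightarrow> (1::real) \<le> Q \<and> 2 / c2 \<le> Q powr l \<and> C1 * (2 / c2) ^ n + 1 \<le> Q powr (l * real n - 1)"
    unfolding eventually_at_top_linorder by blast
  have main: "\<exists>P::int poly. \<exists>h. P \<noteq> 0 \<and> degree P \<le> n \<and> (\<forall>i. \<bar>real_of_int (coeff P i)\<bar> \<le> h) \<and> h \<le> C * Q powr (1 / real N) \<and>
        \<bar>poly (of_int_poly P) \<zeta>\<bar> \<le> C * h * Q powr (- 1 - l)"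
    if z: "\<bar>\<zeta>\<bar> \<le> R" and QQ0: "Q \<ge> Q0" and y: "real_of_int \<bar>y 0\<bar> = Q" "\<forall>i\<le>N. \<bar>\<zeta> ^ i * real_of_int (y 0) - real_of_int (y i)\<bar> \<le> Q powr (- l)"
    for \<zeta> Q and y :: "nat \<Rightarrow> int"
  proof -
    have Q: "1 \<le> Q" "2 / c2 \<le> Q powr l" "C1 * (2 / c2) ^ n + 1 \<le> Q powr (l * real n - 1)" using Q0[OF QQ0] by auto
    define T where "T = \<lfloor>c2 * Q powr l\<rfloor>"
    have cQ: "c2 * Q powr l \<ge> 2" using Q(2) c2 by (simp add: field_simps)
    have T: "T \<ge> 1" "of_int T \<le> c2 * Q powr l" "of_int T \<ge> c2 * Q powr l / 2"
      using cQ unfolding T_def by (linarith | simp)+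
    have TB: "real (N + 1) * (Ca * of_int T) * Q powr (- l) \<le> 1 / 4"
    proof -
      have "real (N + 1) * (Ca * of_int T) * Q powr (- l) \<le> real (N + 1) * (Ca * (c2 * Q powr l)) * Q powr (- l)"
        using T(2) Ca by (intro mult_right_mono mult_left_mono) auto
      also have "\<dots> = real (N + 1) * Ca * c2 * (Q powr l * Q powr (- l))" by (simp add: algebra_simps)
      also have "Q powr l * Q powr (- l) = 1" using Q(1) by (simp add: powr_add[symmetric])
      also have "real (N + 1) * Ca * c2 * 1 = 1 / 4" using Ca by (simp add: c2_def)
      finally show ?thesis by simp
    qed
    have Tn: "real_of_int T ^ n > C1 * Q"
    proof -
      have "C1 * (2 / c2) ^ n < Q powr (l * real n - 1)" using Q(3) by linarith
      then have "C1 * (2 / c2) ^ n * (c2 / 2) ^ n < Q powr (l * real n - 1) * (c2 / 2) ^ n" using c2 by (intro mult_strict_right_mono) auto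
      moreover have "(2 / c2) ^ n * (c2 / 2) ^ n = 1" using c2 by (simp add: power_mult_distrib[symmetric])
      ultimately have "C1 < Q powr (l * real n - 1) * (c2 / 2) ^ n" by (simp add: mult.assoc)
      then have "C1 * Q < Q powr (l * real n - 1) * (c2 / 2) ^ n * Q" using Q(1) by (intro mult_strict_right_mono) auto
      also have "\<dots> = (Q powr (l * real n - 1) * Q powr 1) * (c2 / 2) ^ n" using Q(1) by simp
      also have "Q powr (l * real n - 1) * Q powr 1 = (Q powr l) ^ n"
      proof -
        have "(Q powr l) ^ n = (Q powr l) powr real n" using Q(1) by (intro powr_realpow[symmetric]) simp
        also have "\<dots> = Q powr (l * real n - 1 + 1)" by (simp add: powr_powr)
        also have "\<dots> = Q powr (l * real n - 1) * Q powr 1" by (rule powr_add)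
        finally show ?thesis by (rule sym)
      qed
      also have "(Q powr l) ^ n * (c2 / 2) ^ n = (c2 * Q powr l / 2) ^ n" by (simp add: power_mult_distrib[symmetric] mult.commute)
      also have "\<dots> \<le> real_of_int T ^ n" using T(3) c2 by (intro power_mono) auto
      finally show ?thesis .
    qed
    have yi: "\<And>i. i \<le> N \<Longrightarrow> \<bar>\<zeta> ^ i * real_of_int (y 0) - real_of_int (y i)\<bar> \<le> Q powr (- l)" using y(2) by blast
    define w0 where "w0 = 1 / (2 * R ^ N * Q)"
    have w0: "w0 > 0" using RN Q(1) by (simp add: w0_def)
    text \<open>Any box of more than \<open>C1 * T * Q\<close> polynomials contains two whose difference annihilates initial shifts of \<open>y\<close>.\<close>
    have collide: "\<exists>f\<in>G. \<exists>g\<in>G. f \<noteq> g \<and> degree (f - g) \<le> a \<and> (\<forall>j\<le>N - degree (f - g). seq_eval N y ((f - g) * Polynomial.monom 1 j) = 0)"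
      if fin: "finite G" and Gb: "\<And>f. f \<in> G \<Longrightarrow> degree f \<le> a \<and> (\<forall>i\<le>N. \<bar>real_of_int (coeff f i)\<bar> \<le> Ca * of_int T)"
        and aN: "a \<le> N" and big: "real (card G) > C1 * of_int T * Q" for G a
    proof -
      have B0: "Ca * of_int T \<ge> 0" using Ca T by simp
      have "2 * (real (a + 1) * (Ca * of_int T) * R ^ a) / w0 + 2 \<le> C1 * of_int T * Q"
      proof -
        have "R ^ a \<le> R ^ N" using R aN by (intro power_increasing) auto
        then have "real (a + 1) * (Ca * of_int T) * R ^ a \<le> real (N + 1) * (Ca * of_int T) * R ^ N"
          using aN B0 R Ca T(1) by (intro mult_mono) auto
        then have "2 * (real (a + 1) * (Ca * of_int T) * R ^ a) / w0 \<le> 2 * (real (N + 1) * (Ca * of_int T) * R ^ N) / w0"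
          using w0 by (intro divide_right_mono mult_left_mono) auto
        also have "\<dots> = 2 * (real (N + 1) * Ca * R ^ N) * (2 * R ^ N) * (of_int T * Q)"
          by (simp add: w0_def)
        finally have "2 * (real (a + 1) * (Ca * of_int T) * R ^ a) / w0 \<le> 2 * (real (N + 1) * Ca * R ^ N) * (2 * R ^ N) * (of_int T * Q)" .
        moreover have "of_int T * Q \<ge> 1 * 1" using T Q(1) by (intro mult_mono) auto
        moreover have "C1 * of_int T * Q = 2 * (real (N + 1) * Ca * R ^ N) * (2 * R ^ N) * (of_int T * Q) + 2 * (of_int T * Q)"
          by (simp add: C1_def algebra_simps)
        ultimately show ?thesis by linarith
      qed
      then have "\<exists>f\<in>G. \<exists>g\<in>G. f \<noteq> g \<and> \<bar>poly (of_int_poly (f - g)) \<zeta>\<bar> < w0"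
        using Gb aN by (intro pigeonhole_small_value[OF fin _ z R w0 B0, of a] order_le_less_trans[OF _ big]) auto
      then obtain f g where fg: "f \<in> G" "g \<in> G" "f \<noteq> g" "\<bar>poly (of_int_poly (f - g)) \<zeta>\<bar> < w0" by blast
      have dfg: "degree (f - g) \<le> a" using Gb fg by (intro degree_diff_le) auto
      have "seq_eval N y ((f - g) * Polynomial.monom 1 j) = 0" if j: "j \<le> N - degree (f - g)" for j
      proof (rule annihilates_of_small_value[OF z R _ y(1) yi])
        show "degree (f - g) + j \<le> N" using j dfg aN by simp
        show "\<bar>real_of_int (coeff (f - g) i)\<bar> \<le> 2 * (Ca * of_int T)" if "i \<le> N" for i
        proof -
          have "\<bar>real_of_int (coeff f i)\<bar> \<le> Ca * of_int T" "\<bar>real_of_int (coeff g i)\<bar> \<le> Ca * of_int T" using Gb fg that by auto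
          then show ?thesis by (simp only: coeff_diff of_int_diff)
        qed
        show "\<bar>poly (of_int_poly (f - g)) \<zeta>\<bar> < 1 / (2 * R ^ N * Q)" using fg(4) by (simp only: w0_def)
        show "real (N + 1) * (2 * (Ca * of_int T)) * Q powr (- l) \<le> 1 / 2" using TB by (simp add: algebra_simps)
      qed (use Q in auto)
      then show ?thesis using fg dfg by blast
    qed
    have "\<exists>G. annihilates N y G \<and> degree G \<le> n"
    proof -
      define G where "G = {g::int poly. degree g \<le> n \<and> (\<forall>j\<le>n. 0 \<le> coeff g j \<and> coeff g j < T + 1)}"
      have cG: "card G = (\<Prod>j\<le>n. nat (T + 1))" "finite G" unfolding G_def using T(1) by (intro card_coeff_box; simp)+
      have "real (card G) = of_int (T + 1) ^ (n + 1)" using T(1) by (simp add: cG(1))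
      \<comment> \<open>Here \<open>l > 1 / n\<close> enters: \<open>T^n\<close> is of order
        \<open>Q^(l n)\<close> and exceeds \<open>C1 * Q\<close>.\<close>
      also have "\<dots> > C1 * of_int T * Q"
      proof -
        have "C1 * of_int T * Q < of_int T ^ n * of_int T" using Tn T(1) mult_strict_right_mono[OF Tn, of "of_int T"] by (simp add: ac_simps)
        also have "\<dots> = of_int T ^ (n + 1)" by simp
        also have "\<dots> \<le> of_int (T + 1) ^ (n + 1)" using T(1) by (intro power_mono) auto
        finally show ?thesis .
      qed
      finally have big: "real (card G) > C1 * of_int T * Q" .
      have Gb: "degree f \<le> n \<and> (\<forall>i\<le>N. \<bar>real_of_int (coeff f i)\<bar> \<le> Ca * of_int T)" if "f \<in> G" for f
      proof (intro conjI allI impI)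
        show df: "degree f \<le> n" using that by (simp add: G_def)
        fix i assume "i \<le> N"
        have "0 \<le> coeff f i \<and> coeff f i \<le> T"
        proof (cases "i \<le> n")
          case True then show ?thesis using that by (auto simp: G_def)
        next
          case False then have "coeff f i = 0" using df by (intro coeff_eq_0) simp
          then show ?thesis using T by simp
        qed
        then have "\<bar>real_of_int (coeff f i)\<bar> \<le> 1 * of_int T" by simp
        also have "\<dots> \<le> Ca * of_int T" using Ca T by (intro mult_right_mono) auto
        finally show "\<bar>real_of_int (coeff f i)\<bar> \<le> Ca * of_int T" .
      qed
      have "n \<le> N" using N by simp
      from collide[OF cG(2) Gb this big] obtain f g where fg: "f \<noteq> g" "degree (f - g) \<le> n"
        "\<forall>j\<le>N - degree (f - g). seq_eval N y ((f - g) * Polynomial.monom 1 j) = 0" by blast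
      then show ?thesis using N by (intro exI[of _ "f - g"]) (auto simp: annihilates_def)
    qed
    then obtain G0 where G0: "annihilates N y G0" "degree G0 \<le> n" by blast
    obtain P0 where P0: "annihilates N y P0" "\<And>G. annihilates N y G \<Longrightarrow> degree P0 \<le> degree G"
      using ex_has_least_nat[of "annihilates N y" G0 degree] G0 by blast
    \<comment> \<open>Division by the content keeps the annihilation property and provides the
      primitivity needed for divisibility over the integers.\<close>
    define P where "P = primitive_part P0"
    define m where "m = degree P"
    have P00: "P0 \<noteq> 0" using P0 by (simp add: annihilates_def)
    have P0eq: "P0 = Polynomial.smult (content P0) P" by (simp add: P_def)
    have dP: "degree P0 = m" by (simp add: m_def P_def)
    have Pnz: "P \<noteq> 0" using P00 by (simp add: P_def)
    have prim: "content P = 1" using P00 by (simp add: P_def)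
    have annP: "annihilates N y P"
    proof -
      have "seq_eval N y (P * Polynomial.monom 1 j) = 0" if "j \<le> N - m" for j
      proof -
        have "seq_eval N y (P0 * Polynomial.monom 1 j) = 0" using P0(1) that dP by (simp add: annihilates_def)
        then have "content P0 * seq_eval N y (P * Polynomial.monom 1 j) = 0"
          by (subst (asm) P0eq) (simp add: seq_eval_smult)
        then show ?thesis using P00 by simp
      qed
      then show ?thesis using Pnz P0(1) dP by (simp add: annihilates_def m_def[symmetric])
    qed
    have mn: "m \<le> n" using P0(2)[OF G0(1)] G0(2) dP by simp
    have mmin: "m \<le> degree G" if "annihilates N y G" for G using P0(2)[OF that] dP by simp
    \<comment> \<open>A nonzero constant does not annihilate \<open>y\<close>, because
      \<open>y 0\<close> is nonzero.\<close>
    have m1: "m \<ge> 1"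
    proof (rule ccontr)
      assume "\<not> m \<ge> 1"
      then have "m = 0" by simp
      then obtain k where k: "P = [:k:]" using degree_eq_zeroE m_def by metis
      have "seq_eval N y (P * Polynomial.monom 1 0) = 0" using annP unfolding annihilates_def by (elim conjE allE[of _ 0]) simp
      moreover have "seq_eval N y (P * Polynomial.monom 1 0) = k * y 0"
        unfolding seq_eval_def k by (subst sum.mono_neutral_right[of _ "{0}"]) (auto simp: coeff_pCons split: nat.splits)
      moreover have "k \<noteq> 0" using Pnz k by auto
      moreover have "y 0 \<noteq> 0" using y(1) Q(1) by auto
      ultimately show False by simp
    qed
    define h where "h = Max ((\<lambda>i. \<bar>real_of_int (coeff P i)\<bar>) ` {..m})"
    have h: "\<bar>real_of_int (coeff P i)\<bar> \<le> h" for i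
    proof (cases "i \<le> m")
      case True then show ?thesis unfolding h_def by (intro Max_ge) auto
    next
      case False
      then have "coeff P i = 0" unfolding m_def by (intro coeff_eq_0) simp
      moreover have "\<bar>real_of_int (coeff P 0)\<bar> \<le> h" unfolding h_def by (intro Max_ge) auto
      ultimately show ?thesis by simp
    qed
    have hmem: "\<exists>i. h = \<bar>real_of_int (coeff P i)\<bar>"
    proof -
      have "h \<in> (\<lambda>i. \<bar>real_of_int (coeff P i)\<bar>) ` {..m}" unfolding h_def by (rule Max_in) auto
      then show ?thesis by blast
    qed
    \<comment> \<open>The values at \<open>0, \<dots>, n\<close> determine the coefficients, so one
      of them is at least \<open>h / Cb\<close> in absolute value. Bounding that value bounds the
      height.\<close>
    obtain c where c: "c \<le> n" "h \<le> Cb * real_of_int \<bar>poly P (int c)\<bar>"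
    proof -
      define B where "B = Max ((\<lambda>c. real_of_int \<bar>poly P (int c)\<bar>) ` {..n})"
      have "B \<in> (\<lambda>c. real_of_int \<bar>poly P (int c)\<bar>) ` {..n}" unfolding B_def by (rule Max_in) auto
      then obtain c where cB: "c \<le> n" "B = real_of_int \<bar>poly P (int c)\<bar>" by auto
      have "\<bar>poly (of_int_poly P) (real k)\<bar> \<le> B" if "k \<le> n" for k
      proof -
        have "poly (of_int_poly P) (real k) = real_of_int (poly P (int k))"
          using of_int_hom.poly_map_poly[of P "int k", where 'a = real] by simp
        moreover have "real_of_int \<bar>poly P (int k)\<bar> \<le> B" unfolding B_def using that by (intro Max_ge) auto
        ultimately show ?thesis by simp
      qed
      then have "\<bar>coeff (of_int_poly P :: real poly) i\<bar> \<le> Cb * B" for i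
        using mn by (intro Cbb) (auto simp: card_n m_def)
      then have "h \<le> Cb * B" using hmem by auto
      then show ?thesis using that[of c] cB by simp
    qed
    define b where "b = min \<bar>poly P (int c)\<bar> (T + 1)"
    \<comment> \<open>The degree \<open>a = N - m + 1\<close> is the largest for which all shifts by
      \<open>1, \<dots>, X^(m-1)\<close> stay within degree \<open>N\<close>, as
      \<open>minimal_annihilator_dvd\<close> requires. In the box the \<open>L = a - m + 1\<close>
      lowest coefficients are reduced below \<open>b\<close>, and the \<open>m\<close> highest range
      up to \<open>T\<close>; the minimum in \<open>b\<close> keeps all of them admissible.\<close>
    define L where "L = N - 2 * m + 2"
    define a where "a = N - m + 1"
    have aN: "a \<le> N" "m \<le> a" and aL: "a - m + 1 = L" and aLm: "a + 1 = L + m" using m1 mn N by (auto simp: a_def L_def)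
    have h0: "h > 0"
    proof -
      have "\<bar>real_of_int (coeff P m)\<bar> > 0" using Pnz by (simp add: m_def)
      then show ?thesis using h[of m] by linarith
    qed
    have Pc: "\<bar>poly P (int c)\<bar> \<ge> 1"
    proof -
      have "poly P (int c) \<noteq> 0" using c(2) h0 by auto
      then show ?thesis by linarith
    qed
    have b1: "b \<ge> 1" using Pc T(1) by (simp add: b_def)
    text \<open>No collision can occur inside the reduced box, so it is small.\<close>
    have box: "of_int b ^ L * of_int (T + 1) ^ m \<le> C1 * of_int T * Q"
    proof (rule ccontr)
      assume neg: "\<not> ?thesis"
      define bb where "bb j = (if j \<le> a - m then b else T + 1)" for j
      define H where "H = {g::int poly. degree g \<le> a \<and> (\<forall>j\<le>a. 0 \<le> coeff g j \<and> coeff g j < bb j)}"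
      have cH: "card H = (\<Prod>j\<le>a. nat (bb j))" "finite H" unfolding H_def using T(1) b1 by (intro card_coeff_box; simp add: bb_def)+
      have "(\<Prod>j\<le>a. nat (bb j)) = (\<Prod>j\<in>{..a - m}. nat (bb j)) * (\<Prod>j\<in>{a - m<..a}. nat (bb j))"
      proof -
        have "{..a} = {..a - m} \<union> {a - m<..a}" using aN by auto
        then show ?thesis by (simp add: prod.union_disjoint[symmetric] disjoint_iff)
      qed
      also have "(\<Prod>j\<in>{..a - m}. nat (bb j)) = nat b ^ L" by (simp add: bb_def aL[symmetric])
      also have "(\<Prod>j\<in>{a - m<..a}. nat (bb j)) = nat (T + 1) ^ m" using aN(2) by (simp add: bb_def)
      finally have cH': "real (card H) = of_int b ^ L * of_int (T + 1) ^ m" using b1 T(1) by (simp add: cH(1))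
      define sh where "sh g = pcompose g [:- int c, 1:]" for g :: "int poly"
      have inj: "inj sh"
      proof (rule injI)
        fix g1 g2 assume "sh g1 = sh g2"
        then have "pcompose (sh g1) [:int c, 1:] = pcompose (sh g2) [:int c, 1:]" by simp
        then show "g1 = g2" unfolding sh_def pcompose_shift_cancel .
      qed
      have "real (card (sh ` H)) = of_int b ^ L * of_int (T + 1) ^ m"
        using cH' by (simp add: card_image inj_on_subset[OF inj])
      then have big: "real (card (sh ` H)) > C1 * of_int T * Q" using neg by simp
      have Hb: "degree f \<le> a \<and> (\<forall>i\<le>N. \<bar>real_of_int (coeff f i)\<bar> \<le> Ca * of_int T)" if "f \<in> sh ` H" for f
      proof -
        obtain g where g: "g \<in> H" "f = sh g" using \<open>f \<in> sh ` H\<close> by blast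
        have dg: "degree g \<le> a" using g by (simp add: H_def)
        have "\<bar>real_of_int (coeff g j)\<bar> \<le> of_int T" for j
        proof (cases "j \<le> a")
          case True
          then have "0 \<le> coeff g j" "coeff g j < bb j" "bb j \<le> T + 1" using g by (auto simp: H_def bb_def b_def)
          then show ?thesis by simp
        next
          case False
          then have "coeff g j = 0" using dg by (intro coeff_eq_0) simp
          then show ?thesis using T by simp
        qed
        then show ?thesis using Cab[OF c(1), of g "of_int T"] dg aN by (simp add: g(2) sh_def degree_pcompose)
      qed
      from collide[OF finite_imageI[OF cH(2)] Hb aN(1) big] obtain g1 g2 where g12: "g1 \<in> H" "g2 \<in> H" "sh g1 \<noteq> sh g2"
        "degree (sh g1 - sh g2) \<le> a" "\<forall>j\<le>N - degree (sh g1 - sh g2). seq_eval N y ((sh g1 - sh g2) * Polynomial.monom 1 j) = 0" by blast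
      define g where "g = g1 - g2"
      have shg: "sh g1 - sh g2 = sh g" by (simp add: g_def sh_def pcompose_diff)
      have "P dvd sh g"
      proof (rule minimal_annihilator_dvd[OF annP m_def[symmetric] m1 _ mmin prim])
        show "2 * m \<le> N + 1" using mn N by simp
        show "degree (sh g) \<le> N - m + 1" using g12(4) by (simp add: shg a_def)
        fix j assume "j < m"
        then have "j \<le> N - degree (sh g)" using g12(4) m1 mn N unfolding shg a_def by linarith
        then show "seq_eval N y (sh g * Polynomial.monom 1 j) = 0" using g12(5) by (simp add: shg)
      qed
      moreover have "degree g \<le> a" unfolding g_def using g12(1,2) by (intro degree_diff_le) (auto simp: H_def)
      moreover have "\<bar>coeff g j\<bar> < \<bar>poly P (int c)\<bar>" if "j \<le> a - m" for j
      proof -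
        have "j \<le> a" using that by simp
        then have "0 \<le> coeff g1 j" "coeff g1 j < b" "0 \<le> coeff g2 j" "coeff g2 j < b" using g12(1,2) that by (auto simp: H_def bb_def)
        then have "\<bar>coeff g j\<bar> < b" by (simp add: g_def)
        then show ?thesis by (simp add: b_def)
      qed
      ultimately have "g = 0" unfolding sh_def by (intro dvd_shift_box[OF _ _ m_def[symmetric] aN(2) Pnz])
      then show False using g12(3) by (simp add: g_def)
    qed
    have T0: "real_of_int T \<ge> 1" using T(1) by simp
    have box': "of_int b ^ L * real_of_int T ^ (m - 1) \<le> C1 * Q"
    proof -
      have "of_int b ^ L * real_of_int T ^ m \<le> of_int b ^ L * of_int (T + 1) ^ m"
        using b1 T0 by (intro mult_left_mono power_mono) auto
      also have "\<dots> \<le> C1 * of_int T * Q" by (rule box)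
      finally have "of_int b ^ L * real_of_int T ^ (m - 1) * of_int T \<le> C1 * Q * of_int T"
        using m1 by (cases m) (auto simp: algebra_simps)
      then show ?thesis using T0 by simp
    qed
    \<comment> \<open>Otherwise the low coefficients would range up to \<open>T\<close> as well, and
      \<open>box'\<close> would contradict \<open>T^n > C1 * Q\<close>.\<close>
    have bP: "b = \<bar>poly P (int c)\<bar>"
    proof (rule ccontr)
      assume "b \<noteq> \<bar>poly P (int c)\<bar>"
      then have "b = T + 1" by (auto simp: b_def)
      have "real_of_int T ^ n \<le> real_of_int T ^ (L + (m - 1))"
        using T0 m1 mn N by (intro power_increasing) (auto simp: L_def)
      also have "\<dots> \<le> of_int b ^ L * real_of_int T ^ (m - 1)"
        unfolding power_add \<open>b = T + 1\<close> using T0 by (intro mult_right_mono power_mono) auto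
      also have "\<dots> \<le> C1 * Q" by (rule box')
      finally show False using Tn by simp
    qed
    have bL: "of_int b \<le> C2 * Q powr (1 / real N)"
    proof -
      define q where "q = Q powr (1 / real N)"
      have N0: "real N > 0" using N by simp
      have q: "q \<ge> 1" using Q(1) powr_mono[of 0 "1 / real N" Q] by (auto simp: q_def)
      have qN: "q ^ N = Q" using Q(1) N0 q by (simp add: q_def powr_realpow[symmetric] powr_powr)
      \<comment> \<open>Since \<open>l \<ge> 2 / N\<close>, each of the \<open>m - 1\<close> factors
        \<open>T\<close> in \<open>box'\<close> is worth \<open>q^2\<close> up to a constant. As
        \<open>L + 2 * (m - 1) = N\<close>, exactly \<open>q^L\<close> remains for
        \<open>b^L\<close>, whatever the degree \<open>m\<close>.\<close>
      have Tq: "real_of_int T \<ge> c2 / 2 * q ^ 2"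
      proof -
        have "q ^ 2 = Q powr (2 / real N)" using Q(1) by (simp add: q_def powr_realpow[symmetric] powr_powr)
        also have "\<dots> \<le> Q powr l" using Q(1) lN by (intro powr_mono) auto
        finally have "c2 * q ^ 2 \<le> c2 * Q powr l" using c2 by (intro mult_left_mono) auto
        then show ?thesis using T(3) by simp
      qed
      have "of_int b ^ L * (c2 / 2 * q ^ 2) ^ (m - 1) \<le> of_int b ^ L * real_of_int T ^ (m - 1)"
        using b1 Tq c2 q by (intro mult_left_mono power_mono) auto
      also have "\<dots> \<le> C1 * Q" by (rule box')
      also have "Q = q ^ L * (q ^ 2) ^ (m - 1)"
      proof -
        have "L + 2 * (m - 1) = N" using m1 mn N by (auto simp: L_def)
        then show ?thesis by (simp add: power_mult[symmetric] power_add[symmetric] qN)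
      qed
      finally have "of_int b ^ L * (c2 / 2 * q ^ 2) ^ (m - 1) \<le> C1 * (q ^ L * (q ^ 2) ^ (m - 1))" .
      then have "(of_int b ^ L * (c2 / 2) ^ (m - 1)) * (q ^ 2) ^ (m - 1) \<le> (C1 * q ^ L) * (q ^ 2) ^ (m - 1)"
        unfolding power_mult_distrib[of "c2 / 2" "q ^ 2"] by (simp only: ac_simps)
      then have "of_int b ^ L * (c2 / 2) ^ (m - 1) \<le> C1 * q ^ L" using q by simp
      then have "of_int b ^ L * (c2 / 2) ^ (m - 1) * (2 / c2) ^ (m - 1) \<le> C1 * q ^ L * (2 / c2) ^ (m - 1)"
        using c2 by (intro mult_right_mono) auto
      moreover have "(c2 / 2) ^ (m - 1) * (2 / c2) ^ (m - 1) = 1" using c2 by (simp add: power_mult_distrib[symmetric])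
      ultimately have "of_int b ^ L \<le> C1 * (2 / c2) ^ (m - 1) * q ^ L" by (simp add: mult.assoc mult.commute mult.left_commute)
      also have "\<dots> \<le> C2 * q ^ L"
      proof (intro mult_right_mono)
        have "1 * 1 \<le> real (N + 1) * Ca" using Ca by (intro mult_mono) auto
        moreover have "2 / c2 = 8 * (real (N + 1) * Ca)" by (simp add: c2_def)
        ultimately have "2 / c2 \<ge> 1" by linarith
        then have "(2 / c2) ^ (m - 1) \<le> (2 / c2) ^ n" using mn by (intro power_increasing) auto
        then have "C1 * (2 / c2) ^ (m - 1) \<le> C1 * (2 / c2) ^ n" using C1 by (intro mult_left_mono) auto
        then show "C1 * (2 / c2) ^ (m - 1) \<le> C2" by (simp add: C2_def)
      qed (use q in simp)
      also have "\<dots> \<le> C2 ^ L * q ^ L"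
        using C21 q by (intro mult_right_mono self_le_power) (auto simp: L_def)
      also have "\<dots> = (C2 * q) ^ L" by (simp add: power_mult_distrib)
      finally have "of_int b ^ L \<le> (C2 * q) ^ L" .
      moreover have "L > 0" "0 \<le> real_of_int b" "0 \<le> C2 * q" using b1 C21 q by (auto simp: L_def)
      ultimately show ?thesis unfolding q_def[symmetric] by (meson power_mono_iff)
    qed
    have "h \<le> Cb * real_of_int b" using c(2) bP by simp
    also have "\<dots> \<le> Cb * (C2 * Q powr (1 / real N))" using bL Cb by (intro mult_left_mono) auto
    also have "\<dots> \<le> C * Q powr (1 / real N)" using C(3) Q(1) by (simp add: mult.assoc[symmetric] mult_right_mono)
    finally have hC: "h \<le> C * Q powr (1 / real N)" .
    have "\<bar>poly (of_int_poly P) \<zeta>\<bar> \<le> C * h * Q powr (- 1 - l)"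
    proof -
      have dPN: "degree P \<le> N" using mn N by (simp add: m_def)
      have "seq_eval N y (P * Polynomial.monom 1 0) = 0" using annP unfolding annihilates_def by (elim conjE allE[of _ 0]) simp
      then have "(\<Sum>i\<le>N. coeff P i * y i) = 0" by (simp add: seq_eval_def)
      then have z0: "(\<Sum>i\<le>N. real_of_int (coeff P i) * real_of_int (y i)) = 0"
        by (simp flip: of_int_mult of_int_sum)
      have "poly (of_int_poly P) \<zeta> = (\<Sum>i\<le>N. of_int (coeff P i) * \<zeta> ^ i)"
        using dPN by (subst poly_altdef, simp, intro sum.mono_neutral_left) (auto simp: coeff_eq_0)
      then have "of_int (y 0) * poly (of_int_poly P) \<zeta> = (\<Sum>i\<le>N. of_int (coeff P i) * (\<zeta> ^ i * real_of_int (y 0) - real_of_int (y i)))"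
        using z0 by (simp add: right_diff_distrib sum_subtractf sum_distrib_left ac_simps)
      then have "\<bar>of_int (y 0) * poly (of_int_poly P) \<zeta>\<bar> \<le> (\<Sum>i\<le>N. \<bar>of_int (coeff P i) * (\<zeta> ^ i * real_of_int (y 0) - real_of_int (y i))\<bar>)" by simp
      also have "\<dots> \<le> (\<Sum>i\<le>N. h * Q powr (- l))"
        unfolding abs_mult using h yi h0 by (intro sum_mono mult_mono) auto
      also have "\<dots> = real (N + 1) * (h * Q powr (- l))" by simp
      also have "\<dots> \<le> C * (h * Q powr (- l))" using C(2) h0 by (intro mult_right_mono) auto
      finally have "Q * \<bar>poly (of_int_poly P) \<zeta>\<bar> \<le> C * (h * Q powr (- l))" using y(1) by (simp add: abs_mult)
      also have "Q powr (- l) = Q * Q powr (- 1 - l)"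
      proof -
        have "Q powr (- l) = Q powr (1 + (- 1 - l))" by simp
        also have "\<dots> = Q powr 1 * Q powr (- 1 - l)" by (rule powr_add)
        finally show ?thesis using Q(1) by simp
      qed
      finally have "Q * \<bar>poly (of_int_poly P) \<zeta>\<bar> \<le> Q * (C * h * Q powr (- 1 - l))" by (simp add: ac_simps)
      then show ?thesis using Q(1) by simp
    qed
    then show ?thesis using Pnz mn h hC unfolding m_def by (intro exI[of _ P] exI[of _ h] conjI allI)
  qed
  show ?thesis
    by (rule exI[of _ C], rule conjI[OF C(1)], rule exI[of _ Q0], intro allI impI, rule main)
qed

section \<open>Height, Mahler measure and irreducible factors\<close>

definition poly_height :: "int poly \<Rightarrow> int" where
  "poly_height P = Max ((\<lambda>i. \<bar>coeff P i\<bar>) ` {..degree P})"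

lemma coeff_le_poly_height: "\<bar>coeff P i\<bar> \<le> poly_height P"
proof (cases "i \<le> degree P")
  case True then show ?thesis unfolding poly_height_def by (intro Max_ge) auto
next
  case False
  then have "coeff P i = 0" by (intro coeff_eq_0) simp
  moreover have "\<bar>coeff P 0\<bar> \<le> poly_height P" unfolding poly_height_def by (intro Max_ge) auto
  ultimately show ?thesis by simp
qed

lemma poly_height_attained: "\<exists>i. poly_height P = \<bar>coeff P i\<bar>"
proof -
  have "poly_height P \<in> (\<lambda>i. \<bar>coeff P i\<bar>) ` {..degree P}" unfolding poly_height_def by (rule Max_in) auto
  then show ?thesis by blast
qed

lemma poly_height_ge_1: "P \<noteq> 0 \<Longrightarrow> poly_height P \<ge> 1"
proof -
  assume "P \<noteq> 0"
  then have "\<bar>coeff P (degree P)\<bar> \<ge> 1" by (simp add: leading_coeff_neq_0 Ints_nonzero_abs_ge1 int_one_le_iff_zero_less)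
  then show ?thesis using coeff_le_poly_height[of P "degree P"] by linarith
qed

lemma poly_height_box:
  fixes B :: int
  assumes "B \<ge> 0"
  shows "finite {P::int poly. degree P \<le> n \<and> poly_height P \<le> B}"
    and "card {P::int poly. degree P \<le> n \<and> poly_height P \<le> B} \<le> nat (2 * B + 1) ^ Suc n"
proof -
  let ?G = "{P::int poly. degree P \<le> n \<and> poly_height P \<le> B}"
  let ?E = "{..n} \<rightarrow>\<^sub>E {-B..B}"
  have finE: "finite ?E" by (intro finite_PiE) auto
  have inj: "inj_on (\<lambda>P. restrict (coeff P) {..n}) ?G"
  proof (rule inj_onI, rule poly_eqI)
    fix P P' :: "int poly" and i assume *: "P \<in> ?G" "P' \<in> ?G" "restrict (coeff P) {..n} = restrict (coeff P') {..n}"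
    show "coeff P i = coeff P' i"
    proof (cases "i \<le> n")
      case True then show ?thesis using fun_cong[OF *(3), of i] by simp
    next
      case False then show ?thesis using * by (simp add: coeff_eq_0)
    qed
  qed
  have sub: "(\<lambda>P. restrict (coeff P) {..n}) ` ?G \<subseteq> ?E"
  proof (rule image_subsetI)
    fix P assume "P \<in> ?G"
    then have "\<bar>coeff P i\<bar> \<le> B" for i using coeff_le_poly_height[of P i] by simp
    then have "coeff P i \<in> {-B..B}" for i by (simp add: abs_le_iff minus_le_iff)
    then show "restrict (coeff P) {..n} \<in> ?E" by auto
  qed
  show "finite ?G" using inj sub finE by (rule inj_on_finite)
  have "card ?G \<le> card ?E" using inj sub finE by (rule card_inj_on_le)
  also have "card ?E = nat (2 * B + 1) ^ Suc n" by (simp add: card_PiE)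
  finally show "card ?G \<le> nat (2 * B + 1) ^ Suc n" .
qed

lemma mahler_measure_mult: "mahler_measure (f * g) = mahler_measure f * mahler_measure g"
  unfolding mahler_measure_def by (simp add: of_int_poly_hom.hom_mult measure_eq_prod)

lemma of_int_poly_pCons: "of_int_poly (pCons c p) = (pCons (of_int c) (of_int_poly p) :: 'a::ring_1 poly)"
  by (intro poly_eqI) (auto simp: coeff_pCons split: nat.splits)

text \<open>Landau's inequality, with the Euclidean norm of the coefficients estimated by the
  height.\<close>

lemma mahler_measure_le_height:
  assumes dP: "degree P \<le> n" and h: "\<And>i. \<bar>real_of_int (coeff P i)\<bar> \<le> h"
  shows "mahler_measure P \<le> real (n + 1) * h"
proof -
  have h0: "h \<ge> 0" using h[of 0] by linarith
  have "real_of_int (\<Sum>a\<leftarrow>xs. a * a) \<le> real (length xs) * h\<^sup>2" if "set xs \<subseteq> range (coeff P)" for xs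
    using that
  proof (induction xs)
    case (Cons a xs)
    then obtain i where "a = coeff P i" by auto
    then have "real_of_int (a * a) \<le> h\<^sup>2" using h[of i] by (metis abs_le_square_iff abs_of_nonneg h0 of_int_mult power2_eq_square)
    then show ?case using Cons by (simp add: algebra_simps)
  qed simp
  then have "real_of_int (\<Sum>a\<leftarrow>coeffs P. a * a) \<le> real (length (coeffs P)) * h\<^sup>2"
    using range_coeff[of P] by blast
  also have "\<dots> \<le> real (n + 1) * h\<^sup>2"
    using dP by (intro mult_right_mono) (auto simp: length_coeffs coeffs_def)
  also have "\<dots> \<le> (real (n + 1))\<^sup>2 * h\<^sup>2"
    by (intro mult_right_mono) (auto simp: power2_eq_square)
  also have "\<dots> = (real (n + 1) * h)\<^sup>2" by (simp only: power_mult_distrib)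
  finally have "sqrt (real_of_int (\<Sum>a\<leftarrow>coeffs P. a * a)) \<le> sqrt ((real (n + 1) * h)\<^sup>2)" by (rule real_sqrt_le_mono)
  also have "\<dots> = real (n + 1) * h" using h0 by (simp only: real_sqrt_abs) simp
  finally show ?thesis using Landau_inequality_mahler_measure[of P] by linarith
qed

lemma height_le_mahler_measure:
  assumes "degree P \<le> n"
  shows "real_of_int (poly_height P) \<le> 2 ^ n * mahler_measure P"
proof -
  obtain i where i: "poly_height P = \<bar>coeff P i\<bar>" using poly_height_attained by blast
  have "real_of_int \<bar>coeff P i\<bar> \<le> real (degree P choose i) * mahler_measure P" by (rule Mignotte_bound)
  also have "\<dots> \<le> 2 ^ n * mahler_measure P"
  proof (rule mult_right_mono[OF _ mahler_measure_ge_0])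
    have "degree P choose i \<le> 2 ^ degree P" by (rule binomial_le_pow2)
    also have "\<dots> \<le> 2 ^ n" using assms by (intro power_increasing) auto
    finally have "real (degree P choose i) \<le> real (2 ^ n)" by (rule of_nat_mono)
    then show "real (degree P choose i) \<le> 2 ^ n" by simp
  qed
  finally show ?thesis by (simp add: i)
qed

text \<open>Multiplicativity of the Mahler measure lets a lower bound for irreducible polynomials propagate to products.\<close>

lemma small_value_irreducible:
  fixes \<zeta> W :: real
  assumes W: "W > 0" and B: "B \<ge> 1"
    and trans: "\<And>P::int poly. P \<noteq> 0 \<Longrightarrow> degree P \<le> n \<Longrightarrow> poly (of_int_poly P) \<zeta> \<noteq> 0"
    and irr: "\<And>P. irreducible P \<Longrightarrow> 1 \<le> degree P \<Longrightarrow> degree P \<le> n \<Longrightarrow> poly_height P > B \<Longrightarrow>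
       \<bar>poly (of_int_poly P) \<zeta>\<bar> > real_of_int (poly_height P) powr (- W)"
  shows "\<exists>\<kappa>>0. \<kappa> \<le> 1 \<and> (\<forall>P. P \<noteq> 0 \<longrightarrow> degree P \<le> n \<longrightarrow> \<bar>poly (of_int_poly P) \<zeta>\<bar> \<ge> \<kappa> ^ degree P * mahler_measure P powr (- W))"
proof -
  \<comment> \<open>The hypothesis \<open>irr\<close> is silent about heights up to
    \<open>B\<close>. These are finitely many polynomials, and by \<open>trans\<close> none of them
    vanishes at \<open>\<zeta>\<close>, so their values have a positive minimum.\<close>
  define F where "F = {P::int poly. degree P \<le> n \<and> poly_height P \<le> B} - {0}"
  have finF: "finite F" using poly_height_box(1)[of B n] B by (simp add: F_def)
  define cB where "cB = Min (insert 1 ((\<lambda>P. \<bar>poly (of_int_poly P) \<zeta>\<bar>) ` F))"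
  have cB: "cB > 0" unfolding cB_def using finF trans by (subst Min_gr_iff) (auto simp: F_def)
  have cBF: "cB \<le> \<bar>poly (of_int_poly P) \<zeta>\<bar>" if "P \<in> F" for P unfolding cB_def using finF that by (intro Min_le) auto
  define \<kappa> where "\<kappa> = min 1 (min cB ((2 ^ n) powr (- W)))"
  have \<kappa>: "\<kappa> > 0" "\<kappa> \<le> 1" "\<kappa> \<le> cB" "\<kappa> \<le> (2 ^ n) powr (- W)" using cB by (auto simp: \<kappa>_def)
  have M1: "mahler_measure P \<ge> 1" if "P \<noteq> 0" for P using that by (rule mahler_measure_poly_ge_1)
  have Mle: "mahler_measure P powr (- W) \<le> 1" if "P \<noteq> 0" for P
    using powr_mono[of "- W" 0 "mahler_measure P"] M1[OF that] W by simp
  have const: "\<bar>poly (of_int_poly [:c:]) \<zeta>\<bar> \<ge> mahler_measure [:c:] powr (- W)" if "c \<noteq> 0" for c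
  proof -
    have "\<bar>real_of_int c\<bar> \<ge> 1" using that by linarith
    then show ?thesis using Mle[of "[:c:]"] that by (simp add: of_int_poly_pCons)
  qed
  have prime: "\<bar>poly (of_int_poly P) \<zeta>\<bar> \<ge> \<kappa> ^ degree P * mahler_measure P powr (- W)"
    if P: "irreducible P" "degree P \<le> n" for P
  proof (cases "degree P = 0")
    case True
    then obtain c where "P = [:c:]" using degree_eq_zeroE by blast
    moreover have "c \<noteq> 0" using P(1) calculation by auto
    ultimately show ?thesis using const[of c] True by simp
  next
    case False
    have P0: "P \<noteq> 0" using P(1) by auto
    have "\<kappa> ^ degree P \<le> \<kappa> ^ 1" using \<kappa> False by (intro power_decreasing) auto
    then have le: "\<kappa> ^ degree P * mahler_measure P powr (- W) \<le> \<kappa> * mahler_measure P powr (- W)"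
      by (intro mult_right_mono) auto
    show ?thesis
    proof (cases "poly_height P \<le> B")
      case True
      have "\<kappa> * mahler_measure P powr (- W) \<le> cB * 1" using \<kappa> Mle[OF P0] cB by (intro mult_mono) auto
      then show ?thesis using le cBF[of P] True P0 P(2) by (simp add: F_def)
    next
      case False': False
      have "\<kappa> * mahler_measure P powr (- W) \<le> (2 ^ n) powr (- W) * mahler_measure P powr (- W)"
        using \<kappa> by (intro mult_right_mono) auto
      also have "\<dots> = (2 ^ n * mahler_measure P) powr (- W)" using M1[OF P0] by (simp add: powr_mult)
      also have "\<dots> \<le> real_of_int (poly_height P) powr (- W)"
        using height_le_mahler_measure[OF P(2)] poly_height_ge_1[OF P0] W by (intro powr_mono2') auto
      also have "\<dots> < \<bar>poly (of_int_poly P) \<zeta>\<bar>" using irr[of P] P False False' by simp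
      finally show ?thesis using le by linarith
    qed
  qed
  \<comment> \<open>The loss is \<open>\<kappa>\<close> to the power of the degree and thus
    multiplicative, like the Mahler measure; nonzero constants cost nothing. The bound therefore
    passes to products without any dependence on the number of factors.\<close>
  have "degree P \<le> n \<longrightarrow> P \<noteq> 0 \<longrightarrow> \<bar>poly (of_int_poly P) \<zeta>\<bar> \<ge> \<kappa> ^ degree P * mahler_measure P powr (- W)" for P :: "int poly"
  proof (induction P rule: prime_divisors_induct)
    case (unit x)
    then obtain c where "x = [:c:]" "c dvd 1" by (auto simp: is_unit_poly_iff)
    moreover have "c \<noteq> 0" using calculation(2) by auto
    ultimately show ?case using const[of c] by simp
  next
    case (factor p x)
    show ?case
    proof (intro impI)
      assume d: "degree (p * x) \<le> n" and nz: "p * x \<noteq> 0"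
      then have nz': "p \<noteq> 0" "x \<noteq> 0" by auto
      have dm: "degree (p * x) = degree p + degree x" using nz' by (rule degree_mult_eq)
      have irrp: "irreducible p" using factor(1) by (intro prime_elem_imp_irreducible prime_imp_prime_elem)
      have "(\<kappa> ^ degree p * mahler_measure p powr (- W)) * (\<kappa> ^ degree x * mahler_measure x powr (- W))
        \<le> \<bar>poly (of_int_poly p) \<zeta>\<bar> * \<bar>poly (of_int_poly x) \<zeta>\<bar>"
        using prime[OF irrp] factor(2) nz' d dm \<kappa> by (intro mult_mono) auto
      also have "\<dots> = \<bar>poly (of_int_poly (p * x)) \<zeta>\<bar>" by (simp add: of_int_poly_hom.hom_mult abs_mult)
      also have "(\<kappa> ^ degree p * mahler_measure p powr (- W)) * (\<kappa> ^ degree x * mahler_measure x powr (- W))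
        = \<kappa> ^ degree (p * x) * mahler_measure (p * x) powr (- W)"
        unfolding dm mahler_measure_mult using mahler_measure_ge_0
        by (simp add: powr_mult power_add mult.assoc mult.left_commute)
      finally show "\<kappa> ^ degree (p * x) * mahler_measure (p * x) powr (- W) \<le> \<bar>poly (of_int_poly (p * x)) \<zeta>\<bar>" .
    qed
  qed auto
  then show ?thesis using \<kappa>(1,2) by blast
qed

lemma approx_exponents_mono:
  assumes "l' \<in> approx_exponents N \<zeta>" "l \<le> l'"
  shows "l \<in> approx_exponents N \<zeta>"
  unfolding approx_exponents_def
proof (intro CollectI allI)
  fix X0 :: real
  from assms(1) obtain X and x :: int and y :: "nat \<Rightarrow> int" where X: "X > X0" "1 \<le> \<bar>x\<bar>" "real_of_int \<bar>x\<bar> \<le> X"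
    "(MAX i\<in>{1..N}. \<bar>\<zeta> ^ i * real_of_int x - real_of_int (y i)\<bar>) \<le> X powr (- l')"
    unfolding approx_exponents_def by blast
  have "X \<ge> 1" using X(2,3) by linarith
  then have "X powr (- l') \<le> X powr (- l)" using assms(2) by (intro powr_mono) auto
  then show "\<exists>X>X0. \<exists>x y. 1 \<le> \<bar>x\<bar> \<and> real_of_int \<bar>x\<bar> \<le> X \<and>
     (MAX i\<in>{1..N}. \<bar>\<zeta> ^ i * real_of_int x - real_of_int (y i)\<bar>) \<le> X powr (- l)"
    using X by (meson order_trans)
qed

text \<open>Membership in \<open>approx_exponents\<close> bounds the error by a power of
  \<open>X\<close>, while the denominator could stay small. For irrational \<open>\<zeta>\<close>
  the finitely many denominators up to \<open>B\<close> have errors bounded below by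
  \<open>e\<close>, so \<open>X\<close> with \<open>X powr (- l) < e\<close> forces a larger one.
  Since \<open>\<bar>x\<bar> \<le> X\<close>, the error may then be measured by the
  denominator.\<close>

lemma large_denominators:
  fixes \<zeta> l Q1 :: real
  assumes N: "N \<ge> 1" and l: "l > 0" "l \<in> approx_exponents N \<zeta>" and irrat: "\<And>x y::int. x \<noteq> 0 \<Longrightarrow> \<zeta> * of_int x \<noteq> of_int y"
  shows "\<exists>y::nat \<Rightarrow> int. real_of_int \<bar>y 0\<bar> \<ge> Q1 \<and> (\<forall>i\<le>N. \<bar>\<zeta> ^ i * real_of_int (y 0) - real_of_int (y i)\<bar> \<le> real_of_int \<bar>y 0\<bar> powr (- l))"
proof -
  define B where "B = max 1 \<lceil>Q1\<rceil>"
  define F where "F = {-B..B} - {0}"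
  define e where "e = Min (insert 1 ((\<lambda>x. \<bar>\<zeta> * real_of_int x - real_of_int (round (\<zeta> * real_of_int x))\<bar>) ` F))"
  have finF: "finite F" by (simp add: F_def)
  have e: "e > 0" unfolding e_def using finF irrat by (subst Min_gr_iff) (auto simp: F_def)
  have eF: "e \<le> \<bar>\<zeta> * real_of_int x - real_of_int y\<bar>" if "x \<in> F" for x y
  proof -
    have "e \<le> \<bar>\<zeta> * real_of_int x - real_of_int (round (\<zeta> * real_of_int x))\<bar>" unfolding e_def using finF that by (intro Min_le) auto
    also have "\<dots> \<le> \<bar>\<zeta> * real_of_int x - real_of_int y\<bar>" by (rule round_diff_minimal)
    finally show ?thesis .
  qed
  from l(2) obtain X and x :: int and y :: "nat \<Rightarrow> int" where X: "X > e powr (- (1 / l))" "1 \<le> \<bar>x\<bar>" "real_of_int \<bar>x\<bar> \<le> X"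
    "(MAX i\<in>{1..N}. \<bar>\<zeta> ^ i * real_of_int x - real_of_int (y i)\<bar>) \<le> X powr (- l)"
    unfolding approx_exponents_def by blast
  have err: "\<bar>\<zeta> ^ i * real_of_int x - real_of_int (y i)\<bar> \<le> X powr (- l)" if "i \<in> {1..N}" for i
  proof -
    have "\<bar>\<zeta> ^ i * real_of_int x - real_of_int (y i)\<bar> \<le> (MAX i\<in>{1..N}. \<bar>\<zeta> ^ i * real_of_int x - real_of_int (y i)\<bar>)"
      using that by (intro Max_ge) auto
    then show ?thesis using X(4) by linarith
  qed
  have "X powr (- l) < (e powr (- (1 / l))) powr (- l)" using X(1) e l by (intro powr_less_mono2_neg) auto
  also have "\<dots> = e" using e l by (simp add: powr_powr)
  finally have "\<bar>\<zeta> * real_of_int x - real_of_int (y 1)\<bar> < e" using err[of 1] N by simp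
  then have "x \<notin> F" using eF[of x "y 1"] by linarith
  then have "\<bar>x\<bar> > B" using X(2) by (auto simp: F_def)
  then have "real_of_int \<bar>x\<bar> \<ge> Q1" unfolding B_def by linarith
  define y' where "y' i = (if i = 0 then x else y i)" for i
  have "X powr (- l) \<le> real_of_int \<bar>x\<bar> powr (- l)" using X l by (intro powr_mono2') auto
  then have "\<bar>\<zeta> ^ i * real_of_int (y' 0) - real_of_int (y' i)\<bar> \<le> real_of_int \<bar>y' 0\<bar> powr (- l)" if "i \<le> N" for i
    using err[of i] that by (cases "i = 0") (auto simp: y'_def)
  then show ?thesis using \<open>real_of_int \<bar>x\<bar> \<ge> Q1\<close> by (intro exI[of _ y']) (auto simp: y'_def)
qed

text \<open>If no such factor existed, the annihilator would satisfy
  \<open>|P(\<zeta>)| \<ge> E * h^(-N-1)\<close>. Compared with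
  \<open>|P(\<zeta>)| \<le> C * h * Q^(-1-l)\<close> and \<open>h \<le> C * Q^(1/N)\<close>, this
  bounds \<open>Q^(l - 2/N)\<close>, although the exponent is positive and \<open>Q\<close> is
  arbitrarily large.\<close>

lemma irreducible_approximations:
  fixes \<zeta> l R :: real
  assumes n: "n \<ge> 1" and N: "N \<ge> 2 * n + 1" and l: "l > 1 / real n" "l \<in> approx_exponents N \<zeta>" and R: "R \<ge> 1" "\<bar>\<zeta>\<bar> \<le> R"
    and trans: "\<And>P::int poly. P \<noteq> 0 \<Longrightarrow> degree P \<le> n \<Longrightarrow> poly (of_int_poly P) \<zeta> \<noteq> 0" and B: "B \<ge> 1"
  shows "\<exists>P. irreducible P \<and> 1 \<le> degree P \<and> degree P \<le> n \<and> poly_height P > B \<and>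
       \<bar>poly (of_int_poly P) \<zeta>\<bar> \<le> 1 / real_of_int (poly_height P) ^ (N + 1)"
proof (rule ccontr)
  assume neg: "\<not> ?thesis"
  define W where "W = real (N + 1)"
  have W: "W > 0" by (simp add: W_def)
  have small: "\<bar>poly (of_int_poly P) \<zeta>\<bar> > real_of_int (poly_height P) powr (- W)"
    if P: "irreducible P" "1 \<le> degree P" "degree P \<le> n" "poly_height P > B" for P
  proof -
    have "real_of_int (poly_height P) powr (- W) = 1 / real_of_int (poly_height P) ^ (N + 1)"
      using P(4) B unfolding W_def by (simp only: powr_minus inverse_eq_divide) (subst powr_realpow; simp)
    then show ?thesis using neg P by force
  qed
  have "\<exists>\<kappa>>0. \<kappa> \<le> 1 \<and> (\<forall>P. P \<noteq> 0 \<longrightarrow> degree P \<le> n \<longrightarrow> \<bar>poly (of_int_poly P) \<zeta>\<bar> \<ge> \<kappa> ^ degree P * mahler_measure P powr (- W))"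
    by (rule small_value_irreducible[OF W B]; (rule trans small; assumption))
  then obtain \<kappa> where \<kappa>: "\<kappa> > 0" "\<kappa> \<le> 1" and
    "\<forall>P. P \<noteq> 0 \<longrightarrow> degree P \<le> n \<longrightarrow> \<bar>poly (of_int_poly P) \<zeta>\<bar> \<ge> \<kappa> ^ degree P * mahler_measure P powr (- W)"
    by (elim exE conjE) (rule that)
  note \<kappa> = \<kappa> this(3)[rule_format]
  from annihilator_height[OF n N l(1) R(1)] obtain C Q0 where C: "C \<ge> 1" and ht:
    "\<forall>\<zeta> Q. \<forall>y::nat \<Rightarrow> int. \<bar>\<zeta>\<bar> \<le> R \<longrightarrow> Q \<ge> Q0 \<longrightarrow> real_of_int \<bar>y 0\<bar> = Q \<longrightarrow>
     (\<forall>i\<le>N. \<bar>\<zeta> ^ i * real_of_int (y 0) - real_of_int (y i)\<bar> \<le> Q powr (- l)) \<longrightarrow>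
     (\<exists>P::int poly. \<exists>h. P \<noteq> 0 \<and> degree P \<le> n \<and> (\<forall>i. \<bar>real_of_int (coeff P i)\<bar> \<le> h) \<and> h \<le> C * Q powr (1 / real N) \<and>
        \<bar>poly (of_int_poly P) \<zeta>\<bar> \<le> C * h * Q powr (- 1 - l))"
    by (elim exE conjE) (rule that)
  have "1 / real n > 0" using n by simp
  then have l0: "l > 0" using l by linarith
  have N0: "real N > 0" using N by simp
  have "2 / real N < 1 / real n" using N n by (simp add: field_simps)
  then have lN: "l - 2 / real N > 0" using l(1) by linarith
  define E where "E = \<kappa> ^ n * real (n + 1) powr (- W)"
  have E: "E > 0" using \<kappa> by (simp add: E_def)
  define D where "D = C ^ (N + 3) / E + 1"
  from powr_eventually_ge[OF lN, of D] obtain Q2 where Q2: "\<And>Q. Q \<ge> Q2 \<Longrightarrow> D \<le> Q powr (l - 2 / real N)"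
    unfolding eventually_at_top_linorder by blast
  have irrat: "\<zeta> * of_int x \<noteq> of_int y" if "x \<noteq> 0" for x y :: int
  proof
    assume "\<zeta> * of_int x = of_int y"
    then have "poly (of_int_poly [:- y, x:]) \<zeta> = 0" by (simp add: of_int_poly_pCons mult.commute)
    moreover have "[:- y, x:] \<noteq> 0" "degree [:- y, x:] \<le> n" using that n by auto
    ultimately show False using trans by blast
  qed
  have "N \<ge> 1" using N by simp
  from large_denominators[OF this l0 l(2) irrat, where ?Q1.0 = "max 1 (max Q0 Q2)"] obtain y :: "nat \<Rightarrow> int" where
    y: "real_of_int \<bar>y 0\<bar> \<ge> max 1 (max Q0 Q2)" "\<forall>i\<le>N. \<bar>\<zeta> ^ i * real_of_int (y 0) - real_of_int (y i)\<bar> \<le> real_of_int \<bar>y 0\<bar> powr (- l)" by blast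
  define Q where "Q = real_of_int \<bar>y 0\<bar>"
  have Q: "Q \<ge> 1" "Q \<ge> Q0" "Q \<ge> Q2" using y(1) by (auto simp: Q_def)
  have "\<forall>i\<le>N. \<bar>\<zeta> ^ i * real_of_int (y 0) - real_of_int (y i)\<bar> \<le> Q powr (- l)" using y(2) unfolding Q_def .
  then have "\<exists>P::int poly. \<exists>h. P \<noteq> 0 \<and> degree P \<le> n \<and> (\<forall>i. \<bar>real_of_int (coeff P i)\<bar> \<le> h) \<and> h \<le> C * Q powr (1 / real N) \<and>
        \<bar>poly (of_int_poly P) \<zeta>\<bar> \<le> C * h * Q powr (- 1 - l)"
    using ht[THEN spec[where x = \<zeta>], THEN spec[where x = Q], THEN spec[where x = y]] R(2) Q(2) Q_def by blast
  then obtain P :: "int poly" and h where P: "P \<noteq> 0" "degree P \<le> n"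
    "\<And>i. \<bar>real_of_int (coeff P i)\<bar> \<le> h" "h \<le> C * Q powr (1 / real N)" "\<bar>poly (of_int_poly P) \<zeta>\<bar> \<le> C * h * Q powr (- 1 - l)"
    by blast
  have h1: "h \<ge> 1"
  proof -
    have "\<bar>coeff P (degree P)\<bar> \<ge> 1" using P(1) by (metis abs_of_nonneg int_one_le_iff_zero_less leading_coeff_0_iff zero_less_abs_iff)
    then show ?thesis using P(3)[of "degree P"] by linarith
  qed
  have "E * h powr (- W) \<le> \<kappa> ^ degree P * mahler_measure P powr (- W)"
  proof -
    have "E * h powr (- W) = \<kappa> ^ n * (real (n + 1) * h) powr (- W)" using h1 by (simp add: E_def powr_mult)
    also have "\<dots> \<le> \<kappa> ^ degree P * mahler_measure P powr (- W)"
    proof (intro mult_mono)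
      show "\<kappa> ^ n \<le> \<kappa> ^ degree P" using \<kappa> P(2) by (intro power_decreasing) auto
      show "(real (n + 1) * h) powr (- W) \<le> mahler_measure P powr (- W)"
        using mahler_measure_le_height[OF P(2,3)] mahler_measure_poly_ge_1[OF P(1)] W by (intro powr_mono2') auto
    qed (use \<kappa> in auto)
    finally show ?thesis .
  qed
  also have "\<dots> \<le> C * h * Q powr (- 1 - l)" using \<kappa>(3)[OF P(1,2)] P(5) by linarith
  finally have "E * h powr (- W) * (h powr W * Q powr (1 + l)) \<le> C * h * Q powr (- 1 - l) * (h powr W * Q powr (1 + l))"
    by (intro mult_right_mono) auto
  moreover have "h powr (- W) * h powr W = 1" using h1 by (simp add: powr_add[symmetric])
  then have "E * h powr (- W) * (h powr W * Q powr (1 + l)) = E * Q powr (1 + l)" by (simp add: algebra_simps)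
  moreover have "Q powr (- 1 - l) * Q powr (1 + l) = 1" using Q(1) by (simp add: powr_add[symmetric])
  then have "C * h * Q powr (- 1 - l) * (h powr W * Q powr (1 + l)) = C * (h * h powr W)" by (simp add: algebra_simps)
  moreover have "h * h powr W = h ^ (N + 2)"
  proof -
    have "h powr W = h ^ (N + 1)" using h1 unfolding W_def by (intro powr_realpow) simp
    then show ?thesis by simp
  qed
  ultimately have "E * Q powr (1 + l) \<le> C * h ^ (N + 2)" by simp
  also have "\<dots> \<le> C * (C * Q powr (1 / real N)) ^ (N + 2)" using P(4) h1 C by (intro mult_left_mono power_mono) auto
  also have "\<dots> = C ^ (N + 3) * (Q powr (1 / real N)) ^ (N + 2)" by (simp add: power_mult_distrib numeral_3_eq_3 mult.assoc)
  also have "(Q powr (1 / real N)) ^ (N + 2) = Q powr (1 + 2 / real N)"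
  proof -
    have "(Q powr (1 / real N)) ^ (N + 2) = (Q powr (1 / real N)) powr real (N + 2)" using Q(1) by (intro powr_realpow[symmetric]) simp
    also have "\<dots> = Q powr (1 / real N * real (N + 2))" by (rule powr_powr)
    also have "1 / real N * real (N + 2) = 1 + 2 / real N" using N0 by (simp add: field_simps)
    finally show ?thesis .
  qed
  finally have "E * Q powr (1 + l) \<le> C ^ (N + 3) * Q powr (1 + 2 / real N)" .
  moreover have "Q powr (1 + l) = Q powr (l - 2 / real N) * Q powr (1 + 2 / real N)" by (simp add: powr_add[symmetric] add.commute)
  ultimately have "(E * Q powr (l - 2 / real N)) * Q powr (1 + 2 / real N) \<le> C ^ (N + 3) * Q powr (1 + 2 / real N)"
    by (simp add: mult.assoc)
  then have "E * Q powr (l - 2 / real N) \<le> C ^ (N + 3)" using Q(1) by simp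
  moreover have "E * D \<le> E * Q powr (l - 2 / real N)" using Q2[OF Q(3)] E by (intro mult_left_mono) auto
  moreover have "E * D = C ^ (N + 3) + E" using E by (simp add: D_def field_simps)
  ultimately show False using E by linarith
qed

section \<open>The discriminant and the derivative at a small value\<close>

text \<open>Rows of the Sylvester matrix of \<open>f\<close> and its derivative for degree
  \<open>Suc M\<close>, with columns in ascending degree: \<open>M\<close> multiples of
  \<open>f\<close> followed by \<open>M + 1\<close> multiples of the derivative. The determinant is
  their resultant up to sign.\<close>

definition sylv_row :: "nat \<Rightarrow> 'a::{comm_ring_1,semiring_no_zero_divisors} poly \<Rightarrow> nat \<Rightarrow> 'a poly" where
  "sylv_row M f i = (if i < M then Polynomial.monom 1 i * f else Polynomial.monom 1 (i - M) * pderiv f)"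

definition sylv_mat :: "nat \<Rightarrow> 'a::{comm_ring_1,semiring_no_zero_divisors} poly \<Rightarrow> 'a Matrix.mat" where
  "sylv_mat M f = Matrix.mat (2 * M + 1) (2 * M + 1) (\<lambda>(i, j). coeff (sylv_row M f i) j)"

lemma sum_lessThan_split: "(\<Sum>i<a + b. g i) = (\<Sum>i<a. g i) + (\<Sum>k<b. g (a + k :: nat) :: 'a::comm_monoid_add)"
  by (induction b) (simp_all add: add.assoc)

lemma degree_sylv_row:
  fixes f :: "'a::{idom,semiring_char_0} poly"
  assumes "degree f \<le> Suc M" "i < 2 * M + 1" shows "degree (sylv_row M f i) < 2 * M + 1"
proof (cases "i < M")
  case True
  have "degree (Polynomial.monom 1 i * f) \<le> i + Suc M" using degree_mult_le[of "Polynomial.monom 1 i" f] degree_monom_le[of "1::'a" i] assms(1) by linarith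
  then show ?thesis using True by (simp add: sylv_row_def)
next
  case False
  have "degree (Polynomial.monom 1 (i - M) * pderiv f) \<le> (i - M) + M"
    using degree_mult_le[of "Polynomial.monom 1 (i - M)" "pderiv f"] degree_monom_le[of "1::'a" "i - M"] degree_pderiv[of f] assms(1) by linarith
  then show ?thesis using False assms(2) by (simp add: sylv_row_def)
qed

text \<open>A vector in the left kernel encodes a relation \<open>a * P + b * pderiv P = 0\<close>
  with \<open>degree b \<le> M\<close>. As \<open>P\<close> is prime, it would divide
  \<open>b\<close> or its derivative, both of lower degree; so \<open>b\<close> and then
  \<open>a\<close> vanish.\<close>

lemma det_sylv_mat_nonzero:
  fixes P :: "int poly"
  assumes irr: "irreducible P" and deg: "degree P = Suc M"
  shows "det (sylv_mat M P) \<noteq> 0"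
proof
  let ?K = "2 * M + 1"
  assume "det (sylv_mat M P) = 0"
  moreover have C: "sylv_mat M P \<in> carrier_mat ?K ?K" by (simp add: sylv_mat_def)
  ultimately have "det (transpose_mat (sylv_mat M P)) = 0" by (simp add: det_transpose)
  moreover have "transpose_mat (sylv_mat M P) \<in> carrier_mat ?K ?K" using C by simp
  ultimately obtain v where v: "v \<in> carrier_vec ?K" "v \<noteq> 0\<^sub>v ?K" "transpose_mat (sylv_mat M P) *\<^sub>v v = 0\<^sub>v ?K"
    using det_0_iff_vec_prod_zero by blast
  have z: "(\<Sum>i<?K. vec_index v i * coeff (sylv_row M P i) j) = 0" if "j < ?K" for j
  proof -
    have "vec_index (transpose_mat (sylv_mat M P) *\<^sub>v v) j = 0" using v(3) that by simp
    then show ?thesis using v(1) that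
      by (simp add: sylv_mat_def scalar_prod_def lessThan_atLeast0 mult.commute carrier_vecD)
  qed
  define a where "a = (\<Sum>i<M. Polynomial.monom (vec_index v i) i)"
  define b where "b = (\<Sum>k<Suc M. Polynomial.monom (vec_index v (M + k)) k)"
  have ca: "coeff a i = (if i < M then vec_index v i else 0)" for i
    unfolding a_def coeff_sum by (auto simp: if_distrib cong: if_cong)
  have cb: "coeff b k = (if k < Suc M then vec_index v (M + k) else 0)" for k
    unfolding b_def coeff_sum by (auto simp: if_distrib cong: if_cong)
  have mon: "Polynomial.smult c (Polynomial.monom 1 i * q) = Polynomial.monom c i * q" for c :: int and i q
    by (simp add: mult_smult_left[symmetric] smult_monom)
  have "(\<Sum>i<?K. Polynomial.smult (vec_index v i) (sylv_row M P i)) = a * P + b * pderiv P"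
  proof -
    have K: "?K = M + Suc M" by simp
    show ?thesis unfolding K sum_lessThan_split a_def b_def sum_distrib_right
      by (intro arg_cong2[of _ _ _ _ "(+)"] sum.cong refl) (simp_all add: sylv_row_def mon)
  qed
  moreover have "(\<Sum>i<?K. Polynomial.smult (vec_index v i) (sylv_row M P i)) = 0"
  proof (rule poly_eqI)
    fix j
    show "coeff (\<Sum>i<?K. Polynomial.smult (vec_index v i) (sylv_row M P i)) j = coeff 0 j"
    proof (cases "j < ?K")
      case True then show ?thesis using z[OF True] by (simp add: coeff_sum)
    next
      case False
      have "coeff (sylv_row M P i) j = 0" if "i < ?K" for i
        using degree_sylv_row[of P M i] deg that False by (intro coeff_eq_0) auto
      then show ?thesis by (simp add: coeff_sum)
    qed
  qed
  ultimately have ab: "a * P + b * pderiv P = 0" by simp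
  then have "b * pderiv P = (- a) * P" by (simp add: add_eq_0_iff algebra_simps)
  then have "P dvd b * pderiv P" by simp
  moreover have "prime_elem P" using irr by (rule irreducible_imp_prime_elem)
  ultimately have "P dvd b \<or> P dvd pderiv P" by (simp add: prime_elem_dvd_mult_iff)
  moreover have "\<not> P dvd pderiv P"
  proof
    assume h: "P dvd pderiv P"
    have "pderiv P \<noteq> 0" using deg by (simp add: pderiv_eq_0_iff)
    then have "degree P \<le> degree (pderiv P)" using h by (rule dvd_imp_degree_le[rotated])
    then show False using deg by (simp add: degree_pderiv)
  qed
  ultimately have "P dvd b" by blast
  have b0: "b = 0"
  proof (rule ccontr)
    assume "b \<noteq> 0"
    then have "degree P \<le> degree b" using \<open>P dvd b\<close> by (rule dvd_imp_degree_le[rotated])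
    moreover have "degree b \<le> M" by (rule degree_le) (simp add: cb)
    ultimately show False using deg by simp
  qed
  have a0: "a = 0" using ab b0 deg by auto
  have "v = 0\<^sub>v ?K"
  proof (rule eq_vecI)
    fix i assume "i < dim_vec (0\<^sub>v ?K :: int vec)"
    then have i: "i < ?K" by simp
    have "vec_index v i = 0"
    proof (cases "i < M")
      case True then show ?thesis using ca[of i] a0 by simp
    next
      case False
      then have "i - M < Suc M" "M + (i - M) = i" using i by auto
      then show ?thesis using cb[of "i - M"] b0 by simp
    qed
    then show "vec_index v i = vec_index (0\<^sub>v ?K) i" using i by simp
  qed (use v(1) in simp)
  then show False using v(2) by simp
qed

lemma poly_pderiv_as_sum:
  fixes p :: "real poly"
  assumes "degree p < K"
  shows "poly (pderiv p) x = (\<Sum>t<K. coeff p t * (real t * x ^ (t - 1)))"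
proof -
  have "p = (\<Sum>t\<le>K - 1. Polynomial.monom (coeff p t) t)" using assms by (intro poly_as_sum_of_monoms'[symmetric]) simp
  also have "{..K - 1} = {..<K}" using assms by auto
  finally have "pderiv p = (\<Sum>t<K. pderiv (Polynomial.monom (coeff p t) t))" by (metis pderiv_sum)
  then show ?thesis by (simp add: poly_sum pderiv_monom poly_monom mult_ac)
qed

lemma poly_as_sum_lessThan:
  fixes p :: "real poly"
  assumes "degree p < K" shows "poly p x = (\<Sum>t<K. coeff p t * x ^ t)"
proof -
  have "p = (\<Sum>t\<le>K - 1. Polynomial.monom (coeff p t) t)" using assms by (intro poly_as_sum_of_monoms'[symmetric]) simp
  also have "{..K - 1} = {..<K}" using assms by auto
  finally have "poly p x = poly (\<Sum>t<K. Polynomial.monom (coeff p t) t) x" by (rule arg_cong[where f = "\<lambda>q. poly q x"])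
  then show ?thesis by (simp add: poly_sum poly_monom)
qed

text \<open>Every term of the Leibniz formula takes its entries in columns 0 and 1 from different
  rows, which is why only products with \<open>i \<noteq> i'\<close> have to be small.\<close>

lemma leibniz_two_columns:
  fixes E :: "real Matrix.mat"
  assumes E: "E \<in> carrier_mat K K" "K \<ge> 2" and bnd: "\<And>i j. i < K \<Longrightarrow> j < K \<Longrightarrow> \<bar>E $$ (i, j)\<bar> \<le> A"
    and two: "\<And>i i'. i < K \<Longrightarrow> i' < K \<Longrightarrow> i \<noteq> i' \<Longrightarrow> \<bar>E $$ (i, 0) * E $$ (i', 1)\<bar> \<le> B"
  shows "\<bar>det E\<bar> \<le> fact K * (B * A ^ (K - 2))"
proof -
  have A: "A \<ge> 0" using bnd[of 0 0] E(2) by linarith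
  have B: "B \<ge> 0" using two[of 0 1] E(2) by (auto intro: order_trans[OF abs_ge_zero])
  have "\<bar>signof p * (\<Prod>i = 0..<K. E $$ (i, p i))\<bar> \<le> B * A ^ (K - 2)" if p: "p permutes {0..<K}" for p
  proof -
    obtain i0 where i0: "p i0 = 0" using permutes_surj[OF p] by (metis surjD)
    obtain i1 where i1: "p i1 = 1" using permutes_surj[OF p] by (metis surjD)
    have r: "i0 \<in> {0..<K}" "i1 \<in> {0..<K}" using permutes_in_image[OF p, of i0] permutes_in_image[OF p, of i1] i0 i1 E(2) by auto
    have ne: "i0 \<noteq> i1" using i0 i1 by auto
    have "{0..<K} = insert i0 (insert i1 ({0..<K} - {i0, i1}))" using r by auto
    then have "(\<Prod>i = 0..<K. E $$ (i, p i)) = (\<Prod>i \<in> insert i0 (insert i1 ({0..<K} - {i0, i1})). E $$ (i, p i))" by simp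
    also have "\<dots> = (E $$ (i0, 0) * E $$ (i1, 1)) * (\<Prod>i\<in>{0..<K} - {i0, i1}. E $$ (i, p i))"
      using ne i0 i1 by (simp add: mult.assoc)
    finally have "\<bar>signof p * (\<Prod>i = 0..<K. E $$ (i, p i))\<bar>
      = \<bar>E $$ (i0, 0) * E $$ (i1, 1)\<bar> * (\<Prod>i\<in>{0..<K} - {i0, i1}. \<bar>E $$ (i, p i)\<bar>)"
      by (simp add: abs_mult abs_prod sign_def)
    also have "\<dots> \<le> B * A ^ (K - 2)"
    proof (intro mult_mono)
      show "\<bar>E $$ (i0, 0) * E $$ (i1, 1)\<bar> \<le> B" using two r ne by auto
      have "(\<Prod>i\<in>{0..<K} - {i0, i1}. \<bar>E $$ (i, p i)\<bar>) \<le> (\<Prod>i\<in>{0..<K} - {i0, i1}. A)"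
        using permutes_in_image[OF p] by (intro prod_mono) (auto intro!: bnd)
      also have "\<dots> = A ^ (K - 2)" using r ne by (simp add: card_Diff_subset numeral_2_eq_2)
      finally show "(\<Prod>i\<in>{0..<K} - {i0, i1}. \<bar>E $$ (i, p i)\<bar>) \<le> A ^ (K - 2)" .
    qed (use B in \<open>auto intro: prod_nonneg\<close>)
    finally show ?thesis .
  qed
  then have "\<bar>det E\<bar> \<le> (\<Sum>p | p permutes {0..<K}. B * A ^ (K - 2))"
    unfolding det_def'[OF E(1)] by (intro order_trans[OF sum_abs] sum_mono) auto
  also have "\<dots> = fact K * (B * A ^ (K - 2))" by (simp add: card_permutations)
  finally show ?thesis .
qed

lemma det_lower_unitriangular:
  assumes "A \<in> carrier_mat n n" "\<And>i j. i < j \<Longrightarrow> j < n \<Longrightarrow> A $$ (i, j) = 0" "\<And>i. i < n \<Longrightarrow> A $$ (i, i) = 1"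
  shows "det (A :: real Matrix.mat) = 1"
proof -
  have "diag_mat A = replicate n 1" using assms(1,3) by (auto simp: diag_mat_def map_replicate_const[symmetric] intro!: nth_equalityI)
  then show ?thesis using det_lower_triangular[OF assms(2,1)] by simp
qed

text \<open>Unimodular column operations put the values at \<open>\<zeta>\<close> of the row
  polynomials into column 0 and of their derivatives into column 1; row operations then clear column
  0 below row \<open>M\<close>. What remains there is a multiple of \<open>f(\<zeta>)\<close> in the
  rows above \<open>M\<close>, and \<open>f'(\<zeta>)\<close> in row \<open>M\<close>. Gaining a
  small factor from both columns yields the square of the derivative, which a bound using one column
  would miss.\<close>

lemma det_sylv_mat_bound:
  fixes f :: "real poly"
  assumes M: "M \<ge> 1" and deg: "degree f \<le> Suc M" and H: "H \<ge> 1" "\<And>i. \<bar>coeff f i\<bar> \<le> H" and R: "R \<ge> 1" "\<bar>\<zeta>\<bar> \<le> R"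
  defines "K \<equiv> 2 * M + 1"
  defines "A \<equiv> (1 + R) * (real K * (real K * H * (real K * R ^ K)))"
  shows "\<bar>det (sylv_mat M f)\<bar> \<le> fact K * ((real K * R ^ K * (A * \<bar>poly f \<zeta>\<bar> + \<bar>poly (pderiv f) \<zeta>\<bar>\<^sup>2)) * A ^ (K - 2))"
proof -
  let ?S = "sylv_mat M f" and ?r = "sylv_row M f"
  have S: "?S \<in> carrier_mat K K" by (simp add: sylv_mat_def K_def)
  have K3: "K \<ge> 3" using M by (simp add: K_def)
  have dr: "degree (?r i) < K" if "i < K" for i using degree_sylv_row[OF deg] that by (simp add: K_def)
  define vf where "vf t j = (if j = 0 then \<zeta> ^ t else if j = 1 then real t * \<zeta> ^ (t - 1) else if t = j then 1 else 0)" for t j :: nat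
  define V where "V = Matrix.mat K K (\<lambda>(t, j). vf t j)"
  \<comment> \<open>In the block of the derivative each row polynomial is \<open>X\<close> times the
    previous one. Subtracting \<open>\<zeta>\<close> times the previous row leaves 0 in column 0 and
    the value of the previous row polynomial at \<open>\<zeta>\<close> in column 1.\<close>
  define uf where "uf i t = (if t = i then 1 else if i > M \<and> Suc t = i then - \<zeta> else 0)" for i t :: nat
  define U where "U = Matrix.mat K K (\<lambda>(i, t). uf i t)"
  have V: "V \<in> carrier_mat K K" and U: "U \<in> carrier_mat K K" by (simp_all add: V_def U_def)
  have "det V = 1" by (rule det_lower_unitriangular[OF V]) (auto simp: V_def vf_def)
  moreover have "det U = 1" by (rule det_lower_unitriangular[OF U]) (auto simp: U_def uf_def)
  ultimately have detE: "det (U * (?S * V)) = det ?S"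
    using det_mult[OF U, of "?S * V"] det_mult[OF S V] S V by simp
  define T where "T i j = (if j = 0 then poly (?r i) \<zeta> else if j = 1 then poly (pderiv (?r i)) \<zeta> else coeff (?r i) j)" for i j :: nat
  have TS: "(\<Sum>t<K. coeff (?r i) t * vf t j) = T i j" if "i < K" "j < K" for i j
  proof -
    consider "j = 0" | "j = 1" | "j \<noteq> 0" "j \<noteq> 1" by blast
    then show ?thesis
    proof cases
      case 1 then show ?thesis using poly_as_sum_lessThan[OF dr[OF that(1)], of \<zeta>] by (simp add: T_def vf_def)
    next
      case 2 then show ?thesis using poly_pderiv_as_sum[OF dr[OF that(1)], of \<zeta>] by (simp add: T_def vf_def)
    next
      case 3
      then have "coeff (?r i) t * vf t j = (if t = j then coeff (?r i) t else 0)" for t by (simp add: vf_def)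
      then show ?thesis using 3 that(2) by (simp add: T_def)
    qed
  qed
  have SV: "(?S * V) $$ (i, j) = T i j" if "i < K" "j < K" for i j
  proof -
    have "(?S * V) $$ (i, j) = (\<Sum>t<K. coeff (?r i) t * vf t j)" using that
      by (simp add: sylv_mat_def V_def K_def scalar_prod_def lessThan_atLeast0)
    then show ?thesis using TS[OF that] by simp
  qed
  define E where "E i j = (if i > M then T i j - \<zeta> * T (i - 1) j else T i j)" for i j
  have ES: "(U * (?S * V)) $$ (i, j) = E i j" if h: "i < K" "j < K" for i j
  proof -
    have "(U * (?S * V)) $$ (i, j) = (\<Sum>t<K. uf i t * ((?S * V) $$ (t, j)))" using h S V U
      by (simp add: U_def scalar_prod_def lessThan_atLeast0)
    also have "\<dots> = (\<Sum>t<K. uf i t * T t j)" using SV h by (intro sum.cong) auto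
    also have "\<dots> = E i j"
    proof (cases "i > M")
      case True
      then obtain i' where i': "i = Suc i'" by (cases i) auto
      have "(\<Sum>t<K. uf i t * T t j) = (\<Sum>t<K. (if t = i then T t j else 0) + (if t = i' then - \<zeta> * T t j else 0))"
        using True by (intro sum.cong) (auto simp: uf_def i')
      also have "\<dots> = T i j - \<zeta> * T i' j" using h i' by (simp add: sum.distrib)
      finally show ?thesis using True by (simp add: E_def i')
    next
      case False
      have "(\<Sum>t<K. uf i t * T t j) = (\<Sum>t<K. if t = i then T t j else 0)"
        using False by (intro sum.cong) (auto simp: uf_def)
      also have "\<dots> = T i j" using h by simp
      finally show ?thesis using False by (simp add: E_def)
    qed
    finally show ?thesis .
  qed
  have RK: "R ^ K \<ge> 1" using R by simp
  have zp: "\<bar>\<zeta> ^ t\<bar> \<le> R ^ K" if "t \<le> K" for t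
  proof -
    have "\<bar>\<zeta> ^ t\<bar> \<le> R ^ t" using R(2) by (simp add: power_abs power_mono)
    also have "\<dots> \<le> R ^ K" using R(1) that by (rule power_increasing[rotated])
    finally show ?thesis .
  qed
  have cr: "\<bar>coeff (?r i) t\<bar> \<le> real K * H" for i t
  proof -
    have 1: "\<bar>coeff f t\<bar> \<le> real K * H" for t
    proof -
      have "H \<le> real K * H" using H(1) K3 by simp
      then show ?thesis using H(2)[of t] by linarith
    qed
    have 2: "\<bar>coeff (pderiv f) t\<bar> \<le> real K * H" for t
    proof (cases "t \<le> M")
      case True
      have "\<bar>coeff (pderiv f) t\<bar> = real (Suc t) * \<bar>coeff f (Suc t)\<bar>" by (simp add: coeff_pderiv abs_mult)
      also have "\<dots> \<le> real K * H" using True H M by (intro mult_mono) (auto simp: K_def)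
      finally show ?thesis .
    next
      case False
      then have "coeff (pderiv f) t = 0" using deg by (simp add: coeff_pderiv coeff_eq_0)
      then show ?thesis using H by simp
    qed
    show ?thesis using 1[of "t - i"] 2[of "t - (i - M)"] H(1)
      by (cases "i < M") (auto simp: sylv_row_def coeff_monom_mult)
  qed
  have vb: "\<bar>vf t j\<bar> \<le> real K * R ^ K" if "t < K" for t j
  proof -
    have "1 * R ^ K \<le> real K * R ^ K" using K3 RK by (intro mult_right_mono) auto
    then have "\<bar>\<zeta> ^ t\<bar> \<le> real K * R ^ K" "1 \<le> real K * R ^ K" using zp[of t] that RK by linarith+
    moreover have "\<bar>real t * \<zeta> ^ (t - 1)\<bar> \<le> real K * R ^ K" using zp[of "t - 1"] that by (auto simp: abs_mult intro!: mult_mono)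
    ultimately show ?thesis unfolding vf_def by (cases "j = 0"; cases "j = 1"; cases "t = j"; simp)
  qed
  define B where "B = real K * (real K * H * (real K * R ^ K))"
  have B0: "B \<ge> 0" using H R by (simp add: B_def)
  have AB: "A = (1 + R) * B" by (simp add: A_def B_def)
  have TB: "\<bar>T i j\<bar> \<le> B" if h: "i < K" "j < K" for i j
  proof -
    have "\<bar>T i j\<bar> \<le> (\<Sum>t<K. \<bar>coeff (?r i) t * vf t j\<bar>)" unfolding TS[OF h, symmetric] by (rule sum_abs)
    also have "\<dots> \<le> (\<Sum>t<K. real K * H * (real K * R ^ K))"
      unfolding abs_mult using cr vb H by (intro sum_mono mult_mono) auto
    finally show ?thesis by (simp add: B_def)
  qed
  have EA: "\<bar>E i j\<bar> \<le> A" if h: "i < K" "j < K" for i j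
  proof -
    have "\<bar>\<zeta> * T (i - 1) j\<bar> \<le> R * B" unfolding abs_mult using R TB[of "i - 1" j] h by (intro mult_mono) auto
    moreover have "0 \<le> R * B" using R B0 by simp
    moreover have "A = B + R * B" by (simp add: AB algebra_simps)
    ultimately show ?thesis using TB[OF h] unfolding E_def by (auto simp: abs_le_iff)
  qed
  define p0 where "p0 = \<bar>poly f \<zeta>\<bar>"
  define p1 where "p1 = \<bar>poly (pderiv f) \<zeta>\<bar>"
  have p: "p0 \<ge> 0" "p1 \<ge> 0" by (simp_all add: p0_def p1_def)
  have rlow: "?r i = Polynomial.monom 1 i * f" if "i < M" for i using that by (simp add: sylv_row_def)
  have rup: "?r i = Polynomial.monom 1 (i - M) * pderiv f" if "i \<ge> M" for i using that by (simp add: sylv_row_def)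
  have rstep: "?r i = [:0, 1:] * ?r (i - 1)" if "i > M" for i
  proof -
    have "i - M = Suc (i - 1 - M)" using that by simp
    then show ?thesis using that rup[of i] rup[of "i - 1"] by (simp add: monom_Suc)
  qed
  have e00: "\<bar>E i 0\<bar> \<le> R ^ K * p0" if "i < M" for i
  proof -
    have "E i 0 = \<zeta> ^ i * poly f \<zeta>" using that by (simp add: E_def T_def rlow poly_monom)
    then show ?thesis using zp[of i] that unfolding p0_def by (simp add: abs_mult mult_right_mono K_def)
  qed
  have e01: "\<bar>E M 0\<bar> = p1" by (simp add: E_def T_def rup p1_def)
  have e02: "E i 0 = 0" if "i > M" for i using that by (simp add: E_def T_def rstep[OF that])
  have e10: "\<bar>E i 1\<bar> \<le> real K * R ^ K * (p0 + p1)" if "i < M" for i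
  proof -
    have "E i 1 = real i * \<zeta> ^ (i - 1) * poly f \<zeta> + \<zeta> ^ i * poly (pderiv f) \<zeta>"
      using that by (simp add: E_def T_def rlow poly_monom pderiv_mult pderiv_monom)
    then have "\<bar>E i 1\<bar> \<le> real i * \<bar>\<zeta> ^ (i - 1)\<bar> * p0 + \<bar>\<zeta> ^ i\<bar> * p1"
      unfolding p0_def p1_def by (metis (no_types, lifting) abs_mult abs_of_nat abs_triangle_ineq)
    also have "\<dots> \<le> real K * R ^ K * p0 + real K * R ^ K * p1"
    proof (intro add_mono mult_right_mono p)
      show "real i * \<bar>\<zeta> ^ (i - 1)\<bar> \<le> real K * R ^ K" using zp[of "i - 1"] that by (intro mult_mono) (auto simp: K_def)
      have "\<bar>\<zeta> ^ i\<bar> \<le> 1 * R ^ K" using zp[of i] that by (simp add: K_def)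
      also have "\<dots> \<le> real K * R ^ K" using K3 RK by (intro mult_right_mono) auto
      finally show "\<bar>\<zeta> ^ i\<bar> \<le> real K * R ^ K" .
    qed
    finally show ?thesis by (simp add: algebra_simps)
  qed
  have e11: "\<bar>E i 1\<bar> \<le> real K * R ^ K * (p0 + p1)" if h: "i > M" "i < K" for i
  proof -
    have "E i 1 = poly (?r (i - 1)) \<zeta>"
      using h by (simp add: E_def T_def rstep[OF h(1)] pderiv_mult pderiv_pCons)
    also have "\<dots> = \<zeta> ^ (i - 1 - M) * poly (pderiv f) \<zeta>" using h by (subst rup) (simp_all add: poly_monom)
    finally have "\<bar>E i 1\<bar> = \<bar>\<zeta> ^ (i - 1 - M)\<bar> * p1" by (simp add: abs_mult p1_def)
    also have "\<dots> \<le> (real K * R ^ K) * (p0 + p1)"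
    proof (intro mult_mono)
      have "\<bar>\<zeta> ^ (i - 1 - M)\<bar> \<le> 1 * R ^ K" using zp[of "i - 1 - M"] h by simp
      also have "\<dots> \<le> real K * R ^ K" using K3 RK by (intro mult_right_mono) auto
      finally show "\<bar>\<zeta> ^ (i - 1 - M)\<bar> \<le> real K * R ^ K" .
    qed (use p RK in auto)
    finally show ?thesis .
  qed
  have KR: "R ^ K \<le> real K * R ^ K" using mult_right_mono[of 1 "real K" "R ^ K"] K3 RK by simp
  have A0: "A \<ge> 0" using AB B0 R by simp
  have p1A: "p1 \<le> A" using EA[of M 0] e01 K3 by (simp add: K_def)
  \<comment> \<open>Rows above \<open>M\<close> already supply a factor \<open>f(\<zeta>)\<close> in
    column 0. If the entry of column 0 is taken from row \<open>M\<close>, the entry of column 1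
    comes from another row and is small too; the exception would have been row \<open>M\<close>,
    where column 1 contains the second derivative.\<close>
  have two: "\<bar>E i 0 * E i' 1\<bar> \<le> real K * R ^ K * (A * p0 + p1\<^sup>2)" if h: "i < K" "i' < K" "i \<noteq> i'" for i i'
  proof (cases "i < M")
    case True
    have "\<bar>E i 0 * E i' 1\<bar> \<le> (R ^ K * p0) * A" unfolding abs_mult using e00[OF True] EA[of i' 1] h K3 RK p by (intro mult_mono) auto
    also have "\<dots> \<le> (real K * R ^ K) * (A * p0)" using mult_right_mono[OF KR, of "A * p0"] A0 p by (simp add: algebra_simps)
    also have "\<dots> \<le> real K * R ^ K * (A * p0 + p1\<^sup>2)" using RK by (intro mult_left_mono) auto
    finally show ?thesis .
  next
    case F: False
    show ?thesis
    proof (cases "i = M")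
      case False
      then have "E i 0 = 0" using F by (intro e02) simp
      then show ?thesis using A0 p RK by simp
    next
      case True
      have "\<bar>E i' 1\<bar> \<le> real K * R ^ K * (p0 + p1)" using e10[of i'] e11[of i'] h True by (cases "i' < M") auto
      then have "\<bar>E i 0 * E i' 1\<bar> \<le> p1 * (real K * R ^ K * (p0 + p1))"
        unfolding abs_mult True e01 using p by (intro mult_left_mono) auto
      also have "\<dots> = real K * R ^ K * (p1 * p0 + p1\<^sup>2)" by (simp add: algebra_simps power2_eq_square)
      also have "\<dots> \<le> real K * R ^ K * (A * p0 + p1\<^sup>2)"
        using RK p1A p by (intro mult_left_mono add_mono mult_right_mono) auto
      finally show ?thesis .
    qed
  qed
  have "\<bar>det (U * (?S * V))\<bar> \<le> fact K * ((real K * R ^ K * (A * p0 + p1\<^sup>2)) * A ^ (K - 2))"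
    by (rule leibniz_two_columns) (use K3 U S V EA two ES in auto)
  then show ?thesis unfolding detE p0_def p1_def .
qed

text \<open>The Sylvester determinant of an irreducible integer polynomial is a nonzero integer,
  hence at least 1 in absolute value, and \<open>det_sylv_mat_bound\<close> bounds it from
  above.\<close>

lemma irreducible_derivative_bound:
  fixes R :: real
  assumes M: "M \<ge> 1" and R: "R \<ge> 1"
  shows "\<exists>D\<ge>1. \<forall>P \<zeta>. \<forall>H::real. irreducible P \<longrightarrow> degree P = Suc M \<longrightarrow> \<bar>\<zeta>\<bar> \<le> R \<longrightarrow> H \<ge> 1 \<longrightarrow> (\<forall>i. \<bar>real_of_int (coeff P i)\<bar> \<le> H) \<longrightarrow>
    1 \<le> D * (H * \<bar>poly (of_int_poly P) \<zeta>\<bar> + \<bar>poly (pderiv (of_int_poly P)) \<zeta>\<bar>\<^sup>2) * H ^ (2 * M - 1)"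
proof -
  define K where "K = 2 * M + 1"
  define c where "c = (1 + R) * (real K * (real K * (real K * R ^ K)))"
  define D where "D = fact K * (real K * R ^ K) * c * c ^ (2 * M - 1)"
  have RK: "R ^ K \<ge> 1" using R by simp
  have K1: "real K \<ge> 1" by (simp add: K_def)
  have ge1: "x * y \<ge> 1" if "x \<ge> 1" "y \<ge> 1" for x y :: real using mult_mono[OF that] that by simp
  have c1: "c \<ge> 1" unfolding c_def using R RK K1 by (intro ge1) auto
  have D1: "D \<ge> 1" unfolding D_def using c1 RK K1 by (intro ge1) (auto simp: fact_ge_1)
  have "1 \<le> D * (H * \<bar>poly (of_int_poly P) \<zeta>\<bar> + \<bar>poly (pderiv (of_int_poly P)) \<zeta>\<bar>\<^sup>2) * H ^ (2 * M - 1)"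
    if h: "irreducible P" "degree P = Suc M" "\<bar>\<zeta>\<bar> \<le> R" "H \<ge> 1" "\<forall>i. \<bar>real_of_int (coeff P i)\<bar> \<le> H"
    for P :: "int poly" and \<zeta> H :: real
  proof -
    let ?f = "of_int_poly P :: real poly"
    define p0 where "p0 = \<bar>poly ?f \<zeta>\<bar>"
    define p1 where "p1 = \<bar>poly (pderiv ?f) \<zeta>\<bar>\<^sup>2"
    have p: "p0 \<ge> 0" "p1 \<ge> 0" by (simp_all add: p0_def p1_def)
    have rowh: "sylv_row M ?f i = of_int_poly (sylv_row M P i)" for i
      by (simp add: sylv_row_def of_int_poly_hom.hom_mult of_int_hom.map_poly_pderiv map_poly_monom)
    have "sylv_mat M ?f = map_mat real_of_int (sylv_mat M P)"
      by (rule eq_matI) (auto simp: sylv_mat_def rowh)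
    then have "det (sylv_mat M ?f) = real_of_int (det (sylv_mat M P))" by simp
    moreover have "\<bar>det (sylv_mat M P)\<bar> \<ge> 1" using det_sylv_mat_nonzero[OF h(1,2)] by linarith
    ultimately have "1 \<le> \<bar>det (sylv_mat M ?f)\<bar>" by (metis of_int_1_le_iff of_int_abs)
    also have "\<dots> \<le> fact K * ((real K * R ^ K * (c * H * p0 + p1)) * (c * H) ^ (2 * M - 1))"
    proof -
      have e: "(1 + R) * (real K * (real K * H * (real K * R ^ K))) = c * H" by (simp add: c_def)
      have k: "2 * M + 1 - 2 = 2 * M - 1" by simp
      have "degree ?f \<le> Suc M" "\<And>i. \<bar>coeff ?f i\<bar> \<le> H" using h by simp_all
      from det_sylv_mat_bound[OF M this(1) h(4) this(2) R h(3)]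
      show ?thesis unfolding K_def[symmetric] e p0_def p1_def using k by (simp add: K_def)
    qed
    also have "\<dots> \<le> fact K * ((real K * R ^ K * (c * (H * p0 + p1))) * (c * H) ^ (2 * M - 1))"
    proof -
      have "p1 \<le> c * p1" using mult_right_mono[OF c1 p(2)] by simp
      then have "c * H * p0 + p1 \<le> c * (H * p0 + p1)" by (simp add: algebra_simps)
      then show ?thesis using c1 h(4) RK by (intro mult_left_mono mult_right_mono) auto
    qed
    also have "\<dots> = D * (H * p0 + p1) * H ^ (2 * M - 1)" by (simp add: D_def power_mult_distrib mult_ac)
    finally show ?thesis by (simp add: p0_def p1_def)
  qed
  then show ?thesis using D1 by blast
qed

text \<open>The discriminant inequality times \<open>H\<close> reads \<open>H \<le> D *
  (|P(\<zeta>)| * H^(2M+1) + |P'(\<zeta>)|^2 * H^(2M))\<close>. The first summand is at most 1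
  because \<open>2 * M + 1 \<le> N + 1\<close>; if the derivative were below \<open>H^(-M)\<close>,
  so would be the second, and \<open>H\<close> would be bounded.\<close>

lemma derivative_not_small:
  fixes n N :: nat and R :: real
  assumes n: "n \<ge> 1" and N: "N \<ge> 2 * n + 1" and R: "R \<ge> 1"
  shows "\<exists>H0::real. \<forall>P \<zeta>. irreducible P \<longrightarrow> 1 \<le> degree P \<longrightarrow> degree P \<le> n \<longrightarrow> real_of_int (poly_height P) \<ge> H0 \<longrightarrow> \<bar>\<zeta>\<bar> \<le> R \<longrightarrow>
     \<bar>poly (of_int_poly P) \<zeta>\<bar> \<le> 1 / real_of_int (poly_height P) ^ (N + 1) \<longrightarrow>
     \<bar>poly (pderiv (of_int_poly P)) \<zeta>\<bar> \<ge> 1 / real_of_int (poly_height P) ^ (n - 1)"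
proof -
  let ?B = "\<lambda>M D. \<forall>P \<zeta>. \<forall>H::real. irreducible P \<longrightarrow> degree P = Suc M \<longrightarrow> \<bar>\<zeta>\<bar> \<le> R \<longrightarrow> H \<ge> 1 \<longrightarrow> (\<forall>i. \<bar>real_of_int (coeff P i)\<bar> \<le> H) \<longrightarrow>
    1 \<le> D * (H * \<bar>poly (of_int_poly P) \<zeta>\<bar> + \<bar>poly (pderiv (of_int_poly P)) \<zeta>\<bar>\<^sup>2) * H ^ (2 * M - 1)"
  have "\<forall>M. \<exists>D::real. M \<ge> 1 \<longrightarrow> D \<ge> 1 \<and> ?B M D" using irreducible_derivative_bound[OF _ R] by blast
  then obtain Df :: "nat \<Rightarrow> real" where "\<forall>M. M \<ge> 1 \<longrightarrow> Df M \<ge> 1 \<and> ?B M (Df M)" by (rule choice[THEN exE])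
  then have Df1: "Df M \<ge> 1" and Df: "?B M (Df M)" if "M \<ge> 1" for M using that by blast+
  define H0 where "H0 = 2 * (\<Sum>M\<in>{1..n}. Df M)"
  have DH: "2 * Df M \<le> H0" if "1 \<le> M" "M \<le> n" for M
  proof -
    have "Df M \<le> (\<Sum>M\<in>{1..n}. Df M)" using that Df1 by (intro member_le_sum) (auto intro: order_trans[of 0 1])
    then show ?thesis by (simp add: H0_def)
  qed
  have "\<bar>poly (pderiv (of_int_poly P)) \<zeta>\<bar> \<ge> 1 / real_of_int (poly_height P) ^ (n - 1)"
    if h: "irreducible P" "1 \<le> degree P" "degree P \<le> n" "real_of_int (poly_height P) \<ge> H0" "\<bar>\<zeta>\<bar> \<le> R"
     "\<bar>poly (of_int_poly P) \<zeta>\<bar> \<le> 1 / real_of_int (poly_height P) ^ (N + 1)" for P :: "int poly" and \<zeta>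
  proof -
    define H where "H = real_of_int (poly_height P)"
    have P0: "P \<noteq> 0" using h(2) by auto
    have H1: "H \<ge> 1" using poly_height_ge_1[OF P0] by (simp add: H_def)
    have cH: "\<forall>i. \<bar>real_of_int (coeff P i)\<bar> \<le> H" unfolding H_def using coeff_le_poly_height[of P]
      by (metis of_int_abs of_int_le_iff)
    obtain M where M: "degree P = Suc M" using h(2) by (cases "degree P") auto
    show ?thesis
    proof (cases "M = 0")
      case True
      \<comment> \<open>In degree 1 the derivative is a nonzero integer constant; the discriminant
        inequality is available only from degree 2 on.\<close>
      define b where "b = coeff P 1"
      have "P = [:coeff P 0, b:]"
        by (rule poly_eqI) (auto simp: b_def coeff_pCons coeff_eq_0 M True split: nat.splits)
      moreover have "b \<noteq> 0" using M True P0 leading_coeff_neq_0[of P] by (simp add: b_def)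
      ultimately obtain a where Pab: "P = [:a, b:]" "b \<noteq> 0" by blast
      then have "\<bar>poly (pderiv (of_int_poly P)) \<zeta>\<bar> = real_of_int \<bar>b\<bar>" by (simp add: of_int_poly_pCons pderiv_pCons)
      moreover have "real_of_int \<bar>b\<bar> \<ge> 1" using Pab(2) by linarith
      moreover have "1 / H ^ (n - 1) \<le> 1" using one_le_power[OF H1, of "n - 1"] by (simp add: divide_simps)
      ultimately show ?thesis unfolding H_def by linarith
    next
      case False
      then have M1: "M \<ge> 1" "M \<le> n" using M h(3) by auto
      define p0 where "p0 = \<bar>poly (of_int_poly P) \<zeta>\<bar>"
      define p1 where "p1 = \<bar>poly (pderiv (of_int_poly P)) \<zeta>\<bar>"
      have p: "p0 \<ge> 0" "p1 \<ge> 0" by (simp_all add: p0_def p1_def)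
      have main: "1 \<le> Df M * ((H * p0 + p1\<^sup>2) * H ^ (2 * M - 1))"
        using Df[OF M1(1)] h(1,5) M H1 cH unfolding p0_def p1_def by (simp add: mult.assoc)
      show ?thesis
      proof (rule ccontr)
        assume "\<not> ?thesis"
        then have "p1 < 1 / H ^ (n - 1)" unfolding p1_def H_def by simp
        also have "\<dots> \<le> 1 / H ^ M" using H1 M h(3) by (intro divide_left_mono power_increasing mult_pos_pos) auto
        finally have "p1 * H ^ M < 1" using H1 by (simp add: pos_less_divide_eq)
        moreover have "p1 * H ^ M \<ge> 0" using p H1 by simp
        ultimately have "(p1 * H ^ M)\<^sup>2 < 1" by (simp add: power_less_one_iff abs_square_less_1)
        then have a: "p1\<^sup>2 * H ^ (2 * M) < 1" by (simp add: power_mult_distrib power_mult[symmetric] mult.commute)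
        have "p0 * H ^ (2 * M + 1) \<le> p0 * H ^ (N + 1)" using H1 p N M1(2) by (intro mult_left_mono power_increasing) auto
        also have "\<dots> \<le> 1" using h(6) H1 unfolding p0_def H_def[symmetric] by (simp add: pos_le_divide_eq del: power_Suc)
        finally have b: "p0 * H ^ (2 * M + 1) \<le> 1" .
        have "H ^ (2 * M - 1) * H = H ^ (2 * M)" using M1 by (simp add: power_Suc2[symmetric] del: power_Suc)
        then have "((H * p0 + p1\<^sup>2) * H ^ (2 * M - 1)) * H = p0 * H ^ (2 * M + 1) + p1\<^sup>2 * H ^ (2 * M)"
        proof -
          assume e: "H ^ (2 * M - 1) * H = H ^ (2 * M)"
          have "((H * p0 + p1\<^sup>2) * H ^ (2 * M - 1)) * H = (H * p0 + p1\<^sup>2) * (H ^ (2 * M - 1) * H)" by (simp only: mult.assoc)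
          also have "\<dots> = p0 * H ^ (2 * M + 1) + p1\<^sup>2 * H ^ (2 * M)" unfolding e by (simp add: algebra_simps)
          finally show ?thesis .
        qed
        then have c: "((H * p0 + p1\<^sup>2) * H ^ (2 * M - 1)) * H < 2" using a b by linarith
        have "H \<le> (Df M * ((H * p0 + p1\<^sup>2) * H ^ (2 * M - 1))) * H" using mult_right_mono[OF main, of H] H1 by simp
        also have "\<dots> = Df M * (((H * p0 + p1\<^sup>2) * H ^ (2 * M - 1)) * H)" by (simp only: mult.assoc)
        also have "\<dots> < Df M * 2" using c Df1[OF M1(1)] by (intro mult_strict_left_mono) auto
        finally show False using DH[OF M1] h(4) unfolding H_def by linarith
      qed
    qed
  qed
  then show ?thesis by blast
qed

section \<open>Covering by small-value pieces\<close>

definition small_value_piece :: "real \<Rightarrow> nat \<Rightarrow> int poly \<Rightarrow> nat \<Rightarrow> real set" where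
  "small_value_piece R N P i = {\<zeta>. \<bar>\<zeta>\<bar> \<le> R \<and> \<bar>poly (of_int_poly P) \<zeta>\<bar> \<le> 1 / real_of_int (poly_height P) ^ (N + 1) \<and>
     card {z. poly (pderiv (of_int_poly P)) z = 0 \<and> z < \<zeta>} = i}"

text \<open>No zero of \<open>P'\<close> separates two points of the same piece, so \<open>P\<close> is monotone between them and stays small there.\<close>

lemma small_value_piece_dist:
  fixes P :: "int poly"
  assumes deg: "degree P \<ge> 1" and c: "c > 0"
    and der: "\<And>\<zeta>. \<bar>\<zeta>\<bar> \<le> R \<Longrightarrow> \<bar>poly (of_int_poly P) \<zeta>\<bar> \<le> 1 / real_of_int (poly_height P) ^ (N + 1) \<Longrightarrow> \<bar>poly (pderiv (of_int_poly P)) \<zeta>\<bar> \<ge> c"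
    and x: "x \<in> small_value_piece R N P i" and y: "y \<in> small_value_piece R N P i"
  shows "\<bar>x - y\<bar> \<le> 2 / real_of_int (poly_height P) ^ (N + 1) / c"
proof -
  let ?p = "of_int_poly P :: real poly"
  define \<epsilon> where "\<epsilon> = 1 / real_of_int (poly_height P) ^ (N + 1)"
  have "degree ?p \<noteq> 0" using deg by simp
  then have pd: "pderiv ?p \<noteq> 0" by (simp add: pderiv_eq_0_iff)
  have main: "y - x \<le> 2 * \<epsilon> / c" if xy: "x < y" and x: "x \<in> small_value_piece R N P i" and y: "y \<in> small_value_piece R N P i" for x y
  proof -
    have px: "\<bar>poly ?p x\<bar> \<le> \<epsilon>" and py: "\<bar>poly ?p y\<bar> \<le> \<epsilon>" and R: "\<bar>x\<bar> \<le> R" "\<bar>y\<bar> \<le> R"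
      using x y by (auto simp: small_value_piece_def \<epsilon>_def)
    let ?Z = "\<lambda>t. {z. poly (pderiv ?p) z = 0 \<and> z < t}"
    have "finite (?Z y)" using poly_roots_finite[OF pd] by (rule finite_subset[rotated]) auto
    moreover have "?Z x \<subseteq> ?Z y" using xy by auto
    moreover have "card (?Z x) = card (?Z y)" using x y by (simp add: small_value_piece_def)
    ultimately have Z: "?Z x = ?Z y" by (intro card_subset_eq)
    have noz: "poly (pderiv ?p) z \<noteq> 0" if "x < z" "z < y" for z
    proof
      assume "poly (pderiv ?p) z = 0"
      then have "z \<in> ?Z y" using that by simp
      then have "z \<in> ?Z x" by (simp only: Z)
      then show False using that by simp
    qed
    obtain z where z: "x < z" "z < y" "poly ?p y - poly ?p x = (y - x) * poly (pderiv ?p) z" using poly_MVT[OF xy] by blast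
    obtain a where a: "x < a" "a < z" "poly ?p z - poly ?p x = (z - x) * poly (pderiv ?p) a" using poly_MVT[OF z(1)] by blast
    obtain b where b: "z < b" "b < y" "poly ?p y - poly ?p z = (y - z) * poly (pderiv ?p) b" using poly_MVT[OF z(2)] by blast
    have ab: "a < b" using a b by linarith
    \<comment> \<open>A value beyond \<open>\<epsilon>\<close> between two points with smaller
      values forces slopes of opposite sign at \<open>a < z < b\<close>, hence a zero of the
      derivative between \<open>x\<close> and \<open>y\<close>. With this bound at \<open>z\<close>
      the hypothesis \<open>der\<close> applies there.\<close>
    have "\<bar>poly ?p z\<bar> \<le> \<epsilon>"
    proof (rule ccontr)
      assume "\<not> ?thesis"
      then consider "poly ?p z > \<epsilon>" | "poly ?p z < - \<epsilon>" by linarith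
      then show False
      proof cases
        case 1
        then have "(z - x) * poly (pderiv ?p) a > 0" "(y - z) * poly (pderiv ?p) b < 0" using a(3) b(3) px py by linarith+
        then have "poly (pderiv ?p) a > 0" "poly (pderiv ?p) b < 0" using z by (auto simp: zero_less_mult_iff mult_less_0_iff)
        then obtain w where "a < w" "w < b" "poly (pderiv ?p) w = 0" using poly_IVT_neg[OF ab] by blast
        then show False using noz[of w] a b by linarith
      next
        case 2
        then have "(z - x) * poly (pderiv ?p) a < 0" "(y - z) * poly (pderiv ?p) b > 0" using a(3) b(3) px py by linarith+
        then have "poly (pderiv ?p) a < 0" "poly (pderiv ?p) b > 0" using z by (auto simp: zero_less_mult_iff mult_less_0_iff)
        then obtain w where "a < w" "w < b" "poly (pderiv ?p) w = 0" using poly_IVT_pos[OF ab] by blast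
        then show False using noz[of w] a b by linarith
      qed
    qed
    then have "c \<le> \<bar>poly (pderiv ?p) z\<bar>" using der[of z] z R unfolding \<epsilon>_def by linarith
    then have "(y - x) * c \<le> (y - x) * \<bar>poly (pderiv ?p) z\<bar>" using xy by (intro mult_left_mono) auto
    also have "\<dots> = \<bar>poly ?p y - poly ?p x\<bar>" using xy by (simp add: z(3) abs_mult)
    also have "\<dots> \<le> 2 * \<epsilon>" using px py by linarith
    finally show ?thesis using c by (simp add: pos_le_divide_eq)
  qed
  have e: "\<epsilon> \<ge> 0" using order_trans[of 0 "\<bar>poly ?p x\<bar>" \<epsilon>] x by (simp add: small_value_piece_def \<epsilon>_def)
  have "\<bar>x - y\<bar> \<le> 2 * \<epsilon> / c"
  proof (cases "x = y")
    case True then show ?thesis using e c by simp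
  next
    case False then show ?thesis using main[OF _ x y] main[OF _ y x] by linarith
  qed
  then show ?thesis by (simp add: \<epsilon>_def)
qed

text \<open>The polynomials are grouped by dyadic height: block \<open>j\<close> has
  \<open>O(2^(j(n+1)))\<close> of them, each with at most \<open>n + 1\<close> pieces of length at
  most \<open>2 / 2^(jE)\<close>. The weights form a geometric series, and every point under
  consideration lies in pieces of arbitrarily large height.\<close>

lemma hausdorff_measure_well_approximable:
  fixes n N :: nat and R l s :: real
  assumes n: "n \<ge> 1" and N: "N \<ge> 2 * n + 1" and l: "l > 1 / real n" and R: "R \<ge> 1"
    and s: "s > (real n + 1) / (real N - real n + 1)"
  shows "hausdorff_measure s {\<zeta>. \<bar>\<zeta>\<bar> \<le> R \<and> l \<in> approx_exponents N \<zeta> \<and>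
     (\<forall>P::int poly. P \<noteq> 0 \<longrightarrow> degree P \<le> n \<longrightarrow> poly (of_int_poly P) \<zeta> \<noteq> 0)} = 0"
proof -
  \<comment> \<open>The exponent \<open>N + 1\<close> of the value minus the exponent
    \<open>n - 1\<close> lost through the slope.\<close>
  define E where "E = N + 2 - n"
  have E: "n - 1 + E = N + 1" "real E = real N + 2 - real n" "E \<ge> 1" using n N by (auto simp: E_def)
  have dpos: "real N - real n + 1 > 0" using N by simp
  have "(real n + 1) / (real N - real n + 1) > 0" using dpos by simp
  then have s0: "s > 0" using s by linarith
  have "real n + 1 < s * (real N - real n + 1)" using s dpos by (simp add: pos_divide_less_eq)
  then have sE: "real n + 1 < real E * s" using s0 by (simp add: E(2) algebra_simps)
  obtain H0 where der: "\<forall>P \<zeta>. irreducible P \<longrightarrow> 1 \<le> degree P \<longrightarrow> degree P \<le> n \<longrightarrow> real_of_int (poly_height P) \<ge> H0 \<longrightarrow> \<bar>\<zeta>\<bar> \<le> R \<longrightarrow>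
     \<bar>poly (of_int_poly P) \<zeta>\<bar> \<le> 1 / real_of_int (poly_height P) ^ (N + 1) \<longrightarrow>
     \<bar>poly (pderiv (of_int_poly P)) \<zeta>\<bar> \<ge> 1 / real_of_int (poly_height P) ^ (n - 1)"
    using derivative_not_small[OF n N R] by (elim exE) (rule that)
  obtain j0 :: nat where j0: "H0 \<le> 2 ^ j0" using real_arch_pow[of 2 H0] by (auto intro: less_imp_le)
  \<comment> \<open>Consecutive blocks overlap at powers of 2, which affects the count only by
    constants.\<close>
  define F where "F j = {P::int poly. irreducible P \<and> 1 \<le> degree P \<and> degree P \<le> n \<and> 2 ^ j \<le> poly_height P \<and> poly_height P \<le> 2 ^ Suc j}" for j :: nat
  define \<C> where "\<C> j = (if j0 \<le> j then (\<lambda>(P, i). small_value_piece R N P i) ` (F j \<times> {..n}) else {})" for j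
  define \<rho> where "\<rho> j = (2 / (2 ^ j) ^ E :: real)" for j :: nat
  have \<rho>_eq: "\<rho> j = 2 * (1 / 2 ^ E) ^ j" for j by (simp add: \<rho>_def power_divide power_mult[symmetric] mult.commute)
  have box: "F j \<subseteq> {P. degree P \<le> n \<and> poly_height P \<le> 2 ^ Suc j}" for j by (auto simp: F_def)
  have finF: "finite (F j)" for j using box poly_height_box(1)[of "2 ^ Suc j" n] by (rule finite_subset) simp
  have cardC: "real (card (\<C> j)) \<le> real (n + 1) * (5 * 2 ^ j) ^ (n + 1)" for j
  proof (cases "j0 \<le> j")
    case True
    have "card (\<C> j) \<le> card (F j \<times> {..n})" unfolding \<C>_def using True finF by (simp only: if_True) (rule card_image_le, simp)
    also have "\<dots> = (n + 1) * card (F j)" by (simp add: card_cartesian_product)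
    also have "\<dots> \<le> (n + 1) * nat (2 * 2 ^ Suc j + 1) ^ Suc n"
      using card_mono[OF poly_height_box(1)[of "2 ^ Suc j" n] box] poly_height_box(2)[of "2 ^ Suc j" n] by (intro mult_left_mono) auto
    also have "nat (2 * 2 ^ Suc j + 1) = 4 * 2 ^ j + 1" by (simp add: nat_add_distrib nat_mult_distrib nat_power_eq)
    finally have "real (card (\<C> j)) \<le> real ((n + 1) * (4 * 2 ^ j + 1) ^ Suc n)" by (simp only: of_nat_le_iff)
    also have "\<dots> = real (n + 1) * (4 * 2 ^ j + 1) ^ (n + 1)"
      by (simp add: algebra_simps del: power_Suc)
    also have "\<dots> \<le> real (n + 1) * (5 * 2 ^ j) ^ (n + 1)" by (intro mult_left_mono power_mono) auto
    finally show ?thesis .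
  next
    case False then show ?thesis by (simp add: \<C>_def)
  qed
  have diam: "bounded S \<and> diameter S \<le> \<rho> j" if S: "S \<in> \<C> j" for j S
  proof
    have jj: "j0 \<le> j" using S by (auto simp: \<C>_def split: if_splits)
    then obtain P i where P: "P \<in> F j" "S = small_value_piece R N P i" using S by (auto simp: \<C>_def)
    have "S \<subseteq> cball 0 R" by (auto simp: P(2) small_value_piece_def)
    then show "bounded S" using bounded_cball bounded_subset by blast
    define H where "H = real_of_int (poly_height P)"
    have "real_of_int (2 ^ j) \<le> H" using P(1) unfolding F_def H_def by (simp only: of_int_le_iff mem_Collect_eq)
    then have Hj: "2 ^ j \<le> H" by simp
    have H1: "H \<ge> 1" using Hj one_le_power[of "2::real" j] by linarith
    have "(2::real) ^ j0 \<le> 2 ^ j" using jj by (intro power_increasing) auto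
    then have HH0: "H0 \<le> H" using j0 Hj by linarith
    have c: "1 / H ^ (n - 1) > 0" using H1 by simp
    have *: "\<bar>x - y\<bar> \<le> \<rho> j" if "x \<in> S" "y \<in> S" for x y
    proof -
      have "\<bar>x - y\<bar> \<le> 2 / H ^ (N + 1) / (1 / H ^ (n - 1))" unfolding H_def
        using P(1) that HH0 der c unfolding P(2) F_def H_def by (intro small_value_piece_dist) auto
      also have "\<dots> = 2 / H ^ E" using H1 unfolding E(1)[symmetric] power_add by simp
      also have "\<dots> \<le> \<rho> j" unfolding \<rho>_def using Hj H1 by (intro divide_left_mono power_mono mult_pos_pos) auto
      finally show ?thesis .
    qed
    show "diameter S \<le> \<rho> j" by (rule diameter_le) (use * in \<open>auto simp: \<rho>_def\<close>)
  qed
  \<comment> \<open>The ratio of the series: from one block to the next the number of polynomials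
    grows by \<open>2^(n+1)\<close> and the weight of a piece shrinks by
    \<open>2^(-E s)\<close>.\<close>
  define q where "q = 2 ^ (n + 1) * (1 / 2 ^ E) powr s"
  have q0: "q \<ge> 0" by (simp add: q_def)
  have "q = 2 powr (real (n + 1)) * 2 powr (- real E * s)"
  proof -
    have "(1 / 2 ^ E) = (2::real) powr (- real E)" by (simp add: powr_minus powr_realpow inverse_eq_divide)
    then have "(1 / 2 ^ E) powr s = (2::real) powr (- real E * s)" by (simp only: powr_powr)
    moreover have "(2::real) ^ (n + 1) = 2 powr (real (n + 1))" by (rule powr_realpow[symmetric]) simp
    ultimately show ?thesis unfolding q_def by (simp only:)
  qed
  also have "\<dots> = 2 powr (real (n + 1) + - real E * s)" by (simp only: powr_add)
  also have "\<dots> < 2 powr 0" using sE by (intro powr_less_mono) auto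
  finally have q1: "q < 1" by simp
  define c where "c = real (n + 1) * 5 ^ (n + 1) * 2 powr s"
  have summand_le: "real (card (\<C> j)) * \<rho> j powr s \<le> c * q ^ j" for j
  proof -
    have "\<rho> j powr s = 2 powr s * ((1 / 2 ^ E) ^ j) powr s" unfolding \<rho>_eq by (simp add: powr_mult)
    also have "((1 / 2 ^ E) ^ j) powr s = ((1 / 2 ^ E :: real) powr s) ^ j"
    proof -
      have "((1 / 2 ^ E) ^ j) powr s = ((1 / 2 ^ E :: real) powr real j) powr s" by (simp add: powr_realpow)
      also have "\<dots> = ((1 / 2 ^ E) powr s) powr real j" by (simp only: powr_powr mult.commute)
      also have "\<dots> = ((1 / 2 ^ E) powr s) ^ j" by (rule powr_realpow) simp
      finally show ?thesis .
    qed
    finally have r: "\<rho> j powr s = 2 powr s * ((1 / 2 ^ E) powr s) ^ j" .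
    have "real (card (\<C> j)) * \<rho> j powr s \<le> (real (n + 1) * (5 * 2 ^ j) ^ (n + 1)) * \<rho> j powr s"
      by (intro mult_right_mono cardC) simp
    also have "\<dots> = c * q ^ j" unfolding r c_def q_def
      by (simp add: power_mult_distrib power_mult[symmetric] mult_ac del: power_Suc)
    finally show ?thesis .
  qed
  show ?thesis
  proof (rule hausdorff_measure_limsup[where \<C> = \<C> and \<rho> = \<rho>, OF s0])
    show "finite (\<C> j)" for j by (simp add: \<C>_def finF)
    show "bounded S \<and> diameter S \<le> \<rho> j" if "S \<in> \<C> j" for S j using diam[OF that] .
    have "(\<lambda>j. 2 * (1 / 2 ^ E) ^ j) \<longlonglongrightarrow> 2 * (0::real)"
      using E(3) one_less_power[of "2::real" E] by (intro tendsto_mult tendsto_const LIMSEQ_power_zero) (simp add: divide_simps)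
    then show "\<rho> \<longlonglongrightarrow> 0" unfolding \<rho>_eq[abs_def] by simp
    have "summable (\<lambda>j. c * q ^ j)" using q0 q1 by (intro summable_mult summable_geometric) simp
    then show "summable (\<lambda>j. real (card (\<C> j)) * \<rho> j powr s)"
      by (rule summable_comparison_test'[where N = 0]) (use summand_le in auto)
    fix x k
    assume x: "x \<in> {\<zeta>. \<bar>\<zeta>\<bar> \<le> R \<and> l \<in> approx_exponents N \<zeta> \<and>
     (\<forall>P::int poly. P \<noteq> 0 \<longrightarrow> degree P \<le> n \<longrightarrow> poly (of_int_poly P) \<zeta> \<noteq> 0)}"
    define k' where "k' = max k j0"
    have "(1::int) \<le> 2 ^ k'" by simp
    then have "\<exists>P. irreducible P \<and> 1 \<le> degree P \<and> degree P \<le> n \<and> poly_height P > 2 ^ k' \<and>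
       \<bar>poly (of_int_poly P) x\<bar> \<le> 1 / real_of_int (poly_height P) ^ (N + 1)"
      using x by (intro irreducible_approximations[OF n N l _ R]) auto
    then obtain P where P: "irreducible P" "1 \<le> degree P" "degree P \<le> n" "poly_height P > 2 ^ k'"
      "\<bar>poly (of_int_poly P) x\<bar> \<le> 1 / real_of_int (poly_height P) ^ (N + 1)" by blast
    define h where "h = nat (poly_height P)"
    have h: "int h = poly_height P" using P(4) order_trans[of 0 "2 ^ k'" "poly_height P"] by (simp add: h_def)
    have "h \<ge> 1" using h P(4) one_le_power[of "2::int" k'] by linarith
    then obtain j where j: "2 ^ j \<le> h" "h < 2 ^ (j + 1)" using ex_power_ivl1[of 2 h] by auto
    have "int (2 ^ j) \<le> int h" "int h < int (2 ^ (j + 1))" using j by (simp_all only: of_nat_le_iff of_nat_less_iff)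
    then have j': "2 ^ j \<le> poly_height P" "poly_height P < 2 ^ (j + 1)" by (simp_all add: h)
    have "(2::int) ^ k' < 2 ^ (j + 1)" using j'(2) P(4) by linarith
    then have kj: "k' \<le> j" by (simp add: power_strict_increasing_iff del: power_Suc)
    let ?Z = "{z. poly (pderiv (of_int_poly P)) z = 0 \<and> z < x}"
    have pd: "pderiv (of_int_poly P :: real poly) \<noteq> 0" using P(2) by (simp add: pderiv_eq_0_iff)
    have "card ?Z \<le> card {z. poly (pderiv (of_int_poly P)) z = (0::real)}" using poly_roots_finite[OF pd] by (intro card_mono) auto
    also have "\<dots> \<le> degree (pderiv (of_int_poly P :: real poly))" using pd by (rule card_poly_roots_bound)
    also have "\<dots> \<le> n" using P(3) by (simp add: degree_pderiv)
    finally have "card ?Z \<in> {..n}" by simp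
    moreover have "P \<in> F j" using P j' by (simp add: F_def)
    ultimately have "small_value_piece R N P (card ?Z) \<in> \<C> j" using kj by (auto simp: \<C>_def k'_def)
    moreover have "x \<in> small_value_piece R N P (card ?Z)" using x P(5) by (simp add: small_value_piece_def)
    ultimately show "\<exists>j\<ge>k. \<exists>S\<in>\<C> j. x \<in> S" using kj by (intro exI[of _ j]) (auto simp: k'_def)
  qed
qed

lemma countable_int_poly_roots: "countable {\<zeta>::real. \<exists>P::int poly. P \<noteq> 0 \<and> poly (of_int_poly P) \<zeta> = 0}"
proof -
  have "inj (coeffs :: int poly \<Rightarrow> int list)" by (rule injI) (simp add: coeffs_eq_iff)
  then have "countable (UNIV :: int poly set)" by (rule countableI')
  then have "countable (\<Union>P\<in>- {0::int poly}. {\<zeta>::real. poly (of_int_poly P) \<zeta> = 0})"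
    by (intro countable_UN) (auto intro: countable_subset countable_finite poly_roots_finite)
  then show ?thesis by (rule countable_subset[rotated]) auto
qed

text \<open>The roots of integer polynomials form a countable set and are treated separately; a
  countable union removes the bound on \<open>|\<zeta>|\<close>. The strict inequality in
  \<open>g_dim\<close> places \<open>l\<close> itself among the approximation exponents, so no limit
  in \<open>l\<close> has to be taken.\<close>

lemma g_dim_upper_bound:
  assumes n: "n \<ge> 1" and N: "N \<ge> 2 * n + 1" and l: "l > 1 / real n"
  shows "g_dim N l \<le> ereal ((real n + 1) / (real N - real n + 1))"
  unfolding g_dim_def
proof (rule hausdorff_dim_leI)
  show "0 \<le> (real n + 1) / (real N - real n + 1)" using N by (intro divide_nonneg_nonneg) auto
  fix s assume s: "s > (real n + 1) / (real N - real n + 1)"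
  have "(real n + 1) / (real N - real n + 1) > 0" using N by (intro divide_pos_pos) auto
  then have s0: "s > 0" using s by linarith
  let ?T = "\<lambda>\<zeta>::real. \<forall>P::int poly. P \<noteq> 0 \<longrightarrow> degree P \<le> n \<longrightarrow> poly (of_int_poly P) \<zeta> \<noteq> 0"
  define Alg where "Alg = {\<zeta>::real. \<exists>P::int poly. P \<noteq> 0 \<and> poly (of_int_poly P) \<zeta> = 0}"
  define A where "A k = (if k = 0 then Alg else {\<zeta>. \<bar>\<zeta>\<bar> \<le> real k \<and> l \<in> approx_exponents N \<zeta> \<and> ?T \<zeta>})" for k :: nat
  have "hausdorff_measure s (A k) = 0" for k
  proof (cases "k = 0")
    case True then show ?thesis using hausdorff_measure_countable[OF countable_int_poly_roots s0] by (simp add: A_def Alg_def)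
  next
    case False then show ?thesis using hausdorff_measure_well_approximable[OF n N l _ s, of "real k"] by (simp add: A_def)
  qed
  then have "hausdorff_measure s (\<Union>k. A k) = 0" by (rule hausdorff_measure_zero_UN)
  moreover have "{\<zeta>. lambda_exp N \<zeta> > ereal l} \<subseteq> (\<Union>k. A k)"
  proof
    fix \<zeta> assume "\<zeta> \<in> {\<zeta>. lambda_exp N \<zeta> > ereal l}"
    then obtain l' where l': "l' \<in> approx_exponents N \<zeta>" "l < l'" by (auto simp: lambda_exp_def less_SUP_iff)
    have la: "l \<in> approx_exponents N \<zeta>" using approx_exponents_mono[OF l'(1)] l'(2) by simp
    show "\<zeta> \<in> (\<Union>k. A k)"
    proof (cases "\<zeta> \<in> Alg")
      case True then show ?thesis by (intro UN_I[of 0]) (auto simp: A_def)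
    next
      case False
      have "\<bar>\<zeta>\<bar> \<le> real (Suc (nat \<lceil>\<bar>\<zeta>\<bar>\<rceil>))" by linarith
      then show ?thesis using False la by (intro UN_I[of "Suc (nat \<lceil>\<bar>\<zeta>\<bar>\<rceil>)"]) (auto simp: A_def Alg_def)
    qed
  qed
  ultimately show "hausdorff_measure s {\<zeta>. lambda_exp N \<zeta> > ereal l} = 0" by (rule hausdorff_measure_zero_mono)
qed

section \<open>The intervals and the threshold\<close>

text \<open>For \<open>n < N\<close>, the endpoint \<open>(N + 2) / den N n\<close> is the value of
  \<open>l\<close> at which \<open>lower_bd N n l\<close> and \<open>lower_bd N (n + 1) l\<close>
  coincide. The identity behind it is
  \<open>(n + 2) (N + 1 - n) - (n + 1) (N - n) = N + 2\<close>.\<close>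

definition den :: "nat \<Rightarrow> nat \<Rightarrow> real" where
  "den N n = real N + 2 * real N * real n + real n - (real n)\<^sup>2"

lemma den_pos: "n \<le> N \<Longrightarrow> N \<ge> 1 \<Longrightarrow> den N n > 0"
proof -
  assume h: "n \<le> N" "N \<ge> 1"
  have "real n * real n \<le> real N * real n" using h by (intro mult_right_mono) auto
  moreover have "real N * real n \<ge> 0" by simp
  ultimately show ?thesis using h unfolding den_def power2_eq_square by linarith
qed

lemma den_strict_mono: "m < n \<Longrightarrow> n \<le> N \<Longrightarrow> den N m < den N n"
proof -
  assume h: "m < n" "n \<le> N"
  have "den N n - den N m = (real n - real m) * ((real N - real n) + (real N - real m) + 1)"
    by (simp add: den_def power2_eq_square algebra_simps)
  moreover have "\<dots> > 0" using h by (intro mult_pos_pos) auto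
  ultimately show ?thesis by linarith
qed

lemma den_1: "den N 1 = 3 * real N"
  by (simp add: den_def)

lemma den_self: "den N N = real N * (real N + 2)"
  by (simp add: den_def power2_eq_square algebra_simps)

lemma I_int_den:
  assumes "n \<ge> 1"
  shows "I_int N n = (if n = 1 then {(real N + 2) / den N 1..}
      else {(real N + 2) / den N n ..< (real N + 2) / den N (n - 1)})"
proof -
  have "den N (n - 1) = real N + 2 * (real n - 1) * real N + (real n - 1) - (real n - 1)\<^sup>2"
    using assms by (simp add: den_def of_nat_diff)
  then show ?thesis by (simp only: I_int_def den_1) (simp only: den_def)
qed

lemma endpoint_less: "m < n \<Longrightarrow> n \<le> N \<Longrightarrow> (real N + 2) / den N n < (real N + 2) / den N m"
  using den_strict_mono[of m n N] den_pos[of m N] den_pos[of n N] by (intro divide_strict_left_mono mult_pos_pos) auto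

lemma endpoint_le: "m \<le> n \<Longrightarrow> n \<le> N \<Longrightarrow> (real N + 2) / den N n \<le> (real N + 2) / den N m"
  using endpoint_less[of m n N] by (cases "m = n") auto

lemma endpoint_self: "(real N + 2) / den N N = 1 / real N"
  using nonzero_divide_mult_cancel_right[of "real N + 2" "real N"] by (simp add: den_self)

lemma I_int_subset:
  assumes "n \<in> {1..N}" shows "I_int N n \<subseteq> {1 / real N..}"
proof -
  have "1 / real N \<le> (real N + 2) / den N n" using endpoint_le[of n N N] endpoint_self[of N] assms by simp
  then show ?thesis using assms by (auto simp: I_int_den)
qed

lemma I_int_nonempty: "n \<in> {1..N} \<Longrightarrow> I_int N n \<noteq> {}"
  using endpoint_less[of "n - 1" n N] by (auto simp: I_int_den)

lemma disjoint_family_I_int: "disjoint_family_on (I_int N) {1..N}"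
proof -
  have "I_int N m \<inter> I_int N n = {}" if h: "1 \<le> m" "m < n" "n \<le> N" for m n
  proof -
    have le: "(real N + 2) / den N (n - 1) \<le> (real N + 2) / den N m" using h by (intro endpoint_le) auto
    then show ?thesis using h by (auto simp: I_int_den)
  qed
  then show ?thesis unfolding disjoint_family_on_def
    by (metis (no_types, opaque_lifting) Int_commute atLeastAtMost_iff linorder_neqE_nat)
qed

lemma I_int_cover:
  assumes "x \<ge> 1 / real N" "N \<ge> 1" shows "\<exists>n\<in>{1..N}. x \<in> I_int N n"
proof -
  let ?P = "\<lambda>n. n \<ge> 1 \<and> (real N + 2) / den N n \<le> x"
  have PN: "?P N" using assms endpoint_self[of N] by simp
  define n where "n = (LEAST n. ?P n)"
  have n: "?P n" unfolding n_def by (rule LeastI[of ?P, OF PN])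
  have nN: "n \<le> N" unfolding n_def by (rule Least_le[of ?P, OF PN])
  \<comment> \<open>For \<open>n = 1\<close> this holds merely because \<open>n - 1\<close> is 0;
    the interval of index 1 has no right endpoint, so nothing more is required.\<close>
  have "\<not> ?P (n - 1)" using n unfolding n_def by (intro not_less_Least) auto
  then have "x \<in> I_int N n" using n by (auto simp: I_int_den)
  then show ?thesis using n nN by (intro bexI[of _ n]) auto
qed

lemma partition_on_I_int:
  assumes "N \<ge> 1" shows "partition_on {1 / real N..} (I_int N ` {1..N})"
proof (rule partition_onI)
  show "\<Union> (I_int N ` {1..N}) = {1 / real N..}"
    using I_int_subset I_int_cover[OF _ assms] by blast
  show "disjnt p q" if pq: "p \<in> I_int N ` {1..N}" "q \<in> I_int N ` {1..N}" "p \<noteq> q" for p q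
  proof -
    obtain m n where mn: "m \<in> {1..N}" "n \<in> {1..N}" "p = I_int N m" "q = I_int N n" using pq by (elim imageE) (rule that)
    then have "m \<noteq> n" using pq(3) by auto
    then show ?thesis using disjoint_family_onD[OF disjoint_family_I_int mn(1,2)] by (simp add: disjnt_def mn)
  qed
  show "{} \<notin> I_int N ` {1..N}"
  proof
    assume "{} \<in> I_int N ` {1..N}"
    then obtain n where "{} = I_int N n" "n \<in> {1..N}" by (rule imageE)
    then show False using I_int_nonempty[of n N] by simp
  qed
qed

lemma lower_bd_1: "lower_bd N 1 l = 2 / ((1 + l) * real N)"
  by (simp add: lower_bd_def)

text \<open>With \<open>n = m + 1\<close> the right endpoint gives
  \<open>(1 - m l) * den N m > (m + 1) (N - m)\<close>. The comparison then reduces to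
  \<open>2 * den N m \<le> (m + 2) (m + 1) N\<close>, where the difference of the two sides factors
  as \<open>(N + 2) m (m - 1)\<close>.\<close>

lemma lower_bd_gt:
  assumes N: "N \<ge> 2" and l: "l < 1 / 3 + 2 / (3 * real N)" and n: "n \<in> {1..N}" and lI: "l \<in> I_int N n"
  shows "lower_bd N n l > 2 / ((1 + l) * real N)"
proof -
  have "1 / 3 + 2 / (3 * real N) = (real N + 2) / den N 1" using N unfolding den_1 by (simp add: field_simps)
  with l have "n \<noteq> 1" using lI by (auto simp: I_int_den)
  with n obtain m where m: "n = Suc m" "m \<ge> 1" "m < N" by (cases n) auto
  have dm: "den N m > 0" using m by (intro den_pos) auto
  have l0: "l > 0" using I_int_subset[OF n] lI N by (auto intro: less_le_trans[of 0 "1 / real N"])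
  have "l < (real N + 2) / den N m" using lI m by (auto simp: I_int_den)
  then have "l * den N m < real N + 2" using dm by (simp add: field_simps)
  then have "real m * (l * den N m) < real m * (real N + 2)" using m by (intro mult_strict_left_mono) auto
  then have a: "(1 - real m * l) * den N m > den N m - real m * (real N + 2)" by (simp add: algebra_simps)
  have b: "den N m - real m * (real N + 2) = (real m + 1) * (real N - real m)"
    by (simp add: den_def power2_eq_square algebra_simps)
  have c: "(real m + 2) * (real m + 1) * real N - 2 * den N m = (real N + 2) * real m * (real m - 1)"
    by (simp add: den_def power2_eq_square algebra_simps)
  have c': "(real N + 2) * real m * (real m - 1) \<ge> 0" using m by auto
  have Nm: "real N - real m > 0" using m by simp
  have "2 * (real N - real m) * den N m \<le> (real m + 2) * (real m + 1) * real N * (real N - real m)"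
  proof -
    have "0 \<le> ((real m + 2) * (real m + 1) * real N - 2 * den N m) * (real N - real m)"
      using mult_nonneg_nonneg[OF c' less_imp_le[OF Nm]] by (simp only: c)
    then show ?thesis by (simp add: algebra_simps)
  qed
  also have "\<dots> = (real m + 2) * real N * ((real m + 1) * (real N - real m))" by (simp add: algebra_simps)
  also have "\<dots> < (real m + 2) * real N * ((1 - real m * l) * den N m)" using a b N by (intro mult_strict_left_mono) auto
  finally have "(2 * (real N - real m)) * den N m < ((real m + 2) * real N * (1 - real m * l)) * den N m"
    by (simp add: algebra_simps)
  then have "2 * (real N - real m) < (real m + 2) * real N * (1 - real m * l)"
    using dm by (simp add: mult_less_cancel_right_pos)
  then have "2 * ((1 + l) * (real N - real m)) < (real m + 2) * (1 - real m * l) * ((1 + l) * real N)"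
  proof -
    assume h: "2 * (real N - real m) < (real m + 2) * real N * (1 - real m * l)"
    have "(1 + l) * (2 * (real N - real m)) < (1 + l) * ((real m + 2) * real N * (1 - real m * l))"
      using h l0 by (intro mult_strict_left_mono) auto
    then show ?thesis by (simp add: algebra_simps)
  qed
  then have "2 / ((1 + l) * real N) < (real m + 2) * (1 - real m * l) / ((1 + l) * (real N - real m))"
    using l0 N Nm by (simp add: pos_divide_less_eq pos_less_divide_eq)
  also have "\<dots> = lower_bd N n l" by (simp add: lower_bd_def m algebra_simps)
  finally show ?thesis .
qed

text \<open>With \<open>N = 2 n + k\<close> the numerator of \<open>\<gamma>\<close> factors as
  \<open>(n + k + 2) k\<close>, so \<open>\<gamma> = (n + k + 2) / (n + 1)\<close>. The denominator
  \<open>D\<close> of the threshold then satisfies \<open>(n + 1) D = n (n + 1) - k (k + 1)\<close>;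
  as \<open>1 \<le> k < n\<close>, it lies strictly between 0 and \<open>n\<close>.\<close>

lemma gamma_threshold:
  fixes N n :: nat
  assumes n: "n > 0" and r: "real N / real n \<in> {2<..<3}"
  defines "\<gamma> \<equiv> ((real N)\<^sup>2 + 2 * (real n)\<^sup>2 - 3 * real N * real n + 2 * real N - 4 * real n)
                / ((real n + 1) * (real N - 2 * real n))"
  assumes l: "l \<ge> 1 / ((1 - \<gamma>) * real N + (2 * \<gamma> - 1) * real n)"
  shows "N \<ge> 2 * n + 1" "l > 1 / real n"
proof -
  have "2 * real n < real N" "real N < 3 * real n" using r n by (auto simp: field_simps)
  then show N: "N \<ge> 2 * n + 1" by linarith
  define k where "k = N - 2 * n"
  have k: "N = 2 * n + k" "k \<ge> 1" "k < n" using N \<open>real N < 3 * real n\<close> by (auto simp: k_def)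
  have "(real N)\<^sup>2 + 2 * (real n)\<^sup>2 - 3 * real N * real n + 2 * real N - 4 * real n = (real n + real k + 2) * real k"
    by (simp add: k power2_eq_square algebra_simps)
  moreover have "real N - 2 * real n = real k" by (simp add: k)
  ultimately have g: "\<gamma> = (real n + real k + 2) / (real n + 1)" using k by (simp add: \<gamma>_def)
  define D where "D = (1 - \<gamma>) * real N + (2 * \<gamma> - 1) * real n"
  have g': "\<gamma> * (real n + 1) = real n + real k + 2" by (simp add: g)
  have D_eq: "D = real n + real k - \<gamma> * real k" by (simp add: D_def k algebra_simps)
  have "D * (real n + 1) = (real n + real k) * (real n + 1) - (\<gamma> * (real n + 1)) * real k"
    unfolding D_eq by (simp add: algebra_simps)
  then have D: "D * (real n + 1) = real n * (real n + 1) - real k * (real k + 1)" unfolding g' by (simp add: algebra_simps)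
  have "real k * (real k + 1) < real n * (real n + 1)" using k by (intro mult_strict_mono) auto
  then have "D * (real n + 1) > 0" using D by linarith
  then have D0: "D > 0" by (simp add: zero_less_mult_iff)
  have "real k * (real k + 1) > 0" using k by simp
  then have "D * (real n + 1) < real n * (real n + 1)" using D by linarith
  then have "D < real n" by (simp add: mult_less_cancel_right)
  then have "1 / real n < 1 / D" using D0 n by (intro divide_strict_left_mono) auto
  then show "l > 1 / real n" using l unfolding D_def by linarith
qed

theorem theorem4p9:
  fixes N :: nat
  assumes "N \<ge> 2"
  shows "partition_on {1 / real N..} (I_int N ` {1..N}) \<and> disjoint_family_on (I_int N) {1..N} \<and>
    (\<forall>n\<in>{1..N}. \<forall>l\<in>I_int N n. h_dim N l \<ge> ereal (lower_bd N n l)) \<and>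
    (\<forall>l\<in>I_int N 1. lower_bd N 1 l = 2 / ((1 + l) * real N)) \<and>
    (\<forall>l\<in>{1 / real N..<1 / 3 + 2 / (3 * real N)}. \<forall>n\<in>{1..N}. l \<in> I_int N n \<longrightarrow>
       lower_bd N n l > 2 / ((1 + l) * real N)) \<and>
    (\<forall>n::nat. n > 0 \<and> real N / real n \<in> {2<..<3} \<longrightarrow>
       (let \<gamma> = ((real N)\<^sup>2 + 2 * (real n)\<^sup>2 - 3 * real N * real n + 2 * real N - 4 * real n)
                / ((real n + 1) * (real N - 2 * real n))
        in \<forall>l::real. l \<ge> 1 / ((1 - \<gamma>) * real N + (2 * \<gamma> - 1) * real n) \<longrightarrow>
             g_dim N l \<le> ereal ((real n + 1) / (real N - real n + 1))))"
proof (intro conjI)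
  have N1: "N \<ge> 1" using assms by simp
  show "partition_on {1 / real N..} (I_int N ` {1..N})" by (rule partition_on_I_int[OF N1])
  show "disjoint_family_on (I_int N) {1..N}" by (rule disjoint_family_I_int)
  show "\<forall>n\<in>{1..N}. \<forall>l\<in>I_int N n. h_dim N l \<ge> ereal (lower_bd N n l)"
  proof (intro ballI)
    fix n l assume n: "n \<in> {1..N}" and l: "l \<in> I_int N n"
    have "l \<ge> 1 / real N" using I_int_subset[OF n] l by auto
    then show "h_dim N l \<ge> ereal (lower_bd N n l)" by (rule h_dim_lower_bound[OF assms n])
  qed
  show "\<forall>l\<in>I_int N 1. lower_bd N 1 l = 2 / ((1 + l) * real N)" using lower_bd_1 by blast
  show "\<forall>l\<in>{1 / real N..<1 / 3 + 2 / (3 * real N)}. \<forall>n\<in>{1..N}. l \<in> I_int N n \<longrightarrow>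
       lower_bd N n l > 2 / ((1 + l) * real N)" using lower_bd_gt[OF assms] by auto
  show "\<forall>n::nat. n > 0 \<and> real N / real n \<in> {2<..<3} \<longrightarrow>
       (let \<gamma> = ((real N)\<^sup>2 + 2 * (real n)\<^sup>2 - 3 * real N * real n + 2 * real N - 4 * real n)
                / ((real n + 1) * (real N - 2 * real n))
        in \<forall>l::real. l \<ge> 1 / ((1 - \<gamma>) * real N + (2 * \<gamma> - 1) * real n) \<longrightarrow>
             g_dim N l \<le> ereal ((real n + 1) / (real N - real n + 1)))"
    unfolding Let_def
  proof (intro allI impI, elim conjE)
    fix n :: nat and l :: real
    assume n: "n > 0" and r: "real N / real n \<in> {2<..<3}"
      and l: "1 / ((1 - ((real N)\<^sup>2 + 2 * (real n)\<^sup>2 - 3 * real N * real n + 2 * real N - 4 * real n)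
                / ((real n + 1) * (real N - 2 * real n))) * real N +
           (2 * (((real N)\<^sup>2 + 2 * (real n)\<^sup>2 - 3 * real N * real n + 2 * real N - 4 * real n)
                / ((real n + 1) * (real N - 2 * real n))) - 1) * real n) \<le> l"
    show "g_dim N l \<le> ereal ((real n + 1) / (real N - real n + 1))"
      using gamma_threshold[OF n r l] n by (intro g_dim_upper_bound) auto
  qed
qed

end
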